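(* Let $W$ be an irreducible finite Coxeter group of rank $r_W$. Then the noncrossing partition lattice $\mathrm{NC}_W$ has a real-rooted chain polynomial. Moreover, $h(\Delta(\mathrm{NC}_W),x)$ has a nonnegative real-rooted symmetric decomposition with respect to $r_W-1$. In particular, $h(\Delta(\mathrm{NC}_W),x)$ is unimodal, with a peak at position $\lfloor r_W/2\rfloor$.
   Context: Let $W$ be a finite Coxeter group with set of reflections $T$. For $\alpha\in W$, $\ell_T(\alpha)$ is the smallest $k$ such that $\alpha$ is a product of $k$ reflections in $T$. Define $\alpha\preceq\beta$ if $\ell_T(\alpha)+\ell_T(\alpha^{-1}\beta)=\ell_T(\beta)$. The noncrossing partition lattice $\mathrm{NC}_W$ is the interval $[e,\gamma]$ in $(W,\preceq)$, where $e$ is the identity and $\gamma$ is a Coxeter element (its isomorphism type does not depend on $\gamma$); it is a graded lattice of rank $r_W$. For a finite poset $Q$, $\Delta(Q)$ is its order complex (the simplicial complex of all chains of $Q$); the chain polynomial is $f_Q(x)=\sum_{i=0}^m f_{i-1}(\Delta(Q))x^i$, where $f_{i-1}(\Delta(Q))$ is the number of $i$-element chains and $m$ the maximum size of a chain; $h(\Delta(Q),x)=\sum_{i=0}^m f_{i-1}(\Delta(Q))x^i(1-x)^{m-i}$. A polynomial is real-rooted if all its roots are real or it is identically zero. $p(x)=\sum h_ix^i$ is unimodal with a peak at $k$ if $h_0\le\cdots\le h_k\ge h_{k+1}\ge\cdots$. For a polynomial $p(x)$ of degree at most $d$, its symmetric decomposition with respect to $d$ is the unique expression $p(x)=a(x)+xb(x)$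 with $a,b$ real polynomials satisfying $x^d a(1/x)=a(x)$ and $x^{d-1}b(1/x)=b(x)$; it is nonnegative and real-rooted if $a(x)$ and $b(x)$ both have nonnegative coefficients and are real-rooted. *)

theory Defs
  imports
    "HOL-Algebra.Generated_Groups"
    "HOL-Computational_Algebra.Polynomial"
    "HOL-Library.Extended_Nat"
    Complex_Main
begin

section \<open>Coxeter systems\<close>

definition word_prod :: "('a, 'b) monoid_scheme \<Rightarrow> 'a list \<Rightarrow> 'a" where
  "word_prod G ws = foldr (\<otimes>\<^bsub>G\<^esub>) ws \<one>\<^bsub>G\<^esub>"

definition coxeter_matrix :: "'a set \<Rightarrow> ('a \<Rightarrow> 'a \<Rightarrow> enat) \<Rightarrow> bool" where
  "coxeter_matrix S m \<longleftrightarrow>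
     (\<forall>s\<in>S. m s s = 1) \<and>
     (\<forall>s\<in>S. \<forall>t\<in>S. m s t = m t s) \<and>
     (\<forall>s\<in>S. \<forall>t\<in>S. s \<noteq> t \<longrightarrow> 2 \<le> m s t)"

text \<open>
  Insertion of a defining relator \<open>(s t)\<^sup>k\<close>, \<open>k = m s t < \<infinity>\<close>, at an arbitrary position of a word.
  Since \<open>m s s = 1\<close>, the relators include \<open>s s\<close>.
\<close>

inductive relator_insertion :: "'a set \<Rightarrow> ('a \<Rightarrow> 'a \<Rightarrow> enat) \<Rightarrow> 'a list \<Rightarrow> 'a list \<Rightarrow> bool"
  for S m where
  "\<lbrakk>s \<in> S; t \<in> S; m s t = enat k\<rbrakk> \<Longrightarrow>
     relator_insertion S m (u @ v) (u @ concat (replicate k [s, t]) @ v)"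

text \<open>
  \<open>(G, S)\<close> is a Coxeter system with Coxeter matrix \<open>m\<close>: the group \<open>G\<close> is generated by \<open>S\<close> and has
  the presentation \<open>\<langle>S | (s t)\<^bsup>m s t\<^esup> = 1 whenever m s t < \<infinity>\<rangle>\<close>. Because of the relators \<open>s s\<close>, every
  generator is its own inverse in the presented group, so words in the letters \<open>S\<close> alone (without
  formal inverses), taken modulo insertion and deletion of relators, form the presented group.
\<close>

definition coxeter_system ::
    "('a, 'b) monoid_scheme \<Rightarrow> 'a set \<Rightarrow> ('a \<Rightarrow> 'a \<Rightarrow> enat) \<Rightarrow> bool" where
  "coxeter_system G S m \<longleftrightarrow>
     group G \<and> S \<subseteq> carrier G \<and> coxeter_matrix S m \<and>
     generate G S = carrier G \<and>
     (\<forall>u\<in>lists S. \<forall>v\<in>lists S.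
        word_prod G u = word_prod G v \<longleftrightarrow> equivclp (relator_insertion S m) u v)"

text \<open>The Coxeter graph (edges: pairs with \<open>m s t \<ge> 3\<close>) is nonempty and connected.\<close>

definition coxeter_irreducible :: "'a set \<Rightarrow> ('a \<Rightarrow> 'a \<Rightarrow> enat) \<Rightarrow> bool" where
  "coxeter_irreducible S m \<longleftrightarrow>
     S \<noteq> {} \<and>
     (\<forall>s\<in>S. \<forall>t\<in>S. (\<lambda>x y. x \<in> S \<and> y \<in> S \<and> 3 \<le> m x y)\<^sup>*\<^sup>* s t)"

definition coxeter_element :: "('a, 'b) monoid_scheme \<Rightarrow> 'a set \<Rightarrow> 'a \<Rightarrow> bool" where
  "coxeter_element G S \<gamma> \<longleftrightarrow> (\<exists>ss. distinct ss \<and> set ss = S \<and> \<gamma> = word_prod G ss)"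


section \<open>Absolute order and noncrossing partitions\<close>

definition reflections :: "('a, 'b) monoid_scheme \<Rightarrow> 'a set \<Rightarrow> 'a set" where
  "reflections G S = {w \<otimes>\<^bsub>G\<^esub> s \<otimes>\<^bsub>G\<^esub> inv\<^bsub>G\<^esub> w | w s. w \<in> carrier G \<and> s \<in> S}"

definition refl_length :: "('a, 'b) monoid_scheme \<Rightarrow> 'a set \<Rightarrow> 'a \<Rightarrow> nat" where
  "refl_length G S \<alpha> =
     (LEAST k. \<exists>ts. set ts \<subseteq> reflections G S \<and> length ts = k \<and> word_prod G ts = \<alpha>)"

definition abs_le :: "('a, 'b) monoid_scheme \<Rightarrow> 'a set \<Rightarrow> 'a \<Rightarrow> 'a \<Rightarrow> bool" where
  "abs_le G S \<alpha> \<beta> \<longleftrightarrow>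
     refl_length G S \<alpha> + refl_length G S (inv\<^bsub>G\<^esub> \<alpha> \<otimes>\<^bsub>G\<^esub> \<beta>) = refl_length G S \<beta>"

definition noncrossing :: "('a, 'b) monoid_scheme \<Rightarrow> 'a set \<Rightarrow> 'a \<Rightarrow> 'a set" where
  "noncrossing G S \<gamma> = {w \<in> carrier G. abs_le G S \<one>\<^bsub>G\<^esub> w \<and> abs_le G S w \<gamma>}"


section \<open>Chain polynomials and h-polynomials\<close>

text \<open>
  The faces are all chains, including the empty one and those through the minimum and maximum.
\<close>

definition order_complex :: "'a set \<Rightarrow> ('a \<Rightarrow> 'a \<Rightarrow> bool) \<Rightarrow> 'a set set" where
  "order_complex Q R = {C. C \<subseteq> Q \<and> Complete_Partial_Order.chain R C}"

text \<open>Faces are counted by cardinality: \<open>face_number \<Delta> i\<close> is usually written \<open>f\<^bsub>i-1\<^esub>(\<Delta>)\<close>.\<close>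

definition face_number :: "'a set set \<Rightarrow> nat \<Rightarrow> nat" where
  "face_number \<Delta> i = card {C \<in> \<Delta>. card C = i}"

definition max_face_card :: "'a set set \<Rightarrow> nat" where
  "max_face_card \<Delta> = Max (card ` \<Delta>)"

definition f_poly :: "'a set set \<Rightarrow> real poly" where
  "f_poly \<Delta> = (\<Sum>i\<le>max_face_card \<Delta>. monom (real (face_number \<Delta> i)) i)"

definition h_poly :: "'a set set \<Rightarrow> real poly" where
  "h_poly \<Delta> = (\<Sum>i\<le>max_face_card \<Delta>.
     monom (real (face_number \<Delta> i)) i * [:1, -1:] ^ (max_face_card \<Delta> - i))"

definition chain_poly :: "'a set \<Rightarrow> ('a \<Rightarrow> 'a \<Rightarrow> bool) \<Rightarrow> real poly" where
  "chain_poly Q R = f_poly (order_complex Q R)"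


section \<open>Properties of real polynomials\<close>

definition real_rooted :: "real poly \<Rightarrow> bool" where
  "real_rooted p \<longleftrightarrow>
     p = 0 \<or> (\<forall>z::complex. poly (map_poly of_real p) z = 0 \<longrightarrow> z \<in> \<real>)"

definition nonneg_coeffs :: "real poly \<Rightarrow> bool" where
  "nonneg_coeffs p \<longleftrightarrow> (\<forall>i. 0 \<le> coeff p i)"

definition unimodal_with_peak :: "real poly \<Rightarrow> nat \<Rightarrow> bool" where
  "unimodal_with_peak p k \<longleftrightarrow>
     (\<forall>i<k. coeff p i \<le> coeff p (Suc i)) \<and> (\<forall>i\<ge>k. coeff p (Suc i) \<le> coeff p i)"

text \<open>
  The exponent \<open>d - 1\<close> is an integer, so for \<open>d = 0\<close> the second identity reads
  \<open>x\<^bsup>-1\<^esup> b(1/x) = b(x)\<close>, which forces \<open>b = 0\<close>.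
\<close>

definition symmetric_decomposition ::
    "nat \<Rightarrow> real poly \<Rightarrow> real poly \<Rightarrow> real poly \<Rightarrow> bool" where
  "symmetric_decomposition d p a b \<longleftrightarrow>
     degree p \<le> d \<and>
     p = a + [:0, 1:] * b \<and>
     (\<forall>x. x \<noteq> 0 \<longrightarrow> x ^ d * poly a (1 / x) = poly a x) \<and>
     (\<forall>x. x \<noteq> 0 \<longrightarrow> x powi (int d - 1) * poly b (1 / x) = poly b x)"

definition nonneg_real_rooted_symmetric_decomposition :: "nat \<Rightarrow> real poly \<Rightarrow> bool" where
  "nonneg_real_rooted_symmetric_decomposition d p \<longleftrightarrow>
     (\<exists>a b. symmetric_decomposition d p a b \<and>
        nonneg_coeffs a \<and> real_rooted a \<and> nonneg_coeffs b \<and> real_rooted b)"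

end

theory Submission
  imports Defs "HOL-Computational_Algebra.Computational_Algebra" "HOL-Library.Function_Algebras"
begin

text \<open>
  The proof is uniform and avoids the classification. Let \<open>E\<close> be the Euler form of the Coxeter word
  (\<open>E + E\<^sup>T\<close> is the Tits form). Reading the positive roots greedily along the Coxeter word, and
  continuing with signs, gives a sequence \<open>\<beta>\<^sub>i\<close> with \<open>\<beta>\<^bsub>i+N\<^esub> = -\<beta>\<^sub>i\<close> and
  \<open>E(\<beta>\<^sub>i, \<beta>\<^sub>j) \<ge> 0 \<ge> E(\<beta>\<^sub>j, \<beta>\<^sub>i)\<close> for \<open>i < j < i + N\<close>. Minimal reflection factorisations of the Coxeter
  element are exactly the maximal sequences of roots that are exceptional for \<open>E\<close>, so noncrossing
  partitions correspond to the sets of roots obtained from \<open>\<Phi>\<close> by repeatedly passing to right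
  perpendiculars, and multichains correspond to exceptional sequences inside longer windows of \<open>\<beta>\<close>.
  Rotating such windows yields, for every such set \<open>A\<close> of rank \<open>k\<close>, a recursion
  and a polynomial \<open>c\<^sub>A\<close> with nonnegative coefficients such that the number of multichains
  of length \<open>n\<close> is \<open>(n + 1)\<^sup>k c\<^sub>A(n / (n + 1))\<close>. Inclusion-exclusion over the first slice of roots
  and a positivity argument show that \<open>c\<^sub>A(x) - x\<^sup>k c\<^sub>A(1/x)\<close> is \<open>1 - x\<close> times a polynomial with
  nonnegative coefficients. The \<open>h\<close>-polynomial is the corresponding combination of the Eulerian-type
  polynomials attached to \<open>n\<^sup>j (n + 1)\<^bsup>k-j\<^esup>\<close>; these interlace, and the two positivity statements on \<open>c\<^sub>A\<close>
  give real-rootedness of the \<open>h\<close>-polynomial and of both parts of its symmetric decomposition.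
\<close>


section \<open>Flats and slices\<close>


text \<open>The model is representation theory. In simply laced type \<open>E\<close> is the Euler
  form of a hereditary algebra and \<open>beta\<close> lists its indecomposables and their shifts
  from left to right: for \<open>i < j < i + N\<close> the number \<open>E (beta i) (beta j)\<close>
  counts homomorphisms and \<open>- E (beta j) (beta i)\<close> counts extensions,
  \<open>rperp\<close> and \<open>lperp\<close> are perpendicular categories, and a slice consists
  of the projectives of the heart that starts at a given position. Noncrystallographic types have no
  such algebra, so \<open>euler_system\<close> retains only signs, reflections and half-spaces, and
  the rotation of slices plays the role of the Serre functor. The argument
  \<open>n / (n + 1)\<close> comes from a double count: in \<open>n\<close> windows followed by a
  slice, slice roots occur \<open>n + 1\<close> times and all others \<open>n\<close> times, up to
  sign. Nonnegativity of \<open>c\<close> alone would not give a symmetric decomposition; the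
  obstacle is to compare \<open>c\<close> with its reversal, and for this the same multichains are
  counted a second time, through reciprocity at negative arguments.\<close>

definition rperp :: "('v \<Rightarrow> 'v \<Rightarrow> real) \<Rightarrow> 'v set \<Rightarrow> 'v \<Rightarrow> 'v set" where
  "rperp E A x = {y \<in> A. E y x = 0}"

definition lperp :: "('v \<Rightarrow> 'v \<Rightarrow> real) \<Rightarrow> 'v set \<Rightarrow> 'v \<Rightarrow> 'v set" where
  "lperp E A x = {y \<in> A. E x y = 0}"

text \<open>Perpendiculars are taken only at members of the current set, so on good flats every step
  lowers the rank by one. \<open>le_iff_below\<close> identifies the resulting relation with the
  absolute order.\<close>

inductive_set below :: "('v \<Rightarrow> 'v \<Rightarrow> real) \<Rightarrow> 'v set \<Rightarrow> 'v set set"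
  for E A where
  self: "A \<in> below E A"
| step: "B \<in> below E A \<Longrightarrow> x \<in> B \<Longrightarrow> rperp E B x \<in> below E A"

text \<open>The notions are separated from the axioms because the axiom \<open>base_spans\<close>
  already refers to \<open>spans\<close>.\<close>

locale euler_data =
  fixes E :: "'v::real_vector \<Rightarrow> 'v \<Rightarrow> real"
    and Phi :: "'v set" and beta :: "nat \<Rightarrow> 'v" and N :: nat
begin

text \<open>By \<open>dir2\<close> pairings of later with earlier roots of a window are never
  positive. The slice collects the members of \<open>A\<close> for which all of them vanish, the
  analogue of projective objects.\<close>

definition slice :: "'v set \<Rightarrow> nat \<Rightarrow> nat set" where
  "slice A b = {i. b \<le> i \<and> i < b + N \<and> beta i \<in> A \<and>
     (\<forall>j. b \<le> j \<and> j < i \<and> beta j \<in> A \<longrightarrow> E (beta i) (beta j) = 0)}"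

abbreviation "Rp \<equiv> rperp E"
abbreviation "Lp \<equiv> lperp E"

definition rk :: "'v set \<Rightarrow> nat" where "rk A = card (slice A 0)"

definition flat :: "'v set \<Rightarrow> bool" where
  "flat A \<longleftrightarrow> A \<subseteq> Phi \<and> (\<forall>y\<in>Phi. y \<in> span A \<longrightarrow> y \<in> A)"

definition spans :: "'v set \<Rightarrow> nat \<Rightarrow> bool" where
  "spans A b \<longleftrightarrow> A \<subseteq> span (beta ` slice A b)"

end

text \<open>\<open>base_spans\<close> concerns a single frame; rotation carries it to all others.
  \<open>posit\<close> makes every window a positive system, which is what rules out roots beyond
  the maximum in \<open>Inc_max\<close>.\<close>

locale euler_system = euler_data E Phi beta N
  for E :: "'v::real_vector \<Rightarrow> 'v \<Rightarrow> real" and Phi :: "'v set" and beta :: "nat \<Rightarrow> 'v" and N :: nat +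
  assumes E_add_left: "E (x + y) z = E x z + E y z"
    and E_scale_left: "E (c *\<^sub>R x) z = c * E x z"
    and E_add_right: "E z (x + y) = E z x + E z y"
    and E_scale_right: "E z (c *\<^sub>R x) = c * E z x"
    and N_pos: "0 < N"
    and beta_shift: "beta (i + N) = - beta i"
    and Phi_eq: "Phi = range beta"
    and E_unit: "x \<in> Phi \<Longrightarrow> E x x = 1"
    and refl_closed: "x \<in> Phi \<Longrightarrow> y \<in> Phi \<Longrightarrow> x - (E x y + E y x) *\<^sub>R y \<in> Phi"
    and dir1: "i < j \<Longrightarrow> j < i + N \<Longrightarrow> 0 \<le> E (beta i) (beta j)"
    and dir2: "i < j \<Longrightarrow> j < i + N \<Longrightarrow> E (beta j) (beta i) \<le> 0"
    and posit: "\<exists>f::'v \<Rightarrow> real. linear f \<and> (\<forall>i\<in>{a..<a+N}. 0 < f (beta i))"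
    and base_spans: "spans Phi 0"
begin

lemma E_zero [simp]: "E 0 x = 0" "E x 0 = 0"
  using E_scale_left[of 0 0 x] E_scale_right[of x 0 0] by auto

lemma E_minus [simp]: "E (- x) y = - E x y" "E x (- y) = - E x y"
  using E_scale_left[of "-1" x y] E_scale_right[of x "-1" y] by auto

lemma E_diff: "E (x - y) z = E x z - E y z" "E z (x - y) = E z x - E z y"
  using E_add_left[of x "-y" z] E_add_right[of z x "-y"] by auto

lemmas E_simps = E_add_left E_scale_left E_add_right E_scale_right E_diff

lemma span_zero_left:
  assumes "x \<in> span S" "\<And>s. s \<in> S \<Longrightarrow> E s y = 0" shows "E x y = 0"
  by (rule span_induct[OF assms(1)]) (auto simp: subspace_def E_simps assms(2))

lemma span_zero_right:
  assumes "x \<in> span S" "\<And>s. s \<in> S \<Longrightarrow> E y s = 0" shows "E y x = 0"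
  by (rule span_induct[OF assms(1)]) (auto simp: subspace_def E_simps assms(2))

lemma beta_Phi [simp, intro]: "beta i \<in> Phi" by (auto simp: Phi_eq)

lemma E_beta [simp]: "E (beta i) (beta i) = 1" using E_unit by simp


lemma beta_mult: "beta (i + m * N) = beta i \<or> beta (i + m * N) = - beta i"
proof (induction m)
  case (Suc m)
  have "beta (i + Suc m * N) = - beta (i + m * N)" using beta_shift[of "i + m*N"] by (simp add: algebra_simps)
  then show ?case using Suc by auto
qed simp

lemma window_index:
  obtains i where "b \<le> i" "i < b + N" "beta i = beta k \<or> beta i = - beta k"
proof -
  \<comment> \<open>The summand \<open>N * b\<close>, a multiple of the period up to sign, keeps the
    subtraction of \<open>b\<close> from being truncated in \<open>nat\<close>.\<close>
  define t where "t = k + N * b - b"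
  have le: "b \<le> N * b" using N_pos by (cases N) auto
  define i where "i = b + t mod N"
  have "k + b * N = b + t" using le trans_le_add2[OF le, of k] unfolding t_def by (simp add: mult.commute)
  then have "k + b * N = i + (t div N) * N"
    using mult_div_mod_eq[of N t] unfolding i_def by (simp add: algebra_simps)
  then have "beta k = beta i \<or> beta k = - beta i"
    using beta_mult[of k b] beta_mult[of i "t div N"] by (metis minus_minus)
  then show ?thesis using that[of i] N_pos unfolding i_def by auto
qed

lemma Phi_window:
  assumes "x \<in> Phi" obtains i where "b \<le> i" "i < b + N" "beta i = x \<or> beta i = - x"
  using assms window_index unfolding Phi_eq by (metis rangeE)

lemma beta_distinct:
  assumes "i < j" "j < i + N" shows "beta i \<noteq> beta j" "beta i \<noteq> - beta j"
  using dir1[OF assms] dir2[OF assms] E_beta[of i] E_beta[of j] by auto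

lemma beta_inj: 
  assumes "i \<in> {b..<b+N}" "j \<in> {b..<b+N}" "beta i = beta j \<or> beta i = - beta j" shows "i = j"
proof (rule ccontr)
  assume "i \<noteq> j"
  then consider "i < j" "j < i + N" | "j < i" "i < j + N" using assms(1,2) by force
  then show False
    by cases (use beta_distinct[of i j] beta_distinct[of j i] assms(3) in \<open>metis minus_minus\<close>)+
qed

lemma Phi_minus: "x \<in> Phi \<Longrightarrow> - x \<in> Phi"
  unfolding Phi_eq using beta_shift by (metis rangeE rangeI)

lemma flatD: "flat A \<Longrightarrow> y \<in> Phi \<Longrightarrow> y \<in> span A \<Longrightarrow> y \<in> A"
  by (auto simp: flat_def)

lemma flat_Phi: "flat Phi" by (auto simp: flat_def)

lemma flat_sub: "flat A \<Longrightarrow> x \<in> A \<Longrightarrow> x \<in> Phi" by (auto simp: flat_def)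

lemma flat_minus: "flat A \<Longrightarrow> x \<in> A \<Longrightarrow> - x \<in> A"
  using flatD[of A "-x"] Phi_minus flat_sub span_base span_neg by blast

lemma flat_minus_iff: "flat A \<Longrightarrow> - x \<in> A \<longleftrightarrow> x \<in> A"
  using flat_minus[of A x] flat_minus[of A "-x"] by auto

lemma flat_shift: "flat A \<Longrightarrow> beta (i + N) \<in> A \<longleftrightarrow> beta i \<in> A"
  by (simp add: beta_shift flat_minus_iff)

lemma flat_refl:
  assumes "flat A" "x \<in> A" "y \<in> A" shows "x - (E x y + E y x) *\<^sub>R y \<in> A"
proof (rule flatD[OF assms(1)])
  show "x - (E x y + E y x) *\<^sub>R y \<in> Phi" using refl_closed flat_sub[OF assms(1)] assms by auto
  show "x - (E x y + E y x) *\<^sub>R y \<in> span A" using assms by (intro span_diff span_scale) (auto intro: span_base)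
qed

lemma flat_Rp: "flat A \<Longrightarrow> flat (Rp A x)"
proof -
  assume A: "flat A"
  have "y \<in> Rp A x" if "y \<in> Phi" "y \<in> span (Rp A x)" for y
  proof -
    have "y \<in> span A" using that(2) span_mono[of "Rp A x" A] by (auto simp: rperp_def)
    moreover have "E y x = 0" using span_zero_left[OF that(2)] by (auto simp: rperp_def)
    ultimately show ?thesis using flatD[OF A that(1)] by (auto simp: rperp_def)
  qed
  then show ?thesis using A by (auto simp: flat_def rperp_def)
qed

lemma Rp_minus: "Rp A (- x) = Rp A x" by (auto simp: rperp_def)
lemma Lp_minus: "Lp A (- x) = Lp A x" by (auto simp: lperp_def)
lemma Rp_shift: "Rp A (beta (i + N)) = Rp A (beta i)" by (simp add: beta_shift Rp_minus)

section \<open>Slices and their rotation\<close>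

lemma finite_slice [simp, intro]: "finite (slice A b)"
  by (rule finite_subset[of _ "{b..<b+N}"]) (auto simp: slice_def)

lemma slice_window: "i \<in> slice A b \<Longrightarrow> i \<in> {b..<b+N}" by (auto simp: slice_def)
lemma slice_in: "i \<in> slice A b \<Longrightarrow> beta i \<in> A" by (auto simp: slice_def)

lemma slice_orth: "i \<in> slice A b \<Longrightarrow> j \<in> slice A b \<Longrightarrow> j < i \<Longrightarrow> E (beta i) (beta j) = 0"
  by (auto simp: slice_def)

lemma slice_mono: "B \<subseteq> A \<Longrightarrow> i \<in> slice A b \<Longrightarrow> beta i \<in> B \<Longrightarrow> i \<in> slice B b"
  by (auto simp: slice_def)

text \<open>The root of largest index pairs to zero with everything in the span of the smaller ones
  but to one with itself. \<open>cotriangular_independent\<close> uses the other argument of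
  \<open>E\<close>.\<close>

lemma triangular_independent:
  assumes "finite J" "\<And>i j. i \<in> J \<Longrightarrow> j \<in> J \<Longrightarrow> j < i \<Longrightarrow> E (beta i) (beta j) = 0"
  shows "independent (beta ` J) \<and> inj_on beta J"
  using assms
proof (induction J rule: finite_linorder_max_induct)
  case (insert m J)
  have IH: "independent (beta ` J)" "inj_on beta J" using insert by auto
  have "beta m \<notin> span (beta ` J)"
  proof
    assume "beta m \<in> span (beta ` J)"
    then have "E (beta m) (beta m) = 0"
      by (rule span_zero_right) (use insert in auto)
    then show False by simp
  qed
  then show ?case using IH by (auto simp: independent_insert intro: span_base)
qed (auto simp: independent_empty)

lemma cotriangular_independent:
  assumes "finite J" "\<And>i j. i \<in> J \<Longrightarrow> j \<in> J \<Longrightarrow> j < i \<Longrightarrow> E (beta j) (beta i) = 0"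
  shows "independent (beta ` J) \<and> inj_on beta J"
  using assms
proof (induction J rule: finite_linorder_max_induct)
  case (insert m J)
  have IH: "independent (beta ` J)" "inj_on beta J" using insert by auto
  have "beta m \<notin> span (beta ` J)"
  proof
    assume "beta m \<in> span (beta ` J)"
    then have "E (beta m) (beta m) = 0"
      by (rule span_zero_left) (use insert in auto)
    then show False by simp
  qed
  then show ?case using IH by (auto simp: independent_insert intro: span_base)
qed (auto simp: independent_empty)

lemma slice_independent: "independent (beta ` slice A b)" "inj_on beta (slice A b)"
  using triangular_independent[of "slice A b"] slice_orth by auto

lemma slice_notin_span:
  assumes "I \<subseteq> slice A b" "z \<in> slice A b" "z \<notin> I" shows "beta z \<notin> span (beta ` I)"
proof -
  have sub: "insert z I \<subseteq> slice A b" using assms by auto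
  then have "independent (beta ` insert z I)" using independent_mono[OF slice_independent(1)[of A b]] by (metis image_mono)
  moreover have "beta z \<notin> beta ` I"
    using assms slice_independent(2)[of A b] sub by (auto simp: inj_on_def)
  ultimately show ?thesis by (auto simp: independent_insert)
qed

lemma slice_min: "beta b \<in> A \<Longrightarrow> b \<in> slice A b"
  using N_pos by (auto simp: slice_def)

lemma slice_Suc_notin: "flat A \<Longrightarrow> beta b \<notin> A \<Longrightarrow> slice A (Suc b) = slice A b"
proof (intro Set.set_eqI)
  fix i assume A: "flat A" "beta b \<notin> A"
  have N: "beta (b + N) \<notin> A" using A flat_shift by blast
  have 1: "Suc b \<le> i \<and> i < Suc b + N \<longleftrightarrow> b \<le> i \<and> i < b + N" if "beta i \<in> A"
  proof -
    have "i \<noteq> b" "i \<noteq> b + N" using that A(2) N by auto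
    then show ?thesis by auto
  qed
  have 2: "Suc b \<le> j \<longleftrightarrow> b \<le> j" if "beta j \<in> A" for j
  proof -
    have "j \<noteq> b" using that A(2) by auto
    then show ?thesis by auto
  qed
  show "i \<in> slice A (Suc b) \<longleftrightarrow> i \<in> slice A b"
    unfolding slice_def mem_Collect_eq using 1 2 by blast
qed

text \<open>The vector is reflected in the roots of \<open>Y\<close> one after the other. At each
  step \<open>E (beta m) v\<close> already vanishes, so the reflection subtracts exactly
  \<open>E v (beta m)\<close> times the root and makes \<open>v\<close> orthogonal to it;
  orthogonality to earlier roots persists because \<open>E (beta m)\<close> vanishes on
  them.\<close>

lemma reflect_chain:
  assumes "finite Y" "flat A" "x \<in> A" "beta ` Y \<subseteq> A" "\<And>i. i \<in> Y \<Longrightarrow> E (beta i) x = 0"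
    "\<And>i j. i \<in> Y \<Longrightarrow> j \<in> Y \<Longrightarrow> j < i \<Longrightarrow> E (beta i) (beta j) = 0"
  shows "\<exists>v\<in>A. v - x \<in> span (beta ` Y) \<and> (\<forall>i\<in>Y. E v (beta i) = 0)"
  using assms
proof (induction Y rule: finite_linorder_max_induct)
  case empty then show ?case by (intro bexI[of _ x]) (auto simp: span_zero)
next
  case (insert m Y)
  then obtain v where v: "v \<in> A" "v - x \<in> span (beta ` Y)" "\<forall>i\<in>Y. E v (beta i) = 0" by auto
  have 0: "E (beta m) (v - x) = 0"
    by (rule span_zero_right[OF v(2)]) (use insert in auto)
  have mv: "E (beta m) v = 0" using 0 insert.prems(4)[of m] by (simp add: E_simps)
  define u where "u = v - (E v (beta m) + E (beta m) v) *\<^sub>R beta m"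
  have "u \<in> A" unfolding u_def using insert v flat_refl by auto
  moreover have "u - x \<in> span (beta ` insert m Y)"
  proof -
    have "u - x = (v - x) - E v (beta m) *\<^sub>R beta m" by (simp add: u_def mv)
    moreover have "v - x \<in> span (beta ` insert m Y)" using v(2) span_mono[of "beta ` Y" "beta ` insert m Y"] by auto
    moreover have "beta m \<in> span (beta ` insert m Y)" by (auto intro: span_base)
    ultimately show ?thesis by (metis span_diff span_scale)
  qed
  moreover have "\<forall>i\<in>insert m Y. E u (beta i) = 0"
    using v(3) insert.hyps insert.prems(5) by (auto simp: u_def E_simps mv)
  ultimately show ?case by blast
qed

text \<open>
  Moving the frame past \<open>b\<close> replaces \<open>beta b\<close> in the slice by its image under the element of the
  reflection group attached to \<open>A\<close>; the Serre-type identity \<open>E y' y = - E y (beta b)\<close> determines it.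
\<close>

lemma rotate:
  assumes A: "flat A" and sp: "spans A b" and b: "beta b \<in> A"
  obtains b' where "b < b'" "b' \<le> b + N" "beta b' \<in> A"
    "\<And>y. y \<in> A \<Longrightarrow> E (beta b') y = - E y (beta b)"
    "slice A (Suc b) = insert b' (slice A b - {b})" "b' \<notin> slice A b" "spans A (Suc b)"
proof -
  define Y where "Y = slice A b - {b}"
  have bS: "b \<in> slice A b" using slice_min[OF b] .
  have Yb: "b < i" if "i \<in> Y" for i using that slice_window[of i A b] by (auto simp: Y_def)
  have YE: "E (beta i) (beta b) = 0" if "i \<in> Y" for i
    using slice_orth[of i A b b] bS that Yb[OF that] by (auto simp: Y_def)
  have spA: "A \<subseteq> span (insert (beta b) (beta ` Y))"
    using sp bS unfolding spans_def Y_def by (metis image_insert insert_Diff)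
  \<comment> \<open>\<open>v\<close> is the projection of \<open>beta b\<close> onto the vectors
    that pair to zero, from the left, with the other slice roots; being obtained by reflections it
    stays a root of \<open>A\<close>.\<close>
  obtain v where v: "v \<in> A" "v - beta b \<in> span (beta ` Y)" "\<forall>i\<in>Y. E v (beta i) = 0"
  proof -
    have "\<exists>v\<in>A. v - beta b \<in> span (beta ` Y) \<and> (\<forall>i\<in>Y. E v (beta i) = 0)"
      by (rule reflect_chain) (use A b YE slice_orth[of _ A b] slice_in[of _ A b] in \<open>auto simp: Y_def\<close>)
    then show ?thesis using that by blast
  qed
  have vb: "E v (beta b) = 1"
  proof -
    have "E (v - beta b) (beta b) = 0" by (rule span_zero_left[OF v(2)]) (use YE in auto)
    then show ?thesis by (simp add: E_simps)
  qed
  have vE: "E v y = E y (beta b)" if "y \<in> A" for y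
  proof -
    have "y \<in> span (insert (beta b) (beta ` Y))" using that spA by auto
    then show ?thesis
      by (rule span_induct) (auto simp: subspace_def E_simps vb v(3) YE)
  qed
  obtain i where i: "Suc b \<le> i" "i < Suc b + N" "beta i = - v \<or> beta i = v"
    using Phi_window[of "-v" "Suc b"] flat_sub[OF A] flat_minus[OF A v(1)] by (metis minus_minus)
  have iA: "beta i \<in> A" using i(3) v(1) flat_minus[OF A] by metis
  have "beta i = - v"
  proof (rule ccontr)
    assume "beta i \<noteq> - v"
    then have "beta i = v" using i by auto
    then have 1: "E (beta i) (beta b) = 1" using vb by simp
    show False
    proof (cases "i = b + N")
      case True then show False using 1 by (simp add: beta_shift)
    next
      case False then show False using dir2[of b i] i 1 by auto
    qed
  qed
  then have iE: "E (beta i) y = - E y (beta b)" if "y \<in> A" for y using vE[OF that] by simp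
  have inot: "i \<notin> slice A b"
  proof
    assume "i \<in> slice A b"
    then have "E (beta i) (beta b) = 0" using i b by (auto simp: slice_def)
    then show False using iE[OF b] by simp
  qed
  have Ysub: "Y \<subseteq> slice A (Suc b)" using Yb by (auto simp: Y_def slice_def Suc_le_eq)
  have iS: "i \<in> slice A (Suc b)"
  proof -
    \<comment> \<open>\<open>dir2\<close> at \<open>j < i\<close> gives one inequality; the identity
      \<open>iE\<close> and \<open>dir2\<close> at \<open>b < j\<close> give the opposite
      one.\<close>
    have "E (beta i) (beta j) = 0" if j: "Suc b \<le> j" "j < i" "beta j \<in> A" for j
    proof -
      have "E (beta i) (beta j) \<le> 0" using dir2[of j i] j i by auto
      moreover have "E (beta j) (beta b) \<le> 0" using dir2[of b j] j i by auto
      ultimately show ?thesis using iE[OF j(3)] by simp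
    qed
    then show ?thesis using i iA by (auto simp: slice_def)
  qed
  have spA': "A \<subseteq> span (beta ` insert i Y)"
  proof -
    have 1: "beta b = - (v - beta b) + (- 1) *\<^sub>R beta i" using \<open>beta i = - v\<close> by simp
    have "v - beta b \<in> span (beta ` insert i Y)"
      using v(2) span_mono[of "beta ` Y" "beta ` insert i Y"] by auto
    moreover have "beta i \<in> span (beta ` insert i Y)" by (auto intro: span_base)
    ultimately have "beta b \<in> span (beta ` insert i Y)"
      by (subst 1) (intro span_add span_neg span_scale)
    then have "insert (beta b) (beta ` Y) \<subseteq> span (beta ` insert i Y)" by (auto intro: span_base)
    then show ?thesis using spA span_mono span_span by (metis order_trans)
  qed
  have eq: "slice A (Suc b) = insert i Y"
  proof (rule ccontr)
    assume "slice A (Suc b) \<noteq> insert i Y"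
    then obtain z where z: "z \<in> slice A (Suc b)" "z \<notin> insert i Y" using Ysub iS by auto
    have "beta z \<notin> span (beta ` insert i Y)"
      by (rule slice_notin_span[of _ A "Suc b"]) (use z Ysub iS in auto)
    then show False using spA' slice_in[OF z(1)] by auto
  qed
  show ?thesis
    by (rule that[of i]) (use i iA iE eq inot spA' in \<open>auto simp: Y_def spans_def\<close>)
qed

lemma spans_Suc:
  assumes "flat A" "spans A b" shows "spans A (Suc b) \<and> card (slice A (Suc b)) = card (slice A b)"
proof (cases "beta b \<in> A")
  case True
  obtain b' where b': "slice A (Suc b) = insert b' (slice A b - {b})" "b' \<notin> slice A b" "spans A (Suc b)"
    using rotate[OF assms True] by metis
  have "card (slice A (Suc b)) = Suc (card (slice A b - {b}))" using b' by auto
  also have "\<dots> = card (slice A b)" using slice_min[OF True] by (metis card_Suc_Diff1 finite_slice)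
  finally show ?thesis using b' by auto
next
  case False then show ?thesis using slice_Suc_notin[OF assms(1) False] assms(2) by (auto simp: spans_def)
qed

lemma slice_shift: assumes "flat A" shows "slice A (b + N) = (\<lambda>i. i + N) ` slice A b"
proof (intro Set.set_eqI iffI)
  fix i assume i: "i \<in> slice A (b + N)"
  then obtain k where k: "i = k + N" using slice_window[OF i] by (metis atLeastLessThan_iff add.commute le_Suc_ex add.assoc)
  have "E (beta k) (beta j) = 0" if "b \<le> j" "j < k" "beta j \<in> A" for j
  proof -
    have "E (beta (k + N)) (beta (j + N)) = 0"
      using i that flat_shift[OF assms, of j] unfolding slice_def k by auto
    then show ?thesis by (simp add: beta_shift)
  qed
  then have "k \<in> slice A b" using i flat_shift[OF assms, of k] unfolding k slice_def by auto
  then show "i \<in> (\<lambda>i. i + N) ` slice A b" using k by auto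
next
  fix i assume "i \<in> (\<lambda>i. i + N) ` slice A b"
  then obtain k where k: "i = k + N" "k \<in> slice A b" by auto
  have "E (beta i) (beta j) = 0" if j: "b + N \<le> j" "j < i" "beta j \<in> A" for j
  proof -
    obtain l where l: "j = l + N" using j by (metis add.commute le_Suc_ex add.assoc)
    have "E (beta k) (beta l) = 0" using k j flat_shift[OF assms, of l] unfolding slice_def l by auto
    then show ?thesis by (simp add: beta_shift l k)
  qed
  then show "i \<in> slice A (b + N)" using k flat_shift[OF assms, of k] by (auto simp: slice_def)
qed

lemma beta_slice_shift: "flat A \<Longrightarrow> beta ` slice A (b + N) = uminus ` beta ` slice A b"
  by (simp add: slice_shift image_image beta_shift)

lemma span_uminus_image: "span (uminus ` S) = span (S :: 'v set)"
proof
  show "span (uminus ` S) \<subseteq> span S" by (rule span_minimal) (auto intro: span_neg span_base)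
  show "span S \<subseteq> span (uminus ` S)"
  proof (rule span_minimal)
    show "S \<subseteq> span (uminus ` S)"
      by (metis image_eqI minus_minus span_base span_neg subsetI)
  qed auto
qed

lemma spans_shift: "flat A \<Longrightarrow> spans A (b + N) \<longleftrightarrow> spans A b"
  unfolding spans_def by (simp add: beta_slice_shift span_uminus_image)

lemma card_slice_shift: "flat A \<Longrightarrow> card (slice A (b + N)) = card (slice A b)"
  by (subst slice_shift) (auto simp: card_image)

lemma spans_shift_mult: "flat A \<Longrightarrow> (spans A (b + m * N) \<longleftrightarrow> spans A b) \<and> card (slice A (b + m * N)) = card (slice A b)"
proof (induction m)
  case (Suc m)
  have "b + Suc m * N = (b + m * N) + N" by simp
  then show ?case using Suc spans_shift card_slice_shift by metis
qed simp

text \<open>Frames only move forward, but slices are periodic: an earlier frame \<open>c\<close> is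
  reached at its translate \<open>c + b * N\<close>.\<close>

lemma spans_all:
  assumes "flat A" "spans A b" shows "spans A c \<and> card (slice A c) = card (slice A b)"
proof -
  have fwd: "spans A (b + d) \<and> card (slice A (b + d)) = card (slice A b)" for d
    by (induction d) (use assms spans_Suc in auto)
  have "b \<le> c + b * N" using N_pos by (cases N) auto
  then obtain d where "c + b * N = b + d" by (metis le_Suc_ex)
  then show ?thesis using fwd[of d] spans_shift_mult[OF assms(1), of c b] by auto
qed

text \<open>Since \<open>b\<close> opens the window, all other slice roots pair to zero with
  \<open>beta b\<close>; hence the coefficient of \<open>beta b\<close> in a vector \<open>y\<close>
  is \<open>E y (beta b)\<close>, and the remaining slice spans the perpendicular.\<close>

lemma slice_Rp:
  assumes A: "flat A" and sp: "spans A b" and b: "beta b \<in> A"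
  shows "slice (Rp A (beta b)) b = slice A b - {b}" "spans (Rp A (beta b)) b"
proof -
  define Y where "Y = slice A b - {b}"
  have bS: "b \<in> slice A b" using slice_min[OF b] .
  have Yb: "b < i" if "i \<in> Y" for i using that slice_window[of i A b] by (auto simp: Y_def)
  have YE: "E (beta i) (beta b) = 0" if "i \<in> Y" for i
    using slice_orth[of i A b b] bS that Yb[OF that] by (auto simp: Y_def)
  have sub: "Y \<subseteq> slice (Rp A (beta b)) b"
    using slice_mono[of "Rp A (beta b)" A] YE slice_in[of _ A b] by (auto simp: Y_def rperp_def)
  have sp': "Rp A (beta b) \<subseteq> span (beta ` Y)"
  proof
    fix y assume y: "y \<in> Rp A (beta b)"
    have "y \<in> span (insert (beta b) (beta ` Y))"
      using y sp bS unfolding spans_def Y_def rperp_def by (metis (no_types, lifting) image_insert insert_Diff mem_Collect_eq subsetD)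
    then obtain c where c: "y - c *\<^sub>R beta b \<in> span (beta ` Y)" by (auto simp: span_insert)
    have "E (y - c *\<^sub>R beta b) (beta b) = 0" by (rule span_zero_left[OF c]) (use YE in auto)
    then have "c = 0" using y by (simp add: E_simps rperp_def)
    then show "y \<in> span (beta ` Y)" using c by simp
  qed
  have "slice (Rp A (beta b)) b \<subseteq> Y"
  proof (rule ccontr)
    assume "\<not> ?thesis"
    then obtain z where z: "z \<in> slice (Rp A (beta b)) b" "z \<notin> Y" by auto
    have "beta z \<notin> span (beta ` Y)" by (rule slice_notin_span[of _ "Rp A (beta b)" b]) (use z sub in auto)
    then show False using sp' slice_in[OF z(1)] by auto
  qed
  then show eq: "slice (Rp A (beta b)) b = slice A b - {b}" using sub by (auto simp: Y_def)
  show "spans (Rp A (beta b)) b" unfolding spans_def eq using sp' by (simp add: Y_def)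
qed

text \<open>The induction hypothesis of all later arguments: it passes to perpendiculars on both
  sides and provides a rank that does not depend on the frame.\<close>

definition good :: "'v set \<Rightarrow> bool" where "good A \<longleftrightarrow> flat A \<and> (\<forall>b. spans A b)"

lemma good_flat: "good A \<Longrightarrow> flat A" by (simp add: good_def)
lemma good_spans: "good A \<Longrightarrow> spans A b" by (simp add: good_def)
lemma goodI: "flat A \<Longrightarrow> spans A b \<Longrightarrow> good A" using spans_all by (auto simp: good_def)
lemma good_card: "good A \<Longrightarrow> card (slice A b) = rk A"
  unfolding rk_def good_def using spans_all by blast

lemma good_Phi: "good Phi" using goodI[OF flat_Phi base_spans] .

lemma good_Rp_beta:
  assumes "good A" "beta b \<in> A"
  shows "good (Rp A (beta b))" "rk A = Suc (rk (Rp A (beta b)))" "slice (Rp A (beta b)) b = slice A b - {b}"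
proof -
  note s = slice_Rp[OF good_flat[OF assms(1)] good_spans[OF assms(1)] assms(2)]
  show g: "good (Rp A (beta b))" using goodI[OF flat_Rp s(2)] good_flat[OF assms(1)] by auto
  show "slice (Rp A (beta b)) b = slice A b - {b}" using s by simp
  have "card (slice A b) = Suc (card (slice A b - {b}))"
    using slice_min[OF assms(2)] by (metis card_Suc_Diff1 finite_slice)
  then show "rk A = Suc (rk (Rp A (beta b)))" using good_card[OF g, of b] good_card[OF assms(1), of b] s(1) by simp
qed

lemma good_Rp:
  assumes "good A" "x \<in> A" shows "good (Rp A x)" "rk A = Suc (rk (Rp A x))"
proof -
  obtain i where "beta i = x \<or> beta i = - x"
    using Phi_window[of x 0] flat_sub[OF good_flat[OF assms(1)] assms(2)] by metis
  then have i: "beta i \<in> A" "Rp A x = Rp A (beta i)"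
    using assms flat_minus[OF good_flat[OF assms(1)]] Rp_minus by (metis, metis)
  show "good (Rp A x)" "rk A = Suc (rk (Rp A x))" using good_Rp_beta[OF assms(1) i(1)] i(2) by auto
qed

text \<open>Place \<open>x\<close>, up to sign, at the position \<open>p = p0 + N\<close>, which is
  outside the slice framed at \<open>p0\<close> and inside the one framed at \<open>p\<close>. At
  the frame \<open>b\<close> where it enters, \<open>p\<close> is the rotated position of
  \<open>b\<close>, and the identity of \<open>rotate\<close> turns the left perpendicular of
  \<open>beta p\<close> into the right one of \<open>beta b\<close>.\<close>

lemma Lp_is_Rp:
  assumes "good A" "x \<in> A" obtains y where "y \<in> A" "Lp A x = Rp A y"
proof -
  have A: "flat A" "\<And>b. spans A b" using assms good_def by auto
  obtain p0 where p0: "beta p0 = x \<or> beta p0 = - x"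
    using Phi_window[of x 0] flat_sub[OF A(1) assms(2)] by metis
  define p where "p = p0 + N"
  have px: "beta p = x \<or> beta p = - x" using p0 by (auto simp: p_def beta_shift)
  then have pA: "beta p \<in> A" using assms(2) flat_minus[OF A(1)] by metis
  have ex: "\<exists>b. p0 \<le> b \<and> b < p0 + d \<and> p \<notin> slice A b \<and> p \<in> slice A (Suc b)" 
    if "p \<in> slice A (p0 + d)" for d using that
  proof (induction d)
    case 0 then show ?case using slice_window[OF 0] by (auto simp: p_def)
  next
    case (Suc d)
    show ?case
    proof (cases "p \<in> slice A (p0 + d)")
      case True then show ?thesis using Suc.IH by (metis add_Suc_right less_SucI)
    next
      case False then show ?thesis using Suc.prems by (intro exI[of _ "p0 + d"]) auto
    qed
  qed
  obtain b where b: "p \<notin> slice A b" "p \<in> slice A (Suc b)"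
    using ex[of N] slice_min[OF pA] by (auto simp: p_def)
  have bA: "beta b \<in> A" using slice_Suc_notin[OF A(1)] b by blast
  obtain b' where b': "\<And>y. y \<in> A \<Longrightarrow> E (beta b') y = - E y (beta b)" 
     "slice A (Suc b) = insert b' (slice A b - {b})"
    using rotate[OF A(1) A(2) bA] by metis
  have "p = b'" using b b'(2) by auto
  then have "Lp A (beta p) = Rp A (beta b)" using b'(1) by (auto simp: rperp_def lperp_def)
  then show ?thesis using that[OF bA] px Lp_minus by metis
qed

lemma good_Lp:
  assumes "good A" "x \<in> A" shows "good (Lp A x)" "rk A = Suc (rk (Lp A x))"
  using Lp_is_Rp[OF assms] good_Rp[OF assms(1)] by metis+

lemma rk_0: assumes "good A" shows "rk A = 0 \<longleftrightarrow> A = {}"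
proof
  assume "rk A = 0"
  show "A = {}"
  proof (rule ccontr)
    assume "A \<noteq> {}" then show False using good_Rp[OF assms] \<open>rk A = 0\<close> by fastforce
  qed
qed (auto simp: rk_def slice_def)

lemma good_below: "B \<in> below E A \<Longrightarrow> good A \<Longrightarrow> good B"
  by (induction rule: below.induct) (auto intro: good_Rp)

lemma below_sub: "B \<in> below E A \<Longrightarrow> B \<subseteq> A"
  by (induction rule: below.induct) (auto simp: rperp_def)

lemma below_trans: "C \<in> below E B \<Longrightarrow> B \<in> below E A \<Longrightarrow> C \<in> below E A"
  by (induction rule: below.induct) (auto intro: below.step)

text \<open>Exposes the topmost perpendicular instead of the last one, which is what inductions on
  the rank of \<open>A\<close> need.\<close>

lemma below_cases: "B \<in> below E A \<Longrightarrow> B = A \<or> (\<exists>x\<in>A. B \<in> below E (Rp A x))"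
  by (induction rule: below.induct) (auto intro: below.intros)

lemma below_rk: "B \<in> below E A \<Longrightarrow> good A \<Longrightarrow> B = A \<or> rk B < rk A"
proof (induction rule: below.induct)
  case (step B x)
  then show ?case using good_Rp(2)[OF good_below[OF step.hyps(1)] step.hyps(2)] by auto
qed auto

end

section \<open>Multichains of flats\<close>


text \<open>The top \<open>A\<close> is not counted as a member of the chain, so this is the usual
  zeta polynomial evaluated at \<open>n + 1\<close>.\<close>

primrec multichains :: "('v \<Rightarrow> 'v \<Rightarrow> real) \<Rightarrow> nat \<Rightarrow> 'v set \<Rightarrow> real" where
  "multichains E 0 A = 1"
| "multichains E (Suc n) A = (\<Sum>B\<in>below E A. multichains E n B)"

context euler_system begin

lemma finite_Phi: "finite Phi"
proof -
  have "Phi \<subseteq> beta ` {0..<N} \<union> uminus ` beta ` {0..<N}"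
  proof
    fix x assume "x \<in> Phi"
    then obtain i where "0 \<le> i" "i < 0 + N" "beta i = x \<or> beta i = - x" by (rule Phi_window)
    then show "x \<in> beta ` {0..<N} \<union> uminus ` beta ` {0..<N}"
      by (metis Un_iff add_0 atLeastLessThan_iff image_eqI minus_minus)
  qed
  then show ?thesis by (rule finite_subset) auto
qed

lemma good_finite: "good A \<Longrightarrow> finite A"
  using finite_subset[OF _ finite_Phi] by (auto simp: good_def flat_def)

lemma finite_below: "finite A \<Longrightarrow> finite (below E A)"
  by (rule finite_subset[of _ "Pow A"]) (auto dest: below_sub)

section \<open>Exchange, ordered sets of roots and complements\<close>

lemma good_exchange:
  assumes A: "good A" and I: "finite I" "beta ` I \<subseteq> A" "independent (beta ` I)" "inj_on beta I" "card I = rk A"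
  shows "A \<subseteq> span (beta ` I)"
proof (rule ccontr)
  assume "\<not> ?thesis"
  then obtain y where y: "y \<in> A" "y \<notin> span (beta ` I)" by auto
  have "independent (insert y (beta ` I))" using y I by (auto simp: independent_insert intro: span_base)
  moreover have "insert y (beta ` I) \<subseteq> span (beta ` slice A 0)"
    using y(1) I(2) good_spans[OF A, of 0] unfolding spans_def by auto
  ultimately have "card (insert y (beta ` I)) \<le> card (beta ` slice A 0)"
    using independent_span_bound[of "beta ` slice A 0"] by auto
  also have "\<dots> \<le> rk A" unfolding rk_def by (simp add: card_image_le)
  finally have "card (insert y (beta ` I)) \<le> rk A" .
  moreover have "y \<notin> beta ` I" using y span_base by blast
  ultimately show False using I by (simp add: card_image)
qed

definition resR :: "'v set \<Rightarrow> nat set \<Rightarrow> 'v set" where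
  "resR A K = {y \<in> A. \<forall>i\<in>K. E y (beta i) = 0}"

definition resL :: "'v set \<Rightarrow> nat set \<Rightarrow> 'v set" where
  "resL A F = {y \<in> A. \<forall>i\<in>F. E (beta i) y = 0}"

text \<open>Listed by growing position an increasing set is an exceptional sequence for
  \<open>E\<close>; a decreasing set is one when listed by falling position.\<close>

definition increasing :: "nat set \<Rightarrow> bool" where
  "increasing K \<longleftrightarrow> (\<forall>i\<in>K. \<forall>j\<in>K. i < j \<longrightarrow> E (beta i) (beta j) = 0)"

definition decreasing :: "nat set \<Rightarrow> bool" where
  "decreasing F \<longleftrightarrow> (\<forall>i\<in>F. \<forall>j\<in>F. j < i \<longrightarrow> E (beta i) (beta j) = 0)"

lemma resR_insert: "resR A (insert m K) = resR (Rp A (beta m)) K"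
  by (auto simp: resR_def rperp_def)
lemma resL_insert: "resL A (insert m K) = resL (Lp A (beta m)) K"
  by (auto simp: resL_def lperp_def)
lemma resR_empty [simp]: "resR A {} = A" by (auto simp: resR_def)
lemma resL_empty [simp]: "resL A {} = A" by (auto simp: resL_def)

lemma Rp_below: "x \<in> A \<Longrightarrow> B \<in> below E (Rp A x) \<Longrightarrow> B \<in> below E A"
  using below_trans below.intros by metis

text \<open>Cutting at the largest position first keeps the remaining roots inside the
  perpendicular. For decreasing sets the smallest position has to go first.\<close>

lemma resR_increasing:
  assumes "finite K" "good A" "beta ` K \<subseteq> A" "increasing K"
  shows "resR A K \<in> below E A \<and> rk A = rk (resR A K) + card K"
  using assms
proof (induction K arbitrary: A rule: finite_linorder_max_induct)
  case empty then show ?case by (auto intro: below.self)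
next
  case (insert m K)
  have m: "beta m \<in> A" using insert by auto
  have "beta ` K \<subseteq> Rp A (beta m)" using insert by (auto simp: rperp_def increasing_def)
  then have "resR (Rp A (beta m)) K \<in> below E (Rp A (beta m)) \<and> rk (Rp A (beta m)) = rk (resR (Rp A (beta m)) K) + card K"
    using insert.prems good_Rp[OF insert.prems(1) m] by (intro insert.IH) (auto simp: increasing_def)
  moreover have "m \<notin> K" using insert.hyps by auto
  ultimately show ?case
    using good_Rp(2)[OF insert.prems(1) m] Rp_below[OF m] insert.hyps by (auto simp: resR_insert)
qed

lemma resR_decreasing:
  assumes "finite K" "good A" "beta ` K \<subseteq> A" "decreasing K"
  shows "resR A K \<in> below E A \<and> rk A = rk (resR A K) + card K"
  using assms
proof (induction K arbitrary: A rule: finite_linorder_min_induct)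
  case empty then show ?case by (auto intro: below.self)
next
  case (insert m K)
  have m: "beta m \<in> A" using insert by auto
  have "beta ` K \<subseteq> Rp A (beta m)" using insert by (auto simp: rperp_def decreasing_def)
  then have "resR (Rp A (beta m)) K \<in> below E (Rp A (beta m)) \<and> rk (Rp A (beta m)) = rk (resR (Rp A (beta m)) K) + card K"
    using insert.prems good_Rp[OF insert.prems(1) m] by (intro insert.IH) (auto simp: decreasing_def)
  moreover have "m \<notin> K" using insert.hyps by auto
  ultimately show ?case
    using good_Rp(2)[OF insert.prems(1) m] Rp_below[OF m] insert.hyps by (auto simp: resR_insert)
qed

lemma resL_decreasing:
  assumes "finite K" "good A" "beta ` K \<subseteq> A" "decreasing K"
  shows "good (resL A K) \<and> rk A = rk (resL A K) + card K"
  using assms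
proof (induction K arbitrary: A rule: finite_linorder_max_induct)
  case empty then show ?case by auto
next
  case (insert m K)
  have m: "beta m \<in> A" using insert by auto
  have "beta ` K \<subseteq> Lp A (beta m)" using insert by (auto simp: lperp_def decreasing_def)
  then have "good (resL (Lp A (beta m)) K) \<and> rk (Lp A (beta m)) = rk (resL (Lp A (beta m)) K) + card K"
    using insert.prems good_Lp[OF insert.prems(1) m] by (intro insert.IH) (auto simp: decreasing_def)
  moreover have "m \<notin> K" using insert.hyps by auto
  ultimately show ?case
    using good_Lp(2)[OF insert.prems(1) m] insert.hyps by (auto simp: resL_insert)
qed

lemma slice_decreasing: "decreasing (slice A b)" "F \<subseteq> slice A b \<Longrightarrow> decreasing F"
  unfolding decreasing_def using slice_orth[of _ A b] by blast+

lemma slice_sub: "F \<subseteq> slice A b \<Longrightarrow> finite F" "F \<subseteq> slice A b \<Longrightarrow> beta ` F \<subseteq> A"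
  using finite_subset[OF _ finite_slice] slice_in by (auto simp: subset_iff)

lemma resL_slice_iff:
  assumes "good B" "B \<subseteq> A" "y \<in> A"
  shows "y \<in> resL A (slice B b) \<longleftrightarrow> (\<forall>x\<in>B. E x y = 0)"
proof
  assume y: "y \<in> resL A (slice B b)"
  show "\<forall>x\<in>B. E x y = 0"
  proof
    fix x assume "x \<in> B"
    then have "x \<in> span (beta ` slice B b)" using good_spans[OF assms(1)] by (auto simp: spans_def)
    then show "E x y = 0" by (rule span_zero_left) (use y in \<open>auto simp: resL_def\<close>)
  qed
qed (use assms slice_in in \<open>auto simp: resL_def\<close>)

text \<open>The right complement of \<open>B\<close> in \<open>A\<close> has rank \<open>rk A - rk B\<close>, by peeling a slice of \<open>B\<close> off \<open>A\<close>.\<close>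

lemma complement:
  assumes "good A" "good B" "B \<subseteq> A"
  shows "good (resL A (slice B b))" "rk A = rk (resL A (slice B b)) + rk B"
proof -
  have "good (resL A (slice B b)) \<and> rk A = rk (resL A (slice B b)) + card (slice B b)"
    by (rule resL_decreasing) (use assms slice_in slice_decreasing in auto)
  then show "good (resL A (slice B b))" "rk A = rk (resL A (slice B b)) + rk B"
    using good_card[OF assms(2)] by auto
qed

lemma good_sub_eq:
  assumes "good A" "good B" "B \<subseteq> A" "rk A = rk B" shows "A = B"
proof -
  have "A \<subseteq> span (beta ` slice B 0)"
    by (rule good_exchange) (use assms slice_in[of _ B 0] slice_independent[of B 0] in \<open>auto simp: rk_def\<close>)
  also have "\<dots> \<subseteq> span B" by (rule span_mono) (auto simp: slice_in)
  finally have "A \<subseteq> B" using flatD[OF good_flat[OF assms(2)]] flat_sub[OF good_flat[OF assms(1)]] by blast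
  then show ?thesis using assms by auto
qed

text \<open>Perpendiculars can be reordered. The roots of \<open>A\<close> orthogonal to
  \<open>B\<close> on the right form a good flat \<open>D\<close> of rank
  \<open>rk A - rk B\<close>; a slice of \<open>D\<close> framed so that it starts with
  \<open>d\<close>, up to sign, cuts \<open>A\<close> down to a flat that contains \<open>B\<close>
  and has the rank of \<open>B\<close>, hence equals \<open>B\<close>.\<close>

lemma below_Rp_complement:
  assumes A: "good A" and B: "B \<in> below E A" and d: "d \<in> A" and orth: "\<And>y. y \<in> B \<Longrightarrow> E y d = 0"
  shows "B \<in> below E (Rp A d)"
proof -
  have gB: "good B" using good_below[OF B A] .
  have BA: "B \<subseteq> A" using below_sub[OF B] .
  obtain p where p: "beta p = d \<or> beta p = - d"
    using Phi_window[of d 0] flat_sub[OF good_flat[OF A] d] by metis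
  have pA: "beta p \<in> A" using p d flat_minus[OF good_flat[OF A]] by metis
  define D where "D = resL A (slice B p)"
  have D: "good D" "rk A = rk D + rk B" using complement[OF A gB BA, of p] by (auto simp: D_def)
  have Dsub: "D \<subseteq> A" by (auto simp: D_def resL_def)
  have pD: "beta p \<in> D" unfolding D_def using resL_slice_iff[OF gB BA pA, of p] p orth by auto
  define L where "L = slice D p"
  have pL: "p \<in> L" unfolding L_def by (rule slice_min[OF pD])
  have L: "finite L" "beta ` L \<subseteq> A" "decreasing L" "card L = rk D"
    unfolding L_def using slice_in Dsub slice_decreasing good_card[OF D(1)] by auto
  have Lp: "p < i" if "i \<in> L" "i \<noteq> p" for i using that slice_window[of i D p] by (auto simp: L_def)
  define L' where "L' = L - {p}"
  have LL': "L = insert p L'" using pL by (auto simp: L'_def)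
  have "resR (Rp A (beta p)) L' \<in> below E (Rp A (beta p))"
  proof -
    have "beta ` L' \<subseteq> Rp A (beta p)"
      using L Lp pL unfolding L'_def by (auto simp: rperp_def decreasing_def)
    then show ?thesis
      using resR_decreasing[of L' "Rp A (beta p)"] good_Rp(1)[OF A pA] L by (auto simp: L'_def decreasing_def)
  qed
  then have 1: "resR A L \<in> below E (Rp A (beta p))" using LL' resR_insert by simp
  have 2: "resR A L \<in> below E A \<and> rk A = rk (resR A L) + card L" by (rule resR_decreasing) (use L A in auto)
  have "B \<subseteq> resR A L"
  proof -
    have "E y (beta i) = 0" if "y \<in> B" "i \<in> L" for y i
    proof -
      have "beta i \<in> D" using that slice_in by (auto simp: L_def)
      then show ?thesis using resL_slice_iff[OF gB BA, of "beta i" p] Dsub that unfolding D_def by blast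
    qed
    then show ?thesis using BA by (auto simp: resR_def)
  qed
  then have "resR A L = B"
    using good_sub_eq[OF good_below[OF conjunct1[OF 2] A] gB] 2 D L by auto
  then show ?thesis using 1 p Rp_minus by metis
qed

section \<open>Increasing sets in one window and the flats below\<close>

definition Inc :: "'v set \<Rightarrow> nat \<Rightarrow> nat \<Rightarrow> nat set set" where
  "Inc A a m = {K. K \<subseteq> {a..<a+m} \<and> beta ` K \<subseteq> A \<and> increasing K}"

lemma IncD: "K \<in> Inc A a m \<Longrightarrow> finite K \<and> K \<subseteq> {a..<a+m} \<and> beta ` K \<subseteq> A \<and> increasing K"
  using finite_subset by (auto simp: Inc_def)

text \<open>All coefficients of \<open>x\<close> are nonpositive: the coefficient of the largest
  root is \<open>E x (beta m)\<close>, and subtracting that term keeps the remaining pairings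
  nonpositive because \<open>E (beta m) (beta i)\<close> is nonpositive too.\<close>

lemma nonpositive_combination:
  assumes "finite K" "increasing K" "x \<in> span (beta ` K)" "\<And>i. i \<in> K \<Longrightarrow> E x (beta i) \<le> 0"
    "\<And>i j. i \<in> K \<Longrightarrow> j \<in> K \<Longrightarrow> i < j \<Longrightarrow> E (beta j) (beta i) \<le> 0"
    "linear f" "\<And>i. i \<in> K \<Longrightarrow> 0 \<le> f (beta i)"
  shows "f x \<le> (0::real)"
  using assms
proof (induction K arbitrary: x rule: finite_linorder_max_induct)
  case empty then show ?case by (simp add: linear_0)
next
  case (insert m K)
  obtain c where c: "x - c *\<^sub>R beta m \<in> span (beta ` K)" using insert.prems(2) by (auto simp: span_insert)
  define x' where "x' = x - c *\<^sub>R beta m"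
  have "E x' (beta m) = 0" unfolding x'_def
    by (rule span_zero_left[OF c]) (use insert in \<open>auto simp: increasing_def\<close>)
  then have cn: "c \<le> 0" using insert.prems(3)[of m] by (simp add: x'_def E_simps)
  have "f x' \<le> 0"
  proof (rule insert.IH)
    show "E x' (beta i) \<le> 0" if "i \<in> K" for i
    proof -
      have "E (beta m) (beta i) \<le> 0" using insert.prems(4)[of i m] insert.hyps that by auto
      then have "0 \<le> c * E (beta m) (beta i)" using cn by (simp add: mult_nonpos_nonpos)
      then show ?thesis using insert.prems(3)[of i] that by (simp add: x'_def E_simps)
    qed
  qed (use insert.prems c in \<open>auto simp: x'_def increasing_def\<close>)
  moreover have "f x = f x' + c * f (beta m)" using insert.prems(5) by (simp add: x'_def linear_diff linear_scale)
  moreover have "c * f (beta m) \<le> 0" using cn insert.prems(6)[of m] by (simp add: mult_nonpos_nonneg)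
  ultimately show ?case by linarith
qed

text \<open>A later root of this kind would lie in the complement of \<open>resR A K\<close>, which
  is spanned by the roots of \<open>K\<close>. By \<open>dir2\<close> it pairs nonpositively with
  all of them, so the functional of \<open>posit\<close> would be nonpositive on it.\<close>

lemma Inc_max:
  assumes A: "good A" and K: "K \<in> Inc A a N" "K \<noteq> {}" and i: "i \<in> {a..<a+N}" "beta i \<in> A"
    and orth: "\<And>y. y \<in> resR A K \<Longrightarrow> E y (beta i) = 0"
  shows "i \<le> Max K"
proof (rule ccontr)
  assume "\<not> i \<le> Max K"
  have Kf: "finite K" "K \<subseteq> {a..<a+N}" "beta ` K \<subseteq> A" "increasing K" using IncD[OF K(1)] by auto
  have less: "j < i" if "j \<in> K" for j using Max_ge[OF Kf(1) that] \<open>\<not> i \<le> Max K\<close> by linarith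
  define B where "B = resR A K"
  have B: "B \<in> below E A" "rk A = rk B + card K" using resR_increasing[OF Kf(1) A Kf(3,4)] by (auto simp: B_def)
  have gB: "good B" using good_below[OF B(1) A] .
  have BA: "B \<subseteq> A" using below_sub[OF B(1)] .
  define D where "D = resL A (slice B 0)"
  have D: "good D" "rk D = card K" using complement[OF A gB BA, of 0] B by (auto simp: D_def)
  have KD: "beta ` K \<subseteq> D"
  proof
    fix x assume "x \<in> beta ` K"
    then show "x \<in> D" unfolding D_def using resL_slice_iff[OF gB BA, of x 0] Kf(3) by (auto simp: B_def resR_def)
  qed
  have ind: "independent (beta ` K) \<and> inj_on beta K"
    by (rule cotriangular_independent) (use Kf in \<open>auto simp: increasing_def\<close>)
  have "D \<subseteq> span (beta ` K)" by (rule good_exchange) (use D Kf KD ind in auto)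
  moreover have "beta i \<in> D" unfolding D_def using resL_slice_iff[OF gB BA i(2), of 0] orth by (auto simp: B_def)
  ultimately have isp: "beta i \<in> span (beta ` K)" by auto
  obtain f :: "'v \<Rightarrow> real" where f: "linear f" "\<forall>i\<in>{a..<a+N}. 0 < f (beta i)" using posit by blast
  have "f (beta i) \<le> 0"
  proof (rule nonpositive_combination[OF Kf(1,4) isp])
    show "E (beta i) (beta j) \<le> 0" if "j \<in> K" for j
      using dir2[of j i] less[OF that] i Kf(2) that by (auto simp: subset_iff)
    show "E (beta j) (beta k) \<le> 0" if "k \<in> K" "j \<in> K" "k < j" for j k
    proof -
      have "k \<in> {a..<a+N}" "j \<in> {a..<a+N}" using that Kf(2) by auto
      then show ?thesis using dir2[of k j] that by auto
    qed
    show "0 \<le> f (beta j)" if "j \<in> K" for j using f(2) that Kf(2) by (auto intro!: less_imp_le)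
  qed (rule f(1))
  then show False using f(2) i(1) by force
qed

lemma Inc_remove_max:
  assumes "K \<in> Inc A a N" "K \<noteq> {}"
  shows "K - {Max K} \<in> Inc (Rp A (beta (Max K))) a N" "resR A K = resR (Rp A (beta (Max K))) (K - {Max K})"
    "beta (Max K) \<in> A" "beta (Max K) \<notin> resR A K"
proof -
  have Kf: "finite K" "K \<subseteq> {a..<a+N}" "beta ` K \<subseteq> A" "increasing K" using IncD[OF assms(1)] by auto
  have M: "Max K \<in> K" using Kf assms by auto
  have lt: "i < Max K" if "i \<in> K - {Max K}" for i
    using Max_ge[OF Kf(1), of i] that by fastforce
  show "resR A K = resR (Rp A (beta (Max K))) (K - {Max K})"
    using resR_insert[of A "Max K" "K - {Max K}"] M by (simp add: insert_absorb)
  show "K - {Max K} \<in> Inc (Rp A (beta (Max K))) a N"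
    unfolding Inc_def rperp_def using Kf M lt by (auto simp: increasing_def)
  show "beta (Max K) \<in> A" using M Kf by auto
  show "beta (Max K) \<notin> resR A K" using M E_beta[of "Max K"] unfolding resR_def by force
qed

text \<open>By \<open>Inc_max\<close> the largest element of \<open>K\<close> is determined by the
  flat \<open>resR A K\<close>; the rest follows in the perpendicular of that root.\<close>

lemma Inc_inj:
  assumes "good A" "K1 \<in> Inc A a N" "K2 \<in> Inc A a N" "resR A K1 = resR A K2"
  shows "K1 = K2"
  using assms
proof (induction "rk A" arbitrary: A K1 K2 rule: less_induct)
  case less
  show ?case
  proof (cases "K1 = {} \<or> K2 = {}")
    case True
    then have eq: "resR A K1 = A" "resR A K2 = A" using less.prems(4) by (metis resR_empty)+
    then show ?thesis
      using Inc_remove_max(3,4)[OF less.prems(2)] Inc_remove_max(3,4)[OF less.prems(3)] by blast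
  next
    case False
    have K1: "K1 \<subseteq> {a..<a+N}" "finite K1" and K2: "K2 \<subseteq> {a..<a+N}" "finite K2" 
      using IncD[OF less.prems(2)] IncD[OF less.prems(3)] by auto
    have M1: "Max K1 \<in> K1" and M2: "Max K2 \<in> K2" using K1 K2 False by auto
    have W: "Max K1 \<in> {a..<a+N}" "Max K2 \<in> {a..<a+N}" using M1 M2 K1(1) K2(1) by blast+
    have o1: "E y (beta (Max K1)) = 0" if "y \<in> resR A K1" for y using that M1 by (auto simp: resR_def)
    have o2: "E y (beta (Max K2)) = 0" if "y \<in> resR A K2" for y using that M2 by (auto simp: resR_def)
    have "Max K2 \<le> Max K1"
      by (rule Inc_max[OF less.prems(1,2)]) (use False W Inc_remove_max(3)[OF less.prems(3)] o2 less.prems(4) in auto)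
    moreover have "Max K1 \<le> Max K2"
      by (rule Inc_max[OF less.prems(1,3)]) (use False W Inc_remove_max(3)[OF less.prems(2)] o1 less.prems(4) in auto)
    ultimately have M: "Max K1 = Max K2" by simp
    note r1 = Inc_remove_max[OF less.prems(2)] and r2 = Inc_remove_max[OF less.prems(3)]
    have "K1 - {Max K1} = K2 - {Max K1}"
      by (rule less.hyps[of "Rp A (beta (Max K1))"])
         (use r1 r2 M False good_Rp[OF less.prems(1)] less.prems(4) in auto)
    then show ?thesis using M1 M2 M by (metis insert_Diff)
  qed
qed

text \<open>Greedy choice: take the last position \<open>b\<close> in the window whose root is
  orthogonal to \<open>B\<close>. By \<open>below_Rp_complement\<close> the flat \<open>B\<close>
  lies below the perpendicular, and maximality of \<open>b\<close> places the recursively found set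
  in front of \<open>b\<close>.\<close>

lemma Inc_surj:
  assumes "good A" "B \<in> below E A"
  shows "\<exists>K\<in>Inc A a N. resR A K = B"
  using assms
proof (induction "rk A" arbitrary: A rule: less_induct)
  case less
  show ?case
  proof (cases "B = A")
    case True then show ?thesis by (intro bexI[of _ "{}"]) (auto simp: Inc_def increasing_def)
  next
    case False
    note A = less.prems(1) and B = less.prems(2)
    define I where "I = {i\<in>{a..<a+N}. beta i \<in> A \<and> (\<forall>y\<in>B. E y (beta i) = 0)}"
    obtain x where x: "x \<in> A" "B \<in> below E (Rp A x)" using below_cases[OF B] False by auto
    obtain i where i: "a \<le> i" "i < a + N" "beta i = x \<or> beta i = - x"
      using Phi_window[of x a] flat_sub[OF good_flat[OF A] x(1)] by metis
    have "beta i \<in> A" using i x(1) flat_minus[OF good_flat[OF A]] by metis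
    moreover have "E y (beta i) = 0" if "y \<in> B" for y
      using below_sub[OF x(2)] that i(3) by (auto simp: rperp_def)
    ultimately have "i \<in> I" using i by (auto simp: I_def)
    then have "I \<noteq> {}" "finite I" by (auto simp: I_def)
    define b where "b = Max I"
    have bI: "b \<in> I" using \<open>I \<noteq> {}\<close> \<open>finite I\<close> by (simp add: b_def)
    then have b: "a \<le> b" "b < a + N" "beta b \<in> A" "\<And>y. y \<in> B \<Longrightarrow> E y (beta b) = 0" by (auto simp: I_def)
    have BR: "B \<in> below E (Rp A (beta b))" by (rule below_Rp_complement[OF A B b(3,4)])
    obtain K where K: "K \<in> Inc (Rp A (beta b)) a N" "resR (Rp A (beta b)) K = B"
      using less.hyps[OF _ good_Rp(1)[OF A b(3)] BR] good_Rp(2)[OF A b(3)] by auto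
    have KI: "i \<in> I" if "i \<in> K" for i
      using IncD[OF K(1)] that K(2) by (auto simp: I_def rperp_def resR_def)
    have Kb: "i < b" if "i \<in> K" for i
    proof -
      have "i \<le> b" using Max_ge[OF \<open>finite I\<close> KI[OF that]] by (simp add: b_def)
      moreover have "i \<noteq> b" using IncD[OF K(1)] that E_beta[of b] by (auto simp: rperp_def)
      ultimately show ?thesis by simp
    qed
    have "insert b K \<in> Inc A a N"
      using IncD[OF K(1)] b Kb unfolding Inc_def increasing_def rperp_def by (auto dest: less_asym)
    moreover have "resR A (insert b K) = B" using K(2) by (simp add: resR_insert)
    ultimately show ?thesis by blast
  qed
qed

text \<open>The counterpart of the uniqueness of increasing maximal chains in a lexicographically
  shellable poset.\<close>

lemma Inc_bij: "good A \<Longrightarrow> bij_betw (resR A) (Inc A a N) (below E A)"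
  unfolding bij_betw_def
proof (intro conjI)
  assume A: "good A"
  show "inj_on (resR A) (Inc A a N)" using Inc_inj[OF A] by (auto simp: inj_on_def)
  show "resR A ` Inc A a N = below E A"
    using Inc_surj[OF A] resR_increasing[OF _ A] IncD by (auto simp: image_iff)
qed

section \<open>Operators along the sequence of roots\<close>

text \<open>Let \<open>R_i\<close> send a function \<open>f\<close> to the function whose value at
  \<open>A\<close> is \<open>f (Rp A (beta i))\<close> if \<open>beta i\<close> lies in
  \<open>A\<close>, and zero otherwise. \<open>rwin\<close> applies \<open>1 + R_i\<close> for
  consecutive positions \<open>i\<close>; over a full window the product is summation over
  \<open>below\<close>, by \<open>rwin_N\<close>.\<close>

primrec rwin :: "nat \<Rightarrow> ('v set \<Rightarrow> real) \<Rightarrow> nat \<Rightarrow> 'v set \<Rightarrow> real" where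
  "rwin a \<phi> 0 A = \<phi> A"
| "rwin a \<phi> (Suc m) A = rwin a \<phi> m A + (if beta (a + m) \<in> A then rwin a \<phi> m (Rp A (beta (a + m))) else 0)"

lemma finite_Inc: "finite (Inc A a m)"
  by (rule finite_subset[of _ "Pow {a..<a+m}"]) (auto simp: Inc_def)

lemma rwin_Inc: "rwin a \<phi> m A = (\<Sum>K\<in>Inc A a m. \<phi> (resR A K))"
proof (induction m arbitrary: A)
  case 0
  have "Inc A a 0 = {{}}" by (auto simp: Inc_def increasing_def)
  then show ?case by simp
next
  case (Suc m)
  define b where "b = a + m"
  have split: "Inc A a (Suc m) = Inc A a m \<union> {K \<in> Inc A a (Suc m). b \<in> K}"
    by (auto simp: Inc_def b_def less_Suc_eq)
  have disj: "Inc A a m \<inter> {K \<in> Inc A a (Suc m). b \<in> K} = {}" by (auto simp: Inc_def b_def)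
  have "(\<Sum>K\<in>{K \<in> Inc A a (Suc m). b \<in> K}. \<phi> (resR A K)) = (if beta b \<in> A then rwin a \<phi> m (Rp A (beta b)) else 0)"
  proof (cases "beta b \<in> A")
    case False
    then have "{K \<in> Inc A a (Suc m). b \<in> K} = {}" by (auto simp: Inc_def)
    then have "sum (\<lambda>K. \<phi> (resR A K)) {K \<in> Inc A a (Suc m). b \<in> K} = 0" by (metis sum.empty)
    then show ?thesis using False by simp
  next
    case True
    have "bij_betw (insert b) (Inc (Rp A (beta b)) a m) {K \<in> Inc A a (Suc m). b \<in> K}"
    proof (rule bij_betw_byWitness[where f' = "\<lambda>K. K - {b}"])
      show "\<forall>K\<in>Inc (Rp A (beta b)) a m. insert b K - {b} = K" by (auto simp: Inc_def b_def)
      show "insert b ` Inc (Rp A (beta b)) a m \<subseteq> {K \<in> Inc A a (Suc m). b \<in> K}"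
      proof (rule image_subsetI)
        fix K assume K: "K \<in> Inc (Rp A (beta b)) a m"
        have 1: "a \<le> i \<and> i < b" "beta i \<in> A" "E (beta i) (beta b) = 0" if "i \<in> K" for i
          using K that by (auto simp: Inc_def b_def rperp_def)
        have "insert b K \<subseteq> {a..<a + Suc m}" using 1(1) by (force simp: b_def)
        moreover have "increasing (insert b K)"
          using K 1 by (fastforce simp: Inc_def increasing_def)
        ultimately show "insert b K \<in> {K \<in> Inc A a (Suc m). b \<in> K}" using True 1(2) by (auto simp: Inc_def)
      qed
      show "(\<lambda>K. K - {b}) ` {K \<in> Inc A a (Suc m). b \<in> K} \<subseteq> Inc (Rp A (beta b)) a m"
      proof (clarsimp simp: Inc_def)
        fix K assume K: "K \<subseteq> {a..<Suc (a + m)}" "beta ` K \<subseteq> A" "increasing K" "b \<in> K"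
        then have 1: "i < b" if "i \<in> K - {b}" for i using that by (fastforce simp: b_def)
        then show "K - {b} \<subseteq> {a..<a + m} \<and> beta ` (K - {b}) \<subseteq> Rp A (beta b) \<and> increasing (K - {b})"
          using K by (force simp: rperp_def increasing_def b_def)
      qed
    qed auto
    then have "(\<Sum>K\<in>{K \<in> Inc A a (Suc m). b \<in> K}. \<phi> (resR A K)) = (\<Sum>K\<in>Inc (Rp A (beta b)) a m. \<phi> (resR A (insert b K)))"
      by (intro sum.reindex_bij_betw[symmetric])
    then show ?thesis using True Suc.IH by (simp add: resR_insert)
  qed
  moreover have "finite {K \<in> Inc A a (Suc m). b \<in> K}" using finite_Inc[of A a "Suc m"] by simp
  then have "(\<Sum>K\<in>Inc A a (Suc m). \<phi> (resR A K)) =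
      (\<Sum>K\<in>Inc A a m. \<phi> (resR A K)) + (\<Sum>K\<in>{K \<in> Inc A a (Suc m). b \<in> K}. \<phi> (resR A K))"
    by (subst split) (rule sum.union_disjoint[OF finite_Inc _ disj])
  ultimately show ?case using Suc.IH[of A] unfolding rwin.simps b_def[symmetric] by presburger
qed

lemma rwin_N: "good A \<Longrightarrow> rwin a \<phi> N A = (\<Sum>B\<in>below E A. \<phi> B)"
  using rwin_Inc sum.reindex_bij_betw[OF Inc_bij] by metis

lemma rwin_add: "rwin a \<phi> (m + k) A = rwin (a + m) (rwin a \<phi> m) k A"
  by (induction k arbitrary: A) (auto simp: add.assoc)

lemma rwin_multichains: "good A \<Longrightarrow> rwin a (\<lambda>_. 1) (n * N) A = multichains E n A"
proof (induction n arbitrary: A)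
  case (Suc n)
  have "rwin a (\<lambda>_. 1) (Suc n * N) A = rwin (a + n * N) (rwin a (\<lambda>_. 1) (n * N)) N A"
    using rwin_add[of a "\<lambda>_. 1" "n * N" N A] by (simp add: add.commute)
  also have "\<dots> = (\<Sum>B\<in>below E A. rwin a (\<lambda>_. 1) (n * N) B)" by (rule rwin_N[OF Suc.prems])
  also have "\<dots> = (\<Sum>B\<in>below E A. multichains E n B)" 
    by (rule sum.cong) (use Suc good_below in auto)
  finally show ?case by simp
qed simp

text \<open>The inverse factors \<open>1 - R_i\<close>, applied to the indicator of the empty flat.
  Over whole windows these are the iterated Moebius inverses of the zeta operator.\<close>

primrec swin :: "nat \<Rightarrow> nat \<Rightarrow> 'v set \<Rightarrow> real" where
  "swin 0 a A = (if A = {} then 1 else 0)"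
| "swin (Suc m) a A = swin m (Suc a) A - (if beta a \<in> A then swin m (Suc a) (Rp A (beta a)) else 0)"

lemma rwin_swin: "rwin a (swin (m + k) a) m A = swin k (a + m) A"
proof (induction m arbitrary: k A)
  case (Suc m)
  \<comment> \<open>A root is not in its own perpendicular, so the operator of one position squares
    to zero and the factors \<open>1 + R\<close> and \<open>1 - R\<close> cancel.\<close>
  have "beta (a + m) \<notin> Rp A (beta (a + m))" by (auto simp: rperp_def)
  then show ?case using Suc[of "Suc k"] by simp
qed simp

lemma swin_shift: "flat A \<Longrightarrow> swin k (a + N) A = swin k a A"
proof (induction k arbitrary: a A)
  case (Suc k)
  then show ?case using Suc.IH[of _ "Suc a"] by (simp add: flat_shift Rp_shift flat_Rp)
qed simp

lemma swin_zeta: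
  assumes "good A" shows "(\<Sum>B\<in>below E A. swin (Suc n * N) 0 B) = swin (n * N) 0 A"
proof -
  have "(\<Sum>B\<in>below E A. swin (Suc n * N) 0 B) = rwin 0 (swin (N + n * N) 0) N A"
    using rwin_N[OF assms, of 0 "swin (N + n * N) 0"] by simp
  then show ?thesis using rwin_swin[of 0 N "n*N" A] swin_shift[OF good_flat[OF assms], of "n*N" 0] by simp
qed

end


context euler_system begin

section \<open>Decreasing sets of full rank\<close>

definition Dec :: "'v set \<Rightarrow> nat set \<Rightarrow> nat set set" where
  "Dec A X = {F. F \<subseteq> X \<and> finite F \<and> beta ` F \<subseteq> A \<and> card F = rk A \<and> decreasing F}"

lemma finite_Dec: "finite X \<Longrightarrow> finite (Dec A X)"
  by (rule finite_subset[of _ "Pow X"]) (auto simp: Dec_def)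

text \<open>Only the positions of roots of \<open>A\<close> matter.\<close>

lemma Dec_cong: "X \<inter> {i. beta i \<in> A} = Y \<inter> {i. beta i \<in> A} \<Longrightarrow> Dec A X = Dec A Y"
  unfolding Dec_def by blast

lemma Dec_insert_min:
  assumes A: "good A" and a: "beta a \<in> A" "\<And>x. x \<in> X \<Longrightarrow> a < x"
  shows "bij_betw (insert a) (Dec (Rp A (beta a)) X) {F \<in> Dec A (insert a X). a \<in> F}"
proof (rule bij_betw_byWitness[where f' = "\<lambda>F. F - {a}"])
  have anot: "a \<notin> F" if "F \<subseteq> X" for F using a(2) that by blast
  show "\<forall>F\<in>Dec (Rp A (beta a)) X. insert a F - {a} = F" using anot by (auto simp: Dec_def)
  show "insert a ` Dec (Rp A (beta a)) X \<subseteq> {F \<in> Dec A (insert a X). a \<in> F}"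
  proof (rule image_subsetI)
    fix F assume F: "F \<in> Dec (Rp A (beta a)) X"
    have 1: "a < i" "beta i \<in> A" "E (beta i) (beta a) = 0" if "i \<in> F" for i
      using F a(2) that by (auto simp: Dec_def rperp_def)
    have "decreasing (insert a F)" using F 1 by (fastforce simp: Dec_def decreasing_def)
    moreover have "card (insert a F) = rk A" using F anot[of F] good_Rp(2)[OF A a(1)] by (auto simp: Dec_def)
    ultimately show "insert a F \<in> {F \<in> Dec A (insert a X). a \<in> F}" using F a(1) 1 by (auto simp: Dec_def)
  qed
  show "(\<lambda>F. F - {a}) ` {F \<in> Dec A (insert a X). a \<in> F} \<subseteq> Dec (Rp A (beta a)) X"
  proof (rule image_subsetI)
    fix F assume F: "F \<in> {F \<in> Dec A (insert a X). a \<in> F}"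
    have 1: "a < i" if "i \<in> F - {a}" for i using F a(2) that by (auto simp: Dec_def)
    have "card (F - {a}) = rk (Rp A (beta a))" using F good_Rp(2)[OF A a(1)] by (auto simp: Dec_def)
    moreover have "beta ` (F - {a}) \<subseteq> Rp A (beta a)" using F 1 by (auto simp: Dec_def rperp_def decreasing_def)
    moreover have "decreasing (F - {a})" using F by (auto simp: Dec_def decreasing_def)
    ultimately show "F - {a} \<in> Dec (Rp A (beta a)) X" using F by (auto simp: Dec_def)
  qed
qed (auto simp: insert_absorb)

lemma card_filter_split:
  "finite S \<Longrightarrow> card S = card {F \<in> S. P F} + card {F \<in> S. \<not> P F}"
  by (subst card_Un_disjoint[symmetric]) (auto intro: arg_cong[where f = card])

text \<open>Splitting by use of the first position reproduces the recursion of \<open>swin\<close>;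
  each perpendicular lowers the rank by one, and this absorbs the minus sign.\<close>

lemma swin_Dec: "good A \<Longrightarrow> swin m a A = (-1) ^ rk A * real (card (Dec A {a..<a+m}))"
proof (induction m arbitrary: a A)
  case 0
  have "Dec A {} = (if rk A = 0 then {{}} else {})" by (auto simp: Dec_def decreasing_def)
  then show ?case using rk_0[OF 0] by auto
next
  case (Suc m)
  have w: "{a..<a + Suc m} = insert a {Suc a..<Suc a + m}" by auto
  have 1: "{F \<in> Dec A {a..<a + Suc m}. a \<notin> F} = Dec A {Suc a..<Suc a + m}"
    unfolding w by (auto simp: Dec_def)
  have 2: "card {F \<in> Dec A {a..<a + Suc m}. a \<in> F} =
      (if beta a \<in> A then card (Dec (Rp A (beta a)) {Suc a..<Suc a + m}) else 0)"
  proof (cases "beta a \<in> A")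
    case True
    then show ?thesis using bij_betw_same_card[OF Dec_insert_min[OF Suc.prems True, of "{Suc a..<Suc a + m}"]] unfolding w by auto
  next
    case False
    then have "{F \<in> Dec A {a..<a + Suc m}. a \<in> F} = {}" by (auto simp: Dec_def)
    then show ?thesis using False by (metis card.empty)
  qed
  have 3: "card (Dec A {a..<a + Suc m}) = card {F \<in> Dec A {a..<a + Suc m}. a \<in> F} + card {F \<in> Dec A {a..<a + Suc m}. a \<notin> F}"
    by (rule card_filter_split) (simp add: finite_Dec)
  show ?case
  proof (cases "beta a \<in> A")
    case True
    then show ?thesis
      using Suc.IH[OF Suc.prems, of "Suc a"] Suc.IH[OF good_Rp(1)[OF Suc.prems True], of "Suc a"] 1 2 3 good_Rp(2)[OF Suc.prems True]
      by (simp add: algebra_simps)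
  next
    case False
    then show ?thesis using Suc.IH[OF Suc.prems, of "Suc a"] 1 2 3 by simp
  qed
qed

lemma Dec_slice: assumes "good A" shows "Dec A (slice A b) = {slice A b}"
proof -
  have "F = slice A b" if "F \<in> Dec A (slice A b)" for F
    using that good_card[OF assms, of b] card_subset_eq[OF finite_slice] by (auto simp: Dec_def)
  moreover have "slice A b \<in> Dec A (slice A b)"
    using slice_decreasing(1) slice_in good_card[OF assms, of b] by (auto simp: Dec_def)
  ultimately show ?thesis by blast
qed

text \<open>
  The element replacing \<open>b\<close> in the slice may be placed last: by \<open>rotate\<close> the roots behind it are
  orthogonal to it on both sides.
\<close>

lemma Dec_insert_rotated:
  assumes A: "good A" and b: "beta b \<in> A"
    and b': "b < b'" "beta b' \<in> A" "\<And>y. y \<in> A \<Longrightarrow> E (beta b') y = - E y (beta b)"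
      "slice A (Suc b) = insert b' (slice A b - {b})" "b' \<notin> slice A b"
    and Z: "Z \<subseteq> {..b} \<union> (slice A b - {b})" "b' \<notin> Z" "b \<notin> Z" "\<And>i. i \<in> Z \<Longrightarrow> beta i \<noteq> beta b"
  shows "bij_betw (insert b') (Dec (Rp A (beta b)) Z) {F \<in> Dec A (insert b' Z). b' \<in> F}"
proof (rule bij_betw_byWitness[where f' = "\<lambda>F. F - {b'}"])
  have above: "E (beta i) (beta b') = 0 \<and> E (beta i) (beta b) = 0" if "i \<in> Z" "b' < i" "beta i \<in> A" for i
  proof -
    have "i \<in> slice A b" "i \<noteq> b" using that Z b'(1) by auto
    then have "i \<in> slice A (Suc b)" "b' \<in> slice A (Suc b)" using b'(4) by auto
    then have "E (beta i) (beta b') = 0" using slice_orth that(2) by blast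
    moreover have "E (beta i) (beta b) = 0"
      using slice_orth[OF \<open>i \<in> slice A b\<close> slice_min[OF b]] that b'(1) by auto
    ultimately show ?thesis by simp
  qed
  show "\<forall>F\<in>Dec (Rp A (beta b)) Z. insert b' F - {b'} = F" using Z by (auto simp: Dec_def)
  show "insert b' ` Dec (Rp A (beta b)) Z \<subseteq> {F \<in> Dec A (insert b' Z). b' \<in> F}"
  proof (rule image_subsetI)
    fix F assume F: "F \<in> Dec (Rp A (beta b)) Z"
    have 1: "i \<in> Z" "beta i \<in> A" "E (beta i) (beta b) = 0" "E (beta b') (beta i) = 0" if "i \<in> F" for i
      using F that b'(3)[of "beta i"] by (auto simp: Dec_def rperp_def)
    have "decreasing (insert b' F)"
      unfolding decreasing_def using F 1 above by (auto simp: Dec_def decreasing_def)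
    moreover have "b' \<notin> F" using F Z(2) by (auto simp: Dec_def)
    then have "card (insert b' F) = rk A" using F good_Rp(2)[OF A b] by (auto simp: Dec_def)
    ultimately show "insert b' F \<in> {F \<in> Dec A (insert b' Z). b' \<in> F}" using F b' 1 by (auto simp: Dec_def)
  qed
  show "(\<lambda>F. F - {b'}) ` {F \<in> Dec A (insert b' Z). b' \<in> F} \<subseteq> Dec (Rp A (beta b)) Z"
  proof (rule image_subsetI)
    fix F assume F: "F \<in> {F \<in> Dec A (insert b' Z). b' \<in> F}"
    have orth: "E (beta i) (beta b) = 0" if "i \<in> F - {b'}" for i
    proof (cases "i < b'")
      case True
      then have "E (beta b') (beta i) = 0" using F that by (auto simp: Dec_def decreasing_def)
      then show ?thesis using b'(3)[of "beta i"] F that by (auto simp: Dec_def)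
    next
      case False then show ?thesis using above[of i] F that by (auto simp: Dec_def)
    qed
    have "card (F - {b'}) = rk (Rp A (beta b))" using F good_Rp(2)[OF A b] by (auto simp: Dec_def)
    moreover have "beta ` (F - {b'}) \<subseteq> Rp A (beta b)" using F orth by (auto simp: Dec_def rperp_def)
    moreover have "decreasing (F - {b'})" using F by (auto simp: Dec_def decreasing_def)
    ultimately show "F - {b'} \<in> Dec (Rp A (beta b)) Z" using F by (auto simp: Dec_def)
  qed
qed (auto simp: insert_absorb)

text \<open>When the window advances past \<open>b\<close>, the rotated slice exchanges
  \<open>b\<close> for \<open>b'\<close> while \<open>b\<close> itself enters the window, so the
  union gains exactly \<open>b'\<close>. Sets avoiding \<open>b'\<close> are the old ones, sets
  through \<open>b'\<close> are those of \<open>Rp A (beta b)\<close>; this is the recursion of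
  \<open>rwin\<close>.\<close>

theorem Dec_rwin:
  assumes "good A" shows "real (card (Dec A ({a..<a+m} \<union> slice A (a+m)))) = rwin a (\<lambda>_. 1) m A"
  using assms
proof (induction m arbitrary: A)
  case 0 then show ?case by (simp add: Dec_slice)
next
  case (Suc m)
  define b where "b = a + m"
  note A = Suc.prems
  have w: "{a..<a + Suc m} = insert b {a..<b}" by (auto simp: b_def)
  have sb: "slice A (a + Suc m) = slice A (Suc b)" by (simp add: b_def)
  show ?case
  proof (cases "beta b \<in> A")
    case False
    have "Dec A ({a..<a + Suc m} \<union> slice A (a + Suc m)) = Dec A ({a..<b} \<union> slice A b)"
      unfolding w sb slice_Suc_notin[OF good_flat[OF A] False] by (rule Dec_cong) (use False in blast)
    then show ?thesis using False Suc.IH[OF A] by (simp add: b_def)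
  next
    case True
    obtain b' where b': "b < b'" "b' \<le> b + N" "beta b' \<in> A" "\<And>y. y \<in> A \<Longrightarrow> E (beta b') y = - E y (beta b)"
      "slice A (Suc b) = insert b' (slice A b - {b})" "b' \<notin> slice A b"
      using rotate[OF good_flat[OF A] good_spans[OF A] True] by metis
    have bS: "b \<in> slice A b" using slice_min[OF True] .
    define Z where "Z = {a..<b} \<union> slice A b"
    have X: "{a..<a + Suc m} \<union> slice A (a + Suc m) = insert b' Z"
      unfolding w sb b'(5) Z_def using bS by blast
    have b'Z: "b' \<notin> Z" using b'(1,6) by (auto simp: Z_def)
    have 1: "{F \<in> Dec A (insert b' Z). b' \<notin> F} = Dec A Z" using b'Z by (auto simp: Dec_def)
    \<comment> \<open>Long windows repeat roots. A position carrying \<open>beta b\<close> cannot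
      occur together with \<open>b'\<close> in a decreasing set, because
      \<open>E (beta b') (beta b) = -1\<close>, so all such positions may be discarded.\<close>
    define Z' where "Z' = Z - {i. beta i = beta b}"
    have Eb: "E (beta b') (beta b) = -1" using b'(4)[OF True] by simp
    have eqZ: "{F \<in> Dec A (insert b' Z). b' \<in> F} = {F \<in> Dec A (insert b' Z'). b' \<in> F}"
    proof -
      have "beta i \<noteq> beta b" if F: "F \<in> Dec A (insert b' Z)" "b' \<in> F" "i \<in> F" "i \<noteq> b'" for F i
      proof
        assume ib: "beta i = beta b"
        show False
        proof (cases "i < b'")
          case True
          then have "E (beta b') (beta i) = 0" using F by (auto simp: Dec_def decreasing_def)
          then show False using ib Eb by simp
        next
          case False
          then have "i \<in> slice A b" "i \<noteq> b" using F b'(1) by (auto simp: Dec_def Z_def)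
          then show False using slice_window[of i A b] beta_distinct[of b i] ib by fastforce
        qed
      qed
      then show ?thesis unfolding Z'_def Dec_def by blast
    qed
    have bijZ: "bij_betw (insert b') (Dec (Rp A (beta b)) Z') {F \<in> Dec A (insert b' Z'). b' \<in> F}"
      by (rule Dec_insert_rotated[OF A True b'(1,3,4,5,6)]) (use b'Z in \<open>auto simp: Z'_def Z_def\<close>)
    have 2: "card {F \<in> Dec A (insert b' Z). b' \<in> F} = card (Dec (Rp A (beta b)) Z')"
      unfolding eqZ by (rule bij_betw_same_card[OF bijZ, symmetric])
    have 3: "Dec (Rp A (beta b)) Z' = Dec (Rp A (beta b)) ({a..<b} \<union> slice (Rp A (beta b)) b)"
    proof (rule Dec_cong)
      have "beta i \<noteq> beta b" "i \<noteq> b" if "beta i \<in> Rp A (beta b)" for i 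
        using that E_beta[of b] by (auto simp: rperp_def)
      then show "Z' \<inter> {i. beta i \<in> Rp A (beta b)} = ({a..<b} \<union> slice (Rp A (beta b)) b) \<inter> {i. beta i \<in> Rp A (beta b)}"
        unfolding good_Rp_beta(3)[OF A True] Z'_def Z_def by blast
    qed
    have fin: "finite (Dec A (insert b' Z))" by (rule finite_Dec) (auto simp: Z_def)
    have "card (Dec A (insert b' Z)) = card {F \<in> Dec A (insert b' Z). b' \<in> F} + card {F \<in> Dec A (insert b' Z). b' \<notin> F}"
      by (rule card_filter_split[OF fin])
    then show ?thesis unfolding X
      using 1 2 3 Suc.IH[OF A] Suc.IH[OF good_Rp(1)[OF A True]] True by (simp add: Z_def b_def)
  qed
qed

lemma Dec_multichains:
  assumes "good A" shows "real (card (Dec A ({a..<a+n*N} \<union> slice A (a+n*N)))) = multichains E n A"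
  using Dec_rwin[OF assms, of a "n*N"] rwin_multichains[OF assms] by simp

definition window :: "'v set \<Rightarrow> nat \<Rightarrow> nat \<Rightarrow> nat set" where
  "window A n a = {a..<a+n*N} \<union> slice A (a+n*N)"

lemma finite_window [simp]: "finite (window A n a)" by (simp add: window_def)

text \<open>Moving the window drops \<open>a\<close> and adds \<open>b'\<close>. Sets through
  \<open>a\<close> and sets through \<open>b'\<close> both reduce to \<open>Dec R Y\<close> for the
  same perpendicular \<open>R\<close>, since \<open>beta b\<close> is \<open>beta a\<close> up to
  sign for \<open>b = a + n * N\<close>, and neither reduction touches \<open>x\<close>.\<close>

lemma card_Dec_through_Suc:
  assumes A: "good A" and x: "x \<in> window A n a" "x \<noteq> a" "0 < n"
  shows "x \<in> window A n (Suc a)"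
    "card {F \<in> Dec A (window A n a). x \<in> F} = card {F \<in> Dec A (window A n (Suc a)). x \<in> F}"
proof -
  define b where "b = a + n * N"
  have ab: "a < b" using x(3) N_pos by (simp add: b_def)
  have bA: "beta b \<in> A \<longleftrightarrow> beta a \<in> A"
    using beta_mult[of a n] flat_minus_iff[OF good_flat[OF A], of "beta a"] by (auto simp: b_def)
  have Rb: "Rp A (beta b) = Rp A (beta a)" using beta_mult[of a n] Rp_minus by (auto simp: b_def)
  have w: "{Suc a..<Suc a + n * N} = insert b {Suc a..<b}" "{a..<a + n * N} = insert a {Suc a..<b}"
    using ab by (auto simp: b_def)
  have sb: "slice A (Suc a + n * N) = slice A (Suc b)" "slice A (a + n * N) = slice A b" by (simp_all add: b_def)
  have "x \<in> window A n (Suc a) \<and>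
    card {F \<in> Dec A (window A n a). x \<in> F} = card {F \<in> Dec A (window A n (Suc a)). x \<in> F}"
  proof (cases "beta b \<in> A")
    case False
    have "Dec A (window A n a) = Dec A (window A n (Suc a))"
      unfolding window_def w sb slice_Suc_notin[OF good_flat[OF A] False]
      by (rule Dec_cong) (use False bA in blast)
    moreover have "x \<in> window A n (Suc a)"
      using x unfolding window_def w sb slice_Suc_notin[OF good_flat[OF A] False] by blast
    ultimately show ?thesis by simp
  next
    case True
    obtain b' where b': "b < b'" "b' \<le> b + N" "beta b' \<in> A" "\<And>y. y \<in> A \<Longrightarrow> E (beta b') y = - E y (beta b)"
      "slice A (Suc b) = insert b' (slice A b - {b})" "b' \<notin> slice A b"
      using rotate[OF good_flat[OF A] good_spans[OF A] True] by metis
    have bS: "b \<in> slice A b" using slice_min[OF True] .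
    define Y where "Y = {Suc a..<b} \<union> slice A b"
    have Wa: "window A n a = insert a Y" unfolding window_def w sb Y_def by blast
    have Wb: "window A n (Suc a) = insert b' Y" unfolding window_def w sb b'(5) Y_def using bS by blast
    have aY: "a < i" if "i \<in> Y" for i using that ab slice_window[of i A b] by (auto simp: Y_def)
    have b'Y: "b' \<notin> Y" using b'(1,6) by (auto simp: Y_def)
    have aA: "beta a \<in> A" using True bA by simp
    define Z where "Z = Y - {b} - {i. beta i = beta b}"
    define R where "R = Rp A (beta a)"
    have YZ: "Dec R Y = Dec R Z"
    proof (rule Dec_cong)
      have "beta i \<noteq> beta b" "i \<noteq> b" if "beta i \<in> R" for i 
      proof -
        have "beta i \<in> Rp A (beta b)" using that by (simp only: R_def Rb)
        then show "beta i \<noteq> beta b" "i \<noteq> b" by (auto simp: rperp_def)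
      qed
      then show "Y \<inter> {i. beta i \<in> R} = Z \<inter> {i. beta i \<in> R}" unfolding Z_def by blast
    qed
    have bij1: "bij_betw (insert a) (Dec R Y) {F \<in> Dec A (insert a Y). a \<in> F}"
      unfolding R_def by (rule Dec_insert_min[OF A aA aY])
    have "bij_betw (insert b') (Dec (Rp A (beta b)) Z) {F \<in> Dec A (insert b' Z). b' \<in> F}"
      by (rule Dec_insert_rotated[OF A True b'(1,3,4,5,6)]) (use b'Y in \<open>auto simp: Z_def Y_def\<close>)
    moreover have "{F \<in> Dec A (insert b' Z). b' \<in> F} = {F \<in> Dec A (insert b' Y). b' \<in> F}"
    proof -
      have Eb: "E (beta b') (beta b) = -1" using b'(4)[OF True] by simp
      have "beta i \<noteq> beta b \<and> i \<noteq> b" if F: "F \<in> Dec A (insert b' Y)" "b' \<in> F" "i \<in> F" "i \<noteq> b'" for F i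
      proof (rule ccontr)
        assume "\<not> ?thesis"
        then have ib: "beta i = beta b" by auto
        show False
        proof (cases "i < b'")
          case True
          then have "E (beta b') (beta i) = 0" using F by (auto simp: Dec_def decreasing_def)
          then show False using ib Eb by simp
        next
          case False
          then have "i \<in> slice A b" "i \<noteq> b" using F b'(1) by (auto simp: Dec_def Y_def)
          then show False using slice_window[of i A b] beta_distinct[of b i] ib by fastforce
        qed
      qed
      then show ?thesis unfolding Z_def Dec_def by blast
    qed
    ultimately have bij2: "bij_betw (insert b') (Dec R Y) {F \<in> Dec A (insert b' Y). b' \<in> F}"
      unfolding YZ unfolding R_def Rb by simp
    have xY: "x \<in> Y" using x Wa by auto
    have xa: "x \<noteq> a" "x \<noteq> b'" using x b'Y xY by auto
    have restr: "card {F \<in> Dec A (insert c Y). c \<in> F \<and> x \<in> F} = card {F \<in> Dec R Y. x \<in> F}"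
      if bij: "bij_betw (insert c) (Dec R Y) {F \<in> Dec A (insert c Y). c \<in> F}" and "x \<noteq> c" for c
    proof -
      have "bij_betw (insert c) {F \<in> Dec R Y. x \<in> F} {F \<in> Dec A (insert c Y). c \<in> F \<and> x \<in> F}"
      proof (rule bij_betw_subset[OF bij])
        have "insert c ` {F \<in> Dec R Y. x \<in> F} = {F \<in> insert c ` Dec R Y. x \<in> F}" using \<open>x \<noteq> c\<close> by auto
        also have "insert c ` Dec R Y = {F \<in> Dec A (insert c Y). c \<in> F}" using bij by (simp add: bij_betw_def)
        finally show "insert c ` {F \<in> Dec R Y. x \<in> F} = {F \<in> Dec A (insert c Y). c \<in> F \<and> x \<in> F}" by auto
      qed auto
      then show ?thesis by (rule bij_betw_same_card[symmetric])
    qed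
    have tot: "card {F \<in> Dec A (insert c Y). x \<in> F} = card {F \<in> Dec R Y. x \<in> F} + card {F \<in> Dec A Y. x \<in> F}"
      if bij: "bij_betw (insert c) (Dec R Y) {F \<in> Dec A (insert c Y). c \<in> F}" and "x \<noteq> c" "c \<notin> Y" for c
    proof -
      have "finite {F \<in> Dec A (insert c Y). x \<in> F}" using finite_Dec[of "insert c Y" A] by (auto simp: Y_def)
      from card_filter_split[OF this, of "\<lambda>F. c \<in> F"]
      have "card {F \<in> Dec A (insert c Y). x \<in> F} =
         card {F \<in> Dec A (insert c Y). c \<in> F \<and> x \<in> F} + card {F \<in> Dec A (insert c Y). x \<in> F \<and> c \<notin> F}"
        by (simp add: conj_ac)
      moreover have "{F \<in> Dec A (insert c Y). x \<in> F \<and> c \<notin> F} = {F \<in> Dec A Y. x \<in> F}" using that(3) by (auto simp: Dec_def)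
      ultimately show ?thesis using restr[OF bij that(2)] by (simp add: conj_ac)
    qed
    have "a \<notin> Y" using aY by auto
    then show ?thesis unfolding Wa Wb using tot[OF bij1 xa(1)] tot[OF bij2 xa(2) b'Y] xY by simp
  qed
  then show "x \<in> window A n (Suc a)"
    "card {F \<in> Dec A (window A n a). x \<in> F} = card {F \<in> Dec A (window A n (Suc a)). x \<in> F}" by auto
qed

text \<open>The window is moved until \<open>x\<close> is its first position; there sets through
  \<open>x\<close> are the same as sets for the perpendicular of \<open>beta x\<close>.\<close>

lemma card_Dec_through:
  assumes A: "good A" and x: "x \<in> window A n a" "0 < n" "beta x \<in> A"
  shows "real (card {F \<in> Dec A (window A n a). x \<in> F}) = multichains E n (Rp A (beta x))"
proof -
  have ax: "a \<le> x" using x(1) slice_window[of x A "a+n*N"] by (auto simp: window_def)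
  have "x \<in> window A n (a + d) \<and>
     card {F \<in> Dec A (window A n a). x \<in> F} = card {F \<in> Dec A (window A n (a + d)). x \<in> F}" if "a + d \<le> x" for d
    using that
  proof (induction d)
    case (Suc d)
    then show ?case using card_Dec_through_Suc[OF A, of x n "a + d"] x(2) by auto
  qed (use x in auto)
  from this[of "x - a"] have 1: "card {F \<in> Dec A (window A n a). x \<in> F} = card {F \<in> Dec A (window A n x). x \<in> F}"
    using ax by auto
  define b where "b = x + n * N"
  have xb: "x < b" using x(2) N_pos by (simp add: b_def)
  define R where "R = Rp A (beta x)"
  have Rb: "Rp A (beta b) = R" using beta_mult[of x n] Rp_minus by (auto simp: b_def R_def)
  have bA: "beta b \<in> A"
    using beta_mult[of x n] flat_minus_iff[OF good_flat[OF A], of "beta x"] x(3) by (auto simp: b_def)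
  have w: "{x..<b} = insert x {Suc x..<b}" using xb by auto
  have W: "window A n x = insert x ({Suc x..<b} \<union> slice A b)" using xb by (auto simp: window_def b_def)
  have "bij_betw (insert x) (Dec R ({Suc x..<b} \<union> slice A b)) {F \<in> Dec A (window A n x). x \<in> F}"
    unfolding W R_def
  proof (rule Dec_insert_min[OF A x(3)])
    fix y assume "y \<in> {Suc x..<b} \<union> slice A b"
    then have "y \<in> {Suc x..<b} \<or> b \<le> y" using slice_window[of y A b] by auto
    then show "x < y" using xb by auto
  qed
  then have "card {F \<in> Dec A (window A n x). x \<in> F} = card (Dec R ({Suc x..<b} \<union> slice A b))"
    by (rule bij_betw_same_card[symmetric])
  also have "Dec R ({Suc x..<b} \<union> slice A b) = Dec R ({x..<x+n*N} \<union> slice R (x+n*N))"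
  proof (rule Dec_cong)
    have "beta x \<notin> R" by (simp add: R_def rperp_def)
    moreover have "beta b \<notin> R" by (simp add: Rb[symmetric] rperp_def)
    moreover have "slice R b = slice A b - {b}" using good_Rp_beta(3)[OF A bA] by (simp add: Rb)
    ultimately show "({Suc x..<b} \<union> slice A b) \<inter> {i. beta i \<in> R} = ({x..<x+n*N} \<union> slice R (x+n*N)) \<inter> {i. beta i \<in> R}"
      unfolding b_def[symmetric] w by blast
  qed
  finally show ?thesis using 1 Dec_multichains[OF good_Rp(1)[OF A x(3)], of x n] unfolding R_def by simp
qed

lemma sum_window_periodic:
  assumes "\<And>i. f (i + N) = f i"
  shows "(\<Sum>i\<in>{0..<n*N}. f i) = real n * (\<Sum>i\<in>{0..<N}. f i :: real)"
proof (induction n)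
  case (Suc n)
  have f: "f (i + n * N) = f i" for i 
    by (induction n) (use assms in \<open>auto simp: add.assoc[symmetric] add.commute[of N]\<close>)
  have "{0..<Suc n * N} = {0..<n*N} \<union> {n*N..<n*N+N}" by auto
  then have "(\<Sum>i\<in>{0..<Suc n*N}. f i) = (\<Sum>i\<in>{0..<n*N}. f i) + (\<Sum>i\<in>{n*N..<n*N+N}. f i)"
    by (simp add: sum.union_disjoint)
  also have "(\<Sum>i\<in>{n*N..<n*N+N}. f i) = (\<Sum>i\<in>{0..<N}. f i)"
    using sum.shift_bounds_nat_ivl[of f 0 "n*N" N] f by (simp add: add.commute)
  finally show ?case using Suc by (simp add: algebra_simps)
qed simp

text \<open>Double count of pairs of a set in \<open>Dec\<close> and one of its members: each set
  has \<open>rk A\<close> members, and the sets through a given position are counted by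
  \<open>card_Dec_through\<close>. The \<open>n\<close> windows contribute \<open>n\<close> equal
  sums and the final slice contributes the extra one.\<close>

theorem multichains_recursion:
  assumes A: "good A"
  shows "real (rk A) * multichains E n A =
     real n * (\<Sum>i | i < N \<and> beta i \<in> A. multichains E n (Rp A (beta i))) +
     (\<Sum>i\<in>slice A 0. multichains E n (Rp A (beta i)))"
proof (cases "n = 0")
  case True then show ?thesis by (simp add: rk_def)
next
  case False
  define W where "W = {i \<in> window A n 0. beta i \<in> A}"
  have D: "F \<subseteq> W" "card F = rk A" if "F \<in> Dec A (window A n 0)" for F using that by (auto simp: Dec_def W_def)
  have "rk A * card (Dec A (window A n 0)) = (\<Sum>F\<in>Dec A (window A n 0). card F)"
    using D(2) by simp
  also have "\<dots> = (\<Sum>F\<in>Dec A (window A n 0). \<Sum>x\<in>W. if x \<in> F then 1 else 0)"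
  proof (rule sum.cong)
    fix F assume "F \<in> Dec A (window A n 0)"
    then show "card F = (\<Sum>x\<in>W. if x \<in> F then 1 else 0)"
      using D(1)[of F] sum.inter_restrict[of W "\<lambda>_. 1::nat" F] by (simp add: Int_absorb1 W_def)
  qed simp
  also have "\<dots> = (\<Sum>x\<in>W. \<Sum>F\<in>Dec A (window A n 0). if x \<in> F then 1 else 0)" by (rule sum.swap)
  also have "\<dots> = (\<Sum>x\<in>W. card {F \<in> Dec A (window A n 0). x \<in> F})"
    by (rule sum.cong) (auto simp: sum.If_cases finite_Dec Int_def)
  finally have "real (rk A) * real (card (Dec A (window A n 0))) = (\<Sum>x\<in>W. real (card {F \<in> Dec A (window A n 0). x \<in> F}))"
    unfolding of_nat_mult[symmetric] of_nat_sum[symmetric] by simp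
  also have "\<dots> = (\<Sum>x\<in>W. multichains E n (Rp A (beta x)))"
    by (rule sum.cong) (use card_Dec_through[OF A] False in \<open>auto simp: W_def\<close>)
  also have "W = {i\<in>{0..<n*N}. beta i \<in> A} \<union> slice A (n*N)"
    by (auto simp: W_def window_def slice_in)
  also have "(\<Sum>x\<in>\<dots>. multichains E n (Rp A (beta x))) =
     (\<Sum>x\<in>{i\<in>{0..<n*N}. beta i \<in> A}. multichains E n (Rp A (beta x))) + (\<Sum>x\<in>slice A (n*N). multichains E n (Rp A (beta x)))"
    by (rule sum.union_disjoint) (auto dest: slice_window)
  also have "(\<Sum>x\<in>{i\<in>{0..<n*N}. beta i \<in> A}. multichains E n (Rp A (beta x))) =
     (\<Sum>i\<in>{0..<n*N}. if beta i \<in> A then multichains E n (Rp A (beta i)) else 0)"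
    by (rule sum.inter_filter) auto
  also have "\<dots> = real n * (\<Sum>i\<in>{0..<N}. if beta i \<in> A then multichains E n (Rp A (beta i)) else 0)"
    by (rule sum_window_periodic) (use flat_shift[OF good_flat[OF A]] Rp_shift in auto)
  also have "(\<Sum>i\<in>{0..<N}. if beta i \<in> A then multichains E n (Rp A (beta i)) else 0) =
      (\<Sum>i | i < N \<and> beta i \<in> A. multichains E n (Rp A (beta i)))"
    by (subst sum.inter_filter[symmetric]) (auto intro: sum.cong)
  also have "(\<Sum>x\<in>slice A (n*N). multichains E n (Rp A (beta x))) = (\<Sum>x\<in>slice A 0. multichains E n (Rp A (beta x)))"
  proof -
    have "(\<Sum>x\<in>slice A (m*N). multichains E n (Rp A (beta x))) = (\<Sum>x\<in>slice A 0. multichains E n (Rp A (beta x)))" for m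
    proof (induction m)
      case (Suc m)
      have "slice A (Suc m * N) = (\<lambda>i. i + N) ` slice A (m*N)"
        using slice_shift[OF good_flat[OF A], of "m*N"] by (simp add: add.commute)
      then show ?case using Suc by (simp add: sum.reindex inj_on_def Rp_shift)
    qed simp
    then show ?thesis .
  qed
  finally show ?thesis using Dec_multichains[OF A, of 0 n] by (simp add: window_def)
qed

end

section \<open>The polynomial of a flat\<close>


lemma nonneg_coeffs_add: "nonneg_coeffs p \<Longrightarrow> nonneg_coeffs q \<Longrightarrow> nonneg_coeffs (p + q)"
  by (simp add: nonneg_coeffs_def)
lemma nonneg_coeffs_sum: "(\<And>x. x \<in> S \<Longrightarrow> nonneg_coeffs (f x)) \<Longrightarrow> nonneg_coeffs (sum f S)"
  by (auto simp: nonneg_coeffs_def coeff_sum intro: sum_nonneg)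
lemma nonneg_coeffs_pCons: "nonneg_coeffs p \<Longrightarrow> nonneg_coeffs (pCons 0 p)"
  by (auto simp: nonneg_coeffs_def coeff_pCons split: nat.split)
lemma nonneg_coeffs_mult: "nonneg_coeffs p \<Longrightarrow> nonneg_coeffs q \<Longrightarrow> nonneg_coeffs (p * q)"
  by (auto simp: nonneg_coeffs_def coeff_mult intro: sum_nonneg)
lemma nonneg_coeffs_smult: "0 < c \<Longrightarrow> nonneg_coeffs (smult c p) \<longleftrightarrow> nonneg_coeffs p"
  by (auto simp: nonneg_coeffs_def zero_le_mult_iff)

lemma poly_eq_infinite:
  fixes p q :: "real poly"
  assumes "infinite X" "\<And>x. x \<in> X \<Longrightarrow> poly p x = poly q x" shows "p = q"
proof (rule ccontr)
  assume "p \<noteq> q"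
  then have "finite {x. poly (p - q) x = 0}" by (intro poly_roots_finite) simp
  moreover have "X \<subseteq> {x. poly (p - q) x = 0}" using assms(2) by auto
  ultimately show False using assms(1) finite_subset by blast
qed

lemma inj_ratio: "inj (\<lambda>n::nat. real n / (real n + 1))"
  by (auto simp: inj_def field_simps)

lemma infinite_ratio: "infinite ((\<lambda>n::nat. real n / (real n + 1)) ` {m..})"
  using finite_imageD[of "\<lambda>n::nat. real n / (real n + 1)" "{m..}"] inj_on_subset[OF inj_ratio] infinite_Ici by blast

lemma poly_eq_ratio:
  assumes "\<And>n. m \<le> n \<Longrightarrow> poly p (real n / (real n + 1)) = poly q (real n / (real n + 1))"
  shows "p = q"
  by (rule poly_eq_infinite[OF infinite_ratio[of m]]) (use assms in auto)

lemma poly_sum_le: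
  fixes p :: "real poly" assumes "degree p \<le> k" shows "poly p x = (\<Sum>i\<le>k. coeff p i * x ^ i)"
  unfolding poly_altdef using assms by (intro sum.mono_neutral_left) (auto simp: coeff_eq_0)

definition rev_poly :: "nat \<Rightarrow> real poly \<Rightarrow> real poly" where
  "rev_poly k c = (\<Sum>i\<le>k. monom (coeff c (k - i)) i)"

lemma poly_rev_poly:
  assumes "degree c \<le> k" "z \<noteq> 0" shows "poly (rev_poly k c) z = z ^ k * poly c (1 / z)"
proof -
  have "poly (rev_poly k c) z = (\<Sum>i\<le>k. coeff c (k - i) * z ^ i)" by (simp add: rev_poly_def poly_sum poly_monom)
  also have "\<dots> = (\<Sum>i\<le>k. coeff c i * z ^ (k - i))" 
    by (rule sum.reindex_bij_witness[of _ "\<lambda>i. k - i" "\<lambda>i. k - i"]) auto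
  also have "\<dots> = (\<Sum>i\<le>k. z ^ k * (coeff c i * (1 / z) ^ i))"
    by (rule sum.cong) (use assms(2) in \<open>auto simp: power_diff field_simps\<close>)
  also have "\<dots> = z ^ k * poly c (1 / z)"
    by (simp add: poly_sum_le[OF assms(1)] sum_distrib_left)
  finally show ?thesis .
qed

lemma below_image:
  assumes iso: "inj_on f A" "\<And>x y. x \<in> A \<Longrightarrow> y \<in> A \<Longrightarrow> E (f x) (f y) = E x y"
  shows "below E (f ` A) = (`) f ` below E A"
proof -
  have sub: "B \<in> below E A \<Longrightarrow> B \<subseteq> A" for B by (induction rule: below.induct) (auto simp: rperp_def)
  have r: "rperp E (f ` B) (f x) = f ` rperp E B x" if "B \<subseteq> A" "x \<in> B" for B x
    using that iso(2) by (auto simp: rperp_def subset_iff)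
  show ?thesis
  proof (intro equalityI subsetI)
    fix C assume "C \<in> below E (f ` A)"
    then show "C \<in> (`) f ` below E A"
    proof (induction rule: below.induct)
      case (step C y)
      then obtain B x where "C = f ` B" "B \<in> below E A" "y = f x" "x \<in> B" by auto
      then show ?case using r[OF sub] below.step[of B E A x] by auto
    qed (auto intro: below.self)
  next
    fix C assume "C \<in> (`) f ` below E A"
    then obtain B where "C = f ` B" "B \<in> below E A" by auto
    moreover have "B \<in> below E A \<Longrightarrow> f ` B \<in> below E (f ` A)"
    proof (induction rule: below.induct)
      case (step B x)
      then show ?case using r[OF sub, of B x] below.step[of "f ` B" E "f ` A" "f x"] by auto
    qed (auto intro: below.self)
    ultimately show "C \<in> below E (f ` A)" by auto
  qed
qed

lemma multichains_image:
  assumes "inj_on f A" "\<And>x y. x \<in> A \<Longrightarrow> y \<in> A \<Longrightarrow> E (f x) (f y) = E x y"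
  shows "multichains E n (f ` A) = multichains E n A"
  using assms
proof (induction n arbitrary: A)
  case (Suc n)
  have sub: "B \<in> below E A \<Longrightarrow> B \<subseteq> A" for B by (induction rule: below.induct) (auto simp: rperp_def)
  have inj: "inj_on ((`) f) (below E A)"
    using inj_on_image_Pow[OF Suc.prems(1)] by (rule inj_on_subset) (auto dest: sub)
  have "below E (f ` A) = (`) f ` below E A" by (rule below_image) (use Suc.prems in auto)
  then have "multichains E (Suc n) (f ` A) = (\<Sum>B\<in>below E A. multichains E n (f ` B))"
    using sum.reindex[OF inj, of "multichains E n"] by simp
  also have "\<dots> = (\<Sum>B\<in>below E A. multichains E n B)"
  proof (rule sum.cong)
    fix B assume "B \<in> below E A"
    then have "B \<subseteq> A" by (rule sub)
    then show "multichains E n (f ` B) = multichains E n B"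
      using Suc.prems by (intro Suc.IH) (auto intro: inj_on_subset)
  qed simp
  finally show ?case by simp
qed simp

context euler_system begin

text \<open>The reflection in \<open>x\<close> maps the right perpendicular onto the left one, and
  on the right perpendicular it preserves \<open>E\<close> itself, not only its
  symmetrisation.\<close>

lemma multichains_Rp_Lp:
  assumes A: "good A" and x: "x \<in> A" shows "multichains E n (Rp A x) = multichains E n (Lp A x)"
proof -
  define f where "f y = y - (E y x + E x y) *\<^sub>R x" for y
  have x1: "E x x = 1" using E_unit flat_sub[OF good_flat[OF A] x] by auto
  have ff: "f (f y) = y" for y by (simp add: f_def E_simps x1 algebra_simps)
  have fA: "f y \<in> A" if "y \<in> A" for y using flat_refl[OF good_flat[OF A] that x] by (simp add: f_def)
  have "f ` Rp A x = Lp A x"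
  proof (intro equalityI subsetI)
    fix z assume "z \<in> f ` Rp A x"
    then obtain y where y: "y \<in> A" "E y x = 0" "z = f y" by (auto simp: rperp_def)
    have "E x (f y) = 0" using y(2) by (simp add: f_def E_simps x1)
    then show "z \<in> Lp A x" using fA[OF y(1)] y(3) by (simp add: lperp_def)
  next
    fix z assume z: "z \<in> Lp A x"
    then have "E (f z) x = 0" by (simp add: f_def E_simps x1 lperp_def)
    then have "f z \<in> Rp A x" using fA[of z] z by (simp add: rperp_def lperp_def)
    then show "z \<in> f ` Rp A x" using ff by (metis image_eqI)
  qed
  moreover have "multichains E n (f ` Rp A x) = multichains E n (Rp A x)"
  proof (rule multichains_image)
    show "inj_on f (Rp A x)" by (rule inj_on_inverseI[of _ f]) (rule ff)
    show "E (f y) (f z) = E y z" if "y \<in> Rp A x" "z \<in> Rp A x" for y z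
      using that by (simp add: rperp_def f_def E_simps x1)
  qed
  ultimately show ?thesis by simp
qed

definition pos :: "'v set \<Rightarrow> nat set" where "pos A = {i. i < N \<and> beta i \<in> A}"

lemma finite_pos [simp]: "finite (pos A)" by (simp add: pos_def)
lemma slice_pos: "slice A 0 \<subseteq> pos A" by (auto simp: slice_def pos_def)
lemma slice_posD: "i \<in> slice A 0 \<Longrightarrow> i \<in> pos A" by (auto simp: slice_def pos_def)

text \<open>This is \<open>multichains_recursion\<close> divided by \<open>(n + 1) ^ rk A\<close>:
  slice positions, which occur \<open>n + 1\<close> times, get weight one, the others get weight
  \<open>n / (n + 1)\<close>, the variable of the polynomial. The first argument is the rank and
  only drives the recursion.\<close>

primrec cc :: "nat \<Rightarrow> 'v set \<Rightarrow> real poly" where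
  "cc 0 A = 1"
| "cc (Suc k) A = smult (1 / real (Suc k)) ((\<Sum>i\<in>slice A 0. cc k (Rp A (beta i))) +
     pCons 0 (\<Sum>i\<in>pos A - slice A 0. cc k (Rp A (beta i))))"

definition cpoly :: "'v set \<Rightarrow> real poly" where "cpoly A = cc (rk A) A"

lemma good_Rp_pos: "good A \<Longrightarrow> i \<in> pos A \<Longrightarrow> good (Rp A (beta i)) \<and> rk A = Suc (rk (Rp A (beta i)))"
  using good_Rp by (auto simp: pos_def)

lemma cpoly_rec:
  assumes A: "good A"
  shows "smult (real (rk A)) (cpoly A) = (\<Sum>i\<in>slice A 0. cpoly (Rp A (beta i))) +
     pCons 0 (\<Sum>i\<in>pos A - slice A 0. cpoly (Rp A (beta i)))"
proof (cases "rk A")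
  case 0
  then have "slice A 0 = {}" "pos A = {}" using rk_0[OF A] by (auto simp: slice_def pos_def)
  then show ?thesis using 0 by simp
next
  case (Suc k)
  have *: "cpoly (Rp A (beta i)) = cc k (Rp A (beta i))" if "i \<in> pos A" for i
    using good_Rp_pos[OF A that] Suc by (simp add: cpoly_def)
  have "smult (real (rk A)) (cpoly A) = (\<Sum>i\<in>slice A 0. cc k (Rp A (beta i))) +
     pCons 0 (\<Sum>i\<in>pos A - slice A 0. cc k (Rp A (beta i)))"
    using Suc by (simp add: cpoly_def del: of_nat_Suc)
  also have "(\<Sum>i\<in>slice A 0. cc k (Rp A (beta i))) = (\<Sum>i\<in>slice A 0. cpoly (Rp A (beta i)))"
    by (rule sum.cong) (use * slice_posD in auto)
  also have "(\<Sum>i\<in>pos A - slice A 0. cc k (Rp A (beta i))) = (\<Sum>i\<in>pos A - slice A 0. cpoly (Rp A (beta i)))"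
    by (rule sum.cong) (use * in auto)
  finally show ?thesis .
qed

lemma nonneg_cpoly: "good A \<Longrightarrow> nonneg_coeffs (cpoly A)"
proof (induction "rk A" arbitrary: A rule: less_induct)
  case less
  show ?case
  proof (cases "rk A = 0")
    case True then show ?thesis by (simp add: cpoly_def nonneg_coeffs_def)
  next
    case False
    have IH: "nonneg_coeffs (cpoly (Rp A (beta i)))" if "i \<in> pos A" for i
      using less.hyps good_Rp_pos[OF less.prems that] by auto
    have "nonneg_coeffs (smult (real (rk A)) (cpoly A))"
      unfolding cpoly_rec[OF less.prems]
      by (intro nonneg_coeffs_add nonneg_coeffs_pCons nonneg_coeffs_sum) (use IH slice_posD in auto)
    then show ?thesis using nonneg_coeffs_smult[of "real (rk A)"] False by simp
  qed
qed

lemma pos_rank_1: assumes A: "good A" "rk A = 1" shows "pos A = slice A 0"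
proof -
  obtain i where i: "slice A 0 = {i}" using A(2) card_1_singletonE unfolding rk_def by blast
  have "j = i" if j: "j \<in> pos A" for j
  proof -
    have "beta j \<in> span {beta i}" using good_spans[OF A(1), of 0] i j by (auto simp: spans_def pos_def)
    then obtain c where c: "beta j = c *\<^sub>R beta i" by (auto simp: span_singleton)
    then have "c * c = 1" using E_beta[of j] by (simp add: E_simps)
    then have "c = 1 \<or> c = -1" by algebra
    then have "beta j = beta i \<or> beta j = - beta i" using c by auto
    moreover have "j \<in> {0..<0+N}" using j by (simp add: pos_def)
    moreover have "i \<in> {0..<0+N}" using slice_window[of i A 0] i by blast
    ultimately show "j = i" using beta_inj by blast
  qed
  then have "pos A \<subseteq> slice A 0" unfolding i by blast
  then show ?thesis using slice_pos[of A] by (rule equalityI)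
qed

text \<open>A flat of rank one has a single position in the base window and it belongs to the slice,
  so of the \<open>rk A\<close> steps of the recursion the last one does not raise the degree. The
  vanishing top coefficient is essential in \<open>eulerian_transform\<close>.\<close>

lemma coeff_cpoly_0: "good A \<Longrightarrow> 0 < rk A \<Longrightarrow> rk A \<le> i \<Longrightarrow> coeff (cpoly A) i = 0"
proof (induction "rk A" arbitrary: A i rule: less_induct)
  case less
  have "coeff (smult (real (rk A)) (cpoly A)) i = 0"
  proof (cases "rk A = 1")
    case True
    have "cpoly (Rp A (beta j)) = 1" if "j \<in> slice A 0" for j
      using good_Rp_pos[OF less.prems(1) slice_posD[OF that]] True by (auto simp: cpoly_def)
    then have "smult (real (rk A)) (cpoly A) = of_nat (card (slice A 0))"
      unfolding cpoly_rec[OF less.prems(1)] pos_rank_1[OF less.prems(1) True] by simp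
    then show ?thesis using less.prems True by (cases i) (auto simp: of_nat_poly coeff_pCons)
  next
    case False
    then obtain i' where i': "i = Suc i'" using less.prems by (cases i) auto
    have IH: "coeff (cpoly (Rp A (beta j))) l = 0" if "j \<in> pos A" "i' \<le> l" for j l
      by (rule less.hyps) (use good_Rp_pos[OF less.prems(1) that(1)] that less.prems False i' in auto)
    show ?thesis unfolding cpoly_rec[OF less.prems(1)]
      using slice_posD[of _ A] IH by (auto simp: i' coeff_sum intro!: sum.neutral)
  qed
  then show ?case using less.prems(2) by simp
qed

lemma degree_cpoly: "good A \<Longrightarrow> degree (cpoly A) \<le> rk A"
proof (cases "rk A = 0")
  case False
  assume "good A"
  then show ?thesis using coeff_cpoly_0[of A] False by (intro degree_le) auto
qed (simp add: cpoly_def)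

lemma multichains_cpoly:
  "good A \<Longrightarrow> multichains E n A = (real n + 1) ^ rk A * poly (cpoly A) (real n / (real n + 1))"
proof (induction "rk A" arbitrary: A rule: less_induct)
  case less
  note A = less.prems
  show ?case
  proof (cases "rk A")
    case 0
    then have "below E A = {A}"
      using rk_0[OF A] below_sub below.self by auto
    then have "multichains E n A = 1" by (induction n) auto
    then show ?thesis using 0 by (simp add: cpoly_def)
  next
    case (Suc k)
    define z where "z = real n / (real n + 1)"
    have z: "real n = (real n + 1) * z" "1 = (real n + 1) * (1 - z)" by (auto simp: z_def field_simps)
    have IH: "multichains E n (Rp A (beta i)) = (real n + 1) ^ k * poly (cpoly (Rp A (beta i))) z" if "i \<in> pos A" for i
      using less.hyps good_Rp_pos[OF A that] Suc by (auto simp: z_def)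
    define X where "X = (\<Sum>i\<in>slice A 0. poly (cpoly (Rp A (beta i))) z)"
    define Y where "Y = (\<Sum>i\<in>pos A - slice A 0. poly (cpoly (Rp A (beta i))) z)"
    have 1: "(\<Sum>i\<in>slice A 0. multichains E n (Rp A (beta i))) = (real n + 1) ^ k * X"
      unfolding X_def sum_distrib_left by (rule sum.cong) (use IH slice_posD in auto)
    have 2: "(\<Sum>i\<in>pos A - slice A 0. multichains E n (Rp A (beta i))) = (real n + 1) ^ k * Y"
      unfolding Y_def sum_distrib_left by (rule sum.cong) (use IH in auto)
    have 3: "(\<Sum>i\<in>pos A. multichains E n (Rp A (beta i))) = (real n + 1) ^ k * Y + (real n + 1) ^ k * X"
      using sum.subset_diff[OF slice_pos[of A] finite_pos, of "\<lambda>i. multichains E n (Rp A (beta i))"] 1 2 by simp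
    have "real (rk A) * multichains E n A = real n * ((real n + 1) ^ k * Y + (real n + 1) ^ k * X) + (real n + 1) ^ k * X"
      using multichains_recursion[OF A, of n] 1 3 by (simp add: pos_def)
    also have "\<dots> = (real n + 1) ^ k * (real n * Y + (real n + 1) * X)" by (simp add: algebra_simps)
    also have "\<dots> = (real n + 1) ^ k * ((real n + 1) * (z * Y + X))"
      using z(1) by (metis (no_types, opaque_lifting) add.commute distrib_left mult.assoc)
    also have "z * Y + X = real (rk A) * poly (cpoly A) z"
      using arg_cong[OF cpoly_rec[OF A], of "\<lambda>p. poly p z"] by (simp add: X_def Y_def poly_sum)
    finally show ?thesis using Suc by (simp add: z_def)
  qed
qed

lemma cpoly_eqI:
  assumes "good A" "good B" "rk A = rk B" "\<And>n. multichains E n A = multichains E n B"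
  shows "cpoly A = cpoly B"
proof (rule poly_eq_ratio[of 0])
  fix n
  have "(real n + 1) ^ rk A \<noteq> 0" by simp
  then show "poly (cpoly A) (real n / (real n + 1)) = poly (cpoly B) (real n / (real n + 1))"
    using multichains_cpoly[OF assms(1), of n] multichains_cpoly[OF assms(2), of n] assms(3) assms(4)[of n] by simp
qed

lemma cpoly_Rp_Lp: "good A \<Longrightarrow> x \<in> A \<Longrightarrow> cpoly (Rp A x) = cpoly (Lp A x)"
proof (rule cpoly_eqI)
  assume A: "good A" "x \<in> A"
  show "good (Rp A x)" "good (Lp A x)" "rk (Rp A x) = rk (Lp A x)"
    using good_Rp[OF A] good_Lp[OF A] by auto
qed (rule multichains_Rp_Lp)

section \<open>Zeta polynomials and reciprocity\<close>

lemma empty_below: assumes "good A" shows "{} \<in> below E A"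
proof -
  have "resR A (slice A 0) \<in> below E A \<and> rk A = rk (resR A (slice A 0)) + card (slice A 0)"
    by (rule resR_decreasing) (use assms slice_decreasing slice_in in auto)
  then show ?thesis using rk_0[OF good_below[OF _ assms]] by (auto simp: rk_def)
qed

text \<open>The homogenised form of \<open>cpoly\<close>: a polynomial in the length of multichains,
  which can therefore be evaluated at negative lengths.\<close>

definition zeta_poly :: "'v set \<Rightarrow> real poly" where
  "zeta_poly A = (\<Sum>i\<le>rk A. smult (coeff (cpoly A) i) ([:0, 1:] ^ i * [:1, 1:] ^ (rk A - i)))"

lemma poly_zeta_poly:
  assumes "good A" "x \<noteq> -1" shows "poly (zeta_poly A) x = (x + 1) ^ rk A * poly (cpoly A) (x / (x + 1))"
proof -
  have x: "x + 1 \<noteq> 0" using assms(2) by auto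
  have "poly (zeta_poly A) x = (\<Sum>i\<le>rk A. coeff (cpoly A) i * (x ^ i * (x + 1) ^ (rk A - i)))"
    by (simp add: zeta_poly_def poly_sum add.commute)
  also have "\<dots> = (\<Sum>i\<le>rk A. (x + 1) ^ rk A * (coeff (cpoly A) i * (x / (x + 1)) ^ i))"
    by (rule sum.cong) (use x in \<open>auto simp: power_diff power_divide field_simps\<close>)
  also have "\<dots> = (x + 1) ^ rk A * poly (cpoly A) (x / (x + 1))"
    by (simp add: poly_sum_le[OF degree_cpoly[OF assms(1)]] sum_distrib_left)
  finally show ?thesis .
qed

lemma zeta_poly_multichains: "good A \<Longrightarrow> poly (zeta_poly A) (real n) = multichains E n A"
  using poly_zeta_poly[of A "real n"] multichains_cpoly[of A n] by simp

lemma zeta_poly_shift: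
  assumes "good A" shows "poly (zeta_poly A) x = (\<Sum>B\<in>below E A. poly (zeta_poly B) (x - 1))"
proof -
  have "zeta_poly A = (\<Sum>B\<in>below E A. pcompose (zeta_poly B) [:-1, 1:])"
  proof (rule poly_eq_infinite[of "range (\<lambda>n. real (Suc n))"])
    have "inj (\<lambda>n. real (Suc n))" by (auto simp: inj_def)
    then show "infinite (range (\<lambda>n. real (Suc n)))" by (rule range_inj_infinite)
    fix x assume "x \<in> range (\<lambda>n. real (Suc n))"
    then obtain n where n: "x = real (Suc n)" by auto
    have "poly (\<Sum>B\<in>below E A. pcompose (zeta_poly B) [:-1, 1:]) x = (\<Sum>B\<in>below E A. multichains E n B)"
      unfolding poly_sum poly_pcompose
      by (rule sum.cong) (use n zeta_poly_multichains good_below[OF _ assms] in auto)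
    then show "poly (zeta_poly A) x = poly (\<Sum>B\<in>below E A. pcompose (zeta_poly B) [:-1, 1:]) x"
      using zeta_poly_multichains[OF assms, of "Suc n"] n by simp
  qed
  from arg_cong[OF this, of "\<lambda>p. poly p x"] show ?thesis by (simp add: poly_sum poly_pcompose)
qed

lemma below_sum_top:
  assumes "good A" shows "(\<Sum>B\<in>below E A. f B) = f A + (\<Sum>B\<in>below E A - {A}. f B :: real)"
  using sum.remove[OF finite_below[OF good_finite[OF assms]] below.self, of f] by simp

text \<open>Moebius inversion on \<open>below\<close>: proper members have smaller rank, so the top
  term can be isolated by induction.\<close>

lemma below_sum_inj:
  assumes "\<And>A. good A \<Longrightarrow> (\<Sum>B\<in>below E A. f B) = (\<Sum>B\<in>below E A. g B :: real)"
  shows "good A \<Longrightarrow> f A = g A"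
proof (induction "rk A" arbitrary: A rule: less_induct)
  case less
  have "(\<Sum>B\<in>below E A - {A}. f B) = (\<Sum>B\<in>below E A - {A}. g B)"
  proof (rule sum.cong)
    fix B assume "B \<in> below E A - {A}"
    then show "f B = g B"
      using less.hyps[of B] below_rk[of B A] good_below[of B A] less.prems by blast
  qed simp
  then show ?case using assms[OF less.prems] below_sum_top[OF less.prems] by (metis add_right_cancel)
qed

lemma zeta_poly_minus_1: "good A \<Longrightarrow> poly (zeta_poly A) (-1) = (if A = {} then 1 else 0)"
proof (rule below_sum_inj[of "\<lambda>A. poly (zeta_poly A) (-1)"])
  fix A assume A: "good A"
  have "(\<Sum>B\<in>below E A. poly (zeta_poly B) (-1)) = 1"
    using zeta_poly_shift[OF A, of 0] zeta_poly_multichains[OF A, of 0] by simp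
  then show "(\<Sum>B\<in>below E A. poly (zeta_poly B) (-1)) = (\<Sum>B\<in>below E A. if B = {} then 1 else 0)"
    using empty_below[OF A] finite_below[OF good_finite[OF A]] by (simp add: sum.delta)
qed

text \<open>Summation over \<open>below\<close> lowers the length by one on both sides, by
  \<open>swin_zeta\<close> and \<open>zeta_poly_shift\<close>, and both sides start from the
  indicator of the empty flat.\<close>

theorem reciprocity: "good A \<Longrightarrow> swin (n * N) 0 A = poly (zeta_poly A) (- real n - 1)"
proof (induction n arbitrary: A)
  case 0 then show ?case using zeta_poly_minus_1 by simp
next
  case (Suc n)
  show ?case
  proof (rule below_sum_inj[OF _ Suc.prems])
    fix A assume A: "good A"
    have "(\<Sum>B\<in>below E A. swin (Suc n * N) 0 B) = poly (zeta_poly A) (- real n - 1)"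
      using swin_zeta[OF A] Suc.IH[OF A] by simp
    also have "\<dots> = (\<Sum>B\<in>below E A. poly (zeta_poly B) (- real (Suc n) - 1))"
      using zeta_poly_shift[OF A, of "- real n - 1"] by (simp add: algebra_simps)
    finally show "(\<Sum>B\<in>below E A. swin (Suc n * N) 0 B) = (\<Sum>B\<in>below E A. poly (zeta_poly B) (- real (Suc n) - 1))" .
  qed
qed

text \<open>Every subset \<open>F\<close> of a slice is decreasing, so the part of a set inside
  \<open>S\<close> is arbitrary; the roots in front of \<open>F\<close> are restricted only by lying
  in \<open>resL A F\<close>.\<close>

lemma Dec_split:
  assumes A: "good A" and S: "S \<subseteq> slice A b" and X: "finite X" "\<And>x y. x \<in> X \<Longrightarrow> y \<in> S \<Longrightarrow> x < y"
  shows "card (Dec A (X \<union> S)) = (\<Sum>F\<in>Pow S. card (Dec (resL A F) X))"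
proof -
  have fS: "finite S" using slice_sub[OF S] by auto
  have disj: "x \<notin> S" if "x \<in> X" for x using X(2)[OF that] by blast
  have "bij_betw (\<lambda>(F, H). F \<union> H) (SIGMA F:Pow S. Dec (resL A F) X) (Dec A (X \<union> S))"
  proof (rule bij_betw_byWitness[where f' = "\<lambda>G. (G \<inter> S, G \<inter> X)"])
    show "\<forall>p\<in>SIGMA F:Pow S. Dec (resL A F) X. (\<lambda>G. (G \<inter> S, G \<inter> X)) ((\<lambda>(F, H). F \<union> H) p) = p"
      using disj by (auto simp: Dec_def)
    show "\<forall>G\<in>Dec A (X \<union> S). (\<lambda>(F, H). F \<union> H) (G \<inter> S, G \<inter> X) = G" by (auto simp: Dec_def)
    show "(\<lambda>(F, H). F \<union> H) ` (SIGMA F:Pow S. Dec (resL A F) X) \<subseteq> Dec A (X \<union> S)"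
    proof clarify
      fix F H assume F: "F \<subseteq> S" and H: "H \<in> Dec (resL A F) X"
      have FA: "F \<subseteq> slice A b" using F S by auto
      have r: "good (resL A F) \<and> rk A = rk (resL A F) + card F"
        by (rule resL_decreasing) (use A slice_sub[OF FA] slice_decreasing(2)[OF FA] in auto)
      have "F \<inter> H = {}" using F H disj by (auto simp: Dec_def)
      then have "card (F \<union> H) = rk A" using r H slice_sub(1)[OF FA] by (auto simp: Dec_def card_Un_disjoint)
      moreover have "decreasing (F \<union> H)"
        unfolding decreasing_def
      proof (intro ballI impI)
        fix i j assume ij: "i \<in> F \<union> H" "j \<in> F \<union> H" "j < i"
        have HX: "h < f" if "h \<in> H" "f \<in> F" for h f using H F X(2)[of h f] that by (auto simp: Dec_def)
        consider "i \<in> F" "j \<in> F" | "i \<in> F" "j \<in> H" | "i \<in> H" "j \<in> H"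
          using ij HX[of i j] less_asym by blast
        then show "E (beta i) (beta j) = 0"
        proof cases
          case 1 then show ?thesis using slice_decreasing(2)[OF FA] ij(3) by (auto simp: decreasing_def)
        next
          case 2 then show ?thesis using H by (auto simp: Dec_def resL_def)
        next
          case 3 then show ?thesis using H ij(3) by (auto simp: Dec_def decreasing_def)
        qed
      qed
      ultimately show "F \<union> H \<in> Dec A (X \<union> S)"
        using F H slice_sub[OF FA] by (auto simp: Dec_def resL_def)
    qed
    show "(\<lambda>G. (G \<inter> S, G \<inter> X)) ` Dec A (X \<union> S) \<subseteq> (SIGMA F:Pow S. Dec (resL A F) X)"
    proof (rule image_subsetI)
      fix G assume G: "G \<in> Dec A (X \<union> S)"
      define F where "F = G \<inter> S"
      have FA: "F \<subseteq> slice A b" using S by (auto simp: F_def)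
      have r: "good (resL A F) \<and> rk A = rk (resL A F) + card F"
        by (rule resL_decreasing) (use A slice_sub[OF FA] slice_decreasing(2)[OF FA] in auto)
      have Gu: "G = F \<union> (G \<inter> X)" "F \<inter> (G \<inter> X) = {}" using G disj by (auto simp: Dec_def F_def)
      have "card G = card F + card (G \<inter> X)"
        using card_Un_disjoint[of F "G \<inter> X"] Gu slice_sub(1)[OF FA] X(1) by auto
      then have "card (G \<inter> X) = rk (resL A F)" using r G by (auto simp: Dec_def)
      moreover have "beta ` (G \<inter> X) \<subseteq> resL A F"
        using G X(2) by (auto simp: Dec_def resL_def F_def decreasing_def)
      ultimately show "(G \<inter> S, G \<inter> X) \<in> (SIGMA F:Pow S. Dec (resL A F) X)"
        using G by (auto simp: Dec_def decreasing_def F_def)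
    qed
  qed
  then have "card (Dec A (X \<union> S)) = card (SIGMA F:Pow S. Dec (resL A F) X)" by (rule bij_betw_same_card[symmetric])
  also have "\<dots> = (\<Sum>F\<in>Pow S. card (Dec (resL A F) X))"
    by (rule card_SigmaI) (use fS X(1) finite_Dec in auto)
  finally show ?thesis .
qed

lemma good_resL: "good A \<Longrightarrow> F \<subseteq> slice A b \<Longrightarrow> good (resL A F) \<and> rk A = rk (resL A F) + card F"
  by (rule resL_decreasing[OF slice_sub(1) _ slice_sub(2) slice_decreasing(2)])

lemma slice_shift_mult: "flat A \<Longrightarrow> slice A (m * N) = (\<lambda>i. i + m * N) ` slice A 0"
proof (induction m)
  case (Suc m)
  have "slice A (Suc m * N) = (\<lambda>i. i + N) ` slice A (m * N)"
    using slice_shift[OF Suc.prems, of "m * N"] by (simp add: add.commute)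
  then show ?case using Suc by (simp add: image_image algebra_simps)
qed simp

lemma resL_shift: "resL A ((\<lambda>i. i + m * N) ` F) = resL A F"
proof -
  have "E (beta (i + m * N)) y = 0 \<longleftrightarrow> E (beta i) y = 0" for i y using beta_mult[of i m] by auto
  then show ?thesis by (auto simp: resL_def)
qed

text \<open>The part of a decreasing set in the final slice is split off. What remains lies in whole
  windows and is counted by reciprocity at \<open>- n - 1\<close>, where the argument
  \<open>x / (x + 1)\<close> of \<open>cpoly\<close> becomes \<open>(n + 1) / n\<close>.\<close>

lemma multichains_positive:
  assumes A: "good A" and n: "0 < n"
  shows "multichains E n A = (\<Sum>F\<in>Pow (slice A 0). real n ^ (rk A - card F) * poly (cpoly (resL A F)) ((real n + 1) / real n))"
proof -
  have "multichains E n A = real (card (Dec A ({0..<n*N} \<union> slice A (n*N))))"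
    using Dec_multichains[OF A, of 0 n] by simp
  also have "\<dots> = (\<Sum>F\<in>Pow (slice A (n*N)). real (card (Dec (resL A F) {0..<n*N})))"
    by (subst Dec_split[OF A order.refl]) (auto dest: slice_window)
  also have "Pow (slice A (n*N)) = (`) (\<lambda>i. i + n*N) ` Pow (slice A 0)"
    by (simp add: slice_shift_mult[OF good_flat[OF A]] image_Pow_surj)
  also have "(\<Sum>F\<in>\<dots>. real (card (Dec (resL A F) {0..<n*N}))) = (\<Sum>F\<in>Pow (slice A 0). real (card (Dec (resL A F) {0..<n*N})))"
    by (subst sum.reindex) (auto simp: resL_shift inj_on_def inj_image_eq_iff)
  also have "\<dots> = (\<Sum>F\<in>Pow (slice A 0). real n ^ (rk A - card F) * poly (cpoly (resL A F)) ((real n + 1) / real n))"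
  proof (rule sum.cong)
    fix F assume "F \<in> Pow (slice A 0)"
    then have g: "good (resL A F)" "rk (resL A F) = rk A - card F" using good_resL[OF A] by auto
    have "(-1) ^ rk (resL A F) * swin (n*N) 0 (resL A F) = real (card (Dec (resL A F) {0..<n*N}))"
      using swin_Dec[OF g(1), of "n*N" 0] by (simp flip: power_add mult_2 add: power_mult_distrib mult.assoc[symmetric])
    then have "real (card (Dec (resL A F) {0..<n*N})) = (-1) ^ rk (resL A F) * poly (zeta_poly (resL A F)) (- real n - 1)"
      using reciprocity[OF g(1), of n] by simp
    also have "\<dots> = (-1) ^ rk (resL A F) * ((- real n) ^ rk (resL A F) * poly (cpoly (resL A F)) ((- real n - 1) / (- real n)))"
      using poly_zeta_poly[OF g(1), of "- real n - 1"] n by simp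
    also have "(- real n - 1) / (- real n) = (real n + 1) / real n" using n by (simp add: field_simps)
    also have "(-1) ^ rk (resL A F) * ((- real n) ^ rk (resL A F) * poly (cpoly (resL A F)) ((real n + 1) / real n)) = real n ^ (rk A - card F) * poly (cpoly (resL A F)) ((real n + 1) / real n)"
      by (simp add: g(2) mult.assoc[symmetric] power_mult_distrib[symmetric])
    finally show "real (card (Dec (resL A F) {0..<n*N})) = real n ^ (rk A - card F) * poly (cpoly (resL A F)) ((real n + 1) / real n)" .
  qed simp
  finally show ?thesis .
qed

text \<open>The two counts of multichains are compared at \<open>w = n / (n + 1)\<close>. Since
  \<open>1 - w = 1 / (n + 1)\<close>, the missing powers of \<open>n + 1\<close> become
  \<open>(1 - w) ^ card F\<close>; the substitution \<open>w = 1 / z\<close> then gives the stated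
  form.\<close>

theorem cpoly_reversed:
  assumes A: "good A" and z: "z \<noteq> 0"
  shows "z ^ rk A * poly (cpoly A) (1 / z) = (\<Sum>F\<in>Pow (slice A 0). (z - 1) ^ card F * poly (cpoly (resL A F)) z)"
proof -
  have F: "good (resL A F)" "rk A = rk (resL A F) + card F" if "F \<in> Pow (slice A 0)" for F using good_resL[OF A] that by auto
  have "cpoly A = (\<Sum>F\<in>Pow (slice A 0). [:1, -1:] ^ card F * rev_poly (rk (resL A F)) (cpoly (resL A F)))"
  proof (rule poly_eq_ratio[of 1])
    fix n :: nat assume n: "1 \<le> n"
    define w where "w = real n / (real n + 1)"
    have w: "w \<noteq> 0" "1 - w = 1 / (real n + 1)" "1 / w = (real n + 1) / real n" using n by (auto simp: w_def field_simps)
    have "(real n + 1) ^ rk A * poly (cpoly A) w = 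
      (\<Sum>F\<in>Pow (slice A 0). real n ^ (rk A - card F) * poly (cpoly (resL A F)) (1 / w))"
      using multichains_cpoly[OF A, of n] multichains_positive[OF A, of n] n by (simp add: w_def)
    also have "\<dots> = (\<Sum>F\<in>Pow (slice A 0). (real n + 1) ^ rk A * ((1 - w) ^ card F * (w ^ rk (resL A F) * poly (cpoly (resL A F)) (1 / w))))"
    proof (rule sum.cong)
      fix G assume G: "G \<in> Pow (slice A 0)"
      have "(real n + 1) ^ rk A * ((1 - w) ^ card G * w ^ rk (resL A G)) = real n ^ rk (resL A G)"
        unfolding F(2)[OF G] w(2) w_def by (simp add: power_add power_divide field_simps)
      then show "real n ^ (rk A - card G) * poly (cpoly (resL A G)) (1 / w) =
        (real n + 1) ^ rk A * ((1 - w) ^ card G * (w ^ rk (resL A G) * poly (cpoly (resL A G)) (1 / w)))"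
        using F(2)[OF G] by (simp add: mult.assoc[symmetric])
    qed simp
    finally have "poly (cpoly A) w = (\<Sum>F\<in>Pow (slice A 0). (1 - w) ^ card F * (w ^ rk (resL A F) * poly (cpoly (resL A F)) (1 / w)))"
      by (simp add: sum_distrib_left[symmetric])
    also have "\<dots> = (\<Sum>F\<in>Pow (slice A 0). poly ([:1, -1:] ^ card F * rev_poly (rk (resL A F)) (cpoly (resL A F))) w)"
      by (rule sum.cong) (use poly_rev_poly[OF degree_cpoly w(1)] F in auto)
    finally show "poly (cpoly A) (real n / (real n + 1)) =
      poly (\<Sum>F\<in>Pow (slice A 0). [:1, -1:] ^ card F * rev_poly (rk (resL A F)) (cpoly (resL A F))) (real n / (real n + 1))"
      by (simp add: w_def poly_sum)
  qed
  from arg_cong[OF this, of "\<lambda>p. z ^ rk A * poly p (1 / z)"]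
  have "z ^ rk A * poly (cpoly A) (1 / z) =
    (\<Sum>F\<in>Pow (slice A 0). z ^ rk A * ((1 - 1 / z) ^ card F * poly (rev_poly (rk (resL A F)) (cpoly (resL A F))) (1 / z)))"
    by (simp add: poly_sum sum_distrib_left)
  also have "\<dots> = (\<Sum>F\<in>Pow (slice A 0). (z - 1) ^ card F * poly (cpoly (resL A F)) z)"
  proof (rule sum.cong)
    fix G assume G: "G \<in> Pow (slice A 0)"
    have r: "poly (rev_poly (rk (resL A G)) (cpoly (resL A G))) (1 / z) = (1 / z) ^ rk (resL A G) * poly (cpoly (resL A G)) z"
      using poly_rev_poly[OF degree_cpoly[OF F(1)[OF G]], of "1 / z"] z by simp
    have "z ^ rk A * ((1 - 1 / z) ^ card G * (1 / z) ^ rk (resL A G)) = (z * (1 - 1 / z)) ^ card G"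
      unfolding F(2)[OF G] using z by (simp add: power_add power_divide power_mult_distrib)
    also have "z * (1 - 1 / z) = z - 1" using z by (simp add: field_simps)
    finally show "z ^ rk A * ((1 - 1 / z) ^ card G * poly (rev_poly (rk (resL A G)) (cpoly (resL A G))) (1 / z)) =
      (z - 1) ^ card G * poly (cpoly (resL A G)) z" unfolding r by (simp add: mult.assoc[symmetric])
  qed simp
  finally show ?thesis .
qed

end

section \<open>The antisymmetric part of the polynomial\<close>


context euler_system begin

lemma slice_nonneg:
  assumes "x \<in> slice A b" "j \<in> {b..<b+N}" "beta j \<in> A" shows "0 \<le> E (beta x) (beta j)"
proof (cases j x rule: linorder_cases)
  case less then show ?thesis using assms by (auto simp: slice_def)
next
  case greater then show ?thesis using dir1[of x j] slice_window[OF assms(1)] assms(2) by auto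
qed simp

text \<open>
  Passing to the left complement of a slice element \<open>m\<close>, the slice is projected along \<open>beta m\<close>;
  the projection does not change the pairing with the complement.
\<close>

lemma relabel1:
  assumes A: "good A" and m: "m \<in> slice A b" and x: "x \<in> slice A b" "x \<noteq> m"
  shows "\<exists>x'\<in>slice (Lp A (beta m)) b. beta x' = beta x - E (beta m) (beta x) *\<^sub>R beta m"
proof -
  define v where "v = beta x - E (beta m) (beta x) *\<^sub>R beta m"
  have mA: "beta m \<in> A" and xA: "beta x \<in> A" using m x slice_in by auto
  have vA: "v \<in> A"
  proof (cases "m < x")
    case True
    then have "E (beta x) (beta m) = 0" using slice_orth[OF x(1) m] by simp
    then show ?thesis using flat_refl[OF good_flat[OF A] xA mA] by (simp add: v_def)
  next
    case False
    then have "E (beta m) (beta x) = 0" using slice_orth[OF m x(1)] x(2) by simp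
    then show ?thesis using xA by (simp add: v_def)
  qed
  have vL: "v \<in> Lp A (beta m)" using vA by (simp add: lperp_def v_def E_simps)
  have vE: "E v y = E (beta x) y" if "y \<in> Lp A (beta m)" for y
    using that by (simp add: v_def lperp_def E_simps)
  obtain i where i: "b \<le> i" "i < b + N" "beta i = v \<or> beta i = - v"
    using Phi_window[of v b] flat_sub[OF good_flat[OF A] vA] by metis
  have iA: "beta i \<in> A" using i(3) vA flat_minus[OF good_flat[OF A]] by metis
  have v1: "E v v = 1" using E_unit flat_sub[OF good_flat[OF A] vA] by auto
  \<comment> \<open>The opposite sign would make the slice root \<open>beta x\<close> pair to
    \<open>-1\<close> with a root of its window, against \<open>slice_nonneg\<close>.\<close>
  have "beta i = v"
  proof (rule ccontr)
    assume "beta i \<noteq> v"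
    then have "beta i = - v" using i by auto
    then have "E (beta x) (beta i) = -1" using vE[OF vL] v1 by simp
    then show False using slice_nonneg[OF x(1) _ iA] i by auto
  qed
  moreover have "i \<in> slice (Lp A (beta m)) b"
  proof -
    have "E (beta i) (beta j) = 0" if j: "b \<le> j" "j < i" "beta j \<in> Lp A (beta m)" for j
    proof -
      have "E (beta i) (beta j) = E (beta x) (beta j)" using vE[OF j(3)] \<open>beta i = v\<close> by simp
      moreover have "0 \<le> E (beta x) (beta j)" using slice_nonneg[OF x(1), of j] j i by (auto simp: lperp_def)
      moreover have "E (beta i) (beta j) \<le> 0" using dir2[of j i] j i by auto
      ultimately show ?thesis by simp
    qed
    then show ?thesis using i vL \<open>beta i = v\<close> by (auto simp: slice_def)
  qed
  ultimately show ?thesis by (auto simp: v_def)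
qed

lemma relabel:
  assumes A: "good A" and m: "m \<in> slice A b"
  obtains \<rho> where "bij_betw \<rho> (slice A b - {m}) (slice (Lp A (beta m)) b)"
    "\<And>x y. x \<in> slice A b - {m} \<Longrightarrow> y \<in> Lp A (beta m) \<Longrightarrow> E (beta (\<rho> x)) y = E (beta x) y"
proof -
  have mA: "beta m \<in> A" using m slice_in by auto
  have "\<exists>\<rho>. \<forall>x\<in>slice A b - {m}. \<rho> x \<in> slice (Lp A (beta m)) b \<and> beta (\<rho> x) = beta x - E (beta m) (beta x) *\<^sub>R beta m"
    using relabel1[OF A m] by (intro bchoice) blast
  then obtain \<rho> where r: "\<And>x. x \<in> slice A b - {m} \<Longrightarrow> \<rho> x \<in> slice (Lp A (beta m)) b"
    "\<And>x. x \<in> slice A b - {m} \<Longrightarrow> beta (\<rho> x) = beta x - E (beta m) (beta x) *\<^sub>R beta m" by blast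
  have pair: "E (beta (\<rho> x)) y = E (beta x) y" if "x \<in> slice A b - {m}" "y \<in> Lp A (beta m)" for x y
    unfolding r(2)[OF that(1)] using that(2) by (simp add: lperp_def E_simps)
  \<comment> \<open>If the labels agreed, \<open>beta m\<close> would pair nontrivially with both
    roots; by slice orthogonality this forces \<open>x1 \<le> m\<close> and
    \<open>m \<le> x2\<close>.\<close>
  have less: "\<rho> x1 \<noteq> \<rho> x2" if x: "x1 \<in> slice A b - {m}" "x2 \<in> slice A b - {m}" "x2 < x1" for x1 x2
  proof
    assume eq: "\<rho> x1 = \<rho> x2"
    have L: "beta (\<rho> x2) \<in> Lp A (beta m)" using r(1)[OF x(2)] slice_in by auto
    have "E (beta x1) (beta (\<rho> x2)) = 1" using pair[OF x(1)] eq L by (metis E_beta)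
    moreover have "E (beta x1) (beta (\<rho> x2)) = - E (beta m) (beta x2) * E (beta x1) (beta m)"
      unfolding r(2)[OF x(2)] using slice_orth[of x1 A b x2] x by (simp add: E_simps)
    ultimately have ne: "E (beta m) (beta x2) \<noteq> 0" "E (beta x1) (beta m) \<noteq> 0" by auto
    have "\<not> x2 < m" using slice_orth[OF m, of x2] x ne by auto
    moreover have "\<not> m < x1" using slice_orth[of x1 A b m] m x ne by auto
    ultimately show False using x by auto
  qed
  have inj: "inj_on \<rho> (slice A b - {m})" using less by (auto simp: inj_on_def) (metis linorder_neqE_nat DiffI singletonD)
  have "card (slice A b - {m}) = card (slice (Lp A (beta m)) b)"
    using good_card[OF A, of b] good_card[OF good_Lp(1)[OF A mA], of b] good_Lp(2)[OF A mA] m by simp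
  then have "\<rho> ` (slice A b - {m}) = slice (Lp A (beta m)) b"
    using r(1) inj by (intro card_subset_eq) (auto simp: card_image)
  then have "bij_betw \<rho> (slice A b - {m}) (slice (Lp A (beta m)) b)" using inj by (simp add: bij_betw_def)
  then show ?thesis using that pair by blast
qed

lemma relabel_set:
  assumes A: "good A" and K: "K \<subseteq> slice A b"
  shows "\<exists>\<rho>. bij_betw \<rho> (slice A b - K) (slice (resL A K) b) \<and>
    (\<forall>x\<in>slice A b - K. \<forall>y\<in>resL A K. E (beta (\<rho> x)) y = E (beta x) y)"
proof -
  have "finite K" using slice_sub(1)[OF K] .
  then show ?thesis using K
  proof (induction K)
    case empty show ?case by (intro exI[of _ id]) (auto simp: bij_betw_def)
  next
    case (insert m K)
    then obtain \<rho> where r: "bij_betw \<rho> (slice A b - K) (slice (resL A K) b)"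
      "\<And>x y. x \<in> slice A b - K \<Longrightarrow> y \<in> resL A K \<Longrightarrow> E (beta (\<rho> x)) y = E (beta x) y" by auto
    have g: "good (resL A K)" using good_resL[OF A, of K b] insert.prems by auto
    have m: "m \<in> slice A b - K" using insert by auto
    then have m': "\<rho> m \<in> slice (resL A K) b" using r(1) by (auto simp: bij_betw_def)
    have L: "Lp (resL A K) (beta (\<rho> m)) = resL A (insert m K)"
      using r(2)[OF m] by (auto simp: lperp_def resL_def)
    obtain \<rho>' where r': "bij_betw \<rho>' (slice (resL A K) b - {\<rho> m}) (slice (resL A (insert m K)) b)"
      "\<And>x y. x \<in> slice (resL A K) b - {\<rho> m} \<Longrightarrow> y \<in> resL A (insert m K) \<Longrightarrow> E (beta (\<rho>' x)) y = E (beta x) y"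
      using relabel[OF g m'] unfolding L by metis
    have b1: "bij_betw \<rho> (slice A b - insert m K) (slice (resL A K) b - {\<rho> m})"
    proof -
      have "bij_betw \<rho> (slice A b - K - {m}) (slice (resL A K) b - {\<rho> m})"
        using bij_betw_DiffI[OF r(1), of "{m}" "{\<rho> m}"] m m' by (simp add: bij_betw_def)
      moreover have "slice A b - K - {m} = slice A b - insert m K" by blast
      ultimately show ?thesis by simp
    qed
    have "bij_betw (\<rho>' \<circ> \<rho>) (slice A b - insert m K) (slice (resL A (insert m K)) b)"
      using bij_betw_trans[OF b1 r'(1)] .
    moreover have "E (beta ((\<rho>' \<circ> \<rho>) x)) y = E (beta x) y"
      if "x \<in> slice A b - insert m K" "y \<in> resL A (insert m K)" for x y
    proof -
      have "\<rho> x \<in> slice (resL A K) b - {\<rho> m}" using b1 that(1) by (auto simp: bij_betw_def)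
      then have "E (beta (\<rho>' (\<rho> x))) y = E (beta (\<rho> x)) y" using r'(2) that(2) by auto
      also have "\<dots> = E (beta x) y" using r(2)[of x y] that by (auto simp: resL_def)
      finally show ?thesis by simp
    qed
    ultimately show ?case by blast
  qed
qed

lemma resL_relabel:
  assumes "\<And>x y. x \<in> F \<Longrightarrow> y \<in> resL A K \<Longrightarrow> E (beta (\<rho> x)) y = E (beta x) y"
  shows "resL (resL A K) (\<rho> ` F) = resL A (K \<union> F)"
proof (intro Set.set_eqI iffI)
  fix y assume "y \<in> resL (resL A K) (\<rho> ` F)"
  then show "y \<in> resL A (K \<union> F)" using assms[of _ y] by (auto simp: resL_def)
next
  fix y assume y: "y \<in> resL A (K \<union> F)"
  then have "y \<in> resL A K" by (auto simp: resL_def)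
  then show "y \<in> resL (resL A K) (\<rho> ` F)" using assms[of _ y] y by (auto simp: resL_def)
qed

text \<open>
  \<open>alt A K M\<close> is the alternating sum of the polynomials \<open>cpoly (resL A (K \<union> F))\<close> over \<open>F \<subseteq> M\<close>.
  Positivity of these sums says that \<open>F \<mapsto> cpoly (resL A F)\<close> is totally monotone.
\<close>

definition alt :: "'v set \<Rightarrow> nat set \<Rightarrow> nat set \<Rightarrow> real poly" where
  "alt A K M = (\<Sum>F\<in>Pow M. (-1) ^ card F * cpoly (resL A (K \<union> F)))"

text \<open>Reduces alternating sums relative to \<open>K\<close> to sums with empty second argument
  over a smaller flat, so that positivity can be proved by induction on the rank.\<close>

lemma alt_relabel:
  assumes A: "good A" and K: "K \<subseteq> slice A b" and M: "M \<subseteq> slice A b - K"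
  obtains M' where "M' \<subseteq> slice (resL A K) b" "alt A K M = alt (resL A K) {} M'"
    "M = slice A b - K \<Longrightarrow> M' = slice (resL A K) b"
proof -
  obtain \<rho> where r: "bij_betw \<rho> (slice A b - K) (slice (resL A K) b)"
      "\<And>x y. x \<in> slice A b - K \<Longrightarrow> y \<in> resL A K \<Longrightarrow> E (beta (\<rho> x)) y = E (beta x) y" 
    using relabel_set[OF A K] by blast
  have inj: "inj_on \<rho> M" using r(1) M by (auto simp: bij_betw_def intro: inj_on_subset)
  have "alt (resL A K) {} (\<rho> ` M) = (\<Sum>F\<in>Pow M. (-1) ^ card (\<rho> ` F) * cpoly (resL (resL A K) (\<rho> ` F)))"
    unfolding alt_def image_Pow_surj[OF refl, of \<rho> M, symmetric]
    using sum.reindex[OF inj_on_image_Pow[OF inj]] by simp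
  also have "\<dots> = alt A K M" unfolding alt_def
  proof (rule sum.cong)
    fix F assume F: "F \<in> Pow M"
    have "card (\<rho> ` F) = card F" using card_image[of \<rho> F] inj F by (auto intro: inj_on_subset)
    moreover have "resL (resL A K) (\<rho> ` F) = resL A (K \<union> F)" by (rule resL_relabel) (use r(2) F M in auto)
    ultimately show "(-1) ^ card (\<rho> ` F) * cpoly (resL (resL A K) (\<rho> ` F)) = (-1) ^ card F * cpoly (resL A (K \<union> F))" by simp
  qed simp
  finally have "alt (resL A K) {} (\<rho> ` M) = alt A K M" .
  moreover have "\<rho> ` M \<subseteq> slice (resL A K) b" using r(1) M by (auto simp: bij_betw_def)
  moreover have "\<rho> ` M = slice (resL A K) b" if "M = slice A b - K" using r(1) that by (simp add: bij_betw_def)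
  ultimately show ?thesis using that by metis
qed

lemma Pow_insert_sum:
  assumes "finite M" "x \<notin> M"
  shows "(\<Sum>F\<in>Pow (insert x M). f F) = (\<Sum>F\<in>Pow M. f F) + (\<Sum>F\<in>Pow M. f (insert x F))"
proof -
  have "(\<Sum>F\<in>Pow (insert x M). f F) = (\<Sum>F\<in>Pow M. f F) + (\<Sum>F\<in>insert x ` Pow M. f F)"
    unfolding Pow_insert by (rule sum.union_disjoint) (use assms in auto)
  also have "(\<Sum>F\<in>insert x ` Pow M. f F) = (\<Sum>F\<in>Pow M. f (insert x F))"
    by (subst sum.reindex) (use assms in \<open>auto simp: inj_on_def\<close>)
  finally show ?thesis .
qed

lemma alt_insert:
  assumes "finite M" "x \<notin> M" shows "alt A K (insert x M) = alt A K M - alt A (insert x K) M"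
proof -
  have "(\<Sum>F\<in>Pow M. (-1) ^ card (insert x F) * cpoly (resL A (K \<union> insert x F))) = - alt A (insert x K) M"
    unfolding alt_def sum_negf[symmetric]
  proof (rule sum.cong)
    fix F assume "F \<in> Pow M"
    then have "card (insert x F) = Suc (card F)" using assms finite_subset[of F M] by (auto intro!: card_insert_disjoint)
    then show "(- 1) ^ card (insert x F) * cpoly (resL A (K \<union> insert x F)) = - ((- 1) ^ card F * cpoly (resL A (insert x K \<union> F)))"
      by simp
  qed simp
  then show ?thesis unfolding alt_def using Pow_insert_sum[OF assms, of "\<lambda>F. (-1) ^ card F * cpoly (resL A (K \<union> F))"] by simp
qed

text \<open>Rotation replaces \<open>b\<close> by \<open>b'\<close>, whose left perpendicular is the
  right perpendicular of \<open>beta b\<close> inside each \<open>resL A G\<close>. The two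
  perpendiculars have the same polynomial by \<open>cpoly_Rp_Lp\<close>, so no term of the sum
  changes.\<close>

lemma alt_rotate:
  assumes A: "good A" and X: "X \<subseteq> slice A b" "\<And>x. x \<in> X \<Longrightarrow> b < x"
  shows "X \<subseteq> slice A (Suc b)" "alt A X (slice A (Suc b) - X) = alt A X (slice A b - X)"
proof -
  have "X \<subseteq> slice A (Suc b) \<and> alt A X (slice A (Suc b) - X) = alt A X (slice A b - X)"
  proof (cases "beta b \<in> A")
    case False then show ?thesis using slice_Suc_notin[OF good_flat[OF A] False] X by simp
  next
    case True
    obtain b' where b': "b < b'" "beta b' \<in> A" "\<And>y. y \<in> A \<Longrightarrow> E (beta b') y = - E y (beta b)"
      "slice A (Suc b) = insert b' (slice A b - {b})" "b' \<notin> slice A b"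
      using rotate[OF good_flat[OF A] good_spans[OF A] True] by metis
    have bS: "b \<in> slice A b" using slice_min[OF True] .
    have bX: "b \<notin> X" using X(2) by blast
    define Y where "Y = slice A b - {b} - X"
    have fY: "finite Y" by (simp add: Y_def)
    have s1: "slice A b - X = insert b Y" using bS bX by (auto simp: Y_def)
    have s2: "slice A (Suc b) - X = insert b' Y" using b'(4,5) X(1) by (auto simp: Y_def)
    have "alt A (insert b' X) Y = alt A (insert b X) Y" unfolding alt_def
    proof (rule sum.cong)
      fix F assume F: "F \<in> Pow Y"
      define G where "G = X \<union> F"
      have GS: "G \<subseteq> slice A b" using F X by (auto simp: G_def Y_def)
      have bG: "b < g" if "g \<in> G" for g
        using that F X(2) slice_window[of g A b] by (fastforce simp: G_def Y_def)
      have g: "good (resL A G)" using good_resL[OF A GS] by simp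
      have bR: "beta b \<in> resL A G"
        using True slice_orth[OF _ bS] bG GS by (auto simp: resL_def)
      have 1: "resL A (insert b X \<union> F) = Lp (resL A G) (beta b)" by (auto simp: resL_def lperp_def G_def)
      have 2: "resL A (insert b' X \<union> F) = Rp (resL A G) (beta b)"
        using b'(3) by (auto simp: resL_def rperp_def G_def)
      show "(- 1) ^ card F * cpoly (resL A (insert b' X \<union> F)) = (- 1) ^ card F * cpoly (resL A (insert b X \<union> F))"
        unfolding 1 2 cpoly_Rp_Lp[OF g bR] ..
    qed simp
    moreover have "b \<notin> Y" "b' \<notin> Y" using b'(5) by (auto simp: Y_def)
    ultimately have "alt A X (insert b' Y) = alt A X (insert b Y)" using alt_insert[OF fY] by simp
    moreover have "X \<subseteq> slice A (Suc b)" unfolding b'(4) using X(1) bX by blast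
    ultimately show ?thesis using s1 s2 by simp
  qed
  then show "X \<subseteq> slice A (Suc b)" "alt A X (slice A (Suc b) - X) = alt A X (slice A b - X)" by auto
qed

lemma alt_rotate_many:
  assumes A: "good A" and X: "X \<subseteq> slice A b" "\<And>x. x \<in> X \<Longrightarrow> b + d \<le> x"
  shows "X \<subseteq> slice A (b + d) \<and> alt A X (slice A (b + d) - X) = alt A X (slice A b - X)"
  using X(2)
proof (induction d)
  case (Suc d)
  have "X \<subseteq> slice A (b + d) \<and> alt A X (slice A (b + d) - X) = alt A X (slice A b - X)"
    using Suc.IH Suc.prems by fastforce
  moreover have "b + d < x" if "x \<in> X" for x using Suc.prems[OF that] by simp
  ultimately show ?case using alt_rotate[OF A, of X "b + d"] by auto
qed (use X(1) in auto)

definition ealt :: "'v set \<Rightarrow> real poly" where "ealt A = alt A {} (slice A 0)"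

lemma ealt_frame: "good A \<Longrightarrow> alt A {} (slice A b) = ealt A"
  using alt_rotate_many[of A "{}" 0 b] by (simp add: ealt_def)

text \<open>After rotation to the frame starting with \<open>x\<close>, the root
  \<open>beta x\<close> lies in every \<open>resL A F\<close> that occurs. There its left
  perpendicular can be exchanged for the right one, and the latter is \<open>resL\<close> of the
  fixed flat \<open>Rp A (beta x)\<close>.\<close>

lemma alt_through:
  assumes A: "good A" and x: "x \<in> slice A 0"
  shows "alt A {x} (slice A 0 - {x}) = ealt (Rp A (beta x))"
proof -
  have xA: "beta x \<in> A" using x slice_in by auto
  have "alt A {x} (slice A 0 - {x}) = alt A {x} (slice A x - {x})"
    using alt_rotate_many[OF A, of "{x}" 0 x] x by simp
  also have "\<dots> = alt (Rp A (beta x)) {} (slice A x - {x})" unfolding alt_def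
  proof (rule sum.cong)
    fix F assume F: "F \<in> Pow (slice A x - {x})"
    have xS: "x \<in> slice A x" using slice_min[OF xA] .
    have lt: "x < i" if "i \<in> F" for i using that F slice_window[of i A x] by fastforce
    have FS: "F \<subseteq> slice A x" using F by auto
    have g: "good (resL A F)" using good_resL[OF A FS] by simp
    have xR: "beta x \<in> resL A F" using xA slice_orth[OF _ xS] lt FS by (auto simp: resL_def)
    have 1: "resL A ({x} \<union> F) = Lp (resL A F) (beta x)" by (auto simp: resL_def lperp_def)
    have 2: "resL (Rp A (beta x)) ({} \<union> F) = Rp (resL A F) (beta x)" by (auto simp: resL_def rperp_def)
    show "(- 1) ^ card F * cpoly (resL A ({x} \<union> F)) = (- 1) ^ card F * cpoly (resL (Rp A (beta x)) ({} \<union> F))"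
      unfolding 1 2 cpoly_Rp_Lp[OF g xR] ..
  qed simp
  also have "slice A x - {x} = slice (Rp A (beta x)) x" using good_Rp_beta(3)[OF A xA] by simp
  also have "alt (Rp A (beta x)) {} (slice (Rp A (beta x)) x) = ealt (Rp A (beta x))"
    by (rule ealt_frame[OF good_Rp(1)[OF A xA]])
  finally show ?thesis .
qed

lemma sum_slice_resL:
  assumes A: "good A" and F: "F \<subseteq> slice A 0"
  shows "(\<Sum>t\<in>slice (resL A F) 0. cpoly (Rp (resL A F) (beta t))) = (\<Sum>x\<in>slice A 0 - F. cpoly (resL A (insert x F)))"
proof -
  have g: "good (resL A F)" using good_resL[OF A F] by simp
  obtain \<rho> where r: "bij_betw \<rho> (slice A 0 - F) (slice (resL A F) 0)"
      "\<And>x y. x \<in> slice A 0 - F \<Longrightarrow> y \<in> resL A F \<Longrightarrow> E (beta (\<rho> x)) y = E (beta x) y" 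
    using relabel_set[OF A F] by blast
  have "(\<Sum>t\<in>slice (resL A F) 0. cpoly (Rp (resL A F) (beta t))) = (\<Sum>t\<in>slice (resL A F) 0. cpoly (Lp (resL A F) (beta t)))"
    by (rule sum.cong) (use cpoly_Rp_Lp[OF g] slice_in in auto)
  also have "\<dots> = (\<Sum>x\<in>slice A 0 - F. cpoly (Lp (resL A F) (beta (\<rho> x))))"
    by (rule sum.reindex_bij_betw[OF r(1), symmetric])
  also have "\<dots> = (\<Sum>x\<in>slice A 0 - F. cpoly (resL A (insert x F)))"
  proof (rule sum.cong)
    fix x assume x: "x \<in> slice A 0 - F"
    have "Lp (resL A F) (beta (\<rho> x)) = resL A (insert x F)" using r(2)[OF x] by (auto simp: lperp_def resL_def)
    then show "cpoly (Lp (resL A F) (beta (\<rho> x))) = cpoly (resL A (insert x F))" by simp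
  qed simp
  finally show ?thesis .
qed

lemma sum_Pow_insert_swap:
  fixes f :: "nat set \<Rightarrow> real poly"
  assumes S: "finite S"
  shows "(\<Sum>F\<in>Pow S. \<Sum>x\<in>S - F. (-1) ^ card F * f (insert x F)) = - (\<Sum>G\<in>Pow S. of_nat (card G) * ((-1) ^ card G * f G))"
proof -
  have "(\<Sum>F\<in>Pow S. \<Sum>x\<in>S - F. (-1) ^ card F * f (insert x F)) =
    (\<Sum>(F, x)\<in>(SIGMA F:Pow S. S - F). (-1) ^ card F * f (insert x F))"
    by (rule sum.Sigma) (use S in auto)
  also have "\<dots> = (\<Sum>(G, x)\<in>(SIGMA G:Pow S. G). (-1) ^ (card G - 1) * f G)"
  proof (rule sum.reindex_bij_witness[of _ "\<lambda>(G, x). (G - {x}, x)" "\<lambda>(F, x). (insert x F, x)"])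
    fix p assume "p \<in> (SIGMA F:Pow S. S - F)"
    then obtain F x where p: "p = (F, x)" "F \<subseteq> S" "x \<in> S" "x \<notin> F" by auto
    have "finite F" using p S finite_subset by blast
    then show "(case (case p of (F, x) \<Rightarrow> (insert x F, x)) of (G, x) \<Rightarrow> (-1) ^ (card G - 1) * f G) = (case p of (F, x) \<Rightarrow> (-1) ^ card F * f (insert x F))"
      using p by simp
  qed (auto simp: insert_absorb)
  also have "\<dots> = (\<Sum>G\<in>Pow S. \<Sum>x\<in>G. (-1) ^ (card G - 1) * f G)"
    by (rule sum.Sigma[symmetric]) (use S finite_subset in auto)
  also have "\<dots> = (\<Sum>G\<in>Pow S. - (of_nat (card G) * ((-1) ^ card G * f G)))"
  proof (rule sum.cong)
    fix G assume "G \<in> Pow S"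
    then have "finite G" using S finite_subset by auto
    show "(\<Sum>x\<in>G. (-1) ^ (card G - 1) * f G) = - (of_nat (card G) * ((-1) ^ card G * f G))"
      by (cases "card G") (use \<open>finite G\<close> in auto)
  qed simp
  finally show ?thesis by (simp add: sum_negf)
qed

text \<open>\<open>cpoly_rec\<close> is inserted into every term of the alternating sum. By
  \<open>sum_Pow_insert_swap\<close> the slice terms without the factor \<open>x\<close> cancel
  against the difference \<open>card F\<close> between \<open>rk A\<close> and
  \<open>rk (resL A F)\<close>, so everything left is divisible by \<open>x\<close>. Exchanging the
  sums over \<open>F\<close> and over positions yields alternating sums for smaller flats.\<close>

lemma ealt_recursion:
  assumes A: "good A"
  defines "M \<equiv> \<lambda>t. {m \<in> slice A 0. E (beta m) (beta t) = 0}"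
  shows "of_nat (rk A) * ealt A = pCons 0 ((\<Sum>t\<in>pos A - slice A 0. alt (Rp A (beta t)) {} (M t)) +
    (\<Sum>x\<in>slice A 0. alt (Rp A (beta x)) {} (M x) - ealt (Rp A (beta x))))"
proof -
  define S where "S = slice A 0"
  have fS: "finite S" by (simp add: S_def)
  define c where "c F = cpoly (resL A F)" for F
  define s where "s F = ((-1) ^ card F :: real poly)" for F :: "nat set"
  have g: "good (resL A F)" "rk A = rk (resL A F) + card F" if "F \<in> Pow S" for F using good_resL[OF A] that by (auto simp: S_def)
  have rec: "of_nat (rk A - card F) * c F - (\<Sum>x\<in>S - F. c (insert x F)) =
     pCons 0 ((\<Sum>t\<in>pos (resL A F). cpoly (Rp (resL A F) (beta t))) - (\<Sum>x\<in>S - F. c (insert x F)))" if F: "F \<in> Pow S" for F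
  proof -
    have sl: "(\<Sum>t\<in>slice (resL A F) 0. cpoly (Rp (resL A F) (beta t))) = (\<Sum>x\<in>S - F. c (insert x F))"
      using sum_slice_resL[OF A, of F] F by (simp add: S_def c_def)
    have "of_nat (rk A - card F) * c F = smult (real (rk (resL A F))) (cpoly (resL A F))"
      using g(2)[OF F] by (simp add: c_def of_nat_poly)
    also have "\<dots> = (\<Sum>x\<in>S - F. c (insert x F)) + pCons 0 (\<Sum>t\<in>pos (resL A F) - slice (resL A F) 0. cpoly (Rp (resL A F) (beta t)))"
      using cpoly_rec[OF g(1)[OF F]] sl by simp
    also have "(\<Sum>t\<in>pos (resL A F) - slice (resL A F) 0. cpoly (Rp (resL A F) (beta t))) =
      (\<Sum>t\<in>pos (resL A F). cpoly (Rp (resL A F) (beta t))) - (\<Sum>x\<in>S - F. c (insert x F))"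
      using sum_diff[OF finite_pos slice_pos, of "\<lambda>t. cpoly (Rp (resL A F) (beta t))" "resL A F"] sl by simp
    finally show ?thesis by simp
  qed
  have "of_nat (rk A) * ealt A = (\<Sum>F\<in>Pow S. s F * (of_nat (rk A - card F) * c F - (\<Sum>x\<in>S - F. c (insert x F))))"
  proof -
    have "(\<Sum>F\<in>Pow S. s F * (\<Sum>x\<in>S - F. c (insert x F))) = - (\<Sum>G\<in>Pow S. of_nat (card G) * (s G * c G))"
      using sum_Pow_insert_swap[OF fS, of c] by (simp add: s_def sum_distrib_left)
    then have "(\<Sum>F\<in>Pow S. s F * (of_nat (rk A - card F) * c F - (\<Sum>x\<in>S - F. c (insert x F)))) =
      (\<Sum>F\<in>Pow S. s F * (of_nat (rk A - card F) * c F) + of_nat (card F) * (s F * c F))"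
      by (simp add: right_diff_distrib sum_subtractf sum.distrib)
    also have "\<dots> = (\<Sum>F\<in>Pow S. of_nat (rk A) * (s F * c F))"
    proof (rule sum.cong)
      fix F assume F: "F \<in> Pow S"
      have "(of_nat (rk A) :: real poly) = of_nat (rk A - card F) + of_nat (card F)"
        using g(2)[OF F] by (simp flip: of_nat_add)
      then show "s F * (of_nat (rk A - card F) * c F) + of_nat (card F) * (s F * c F) = of_nat (rk A) * (s F * c F)"
        by (simp add: algebra_simps)
    qed simp
    finally show ?thesis by (simp add: ealt_def alt_def S_def s_def c_def sum_distrib_left)
  qed
  also have "\<dots> = (\<Sum>F\<in>Pow S. pCons 0 (s F * ((\<Sum>t\<in>pos (resL A F). cpoly (Rp (resL A F) (beta t))) - (\<Sum>x\<in>S - F. c (insert x F)))))"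
    by (rule sum.cong) (use rec in auto)
  also have "\<dots> = pCons 0 (\<Sum>F\<in>Pow S. s F * ((\<Sum>t\<in>pos (resL A F). cpoly (Rp (resL A F) (beta t))) - (\<Sum>x\<in>S - F. c (insert x F))))"
    by (induction rule: infinite_finite_induct) auto
  also have "(\<Sum>F\<in>Pow S. s F * ((\<Sum>t\<in>pos (resL A F). cpoly (Rp (resL A F) (beta t))) - (\<Sum>x\<in>S - F. c (insert x F)))) =
    (\<Sum>F\<in>Pow S. \<Sum>t\<in>pos (resL A F). s F * cpoly (Rp (resL A F) (beta t))) - (\<Sum>F\<in>Pow S. \<Sum>x\<in>S - F. s F * c (insert x F))"
    by (simp add: right_diff_distrib sum_subtractf sum_distrib_left)
  also have "(\<Sum>F\<in>Pow S. \<Sum>t\<in>pos (resL A F). s F * cpoly (Rp (resL A F) (beta t))) = (\<Sum>t\<in>pos A. alt (Rp A (beta t)) {} (M t))"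
  proof -
    have "(\<Sum>F\<in>Pow S. \<Sum>t\<in>pos (resL A F). s F * cpoly (Rp (resL A F) (beta t))) =
      (\<Sum>F\<in>Pow S. \<Sum>t\<in>pos A. if F \<subseteq> M t then s F * cpoly (Rp (resL A F) (beta t)) else 0)"
    proof (rule sum.cong)
      fix F assume F: "F \<in> Pow S"
      have "pos (resL A F) = {t \<in> pos A. F \<subseteq> M t}" using F by (auto simp: pos_def resL_def M_def S_def)
      then show "(\<Sum>t\<in>pos (resL A F). s F * cpoly (Rp (resL A F) (beta t))) =
        (\<Sum>t\<in>pos A. if F \<subseteq> M t then s F * cpoly (Rp (resL A F) (beta t)) else 0)"
        by (simp add: sum.inter_filter)
    qed simp
    also have "\<dots> = (\<Sum>t\<in>pos A. \<Sum>F\<in>Pow S. if F \<subseteq> M t then s F * cpoly (Rp (resL A F) (beta t)) else 0)"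
      by (rule sum.swap)
    also have "\<dots> = (\<Sum>t\<in>pos A. alt (Rp A (beta t)) {} (M t))"
    proof (rule sum.cong)
      fix t assume "t \<in> pos A"
      have P: "Pow (M t) = {F \<in> Pow S. F \<subseteq> M t}" by (auto simp: M_def S_def)
      have R: "resL (Rp A (beta t)) ({} \<union> F) = Rp (resL A F) (beta t)" for F by (auto simp: resL_def rperp_def)
      show "(\<Sum>F\<in>Pow S. if F \<subseteq> M t then s F * cpoly (Rp (resL A F) (beta t)) else 0) = alt (Rp A (beta t)) {} (M t)"
        unfolding alt_def P R s_def by (rule sum.inter_filter[symmetric]) (use fS in auto)
    qed simp
    finally show ?thesis .
  qed
  also have "(\<Sum>F\<in>Pow S. \<Sum>x\<in>S - F. s F * c (insert x F)) = (\<Sum>x\<in>S. ealt (Rp A (beta x)))"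
  proof -
    have "(\<Sum>F\<in>Pow S. \<Sum>x\<in>S - F. s F * c (insert x F)) = (\<Sum>F\<in>Pow S. \<Sum>x\<in>S. if x \<notin> F then s F * c (insert x F) else 0)"
      by (rule sum.cong) (use fS in \<open>auto simp: sum.inter_filter[symmetric] intro!: sum.cong\<close>)
    also have "\<dots> = (\<Sum>x\<in>S. \<Sum>F\<in>Pow S. if x \<notin> F then s F * c (insert x F) else 0)" by (rule sum.swap)
    also have "\<dots> = (\<Sum>x\<in>S. ealt (Rp A (beta x)))"
    proof (rule sum.cong)
      fix x assume x: "x \<in> S"
      have P: "Pow (S - {x}) = {F \<in> Pow S. x \<notin> F}" by auto
      have "(\<Sum>F\<in>Pow S. if x \<notin> F then s F * c (insert x F) else 0) = alt A {x} (S - {x})"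
        unfolding alt_def P s_def c_def insert_is_Un[symmetric] by (rule sum.inter_filter[symmetric]) (use fS in auto)
      then show "(\<Sum>F\<in>Pow S. if x \<notin> F then s F * c (insert x F) else 0) = ealt (Rp A (beta x))"
        using alt_through[OF A, of x] x by (simp add: S_def)
    qed simp
    finally show ?thesis .
  qed
  also have "(\<Sum>t\<in>pos A. alt (Rp A (beta t)) {} (M t)) = 
    (\<Sum>t\<in>pos A - S. alt (Rp A (beta t)) {} (M t)) + (\<Sum>t\<in>S. alt (Rp A (beta t)) {} (M t))"
    using sum.subset_diff[OF slice_pos finite_pos] by (simp add: S_def)
  finally show ?thesis by (simp add: S_def sum_subtractf)
qed

text \<open>Removing \<open>x\<close> from the index set adds an alternating sum through
  \<open>x\<close>, which relabelling turns into one for the smaller flat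
  \<open>Lp A (beta x)\<close>. Hence the sum over the full slice is the smallest.\<close>

lemma alt_mono:
  assumes A: "good A" and pos: "\<And>x M. x \<in> slice A 0 \<Longrightarrow> M \<subseteq> slice (Lp A (beta x)) 0 \<Longrightarrow> nonneg_coeffs (alt (Lp A (beta x)) {} M)"
    and M: "M \<subseteq> slice A 0"
  shows "nonneg_coeffs (alt A {} M - ealt A)"
proof -
  define D where "D = slice A 0 - M"
  have "finite D" by (simp add: D_def)
  moreover have "D \<subseteq> slice A 0" "D \<inter> M = {}" by (auto simp: D_def)
  ultimately have "nonneg_coeffs (alt A {} M - alt A {} (M \<union> D))"
  proof (induction D)
    case empty then show ?case by (simp add: nonneg_coeffs_def)
  next
    case (insert x D)
    have fin: "finite (M \<union> D)" using insert M finite_subset[OF M] by auto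
    have x: "x \<in> slice A 0" "x \<notin> M \<union> D" using insert by auto
    obtain M' where "M' \<subseteq> slice (resL A {x}) 0" "alt A {x} (M \<union> D) = alt (resL A {x}) {} M'"
      by (rule alt_relabel[OF A, of "{x}" 0 "M \<union> D"]) (use x insert M in auto)
    moreover have "resL A {x} = Lp A (beta x)" by (auto simp: resL_def lperp_def)
    ultimately have "nonneg_coeffs (alt A {x} (M \<union> D))" using pos[OF x(1)] by simp
    moreover have "alt A {} (M \<union> insert x D) = alt A {} (M \<union> D) - alt A {x} (M \<union> D)"
      using alt_insert[OF fin x(2), of A "{}"] by simp
    moreover have "nonneg_coeffs (alt A {} M - alt A {} (M \<union> D))" using insert by auto
    ultimately show ?case using nonneg_coeffs_add[of "alt A {} M - alt A {} (M \<union> D)" "alt A {x} (M \<union> D)"] by (simp add: diff_diff_eq2 diff_add_eq)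
  qed
  moreover have "M \<union> D = slice A 0" using M by (auto simp: D_def)
  ultimately show ?thesis by (simp add: ealt_def)
qed

text \<open>Induction on the rank, with the full sum \<open>ealt\<close> treated before the others.
  In \<open>ealt_recursion\<close> the slice terms enter as differences, and these are covered by
  \<open>alt_mono\<close> for the perpendicular flats; \<open>alt_mono\<close> for \<open>A\<close>
  then passes from \<open>ealt A\<close> to arbitrary \<open>M\<close>.\<close>

theorem alt_nonneg: "good A \<Longrightarrow> M \<subseteq> slice A 0 \<Longrightarrow> nonneg_coeffs (alt A {} M)"
proof (induction "rk A" arbitrary: A M rule: less_induct)
  case less
  note A = less.prems(1)
  have mono: "nonneg_coeffs (alt B {} K - ealt B)" if B: "good B" "rk B \<le> rk A" "K \<subseteq> slice B 0" for B K
  proof (rule alt_mono[OF B(1) _ B(3)])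
    fix x M assume x: "x \<in> slice B 0" "M \<subseteq> slice (Lp B (beta x)) 0"
    show "nonneg_coeffs (alt (Lp B (beta x)) {} M)"
      by (rule less.hyps) (use good_Lp[OF B(1) slice_in[OF x(1)]] B x in auto)
  qed
  have "nonneg_coeffs (ealt A)"
  proof (cases "rk A = 0")
    case True
    then have "slice A 0 = {}" using rk_0[OF A] by (auto simp: slice_def)
    then show ?thesis using nonneg_cpoly[OF A] by (simp add: ealt_def alt_def)
  next
    case False
    define M where "M t = {m \<in> slice A 0. E (beta m) (beta t) = 0}" for t
    have Msub: "M t \<subseteq> slice (Rp A (beta t)) 0" for t
    proof
      fix m assume m: "m \<in> M t"
      then have "m \<in> slice A 0" "beta m \<in> Rp A (beta t)" by (auto simp: M_def rperp_def slice_in)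
      then show "m \<in> slice (Rp A (beta t)) 0" using slice_mono[of "Rp A (beta t)" A m 0] by (auto simp: rperp_def)
    qed
    have "nonneg_coeffs (of_nat (rk A) * ealt A)"
      unfolding ealt_recursion[OF A] M_def[symmetric]
    proof (intro nonneg_coeffs_pCons nonneg_coeffs_add nonneg_coeffs_sum)
      fix t assume t: "t \<in> pos A - slice A 0"
      show "nonneg_coeffs (alt (Rp A (beta t)) {} (M t))"
        by (rule less.hyps) (use good_Rp_pos[OF A, of t] t Msub in auto)
    next
      fix x assume x: "x \<in> slice A 0"
      show "nonneg_coeffs (alt (Rp A (beta x)) {} (M x) - ealt (Rp A (beta x)))"
        by (rule mono) (use good_Rp_pos[OF A slice_posD[OF x]] Msub in auto)
    qed
    then have "nonneg_coeffs (smult (real (rk A)) (ealt A))" by (simp add: of_nat_poly)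
    then show ?thesis using nonneg_coeffs_smult[of "real (rk A)" "ealt A"] False by simp
  qed
  moreover have "nonneg_coeffs (alt A {} M - ealt A)" by (rule mono) (use less.prems in auto)
  ultimately show ?case using nonneg_coeffs_add by fastforce
qed

lemma sum_Pow_binomial:
  fixes w :: real
  assumes "finite G" shows "(\<Sum>K\<in>Pow G. w ^ card K * (-1) ^ card (G - K)) = (w - 1) ^ card G"
  using assms
proof (induction G)
  case (insert x G)
  have 1: "(\<Sum>K\<in>Pow G. w ^ card K * (-1) ^ card (insert x G - K)) = - (\<Sum>K\<in>Pow G. w ^ card K * (-1) ^ card (G - K))"
    unfolding sum_negf[symmetric]
  proof (rule sum.cong)
    fix K assume K: "K \<in> Pow G"
    then have "insert x G - K = insert x (G - K)" using insert by auto
    then have "card (insert x G - K) = Suc (card (G - K))" using insert by simp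
    then show "w ^ card K * (-1) ^ card (insert x G - K) = - (w ^ card K * (-1) ^ card (G - K))" by simp
  qed simp
  have 2: "(\<Sum>K\<in>Pow G. w ^ card (insert x K) * (-1) ^ card (insert x G - insert x K)) = w * (\<Sum>K\<in>Pow G. w ^ card K * (-1) ^ card (G - K))"
    unfolding sum_distrib_left
  proof (rule sum.cong)
    fix K assume K: "K \<in> Pow G"
    then have "insert x G - insert x K = G - K" using insert by auto
    moreover have "card (insert x K) = Suc (card K)" using K insert finite_subset[of K G] by (auto intro!: card_insert_disjoint)
    ultimately show "w ^ card (insert x K) * (-1) ^ card (insert x G - insert x K) = w * (w ^ card K * (-1) ^ card (G - K))" by simp
  qed simp
  show ?case using Pow_insert_sum[OF insert.hyps, of "\<lambda>K. w ^ card K * (-1) ^ card (insert x G - K)"] 1 2 insert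
    by (simp add: algebra_simps)
qed simp

text \<open>Moebius inversion over subsets of the slice writes
  \<open>\<Sum> w ^ card K * e K\<close> as the sum of \<open>(w - 1) ^ card G\<close> times the
  polynomial of \<open>resL A G\<close>. At \<open>w = 1\<close> this is \<open>cpoly A\<close>, at
  \<open>w = z\<close> its reversal by \<open>cpoly_reversed\<close>; the difference is a sum of
  terms \<open>(1 - z ^ card K) * e K\<close> with nonnegative \<open>e K\<close>.\<close>

theorem cpoly_symmetric_part:
  assumes A: "good A"
  shows "\<exists>D. nonneg_coeffs D \<and> (\<forall>z. z \<noteq> 0 \<longrightarrow> poly (cpoly A) z - z ^ rk A * poly (cpoly A) (1 / z) = (1 - z) * poly D z)"
proof -
  define S where "S = slice A 0"
  have fS: "finite S" by (simp add: S_def)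
  define e where "e K = alt A K (S - K)" for K
  have e: "nonneg_coeffs (e K)" if K: "K \<in> Pow S" for K
  proof -
    have KS: "K \<subseteq> slice A 0" using K by (auto simp: S_def)
    obtain M where "M \<subseteq> slice (resL A K) 0" "alt A K (S - K) = alt (resL A K) {} M"
      by (rule alt_relabel[OF A KS, of "S - K"]) (auto simp: S_def)
    then show ?thesis using alt_nonneg good_resL[OF A KS] by (simp add: e_def)
  qed
  have key: "(\<Sum>K\<in>Pow S. w ^ card K * poly (e K) z) = (\<Sum>G\<in>Pow S. (w - 1) ^ card G * poly (cpoly (resL A G)) z)" for w z :: real
  proof -
    have "(\<Sum>K\<in>Pow S. w ^ card K * poly (e K) z) =
      (\<Sum>K\<in>Pow S. \<Sum>F\<in>Pow (S - K). w ^ card K * ((-1) ^ card F * poly (cpoly (resL A (K \<union> F))) z))"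
      by (simp add: e_def alt_def poly_sum sum_distrib_left)
    also have "\<dots> = (\<Sum>(K, F)\<in>(SIGMA K:Pow S. Pow (S - K)). w ^ card K * ((-1) ^ card F * poly (cpoly (resL A (K \<union> F))) z))"
      by (rule sum.Sigma) (use fS in auto)
    also have "\<dots> = (\<Sum>(G, K)\<in>(SIGMA G:Pow S. Pow G). w ^ card K * ((-1) ^ card (G - K) * poly (cpoly (resL A G)) z))"
    proof (rule sum.reindex_bij_witness[of _ "\<lambda>(G, K). (K, G - K)" "\<lambda>(K, F). (K \<union> F, K)"])
      fix p assume "p \<in> (SIGMA K:Pow S. Pow (S - K))"
      then obtain K F where p: "p = (K, F)" "K \<subseteq> S" "F \<subseteq> S - K" by auto
      then have "K \<union> F - K = F" by auto
      then show "(case (case p of (K, F) \<Rightarrow> (K \<union> F, K)) of (G, K) \<Rightarrow> w ^ card K * ((-1) ^ card (G - K) * poly (cpoly (resL A G)) z)) =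
        (case p of (K, F) \<Rightarrow> w ^ card K * ((-1) ^ card F * poly (cpoly (resL A (K \<union> F))) z))" by (simp add: p)
    qed (auto simp: Un_absorb1)
    also have "\<dots> = (\<Sum>G\<in>Pow S. \<Sum>K\<in>Pow G. w ^ card K * ((-1) ^ card (G - K) * poly (cpoly (resL A G)) z))"
      by (rule sum.Sigma[symmetric]) (use fS finite_subset in auto)
    also have "\<dots> = (\<Sum>G\<in>Pow S. (w - 1) ^ card G * poly (cpoly (resL A G)) z)"
    proof (rule sum.cong)
      fix G assume "G \<in> Pow S"
      then have "finite G" using fS finite_subset by auto
      then show "(\<Sum>K\<in>Pow G. w ^ card K * ((-1) ^ card (G - K) * poly (cpoly (resL A G)) z)) = (w - 1) ^ card G * poly (cpoly (resL A G)) z"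
        by (simp add: sum_Pow_binomial[symmetric] sum_distrib_right mult.assoc)
    qed simp
    finally show ?thesis .
  qed
  have c1: "poly (cpoly A) z = (\<Sum>K\<in>Pow S. poly (e K) z)" for z
  proof -
    have "(\<Sum>G\<in>Pow S. (1 - 1) ^ card G * poly (cpoly (resL A G)) z) = (\<Sum>G\<in>Pow S. if G = {} then poly (cpoly A) z else 0)"
    proof (rule sum.cong)
      fix G assume "G \<in> Pow S"
      then have "finite G" using fS finite_subset by auto
      then show "(1 - 1) ^ card G * poly (cpoly (resL A G)) z = (if G = {} then poly (cpoly A) z else 0)"
        by (cases "G = {}") (auto simp: power_0_left)
    qed simp
    then show ?thesis using key[of 1 z] fS by simp
  qed
  define D where "D = (\<Sum>K\<in>Pow S. (\<Sum>i<card K. monom 1 i) * e K)"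
  have "nonneg_coeffs D" unfolding D_def
    by (intro nonneg_coeffs_sum nonneg_coeffs_mult e) (auto simp: nonneg_coeffs_def)
  moreover have "poly (cpoly A) z - z ^ rk A * poly (cpoly A) (1 / z) = (1 - z) * poly D z" if "z \<noteq> 0" for z
  proof -
    have "poly (cpoly A) z - z ^ rk A * poly (cpoly A) (1 / z) = (\<Sum>K\<in>Pow S. poly (e K) z) - (\<Sum>K\<in>Pow S. z ^ card K * poly (e K) z)"
      using cpoly_reversed[OF A that] key[of z z] c1[of z] by (simp add: S_def)
    also have "\<dots> = (\<Sum>K\<in>Pow S. (1 - z ^ card K) * poly (e K) z)" by (simp add: sum_subtractf left_diff_distrib)
    also have "\<dots> = (1 - z) * poly D z"
      unfolding D_def poly_sum sum_distrib_left
      by (rule sum.cong) (auto simp: one_diff_power_eq poly_sum poly_monom mult.assoc)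
    finally show ?thesis .
  qed
  ultimately show ?thesis by blast
qed

end

lemma coeff_symmetric:
  fixes a :: "real poly"
  assumes "degree a \<le> d" "\<And>x. x \<noteq> 0 \<Longrightarrow> x ^ d * poly a (1 / x) = poly a x" "i \<le> d"
  shows "coeff a i = coeff a (d - i)"
proof -
  have "infinite (- {0::real})" using infinite_UNIV_char_0[where 'a=real] by (simp add: Compl_eq_Diff_UNIV)
  then have "a = rev_poly d a"
    by (rule poly_eq_infinite) (use poly_rev_poly[OF assms(1)] assms(2) in auto)
  then have "coeff a i = coeff (rev_poly d a) i" by simp
  also have "\<dots> = (\<Sum>j\<le>d. if j = i then coeff a (d - j) else 0)" by (simp add: rev_poly_def coeff_sum)
  finally show ?thesis using assms(3) by simp
qed

section \<open>Polynomials with real roots\<close>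

lemma map_poly_of_real_add: "map_poly complex_of_real (p + q) = map_poly of_real p + map_poly of_real q"
  by (intro poly_eqI) (simp add: coeff_map_poly)

lemma map_poly_of_real_smult: "map_poly complex_of_real (smult a p) = smult (of_real a) (map_poly of_real p)"
  by (intro poly_eqI) (simp add: coeff_map_poly)

lemma map_poly_of_real_mult: "map_poly complex_of_real (p * q) = map_poly of_real p * map_poly of_real q"
  by (intro poly_eqI) (simp add: coeff_map_poly coeff_mult)

lemma map_poly_of_real_sum: "map_poly complex_of_real (sum f S) = (\<Sum>x\<in>S. map_poly of_real (f x))"
  by (induction S rule: infinite_finite_induct) (auto simp: map_poly_of_real_add)

lemma Im_of_real_mult: "Im (of_real a * z) = a * Im z"
  by simp

lemma poly_map_of_real: "poly (map_poly complex_of_real p) (of_real x) = of_real (poly p x)"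
  by (simp add: poly_altdef degree_map_poly coeff_map_poly)

text \<open>Integer indices give coefficients below the constant term the value zero, so the minors
  of the coefficient sequence need no boundary cases.\<close>

definition int_coeff :: "real poly \<Rightarrow> int \<Rightarrow> real" where
  "int_coeff p k = (if k < 0 then 0 else coeff p (nat k))"

lemma int_coeff_linear_mult: "int_coeff ([:\<rho>, 1:] * p) k = int_coeff p (k - 1) + \<rho> * int_coeff p k"
proof (cases "k \<le> 0")
  case True then show ?thesis by (cases "k = 0") (auto simp: int_coeff_def)
next
  case False
  then obtain n where "k = int (Suc n)" using zero_less_imp_eq_int[of k] gr0_conv_Suc by auto
  then show ?thesis by (simp add: int_coeff_def nat_add_distrib)
qed

text \<open>Roots are divided out one at a time; multiplication by \<open>[:\<rho>, 1:]\<close>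
  preserves the inequalities. They are carried along for all \<open>i \<le> j\<close> because the
  step for \<open>i = j\<close> involves a mixed product of the neighbouring pair.\<close>

lemma log_concave_of_nonpositive_roots:
  fixes p :: "real poly"
  assumes "p \<noteq> 0" "0 < lead_coeff p"
    "\<And>z. poly (map_poly of_real p) z = 0 \<Longrightarrow> z \<in> \<real> \<and> Re z \<le> 0"
  shows "(\<forall>k. 0 \<le> int_coeff p k) \<and> (\<forall>i j. i \<le> j \<longrightarrow> int_coeff p (i - 1) * int_coeff p (j + 1) \<le> int_coeff p i * int_coeff p j)"
  using assms
proof (induction "degree p" arbitrary: p)
  case 0
  then obtain c where p: "p = [:c:]" using degree_0_id by metis
  have "int_coeff p k = (if k = 0 then c else 0)" for k
    by (auto simp: int_coeff_def p coeff_pCons split: nat.split)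
  then show ?case using 0 p by auto
next
  case (Suc n)
  let ?P = "map_poly complex_of_real p"
  have "degree ?P = Suc n" using Suc.hyps(2) by (simp add: degree_map_poly)
  then have "\<not> constant (poly ?P)" by (simp add: constant_degree)
  then obtain z where z: "poly ?P z = 0" using fundamental_theorem_of_algebra by blast
  define \<rho> where "\<rho> = - Re z"
  have zr: "z = of_real (- \<rho>)" "0 \<le> \<rho>" using Suc.prems(3)[OF z] by (auto simp: \<rho>_def complex_is_Real_iff complex_eq_iff)
  have "poly p (- \<rho>) = 0" using z unfolding zr(1) poly_map_of_real by simp
  then obtain q where q: "p = [:\<rho>, 1:] * q" using poly_eq_0_iff_dvd[of p "- \<rho>"] by (auto elim: dvdE)
  have q0: "q \<noteq> 0" using Suc.prems(1) q by auto
  have deg: "degree q = n" using Suc.hyps(2) q q0 degree_mult_eq[of "[:\<rho>, 1:]" q] by simp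
  have lead: "lead_coeff q > 0" using Suc.prems(2) unfolding q lead_coeff_mult by simp
  have roots: "y \<in> \<real> \<and> Re y \<le> 0" if "poly (map_poly of_real q) y = 0" for y :: complex
  proof (rule Suc.prems(3))
    have "map_poly complex_of_real p = map_poly of_real [:\<rho>, 1:] * map_poly of_real q"
      unfolding q by (rule map_poly_of_real_mult)
    then show "poly (map_poly complex_of_real p) y = 0" using that by simp
  qed
  have IH: "\<And>k. 0 \<le> int_coeff q k" "\<And>i j. i \<le> j \<Longrightarrow> int_coeff q (i - 1) * int_coeff q (j + 1) \<le> int_coeff q i * int_coeff q j"
    using Suc.hyps(1)[OF deg[symmetric] q0 lead roots] by auto
  define f where "f = int_coeff q"
  have f': "int_coeff p k = f (k - 1) + \<rho> * f k" for k unfolding q f_def by (rule int_coeff_linear_mult)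
  have f: "\<And>k. 0 \<le> f k" "\<And>i j. i \<le> j \<Longrightarrow> f (i - 1) * f (j + 1) \<le> f i * f j" using IH by (auto simp: f_def)
  have "int_coeff p (i - 1) * int_coeff p (j + 1) \<le> int_coeff p i * int_coeff p j" if ij: "i \<le> j" for i j
  proof -
    have 1: "f (i - 2) * f j \<le> f (i - 1) * f (j - 1)" using f(2)[of "i - 1" "j - 1"] ij by simp
    have 2: "\<rho>\<^sup>2 * (f (i - 1) * f (j + 1)) \<le> \<rho>\<^sup>2 * (f i * f j)" using f(2)[OF ij] by (simp add: mult_left_mono)
    have 3: "f (i - 2) * f (j + 1) \<le> f i * f (j - 1)"
    proof (cases "i = j")
      case True then show ?thesis using f(2)[of "i - 1" i] by (simp add: mult.commute)
    next
      case False
      then have "f (i - 1) * f j \<le> f i * f (j - 1)" using f(2)[of i "j - 1"] ij by simp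
      moreover have "f (i - 2) * f (j + 1) \<le> f (i - 1) * f j" using f(2)[of "i - 1" j] ij by simp
      ultimately show ?thesis by simp
    qed
    have 4: "\<rho> * (f (i - 2) * f (j + 1)) \<le> \<rho> * (f i * f (j - 1))" using 3 zr(2) by (simp add: mult_left_mono)
    show ?thesis unfolding f' using 1 2 4 by (simp add: algebra_simps power2_eq_square)
  qed
  then show ?case using f(1) zr(2) by (auto simp: f')
qed

lemma log_concave_of_real_rooted:
  assumes "nonneg_coeffs p" "real_rooted p" "i \<le> j"
  shows "coeff p i * coeff p (Suc (Suc j)) \<le> coeff p (Suc i) * coeff p (Suc j)"
proof (cases "p = 0")
  case False
  have lead: "lead_coeff p > 0" using assms(1) False by (auto simp: nonneg_coeffs_def less_le)
  have roots: "z \<in> \<real> \<and> Re z \<le> 0" if z: "poly (map_poly of_real p) z = 0" for z :: complex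
  proof
    show zR: "z \<in> \<real>" using assms(2) False z by (auto simp: real_rooted_def)
    then obtain x where x: "z = of_real x" by (auto elim: Reals_cases)
    have px: "poly p x = 0" using z unfolding x poly_map_of_real by simp
    show "Re z \<le> 0"
    proof (rule ccontr)
      assume "\<not> Re z \<le> 0"
      then have "0 < x" using x by simp
      then have "0 < coeff p (degree p) * x ^ degree p" using lead by simp
      also have "\<dots> \<le> (\<Sum>i\<le>degree p. coeff p i * x ^ i)"
        using assms(1) \<open>0 < x\<close> by (intro member_le_sum) (auto simp: nonneg_coeffs_def)
      finally show False using px by (simp add: poly_altdef)
    qed
  qed
  from log_concave_of_nonpositive_roots[OF False lead roots]
  have "int_coeff p (int (Suc i) - 1) * int_coeff p (int (Suc j) + 1) \<le> int_coeff p (int (Suc i)) * int_coeff p (int (Suc j))"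
    using assms(3) by (metis of_nat_le_iff Suc_le_mono)
  then show ?thesis by (simp add: int_coeff_def nat_add_distrib)
qed simp

text \<open>Log-concavity is applied to an index and its mirror image. By symmetry it compares the
  squares of neighbouring coefficients directly, so zeros among the coefficients cause no
  trouble.\<close>

lemma symmetric_unimodal:
  assumes p: "nonneg_coeffs p" "real_rooted p" "\<And>i. d < i \<Longrightarrow> coeff p i = 0"
    and sym: "\<And>i. i \<le> d \<Longrightarrow> coeff p i = coeff p (d - i)"
  shows "2 * i + 1 \<le> d \<Longrightarrow> coeff p i \<le> coeff p (Suc i)" "d \<le> 2 * i + 1 \<Longrightarrow> coeff p (Suc i) \<le> coeff p i"
proof -
  have up: "coeff p i \<le> coeff p (Suc i)" if "2 * i + 1 \<le> d" for i
  proof (cases "2 * i + 1 = d")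
    case True
    then have "d - i = Suc i" by simp
    then show ?thesis using sym[of i] True by simp
  next
    case False
    define j where "j = d - i - 2"
    have j: "Suc (Suc j) = d - i" "Suc j = d - Suc i" "i \<le> j" using that False by (auto simp: j_def)
    have "coeff p i * coeff p (d - i) \<le> coeff p (Suc i) * coeff p (d - Suc i)"
      using log_concave_of_real_rooted[OF p(1,2) j(3)] by (metis j(1,2))
    then have "coeff p i * coeff p i \<le> coeff p (Suc i) * coeff p (Suc i)"
      using sym[of i] sym[of "Suc i"] that by simp
    then show ?thesis using p(1) unfolding nonneg_coeffs_def by (metis abs_le_square_iff abs_of_nonneg power2_eq_square)
  qed
  then show "2 * i + 1 \<le> d \<Longrightarrow> coeff p i \<le> coeff p (Suc i)" .
  show "coeff p (Suc i) \<le> coeff p i" if "d \<le> 2 * i + 1"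
  proof (cases "Suc i \<le> d")
    case True
    have "coeff p (d - Suc i) \<le> coeff p (Suc (d - Suc i))" by (rule up) (use that True in auto)
    moreover have "Suc (d - Suc i) = d - i" using True by simp
    ultimately show ?thesis using sym[of i] sym[of "Suc i"] True by simp
  next
    case False then show ?thesis using p(1,3) by (simp add: nonneg_coeffs_def)
  qed
qed

lemma real_rootedI:
  assumes "\<And>z::complex. 0 < Im z \<Longrightarrow> poly (map_poly of_real p) z \<noteq> 0"
  shows "real_rooted p"
proof -
  have "z \<in> \<real>" if z: "poly (map_poly of_real p) z = 0" for z :: complex
  proof (rule ccontr)
    assume "z \<notin> \<real>"
    then consider "0 < Im z" | "0 < Im (cnj z)" by (force simp: complex_is_Real_iff)
    moreover have "poly (map_poly complex_of_real p) (cnj z) = cnj (poly (map_poly of_real p) z)"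
      by (simp add: poly_altdef coeff_map_poly degree_map_poly)
    ultimately show False using assms z by cases auto
  qed
  then show ?thesis by (auto simp: real_rooted_def)
qed

section \<open>Eulerian-type polynomials\<close>

text \<open>\<open>\<Sum>\<^sub>n n\<^sup>k (n + 1)\<^bsup>m-k\<^esup> x\<^sup>n = eul m k / (1 - x)\<^bsup>m+1\<^esup>\<close> for \<open>k \<le> m\<close>.\<close>

primrec eul :: "nat \<Rightarrow> nat \<Rightarrow> real poly" where
  "eul 0 k = 1"
| "eul (Suc m) k = pCons 0 (\<Sum>i<k. eul m i) + (\<Sum>i\<in>{k..m}. eul m i)"

lemma telescope: 
  fixes u v :: real
  shows "k \<le> Suc m \<Longrightarrow> (\<Sum>i<k. u ^ i * v ^ (m - i)) * (v - u) = v ^ (Suc m - k) * (v ^ k - u ^ k)"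
proof (induction k)
  case (Suc k)
  have "v ^ (Suc m - k) = v * v ^ (m - k)" using Suc.prems by (simp add: Suc_diff_le)
  then show ?case using Suc by (simp add: algebra_simps)
qed simp

lemma telescope_tail:
  fixes u v :: real
  assumes "k \<le> Suc m" "v - u = 1" shows "(\<Sum>i\<in>{k..m}. u ^ i * v ^ (m - i)) = u ^ k * v ^ (Suc m - k) - u ^ Suc m"
proof -
  have "(\<Sum>i<Suc m. u ^ i * v ^ (m - i)) = (\<Sum>i<k. u ^ i * v ^ (m - i)) + (\<Sum>i\<in>{k..m}. u ^ i * v ^ (m - i))"
    using sum.atLeastLessThan_concat[of 0 k "Suc m" "\<lambda>i. u ^ i * v ^ (m - i)"] assms(1)
    by (simp add: lessThan_atLeast0 atLeastLessThanSuc_atLeastAtMost)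
  moreover have "v ^ (Suc m - k) * v ^ k = v ^ Suc m" using assms(1) by (simp flip: power_add)
  ultimately show ?thesis using telescope[of "Suc m" m u v] telescope[of k m u v] assms by (simp add: algebra_simps)
qed

text \<open>After removing one factor \<open>1 - fps_X\<close> the coefficient to be matched is
  \<open>n ^ k * (n + 1) ^ (Suc m - k)\<close> minus its predecessor. Inserting
  \<open>n ^ Suc m\<close> splits this difference into two telescoping sums: the head at
  \<open>(n - 1, n)\<close> is the part of the recursion multiplied by \<open>x\<close>, the tail at
  \<open>(n, n + 1)\<close> the other one.\<close>

lemma fps_eul:
  "k \<le> m \<Longrightarrow> fps_of_poly (eul m k) = (1 - fps_X) ^ Suc m * Abs_fps (\<lambda>n. real n ^ k * (real n + 1) ^ (m - k))"
proof (induction m arbitrary: k)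
  case 0
  have "Abs_fps (\<lambda>n. 1::real) * (1 - fps_X) = 1"
    using fps_inverse_gp inverse_mult_eq_1[of "Abs_fps (\<lambda>n. 1::real)"] 
    by (simp add: fps_eq_iff fps_mult_fps_X_commute right_diff_distrib)
  then show ?case using 0 by (simp add: mult.commute)
next
  case (Suc m)
  define s where "s m k = Abs_fps (\<lambda>n. real n ^ k * (real n + 1) ^ (m - k))" for m k
  have "fps_of_poly (eul (Suc m) k) = fps_X * (\<Sum>i<k. fps_of_poly (eul m i)) + (\<Sum>i\<in>{k..m}. fps_of_poly (eul m i))"
    by (simp add: fps_of_poly_add fps_of_poly_pCons fps_of_poly_sum mult.commute)
  also have "(\<Sum>i<k. fps_of_poly (eul m i)) = (1 - fps_X) ^ Suc m * (\<Sum>i<k. s m i)"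
    unfolding sum_distrib_left by (rule sum.cong) (use Suc in \<open>auto simp: s_def\<close>)
  also have "(\<Sum>i\<in>{k..m}. fps_of_poly (eul m i)) = (1 - fps_X) ^ Suc m * (\<Sum>i\<in>{k..m}. s m i)"
    unfolding sum_distrib_left by (rule sum.cong) (use Suc in \<open>auto simp: s_def\<close>)
  also have "fps_X * ((1 - fps_X) ^ Suc m * (\<Sum>i<k. s m i)) + (1 - fps_X) ^ Suc m * (\<Sum>i\<in>{k..m}. s m i) =
    (1 - fps_X) ^ Suc m * (fps_X * (\<Sum>i<k. s m i) + (\<Sum>i\<in>{k..m}. s m i))" by (simp only: algebra_simps)
  also have "fps_X * (\<Sum>i<k. s m i) + (\<Sum>i\<in>{k..m}. s m i) = (1 - fps_X) * s (Suc m) k"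
  proof (rule fps_ext)
    fix n
    have tail: "(\<Sum>i\<in>{k..m}. real n ^ i * (real n + 1) ^ (m - i)) = real n ^ k * (real n + 1) ^ (Suc m - k) - real n ^ Suc m"
      by (rule telescope_tail) (use Suc.prems in auto)
    show "fps_nth (fps_X * (\<Sum>i<k. s m i) + (\<Sum>i\<in>{k..m}. s m i)) n = fps_nth ((1 - fps_X) * s (Suc m) k) n"
    proof (cases n)
      case 0
      have "(\<Sum>i\<in>{k..m}. (0::real) ^ i) = 0 ^ k * 1 - 0" using tail 0 by simp
      then show ?thesis using 0 by (simp add: s_def fps_sum_nth algebra_simps)
    next
      case (Suc n')
      have "(\<Sum>i<k. real n' ^ i * real n ^ (m - i)) = real n ^ (Suc m - k) * (real n ^ k - real n' ^ k)"
        using telescope[of k m "real n'" "real n"] Suc.prems Suc by simp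
      moreover have "real n ^ (Suc m - k) * real n ^ k = real n ^ Suc m" using Suc.prems by (simp flip: power_add)
      ultimately show ?thesis using tail Suc
        by (simp add: s_def fps_sum_nth algebra_simps)
    qed
  qed
  finally show ?case by (simp add: s_def algebra_simps)
qed

lemma nonneg_eul: "nonneg_coeffs (eul m k)"
  by (induction m arbitrary: k) (auto simp: nonneg_coeffs_def[of 1] intro!: nonneg_coeffs_add nonneg_coeffs_pCons nonneg_coeffs_sum)

lemma coeff_eul_high: "k \<le> m \<Longrightarrow> m < i \<or> (m = i \<and> k < m) \<Longrightarrow> coeff (eul m k) i = 0"
proof (induction m arbitrary: k i)
  case (Suc m)
  have 1: "coeff (pCons 0 (\<Sum>j<k. eul m j)) i = 0"
    using Suc by (auto simp: coeff_pCons coeff_sum split: nat.split intro!: sum.neutral)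
  have 2: "coeff (\<Sum>j\<in>{k..m}. eul m j) i = 0"
    using Suc by (auto simp: coeff_sum intro!: sum.neutral)
  show ?case using 1 2 by simp
qed (auto simp: coeff_pCons split: nat.split)

lemma coeff_eul_0: "1 \<le> k \<Longrightarrow> k \<le> m \<Longrightarrow> coeff (eul m k) 0 = 0"
proof (induction m arbitrary: k)
  case (Suc m) then show ?case by (auto simp: coeff_sum intro!: sum.neutral)
qed simp

lemma eul_palindromic: "k \<le> m \<Longrightarrow> x \<noteq> 0 \<Longrightarrow> x ^ m * poly (eul m k) (1 / x) = poly (eul m (m - k)) x"
proof (induction m arbitrary: k)
  case (Suc m)
  have 1: "x ^ m * (\<Sum>i<k. poly (eul m i) (1 / x)) = (\<Sum>i\<in>{Suc m - k..m}. poly (eul m i) x)"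
  proof -
    have "x ^ m * (\<Sum>i<k. poly (eul m i) (1 / x)) = (\<Sum>i<k. poly (eul m (m - i)) x)"
      unfolding sum_distrib_left by (rule sum.cong) (use Suc in auto)
    also have "\<dots> = (\<Sum>i\<in>{Suc m - k..m}. poly (eul m i) x)"
      by (rule sum.reindex_bij_witness[of _ "\<lambda>i. m - i" "\<lambda>i. m - i"]) (use Suc.prems in auto)
    finally show ?thesis .
  qed
  have 2: "x ^ m * (\<Sum>i\<in>{k..m}. poly (eul m i) (1 / x)) = (\<Sum>i<Suc m - k. poly (eul m i) x)"
  proof -
    have "x ^ m * (\<Sum>i\<in>{k..m}. poly (eul m i) (1 / x)) = (\<Sum>i\<in>{k..m}. poly (eul m (m - i)) x)"
      unfolding sum_distrib_left by (rule sum.cong) (use Suc in auto)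
    also have "\<dots> = (\<Sum>i<Suc m - k. poly (eul m i) x)"
      by (rule sum.reindex_bij_witness[of _ "\<lambda>i. m - i" "\<lambda>i. m - i"]) (use Suc.prems in auto)
    finally show ?thesis .
  qed
  have "x ^ Suc m * poly (eul (Suc m) k) (1 / x) = x ^ m * (\<Sum>i<k. poly (eul m i) (1 / x)) + x * (x ^ m * (\<Sum>i\<in>{k..m}. poly (eul m i) (1 / x)))"
    using Suc.prems(2) by (simp add: poly_sum field_simps)
  then show ?case unfolding 1 2 by (simp add: poly_sum)
qed simp

text \<open>
  Interlacing in Hermite--Biehler form: for \<open>z\<close> in the upper half-plane the values of
  \<open>eul m 0, \<dots>, eul m m\<close> turn counterclockwise, by a total angle of at most \<open>arg z\<close>.  In this form
  interlacing is preserved by nonnegative combinations for trivial reasons.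
\<close>

definition fan :: "complex \<Rightarrow> nat \<Rightarrow> (nat \<Rightarrow> complex) \<Rightarrow> bool" where
  "fan z m Q \<longleftrightarrow> (\<forall>j\<le>m. Q j \<noteq> 0) \<and>
     (\<forall>i j. i \<le> j \<and> j \<le> m \<longrightarrow> 0 \<le> Im (Q j * cnj (Q i)) \<and> 0 \<le> Im (z * Q i * cnj (Q j)))"

lemma cmod_sq: "(cmod x)\<^sup>2 = Re x * Re x + Im x * Im x"
  by (simp only: cmod_power2 power2_eq_square[of "Re x"] power2_eq_square[of "Im x"])

text \<open>The vanishing sum is paired with \<open>Q 0\<close> and with \<open>z * Q 0\<close>. In
  both cases all summands are nonnegative and therefore vanish; as \<open>Im z > 0\<close>, a
  nonzero weight would force \<open>Q j * cnj (Q 0) = 0\<close>.\<close>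

lemma fan_combination:
  assumes z: "0 < Im z" and Q: "fan z m Q" and \<nu>: "\<And>j. j \<le> m \<Longrightarrow> 0 \<le> \<nu> j"
    and zero: "(\<Sum>j\<le>m. of_real (\<nu> j) * Q j) = 0" and j: "j \<le> m"
  shows "\<nu> j = (0::real)"
proof (rule ccontr)
  assume nz: "\<nu> j \<noteq> 0"
  have "0 = Im ((\<Sum>j\<le>m. of_real (\<nu> j) * Q j) * cnj (Q 0))" using zero by simp
  also have "\<dots> = (\<Sum>j\<le>m. \<nu> j * Im (Q j * cnj (Q 0)))" 
    by (simp only: sum_distrib_right Im_sum mult.assoc Im_of_real_mult)
  finally have s: "(\<Sum>j\<le>m. \<nu> j * Im (Q j * cnj (Q 0))) = 0" ..
  have "\<nu> j * Im (Q j * cnj (Q 0)) = 0"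
    using s j \<nu> Q by (subst (asm) sum_nonneg_eq_0_iff) (auto simp: fan_def)
  then have 1: "Im (Q j * cnj (Q 0)) = 0" using nz by simp
  have "0 = Im (z * Q 0 * cnj (\<Sum>j\<le>m. of_real (\<nu> j) * Q j))" unfolding zero by simp
  also have "\<dots> = (\<Sum>j\<le>m. Im (of_real (\<nu> j) * (z * Q 0 * cnj (Q j))))"
    by (simp only: cnj_sum sum_distrib_left Im_sum complex_cnj_mult complex_cnj_complex_of_real mult.left_commute mult.assoc)
  also have "\<dots> = (\<Sum>j\<le>m. \<nu> j * Im (z * Q 0 * cnj (Q j)))" by (simp only: Im_of_real_mult)
  finally have s: "(\<Sum>j\<le>m. \<nu> j * Im (z * Q 0 * cnj (Q j))) = 0" ..
  have "\<nu> j * Im (z * Q 0 * cnj (Q j)) = 0"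
    using s j \<nu> Q by (subst (asm) sum_nonneg_eq_0_iff) (auto simp: fan_def)
  then have "Im (z * Q 0 * cnj (Q j)) = 0" using nz mult_eq_0_iff by blast
  moreover have "z * Q 0 * cnj (Q j) = z * cnj (Q j * cnj (Q 0))" by (simp add: mult_ac)
  ultimately have "Im (z * cnj (Q j * cnj (Q 0))) = 0" by simp
  then have "Im z * Re (Q j * cnj (Q 0)) = 0" using 1 by (simp only: times_complex.sel cnj.sel)
  then have "Q j * cnj (Q 0) = 0" using 1 z by (simp add: complex_eq_iff)
  then show False using Q j by (auto simp: fan_def)
qed

lemma fan_pair:
  assumes Q: "fan z m Q" and sep: "\<And>i j. i \<in> I \<Longrightarrow> j \<in> J \<Longrightarrow> i \<le> j \<and> j \<le> m"
  shows "0 \<le> Im ((\<Sum>j\<in>J. Q j) * cnj (\<Sum>i\<in>I. Q i))" "0 \<le> Im (z * (\<Sum>i\<in>I. Q i) * cnj (\<Sum>j\<in>J. Q j))"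
  using Q sep unfolding cnj_sum sum_product sum_distrib_left sum_distrib_right Im_sum fan_def
  by (auto intro!: sum_nonneg)

text \<open>For \<open>k \<le> l\<close> the two new values are \<open>z * L + M + R\<close> and
  \<open>z * (L + M) + R\<close> with consecutive blocks \<open>L\<close>, \<open>M\<close>,
  \<open>R\<close> of the old fan. They differ only in the factor in front of \<open>M\<close>, and
  both imaginary parts expand into terms that the old fan makes nonnegative.\<close>

lemma fan_eul: 
  assumes z: "0 < Im z" shows "fan z m (\<lambda>k. poly (map_poly of_real (eul m k)) z)"
proof (induction m)
  case 0 then show ?case using z by (auto simp: fan_def map_poly_1')
next
  case (Suc m)
  define Q where "Q k = poly (map_poly complex_of_real (eul m k)) z" for k
  have Q: "fan z m Q" using Suc by (simp add: Q_def[abs_def])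
  have P: "poly (map_poly complex_of_real (eul (Suc m) k)) z = z * (\<Sum>i<k. Q i) + (\<Sum>i\<in>{k..m}. Q i)" for k
    by (simp add: Q_def map_poly_of_real_add map_poly_pCons map_poly_of_real_sum poly_sum)
  have pair: "0 \<le> Im ((z * (\<Sum>i<l. Q i) + (\<Sum>i\<in>{l..m}. Q i)) * cnj (z * (\<Sum>i<k. Q i) + (\<Sum>i\<in>{k..m}. Q i))) \<and>
     0 \<le> Im (z * (z * (\<Sum>i<k. Q i) + (\<Sum>i\<in>{k..m}. Q i)) * cnj (z * (\<Sum>i<l. Q i) + (\<Sum>i\<in>{l..m}. Q i)))"
    if kl: "k \<le> l" "l \<le> Suc m" for k l
  proof -
    define L where "L = (\<Sum>i\<in>{..<k}. Q i)"
    define M where "M = (\<Sum>i\<in>{k..<l}. Q i)"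
    define R where "R = (\<Sum>i\<in>{l..m}. Q i)"
    have e1: "(\<Sum>i<l. Q i) = L + M" unfolding L_def M_def
      using sum.atLeastLessThan_concat[of 0 k l Q] kl by (simp add: lessThan_atLeast0)
    have e2: "(\<Sum>i\<in>{k..m}. Q i) = M + R" unfolding M_def R_def
      using sum.atLeastLessThan_concat[of k l "Suc m" Q] kl by (simp add: atLeastLessThanSuc_atLeastAtMost)
    have LM: "0 \<le> Im (M * cnj L)" "0 \<le> Im (z * L * cnj M)"
      unfolding L_def M_def by (rule fan_pair[OF Q]; use kl in auto)+
    have MR: "0 \<le> Im (R * cnj M)" "0 \<le> Im (z * M * cnj R)"
      unfolding M_def R_def by (rule fan_pair[OF Q]; use kl in auto)+
    have "Im ((z * (L + M) + R) * cnj (z * L + (M + R))) =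
      (cmod z)\<^sup>2 * Im (M * cnj L) + Im (z * L * cnj M) + Im z * (cmod M)\<^sup>2 + Im (z * M * cnj R) + Im (R * cnj M)"
      unfolding cmod_sq by (simp add: algebra_simps)
    moreover have "Im (z * (z * L + (M + R)) * cnj (z * (L + M) + R)) =
      Im z * (cmod (z * L + R))\<^sup>2 + (cmod z)\<^sup>2 * (Im (z * L * cnj M) + Im (R * cnj M)) + (cmod z)\<^sup>2 * Im (M * cnj L) + Im (z * M * cnj R)"
      unfolding cmod_sq by (simp add: algebra_simps)
    moreover have "0 \<le> Im z * (cmod M)\<^sup>2" "0 \<le> Im z * (cmod (z * L + R))\<^sup>2" using z by simp_all
    moreover have "0 \<le> (cmod z)\<^sup>2 * Im (M * cnj L)" "0 \<le> (cmod z)\<^sup>2 * (Im (z * L * cnj M) + Im (R * cnj M))"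
      using LM MR by simp_all
    ultimately show ?thesis unfolding e1 e2 R_def[symmetric] L_def[symmetric] using LM MR by linarith
  qed
  have ne: "z * (\<Sum>i<k. Q i) + (\<Sum>i\<in>{k..m}. Q i) \<noteq> 0" if k: "k \<le> Suc m" for k
  proof
    assume 0: "z * (\<Sum>i<k. Q i) + (\<Sum>i\<in>{k..m}. Q i) = 0"
    define L where "L = (\<Sum>i\<in>{..<k}. Q i)"
    define R where "R = (\<Sum>i\<in>{k..m}. Q i)"
    \<comment> \<open>The fan requires \<open>Im (R * cnj L)\<close> to be nonnegative, but here it
      equals \<open>- Im z\<close> times the square of \<open>cmod L\<close>; hence both blocks
      vanish, and with them the sum of the whole fan.\<close>
    have "R = - z * L" using 0 by (simp add: L_def R_def add_eq_0_iff)
    moreover have "0 \<le> Im (R * cnj L)" unfolding L_def R_def by (rule fan_pair(1)[OF Q]) (use k in auto)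
    ultimately have "Im z * (cmod L)\<^sup>2 \<le> 0" by (simp add: cmod_sq algebra_simps)
    then have L0: "L = 0" using z by (simp add: mult_le_0_iff)
    then have R0: "R = 0" using 0 by (simp add: L_def R_def)
    define \<nu> where "\<nu> j = (1::real)" for j :: nat
    have "(\<Sum>j\<le>m. Q j) = L + R"
      using sum.atLeastLessThan_concat[of 0 k "Suc m" Q] k unfolding L_def R_def
      by (simp add: lessThan_atLeast0 atLeastLessThanSuc_atLeastAtMost atLeast0AtMost)
    then have "(\<Sum>j\<le>m. of_real (\<nu> j) * Q j) = 0" using L0 R0 by (simp add: \<nu>_def)
    from fan_combination[OF z Q _ this, of 0] show False by (simp add: \<nu>_def)
  qed
  show ?case unfolding fan_def P using ne pair by auto
qed

lemma eul_combination_nonzero: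
  assumes z: "0 < Im z" and \<nu>: "\<And>j. j \<le> m \<Longrightarrow> 0 \<le> \<nu> j" and i: "i \<le> m" "0 < \<nu> i"
  shows "poly (map_poly complex_of_real (\<Sum>j\<le>m. smult (\<nu> j) (eul m j))) z \<noteq> 0"
proof
  assume "poly (map_poly complex_of_real (\<Sum>j\<le>m. smult (\<nu> j) (eul m j))) z = 0"
  then have "(\<Sum>j\<le>m. of_real (\<nu> j) * poly (map_poly complex_of_real (eul m j)) z) = 0"
    by (simp add: map_poly_of_real_sum poly_sum map_poly_of_real_smult)
  from fan_combination[OF z fan_eul[OF z] \<nu> this i(1)] show False using i by simp
qed

lemma real_rooted_eul_combination:
  assumes "\<And>j. j \<le> m \<Longrightarrow> 0 \<le> \<nu> j" shows "real_rooted (\<Sum>j\<le>m. smult (\<nu> j) (eul m j))"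
proof (cases "\<exists>i\<le>m. 0 < \<nu> i")
  case True then show ?thesis using eul_combination_nonzero[of _ m \<nu>] assms by (intro real_rootedI) blast
next
  case False
  then have "\<nu> j = 0" if "j \<le> m" for j using assms that by (metis less_le)
  then have "(\<Sum>j\<le>m. smult (\<nu> j) (eul m j)) = 0" by (intro sum.neutral) auto
  then show ?thesis by (simp add: real_rooted_def)
qed

text \<open>The hypothesis on \<open>\<mu>\<close> and \<open>\<nu>\<close> makes \<open>F = \<Sum> \<nu>\<^sub>j eul m j\<close> interlace \<open>G = \<Sum> \<mu>\<^sub>j eul m j\<close>.\<close>

lemma real_rooted_eul_shift_combination:
  assumes \<nu>: "\<And>j. j \<le> m \<Longrightarrow> 0 \<le> \<nu> j" and \<mu>: "\<And>j. j \<le> m \<Longrightarrow> 0 \<le> \<mu> j"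
    and tp: "\<And>i j. i < j \<Longrightarrow> j \<le> m \<Longrightarrow> \<nu> j * \<mu> i \<le> \<nu> i * \<mu> j"
  shows "real_rooted (pCons 0 (\<Sum>j\<le>m. smult (\<nu> j) (eul m j)) + (\<Sum>j\<le>m. smult (\<mu> j) (eul m j)))"
proof (cases "\<exists>i\<le>m. 0 < \<nu> i")
  case False
  then have "\<nu> j = 0" if "j \<le> m" for j using \<nu> that by (metis less_le)
  then have "(\<Sum>j\<le>m. smult (\<nu> j) (eul m j)) = 0" by (intro sum.neutral) auto
  then show ?thesis using real_rooted_eul_combination[of m \<mu>] \<mu> by simp
next
  case True
  define F where "F = (\<Sum>j\<le>m. smult (\<nu> j) (eul m j))"
  define G where "G = (\<Sum>j\<le>m. smult (\<mu> j) (eul m j))"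
  have "poly (map_poly of_real (pCons 0 F + G)) z \<noteq> 0" if z: "0 < Im z" for z :: complex
  proof
    define f where "f = poly (map_poly complex_of_real F) z"
    define g where "g = poly (map_poly complex_of_real G) z"
    define Q where "Q k = poly (map_poly complex_of_real (eul m k)) z" for k
    have Q: "fan z m Q" using fan_eul[OF z, of m] by (simp add: Q_def[abs_def])
    assume "poly (map_poly of_real (pCons 0 F + G)) z = 0"
    then have 0: "g = - z * f" by (simp add: map_poly_of_real_add map_poly_pCons f_def g_def add_eq_0_iff add.commute)
    have f: "f = (\<Sum>j\<le>m. of_real (\<nu> j) * Q j)" by (simp add: f_def F_def Q_def map_poly_of_real_sum poly_sum map_poly_of_real_smult)
    have g: "g = (\<Sum>j\<le>m. of_real (\<mu> j) * Q j)" by (simp add: g_def G_def Q_def map_poly_of_real_sum poly_sum map_poly_of_real_smult)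
    have fn: "f \<noteq> 0" unfolding f_def F_def using eul_combination_nonzero[OF z] \<nu> True by blast
    define T where "T i j = \<mu> j * \<nu> i * Im (Q j * cnj (Q i))" for i j
    have "Im (g * cnj f) = (\<Sum>j\<le>m. \<Sum>i\<le>m. T i j)"
      unfolding f g cnj_sum sum_product Im_sum by (simp add: T_def algebra_simps)
    \<comment> \<open>Joining \<open>(i, j)\<close> with \<open>(j, i)\<close> leaves the product of
      the minor in \<open>tp\<close> and the orientation of \<open>Q i\<close>, \<open>Q j\<close>;
      the two factors change sign together when \<open>i\<close> and \<open>j\<close> are
      exchanged.\<close>
    then have "2 * Im (g * cnj f) = (\<Sum>j\<le>m. \<Sum>i\<le>m. T i j + T j i)"
      using sum.swap[of T "{..m}" "{..m}"] by (simp add: sum.distrib)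
    also have "\<dots> \<ge> 0"
    proof (intro sum_nonneg)
      fix i j assume ij: "j \<in> {..m}" "i \<in> {..m}"
      have anti: "Im (Q i * cnj (Q j)) = - Im (Q j * cnj (Q i))" by (simp add: algebra_simps)
      have eq: "T i j + T j i = (\<nu> i * \<mu> j - \<nu> j * \<mu> i) * Im (Q j * cnj (Q i))"
        unfolding T_def anti by (simp add: algebra_simps)
      consider "i < j" | "i = j" | "j < i" by linarith
      then show "0 \<le> T i j + T j i" unfolding eq
      proof cases
        case 1
        then have "0 \<le> Im (Q j * cnj (Q i))" using Q ij by (auto simp: fan_def)
        then show "0 \<le> (\<nu> i * \<mu> j - \<nu> j * \<mu> i) * Im (Q j * cnj (Q i))" using tp[of i j] 1 ij by simp
      next
        case 3
        then have "0 \<le> Im (Q i * cnj (Q j))" using Q ij by (auto simp: fan_def)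
        then have "Im (Q j * cnj (Q i)) \<le> 0" using anti by linarith
        then show "0 \<le> (\<nu> i * \<mu> j - \<nu> j * \<mu> i) * Im (Q j * cnj (Q i))"
          using tp[of j i] 3 ij by (intro mult_nonpos_nonpos) auto
      qed simp
    qed
    finally have "0 \<le> Im (g * cnj f)" by simp
    \<comment> \<open>At a zero of the combination \<open>g = - z * f\<close>, so the imaginary part
      just shown to be nonnegative is also nonpositive.\<close>
    then have "Im z * (cmod f)\<^sup>2 \<le> 0" unfolding 0 by (simp add: cmod_sq algebra_simps)
    then show False using fn z by (simp add: mult_le_0_iff)
  qed
  then show ?thesis unfolding F_def[symmetric] G_def[symmetric] by (rule real_rootedI)
qed

section \<open>The symmetric decomposition\<close>

lemma smult_sum_right: "smult a (sum f S) = (\<Sum>x\<in>S. smult a (f x))"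
  by (induction S rule: infinite_finite_induct) (auto simp: smult_add_right)

text \<open>One step of the recursion of \<open>eul\<close> rewrites
  \<open>h = \<Sum> coeff c i * eul r i\<close> over \<open>eul m\<close> with
  \<open>m = r - 1\<close>: the tail sums \<open>C\<close> of \<open>c\<close> appear in front of
  \<open>x\<close>, the head sums \<open>C'\<close> without it. Reversal exchanges \<open>j\<close>
  with \<open>m - j\<close>, so splitting \<open>C' j\<close> into \<open>C (m - j)\<close> and a
  remainder separates the two symmetric parts.\<close>

theorem eulerian_transform:
  fixes c D h :: "real poly"
  assumes r: "0 < r" and c: "nonneg_coeffs c" "\<And>i. r \<le> i \<Longrightarrow> coeff c i = 0"
    and D: "nonneg_coeffs D" "\<And>z. z \<noteq> 0 \<Longrightarrow> poly c z - z ^ r * poly c (1 / z) = (1 - z) * poly D z"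
    and h: "fps_of_poly h = (1 - fps_X) ^ Suc r * Abs_fps (\<lambda>n. (real n + 1) ^ r * poly c (real n / (real n + 1)))"
  shows "real_rooted h" "nonneg_real_rooted_symmetric_decomposition (r - 1) h" "unimodal_with_peak h (r div 2)"
proof -
  obtain m where m: "r = Suc m" using r gr0_implies_Suc by blast
  have dc: "degree c \<le> r" by (rule degree_le) (use c(2) in auto)
  define C where "C j = (\<Sum>i\<in>{Suc j..r}. coeff c i)" for j
  define C' where "C' j = (\<Sum>i\<le>j. coeff c i)" for j
  define tot where "tot = (\<Sum>i\<le>r. coeff c i)"
  have ci: "0 \<le> coeff c i" for i using c(1) by (simp add: nonneg_coeffs_def)
  have C0: "0 \<le> C j" "0 \<le> C' j" for j using ci by (auto simp: C_def C'_def intro: sum_nonneg)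
  have CC: "C' j + C j = tot" if "j \<le> m" for j
  proof -
    have "{..r} = {..j} \<union> {Suc j..r}" using that m by auto
    then show ?thesis unfolding C_def C'_def tot_def by (simp add: sum.union_disjoint)
  qed
  have Cdec: "C j \<le> C i" if "i \<le> j" for i j unfolding C_def by (rule sum_mono2) (use that ci in auto)
  have C'inc: "C' i \<le> C' j" if "i \<le> j" for i j unfolding C'_def by (rule sum_mono2) (use that ci in auto)
  have Cm: "C m = 0" using c(2) by (simp add: C_def m)
  define q where "q = eul m"
  define F where "F = (\<Sum>j\<le>m. smult (C j) (q j))"
  define F' where "F' = (\<Sum>j\<le>m. smult (C (m - j)) (q j))"
  define G where "G = (\<Sum>j\<le>m. smult (C' j) (q j))"
  define a where "a = (\<Sum>j\<le>m. smult (C' j - C (m - j)) (q j))"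
  \<comment> \<open>\<open>poly_shift 1\<close> divides by \<open>x\<close>: each \<open>q j\<close>
    with \<open>j \<ge> 1\<close> has constant term zero, and the term for \<open>j = 0\<close> has
    weight \<open>C m = 0\<close>.\<close>
  define b where "b = F + (\<Sum>j\<in>{1..m}. smult (C (m - j)) (poly_shift 1 (q j)))"
  have h1: "h = (\<Sum>i\<le>r. smult (coeff c i) (eul r i))"
  proof -
    have "fps_of_poly (\<Sum>i\<le>r. smult (coeff c i) (eul r i)) =
      (\<Sum>i\<le>r. fps_const (coeff c i) * ((1 - fps_X) ^ Suc r * Abs_fps (\<lambda>n. real n ^ i * (real n + 1) ^ (r - i))))"
      unfolding fps_of_poly_sum fps_of_poly_smult by (rule sum.cong) (use fps_eul in auto)
    also have "\<dots> = (1 - fps_X) ^ Suc r * (\<Sum>i\<le>r. fps_const (coeff c i) * Abs_fps (\<lambda>n. real n ^ i * (real n + 1) ^ (r - i)))"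
      unfolding sum_distrib_left by (rule sum.cong) (auto simp: algebra_simps)
    also have "(\<Sum>i\<le>r. fps_const (coeff c i) * Abs_fps (\<lambda>n. real n ^ i * (real n + 1) ^ (r - i))) =
        Abs_fps (\<lambda>n. (real n + 1) ^ r * poly c (real n / (real n + 1)))"
    proof (rule fps_ext)
      fix n
      have "(real n + 1) ^ r * poly c (real n / (real n + 1)) = (\<Sum>i\<le>r. coeff c i * (real n ^ i * (real n + 1) ^ (r - i)))"
        unfolding poly_sum_le[OF dc] sum_distrib_left
        by (rule sum.cong) (auto simp: power_divide power_diff field_simps)
      then show "fps_nth (\<Sum>i\<le>r. fps_const (coeff c i) * Abs_fps (\<lambda>n. real n ^ i * (real n + 1) ^ (r - i))) n =
         fps_nth (Abs_fps (\<lambda>n. (real n + 1) ^ r * poly c (real n / (real n + 1)))) n" by (simp add: fps_sum_nth)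
    qed
    finally show ?thesis using h by (metis fps_of_poly_eq_iff)
  qed
  have hFG: "h = pCons 0 F + G"
  proof -
    have "h = (\<Sum>i\<le>r. pCons 0 (\<Sum>j\<le>m. if j < i then smult (coeff c i) (q j) else 0) + (\<Sum>j\<le>m. if i \<le> j then smult (coeff c i) (q j) else 0))"
      unfolding h1
    proof (rule sum.cong)
      fix i assume i: "i \<in> {..r}"
      have e1: "{j. j \<le> m \<and> j < i} = {..<i}" and e2: "{j. j \<le> m \<and> i \<le> j} = {i..m}" using i m by auto
      show "smult (coeff c i) (eul r i) = pCons 0 (\<Sum>j\<le>m. if j < i then smult (coeff c i) (q j) else 0) + (\<Sum>j\<le>m. if i \<le> j then smult (coeff c i) (q j) else 0)"
        unfolding m q_def by (simp add: sum.inter_filter[symmetric] e1 e2 smult_add_right smult_sum_right)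
    qed simp
    also have "\<dots> = pCons 0 (\<Sum>i\<le>r. \<Sum>j\<le>m. if j < i then smult (coeff c i) (q j) else 0) + (\<Sum>i\<le>r. \<Sum>j\<le>m. if i \<le> j then smult (coeff c i) (q j) else 0)"
    proof -
      have "(\<Sum>i\<le>r. pCons 0 (g i)) = pCons 0 (\<Sum>i\<le>r. g i)" for g :: "nat \<Rightarrow> real poly" by (induction r) auto
      then show ?thesis by (simp add: sum.distrib)
    qed
    also have "(\<Sum>i\<le>r. \<Sum>j\<le>m. if j < i then smult (coeff c i) (q j) else 0) = F"
    proof -
      have e: "{i. i \<le> r \<and> j < i} = {Suc j..r}" for j by auto
      show ?thesis unfolding F_def C_def smult_sum
        by (subst sum.swap, rule sum.cong) (auto simp: sum.inter_filter[symmetric] e)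
    qed
    also have "(\<Sum>i\<le>r. \<Sum>j\<le>m. if i \<le> j then smult (coeff c i) (q j) else 0) = G"
    proof -
      have e: "{i. i \<le> r \<and> i \<le> j} = {..j}" if "j \<le> m" for j using that m by auto
      show ?thesis unfolding G_def C'_def smult_sum
        by (subst sum.swap, rule sum.cong) (auto simp: sum.inter_filter[symmetric] e)
    qed
    finally show ?thesis .
  qed
  \<comment> \<open>These differences are the partial sums of the coefficients of \<open>c\<close>
    minus its reversal. That polynomial is \<open>(1 - x) * D\<close>, so they are the coefficients
    of \<open>D\<close>.\<close>
  have A0: "0 \<le> C' j - C (m - j)" if j: "j \<le> m" for j
  proof -
    have "c - rev_poly r c = [:1, -1:] * D"
    proof (rule poly_eq_infinite[of "- {0}"])
      show "infinite (- {0::real})" using infinite_UNIV_char_0[where 'a=real] by (simp add: Compl_eq_Diff_UNIV)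
    qed (use D(2) poly_rev_poly[OF dc] in \<open>auto simp: left_diff_distrib\<close>)
    then have d: "coeff c i - coeff (rev_poly r c) i = coeff D i - (if i = 0 then 0 else coeff D (i - 1))" for i
      by (cases i) (auto simp: coeff_diff[symmetric] simp del: coeff_diff)
    have rc: "coeff (rev_poly r c) i = coeff c (r - i)" if "i \<le> r" for i
      using that by (simp add: rev_poly_def coeff_sum)
    have "C' j - (\<Sum>i\<le>j. coeff c (r - i)) = coeff D j" using j
    proof (induction j)
      case 0 then show ?case using d[of 0] rc[of 0] by (simp add: C'_def)
    next
      case (Suc j) then show ?case using d[of "Suc j"] rc[of "Suc j"] m by (simp add: C'_def)
    qed
    moreover have "(\<Sum>i\<le>j. coeff c (r - i)) = C (m - j)" unfolding C_def
      by (rule sum.reindex_bij_witness[of _ "\<lambda>i. r - i" "\<lambda>i. r - i"]) (use j m in auto)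
    ultimately show ?thesis using D(1) by (simp add: nonneg_coeffs_def)
  qed
  have shift: "pCons 0 (poly_shift 1 (q j)) = q j" if "j \<in> {1..m}" for j
    using coeff_eul_0[of j m] that by (intro poly_eqI) (auto simp: coeff_pCons coeff_poly_shift q_def split: nat.split)
  have shift': "smult k (q j) = pCons 0 (smult k (poly_shift 1 (q j)))" if "j \<in> {1..m}" for j k
    using arg_cong[OF shift[OF that], of "smult k"] by simp
  have xb: "pCons 0 b = pCons 0 F + F'"
  proof -
    have "F' = (\<Sum>j\<in>insert 0 {1..m}. smult (C (m - j)) (q j))" unfolding F'_def by (rule sum.cong) auto
    also have "\<dots> = (\<Sum>j\<in>{1..m}. pCons 0 (smult (C (m - j)) (poly_shift 1 (q j))))"
      using shift' Cm by simp
    also have "\<dots> = pCons 0 (\<Sum>j\<in>{1..m}. smult (C (m - j)) (poly_shift 1 (q j)))"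
      by (induction rule: infinite_finite_induct) auto
    finally show ?thesis by (simp add: b_def)
  qed
  have dec: "h = a + [:0, 1:] * b"
  proof -
    have "a = G - F'" by (simp add: a_def G_def F'_def smult_diff_left sum_subtractf)
    then show ?thesis using xb hFG by simp
  qed
  show "real_rooted h" unfolding hFG F_def G_def q_def
  proof (rule real_rooted_eul_shift_combination)
    fix i j :: nat assume "i < j"
    then show "C j * C' i \<le> C i * C' j" using Cdec[of i j] C'inc[of i j] C0 by (intro mult_mono) auto
  qed (use C0 in auto)
  have ra: "real_rooted a" unfolding a_def q_def by (rule real_rooted_eul_combination) (use A0 in auto)
  have rb: "real_rooted b"
  proof -
    have "real_rooted (pCons 0 F + F')" unfolding F_def F'_def q_def
    proof (rule real_rooted_eul_shift_combination)
      fix i j :: nat assume "i < j" "j \<le> m"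
      then show "C j * C (m - i) \<le> C i * C (m - j)" using Cdec[of i j] Cdec[of "m - j" "m - i"] C0 by (intro mult_mono) auto
    qed (use C0 in auto)
    then show ?thesis unfolding xb[symmetric] real_rooted_def by (auto simp: map_poly_pCons)
  qed
  have na: "nonneg_coeffs a" unfolding a_def
    using A0 nonneg_eul[of m] by (auto simp: nonneg_coeffs_def coeff_sum q_def intro!: sum_nonneg)
  have nb: "nonneg_coeffs b"
  proof -
    have "0 \<le> coeff b i" for i
      unfolding b_def F_def using C0 nonneg_eul[of m]
      by (auto simp: nonneg_coeffs_def coeff_sum q_def coeff_poly_shift intro!: sum_nonneg add_nonneg_nonneg)
    then show ?thesis by (simp add: nonneg_coeffs_def)
  qed
  have sa: "x ^ m * poly a (1 / x) = poly a x" if "x \<noteq> 0" for x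
  proof -
    have "x ^ m * poly a (1 / x) = (\<Sum>j\<le>m. (C' j - C (m - j)) * poly (q (m - j)) x)"
      unfolding a_def poly_sum sum_distrib_left
    proof (rule sum.cong)
      fix j assume "j \<in> {..m}"
      then show "x ^ m * poly (smult (C' j - C (m - j)) (q j)) (1 / x) = (C' j - C (m - j)) * poly (q (m - j)) x"
        using eul_palindromic[of j m x] that by (simp add: q_def algebra_simps)
    qed simp
    also have "\<dots> = (\<Sum>j\<le>m. (C' (m - j) - C j) * poly (q j) x)"
      by (rule sum.reindex_bij_witness[of _ "\<lambda>i. m - i" "\<lambda>i. m - i"]) auto
    also have "\<dots> = poly a x" unfolding a_def poly_sum
    proof (rule sum.cong)
      fix j assume "j \<in> {..m}"
      then have "C' (m - j) - C j = C' j - C (m - j)" using CC[of j] CC[of "m - j"] by simp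
      then show "(C' (m - j) - C j) * poly (q j) x = poly (smult (C' j - C (m - j)) (q j)) x" by simp
    qed simp
    finally show ?thesis .
  qed
  have FF: "x ^ m * poly F (1 / x) = poly F' x" if "x \<noteq> 0" for x
  proof -
    have "x ^ m * poly F (1 / x) = (\<Sum>j\<le>m. C j * poly (q (m - j)) x)"
      unfolding F_def poly_sum sum_distrib_left
    proof (rule sum.cong)
      fix j assume "j \<in> {..m}"
      then show "x ^ m * poly (smult (C j) (q j)) (1 / x) = C j * poly (q (m - j)) x"
        using eul_palindromic[of j m x] that by (simp add: q_def algebra_simps)
    qed simp
    also have "\<dots> = (\<Sum>j\<le>m. C (m - j) * poly (q j) x)"
      by (rule sum.reindex_bij_witness[of _ "\<lambda>i. m - i" "\<lambda>i. m - i"]) auto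
    finally show ?thesis by (simp add: F'_def poly_sum)
  qed
  have pb: "x * poly b x = x * poly F x + poly F' x" for x
    using arg_cong[OF xb, of "\<lambda>p. poly p x"] by simp
  have sb: "x powi (int m - 1) * poly b (1 / x) = poly b x" if x: "x \<noteq> 0" for x
  proof -
    have F'x: "x ^ m * poly F' (1 / x) = poly F x"
      using FF[of "1 / x"] x by (simp add: field_simps power_one_over)
    have "x powi (int m - 1) = x ^ m / x" using power_int_diff[of x "int m" 1] x by simp
    then have "x * (x powi (int m - 1) * poly b (1 / x)) = x ^ m * poly b (1 / x)" using x by simp
    also have "\<dots> = x * (x ^ m * (1 / x * poly b (1 / x)))" using x by simp
    also have "\<dots> = poly F' x + x * poly F x"
      unfolding pb using FF[OF x] F'x x by (simp add: algebra_simps)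
    also have "\<dots> = x * poly b x" using pb[of x] by simp
    finally show ?thesis using x by simp
  qed
  have ca: "coeff a i = 0" if "m < i" for i
    using that coeff_eul_high[of _ m i] by (auto simp: a_def coeff_sum q_def)
  \<comment> \<open>Among the \<open>q j\<close> only \<open>q m\<close> reaches degree
    \<open>m\<close>, and its weight in \<open>F\<close> is \<open>C m = 0\<close>; in the other
    summand the division by \<open>x\<close> lowers the degree.\<close>
  have cb: "coeff b i = 0" if "m \<le> i" for i
  proof -
    have "coeff F i = (\<Sum>j\<le>m. 0)" unfolding F_def coeff_sum
    proof (rule sum.cong)
      fix j assume j: "j \<in> {..m}"
      show "coeff (smult (C j) (q j)) i = 0"
      proof (cases "j = m")
        case False
        then have "coeff (eul m j) i = 0" using j that by (intro coeff_eul_high) auto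
        then show ?thesis by (simp add: q_def)
      qed (simp add: Cm)
    qed simp
    moreover have "coeff (poly_shift 1 (q j)) i = 0" if "j \<le> m" for j
      using coeff_eul_high[of j m "Suc i"] that \<open>m \<le> i\<close> by (simp add: coeff_poly_shift q_def)
    ultimately show ?thesis by (simp add: b_def coeff_sum)
  qed
  have da: "degree a \<le> m" by (rule degree_le) (use ca in auto)
  have coeffh: "coeff h i = coeff a i + (if i = 0 then 0 else coeff b (i - 1))" for i
    unfolding dec by (cases i) auto
  have dh: "degree h \<le> m" by (rule degree_le) (use ca cb coeffh in auto)
  have "symmetric_decomposition m h a b"
    unfolding symmetric_decomposition_def using dh dec sa sb by auto
  then show "nonneg_real_rooted_symmetric_decomposition (r - 1) h"
    unfolding nonneg_real_rooted_symmetric_decomposition_def using na nb ra rb m by auto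
  note ua = symmetric_unimodal[OF na ra ca coeff_symmetric[OF da sa]]
  show "unimodal_with_peak h (r div 2)"
  proof (cases m)
    case 0
    then show ?thesis using ua(2) cb coeffh m by (auto simp: unimodal_with_peak_def)
  next
    case (Suc k)
    have db: "degree b \<le> k" by (rule degree_le) (use cb Suc in auto)
    have sb': "x ^ k * poly b (1 / x) = poly b x" if "x \<noteq> 0" for x
      using sb[OF that] Suc by (simp add: power_int_def)
    note ub = symmetric_unimodal[OF nb rb _ coeff_symmetric[OF db sb']]
    have cbk: "coeff b i = 0" if "k < i" for i using cb that Suc by simp
    show ?thesis unfolding unimodal_with_peak_def
    proof (intro conjI allI impI)
      fix i assume i: "i < r div 2"
      have 1: "coeff a i \<le> coeff a (Suc i)" by (rule ua(1)) (use i m in auto)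
      show "coeff h i \<le> coeff h (Suc i)"
      proof (cases i)
        case 0 then show ?thesis using 1 nb coeffh by (simp add: nonneg_coeffs_def add_increasing2)
      next
        case (Suc i')
        have "coeff b i' \<le> coeff b (Suc i')" by (rule ub(1)[OF cbk]) (use i m Suc \<open>m = Suc k\<close> in auto)
        then show ?thesis using 1 coeffh Suc by simp
      qed
    next
      fix i assume i: "r div 2 \<le> i"
      have 1: "coeff a (Suc i) \<le> coeff a i" by (rule ua(2)) (use i m in auto)
      obtain i' where i': "i = Suc i'" using i m Suc by (cases i) auto
      have "coeff b (Suc i') \<le> coeff b i'" by (rule ub(2)[OF cbk]) (use i i' m Suc in auto)
      then show "coeff h (Suc i) \<le> coeff h i" using 1 coeffh i' by simp
    qed
  qed
qed


section \<open>Multichains and the h-polynomial\<close>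

primrec multichain_count :: "'a set \<Rightarrow> ('a \<Rightarrow> 'a \<Rightarrow> bool) \<Rightarrow> nat \<Rightarrow> 'a \<Rightarrow> real" where
  "multichain_count Q R 0 x = 1"
| "multichain_count Q R (Suc n) x = (\<Sum>y | y \<in> Q \<and> R y x. multichain_count Q R n y)"

lemma finite_order_complex: "finite Q \<Longrightarrow> finite (order_complex Q R)"
  by (rule finite_subset[of _ "Pow Q"]) (auto simp: order_complex_def)

lemma face_card_le:
  assumes "finite Q" "C \<in> order_complex Q R" shows "card C \<le> max_face_card (order_complex Q R)"
  unfolding max_face_card_def using assms finite_order_complex by (intro Max_ge) auto

lemma sum_face_number:
  assumes "finite Q"
  shows "(\<Sum>i\<le>max_face_card (order_complex Q R). of_nat (face_number (order_complex Q R) i) * g i) =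
    (\<Sum>C\<in>order_complex Q R. g (card C) :: 'b::comm_semiring_1)"
proof -
  let ?D = "order_complex Q R" and ?m = "max_face_card (order_complex Q R)"
  have "(\<Sum>C\<in>?D. g (card C)) = (\<Sum>i\<in>{..?m}. \<Sum>C\<in>{C \<in> ?D. card C = i}. g (card C))"
    by (rule sum.group[symmetric]) (use assms finite_order_complex face_card_le in auto)
  also have "\<dots> = (\<Sum>i\<in>{..?m}. of_nat (face_number ?D i) * g i)"
    by (rule sum.cong) (auto simp: face_number_def)
  finally show ?thesis ..
qed

lemma finite_chain_max:
  assumes "finite C" "C \<noteq> {}" "Complete_Partial_Order.chain R C"
    "\<And>x y z. x \<in> C \<Longrightarrow> y \<in> C \<Longrightarrow> z \<in> C \<Longrightarrow> R x y \<Longrightarrow> R y z \<Longrightarrow> R x z"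
  shows "\<exists>y\<in>C. \<forall>x\<in>C. R x y"
  using assms
proof (induction C rule: finite_ne_induct)
  case (singleton x)
  have "R x x" using singleton.prems(1) by (simp add: chain_def)
  then show ?case by simp
next
  case (insert a C)
  have "\<exists>y\<in>C. \<forall>x\<in>C. R x y"
  proof (rule insert.IH)
    show "Complete_Partial_Order.chain R C" using insert.prems(1) by (auto simp: chain_def)
    show "R x z" if "x \<in> C" "y \<in> C" "z \<in> C" "R x y" "R y z" for x y z
      by (rule insert.prems(2)[of x y z]) (use that in auto)
  qed
  then obtain y where y: "y \<in> C" "\<forall>x\<in>C. R x y" by blast
  have aa: "R a a" "R a y \<or> R y a" using insert.prems(1) y(1) by (auto simp: chain_def)
  show ?case
  proof (cases "R a y")
    case True then show ?thesis using y by auto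
  next
    case False
    then have "R y a" using aa by auto
    then have "R x a" if "x \<in> C" for x using insert.prems(2)[of x y a] y that by auto
    then show ?thesis using aa by auto
  qed
qed

lemma fps_geometric: "(1 - fps_X) * Abs_fps (\<lambda>_. 1) = (1 :: real fps)"
proof (rule fps_ext)
  fix n show "fps_nth ((1 - fps_X) * Abs_fps (\<lambda>_. 1)) n = fps_nth (1 :: real fps) n"
    by (cases n) (auto simp: left_diff_distrib)
qed

context
  fixes Q :: "'a set" and R :: "'a \<Rightarrow> 'a \<Rightarrow> bool"
  assumes fin: "finite Q"
    and rf: "\<And>x. x \<in> Q \<Longrightarrow> R x x"
    and anti: "\<And>x y. x \<in> Q \<Longrightarrow> y \<in> Q \<Longrightarrow> R x y \<Longrightarrow> R y x \<Longrightarrow> x = y"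
    and tr: "\<And>x y z. x \<in> Q \<Longrightarrow> y \<in> Q \<Longrightarrow> z \<in> Q \<Longrightarrow> R x y \<Longrightarrow> R y z \<Longrightarrow> R x z"
begin

lemma chains_with_top:
  assumes y: "y \<in> Q"
  shows "bij_betw (insert y) (order_complex {z \<in> Q. R z y \<and> z \<noteq> y} R) {C \<in> order_complex Q R. y \<in> C \<and> (\<forall>x\<in>C. R x y)}"
proof (rule bij_betw_byWitness[where f' = "\<lambda>C. C - {y}"])
  show "insert y ` order_complex {z \<in> Q. R z y \<and> z \<noteq> y} R \<subseteq> {C \<in> order_complex Q R. y \<in> C \<and> (\<forall>x\<in>C. R x y)}"
    using y rf[OF y] by (auto simp: order_complex_def chain_def subset_iff)
  show "(\<lambda>C. C - {y}) ` {C \<in> order_complex Q R. y \<in> C \<and> (\<forall>x\<in>C. R x y)} \<subseteq> order_complex {z \<in> Q. R z y \<and> z \<noteq> y} R"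
    by (auto simp: order_complex_def chain_def)
qed (auto simp: order_complex_def)

lemma sum_chains_with_top:
  fixes v :: "'b::comm_semiring_1"
  assumes y: "y \<in> Q"
  shows "(\<Sum>C | C \<in> order_complex Q R \<and> y \<in> C \<and> (\<forall>x\<in>C. R x y). v ^ card C) =
    v * (\<Sum>C\<in>order_complex {z \<in> Q. R z y \<and> z \<noteq> y} R. v ^ card C)"
proof -
  have "(\<Sum>C | C \<in> order_complex Q R \<and> y \<in> C \<and> (\<forall>x\<in>C. R x y). v ^ card C) =
    (\<Sum>C\<in>order_complex {z \<in> Q. R z y \<and> z \<noteq> y} R. v ^ card (insert y C))"
    by (rule sum.reindex_bij_betw[OF chains_with_top[OF y], symmetric])
  also have "\<dots> = (\<Sum>C\<in>order_complex {z \<in> Q. R z y \<and> z \<noteq> y} R. v * v ^ card C)"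
  proof (rule sum.cong)
    fix C assume C: "C \<in> order_complex {z \<in> Q. R z y \<and> z \<noteq> y} R"
    then have "finite C" "y \<notin> C" using fin finite_subset[of C Q] by (auto simp: order_complex_def)
    then show "v ^ card (insert y C) = v * v ^ card C" by simp
  qed simp
  finally show ?thesis by (simp add: sum_distrib_left)
qed

lemma sum_chains_by_top:
  fixes v :: "'b::comm_semiring_1"
  assumes x: "x \<in> Q"
  shows "(\<Sum>C\<in>order_complex {z \<in> Q. R z x} R. v ^ card C) =
     1 + (\<Sum>y | y \<in> Q \<and> R y x. v * (\<Sum>C\<in>order_complex {z \<in> Q. R z y \<and> z \<noteq> y} R. v ^ card C))"
proof -
  let ?K = "order_complex {z \<in> Q. R z x} R"
  define T where "T y = {C \<in> order_complex Q R. y \<in> C \<and> (\<forall>z\<in>C. R z y)}" for y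
  have finK: "finite ?K" by (rule finite_order_complex) (use fin in auto)
  have Teq: "?K - {{}} = (\<Union>y\<in>{y \<in> Q. R y x}. T y)"
  proof (intro equalityI subsetI)
    fix C assume C: "C \<in> ?K - {{}}"
    then have "C \<subseteq> Q" "finite C" using fin finite_subset[of C Q] by (auto simp: order_complex_def)
    moreover have "\<exists>y\<in>C. \<forall>z\<in>C. R z y"
      by (rule finite_chain_max) (use C \<open>finite C\<close> \<open>C \<subseteq> Q\<close> tr in \<open>auto simp: order_complex_def subset_iff\<close>)
    ultimately show "C \<in> (\<Union>y\<in>{y \<in> Q. R y x}. T y)" using C by (auto simp: T_def order_complex_def)
  next
    fix C assume "C \<in> (\<Union>y\<in>{y \<in> Q. R y x}. T y)"
    then obtain y where y: "y \<in> Q" "R y x" "C \<in> order_complex Q R" "y \<in> C" "\<forall>z\<in>C. R z y" by (auto simp: T_def)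
    then have "R z x" if "z \<in> C" for z using tr[of z y x] x that by (auto simp: order_complex_def)
    then show "C \<in> ?K - {{}}" using y by (auto simp: order_complex_def)
  qed
  have e: "{} \<in> ?K" by (auto simp: order_complex_def chain_def)
  have "(\<Sum>C\<in>?K. v ^ card C) = 1 + (\<Sum>C\<in>?K - {{}}. v ^ card C)"
    using sum.remove[OF finK e, of "\<lambda>C. v ^ card C"] by simp
  also have "(\<Sum>C\<in>?K - {{}}. v ^ card C) = (\<Sum>y\<in>{y \<in> Q. R y x}. \<Sum>C\<in>T y. v ^ card C)"
    unfolding Teq
  proof (rule sum.UNION_disjoint)
    show "finite {y \<in> Q. R y x}" using fin by simp
    show "\<forall>i\<in>{y \<in> Q. R y x}. finite (T i)" unfolding T_def using finite_order_complex[OF fin] by simp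
    show "\<forall>i\<in>{y \<in> Q. R y x}. \<forall>j\<in>{y \<in> Q. R y x}. i \<noteq> j \<longrightarrow> T i \<inter> T j = {}"
      using anti by (auto simp: T_def)
  qed
  also have "\<dots> = (\<Sum>y\<in>{y \<in> Q. R y x}. v * (\<Sum>C\<in>order_complex {z \<in> Q. R z y \<and> z \<noteq> y} R. v ^ card C))"
    by (rule sum.cong) (use sum_chains_with_top in \<open>auto simp: T_def\<close>)
  finally show ?thesis by simp
qed

lemma sum_chains_split_top:
  fixes v :: "'b::comm_semiring_1"
  assumes y: "y \<in> Q"
  shows "(\<Sum>C\<in>order_complex {z \<in> Q. R z y} R. v ^ card C) =
     (1 + v) * (\<Sum>C\<in>order_complex {z \<in> Q. R z y \<and> z \<noteq> y} R. v ^ card C)"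
proof -
  let ?K = "order_complex {z \<in> Q. R z y} R" and ?L = "order_complex {z \<in> Q. R z y \<and> z \<noteq> y} R"
  have "?K = ?L \<union> {C \<in> order_complex Q R. y \<in> C \<and> (\<forall>x\<in>C. R x y)}"
    by (auto simp: order_complex_def)
  then have "(\<Sum>C\<in>?K. v ^ card C) = (\<Sum>C\<in>?L. v ^ card C) + (\<Sum>C | C \<in> order_complex Q R \<and> y \<in> C \<and> (\<forall>x\<in>C. R x y). v ^ card C)"
    using finite_order_complex[of "{z \<in> Q. R z y \<and> z \<noteq> y}" R] finite_order_complex[of Q R] fin
    by (auto simp: order_complex_def intro!: sum.union_disjoint)
  then show ?thesis using sum_chains_with_top[OF y, of v] by (simp add: algebra_simps)
qed

text \<open>\<open>v\<close> is the series of positive multiplicities, so the left side sorts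
  multichains by their support. Formally, both sides satisfy the recursion
  \<open>K x = 1 + fps_X * \<Sum> K y\<close> over all \<open>y\<close> below \<open>x\<close>,
  which rests on \<open>fps_X * (1 + v) = v\<close>.\<close>

lemma chains_multichains:
  assumes x: "x \<in> Q"
  defines "v \<equiv> fps_X * Abs_fps (\<lambda>_. 1) :: real fps"
  shows "(\<Sum>C\<in>order_complex {z \<in> Q. R z x} R. v ^ card C) = Abs_fps (\<lambda>n. multichain_count Q R n x)"
proof -
  define K where "K x = (\<Sum>C\<in>order_complex {z \<in> Q. R z x} R. v ^ card C)" for x
  have v: "fps_X * (1 + v) = v"
    using fps_geometric by (simp add: v_def algebra_simps)
  have rec: "K x = 1 + fps_X * (\<Sum>y | y \<in> Q \<and> R y x. K y)" if "x \<in> Q" for x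
  proof -
    have "v * (\<Sum>C\<in>order_complex {z \<in> Q. R z y \<and> z \<noteq> y} R. v ^ card C) = fps_X * K y" if "y \<in> Q" for y
    proof -
      have "fps_X * K y = fps_X * (1 + v) * (\<Sum>C\<in>order_complex {z \<in> Q. R z y \<and> z \<noteq> y} R. v ^ card C)"
        unfolding K_def sum_chains_split_top[OF that, of v] by (rule mult.assoc[symmetric])
      then show ?thesis unfolding v by (rule sym)
    qed
    then show ?thesis unfolding K_def[of x] sum_chains_by_top[OF that] sum_distrib_left by (auto intro!: sum.cong)
  qed
  have "fps_nth (K x) n = multichain_count Q R n x" if "x \<in> Q" for n x using that
  proof (induction n arbitrary: x)
    case 0 then show ?case by (simp add: rec)
  next
    case (Suc n)
    have "fps_nth (K x) (Suc n) = (\<Sum>y | y \<in> Q \<and> R y x. fps_nth (K y) n)"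
      by (subst rec[OF Suc.prems]) (simp add: fps_sum_nth)
    then show ?case using Suc.IH by simp
  qed
  then show ?thesis using x by (auto simp: fps_eq_iff K_def)
qed

theorem fps_h_poly:
  assumes top: "t \<in> Q" "\<And>x. x \<in> Q \<Longrightarrow> R x t"
  shows "fps_of_poly (h_poly (order_complex Q R)) =
    (1 - fps_X) ^ max_face_card (order_complex Q R) * Abs_fps (\<lambda>n. multichain_count Q R n t)"
proof -
  let ?D = "order_complex Q R" and ?m = "max_face_card (order_complex Q R)"
  define v where "v = (fps_X * Abs_fps (\<lambda>_. 1) :: real fps)"
  have v: "(1 - fps_X) * v = fps_X" using fps_geometric by (simp add: v_def mult.left_commute)
  have lin: "fps_of_poly [:1, -1 :: real:] = 1 - fps_X" by (simp add: fps_of_poly_pCons)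
  have "fps_of_poly (h_poly ?D) = (\<Sum>i\<le>?m. of_nat (face_number ?D i) * (fps_X ^ i * (1 - fps_X) ^ (?m - i)))"
    unfolding h_poly_def fps_of_poly_sum
    by (rule sum.cong) (auto simp: fps_of_poly_mult fps_of_poly_power fps_of_poly_monom lin fps_of_nat mult.assoc)
  also have "\<dots> = (\<Sum>C\<in>?D. fps_X ^ card C * (1 - fps_X) ^ (?m - card C))" by (rule sum_face_number[OF fin])
  also have "\<dots> = (\<Sum>C\<in>?D. (1 - fps_X) ^ ?m * v ^ card C)"
  proof (rule sum.cong)
    fix C assume "C \<in> ?D"
    then have "?m = (?m - card C) + card C" using face_card_le[OF fin] by simp
    then have "(1 - fps_X) ^ ?m * v ^ card C = (1 - fps_X) ^ (?m - card C) * ((1 - fps_X) * v) ^ card C"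
      by (metis (no_types, lifting) mult.assoc power_add power_mult_distrib)
    then show "fps_X ^ card C * (1 - fps_X) ^ (?m - card C) = (1 - fps_X) ^ ?m * v ^ card C" unfolding v by (simp add: mult.commute)
  qed simp
  also have "\<dots> = (1 - fps_X) ^ ?m * (\<Sum>C\<in>order_complex {z \<in> Q. R z t} R. v ^ card C)"
  proof -
    have "{z \<in> Q. R z t} = Q" using top by auto
    then show ?thesis by (simp add: sum_distrib_left)
  qed
  finally show ?thesis using chains_multichains[OF top(1)] by (simp add: v_def)
qed

end

text \<open>The real Moebius map \<open>w = z / (1 + z)\<close> turns the value of the
  \<open>h\<close>-polynomial at \<open>w\<close> into that of the \<open>f\<close>-polynomial at
  \<open>z\<close> divided by a power of \<open>1 + z\<close>; the excluded point
  \<open>z = -1\<close> is itself real.\<close>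

lemma real_rooted_f_poly:
  assumes fin: "finite Q" and h: "real_rooted (h_poly (order_complex Q R))"
  shows "real_rooted (f_poly (order_complex Q R))"
proof -
  let ?D = "order_complex Q R" and ?m = "max_face_card (order_complex Q R)"
  let ?f = "\<lambda>i. complex_of_nat (face_number ?D i)"
  have mon: "map_poly complex_of_real (monom a i) = monom (of_real a) i" for a i by (intro poly_eqI) (simp add: coeff_map_poly)
  have pw: "map_poly complex_of_real (p ^ n) = map_poly of_real p ^ n" for p n
    by (induction n) (auto simp: map_poly_of_real_mult)
  have f: "poly (map_poly of_real (f_poly ?D)) z = (\<Sum>i\<le>?m. ?f i * z ^ i)" for z
    by (simp add: f_poly_def map_poly_of_real_sum poly_sum mon poly_monom)
  have hh: "poly (map_poly of_real (h_poly ?D)) z = (\<Sum>i\<le>?m. ?f i * z ^ i * (1 - z) ^ (?m - i))" for z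
    by (simp add: h_poly_def map_poly_of_real_sum poly_sum mon map_poly_of_real_mult pw poly_monom map_poly_pCons)
  \<comment> \<open>\<open>real_rooted\<close> admits the zero polynomial, so nonvanishing has to be
    known before roots are transferred. The constant term counts the empty chain.\<close>
  have h0: "h_poly ?D \<noteq> 0"
  proof
    assume "h_poly ?D = 0"
    then have "0 = poly (map_poly complex_of_real (h_poly ?D)) 0" by simp
    also have "\<dots> = (\<Sum>i\<le>?m. if i = 0 then ?f 0 else 0)" unfolding hh by (rule sum.cong) auto
    also have "\<dots> = ?f 0" by simp
    finally have "face_number ?D 0 = 0" by simp
    moreover have "{C \<in> ?D. card C = 0} = {{}}"
      using finite_subset[OF _ fin] by (force simp: order_complex_def chain_def)
    ultimately show False by (simp add: face_number_def)
  qed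
  have "z \<in> \<real>" if z: "poly (map_poly complex_of_real (f_poly ?D)) z = 0" for z
  proof (cases "1 + z = 0")
    case True
    then have "z = -1" by (simp add: add_eq_0_iff)
    then show ?thesis by simp
  next
    case False
    define w where "w = z / (1 + z)"
    have w: "1 - w = 1 / (1 + z)" using False by (simp add: w_def field_simps)
    have "poly (map_poly of_real (h_poly ?D)) w = (\<Sum>i\<le>?m. (1 / (1 + z)) ^ ?m * (?f i * z ^ i))"
      unfolding hh
    proof (rule sum.cong)
      fix i assume "i \<in> {..?m}"
      then have "?m = i + (?m - i)" by simp
      then have "(1 / (1 + z)) ^ ?m = (1 / (1 + z)) ^ i * (1 / (1 + z)) ^ (?m - i)" by (metis power_add)
      then show "?f i * w ^ i * (1 - w) ^ (?m - i) = (1 / (1 + z)) ^ ?m * (?f i * z ^ i)"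
        unfolding w by (simp add: w_def power_divide)
    qed simp
    also have "\<dots> = (1 / (1 + z)) ^ ?m * poly (map_poly of_real (f_poly ?D)) z" by (simp add: f sum_distrib_left)
    finally have "w \<in> \<real>" using h h0 z by (auto simp: real_rooted_def)
    moreover have "z = w / (1 - w)" unfolding w using False by (simp add: w_def)
    ultimately show ?thesis by (metis Reals_1 Reals_diff Reals_divide)
  qed
  then show ?thesis by (auto simp: real_rooted_def)
qed


text \<open>The representation acts on all functions \<open>'a \<Rightarrow> real\<close>, which
  avoids a vector space type depending on \<open>S\<close>; the vectors that matter are later
  singled out by \<open>supp\<close>.\<close>

instantiation "fun" :: (type, real_vector) real_vector
begin
definition scaleR_fun :: "real \<Rightarrow> ('a \<Rightarrow> 'b) \<Rightarrow> 'a \<Rightarrow> 'b" where "scaleR_fun r f = (\<lambda>x. r *\<^sub>R f x)"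
instance by standard (auto simp: scaleR_fun_def algebra_simps fun_eq_iff)
end

lemma scaleR_apply [simp]: "(c *\<^sub>R f) x = c *\<^sub>R f x" by (simp add: scaleR_fun_def)

lemma sum_apply [simp]: "(sum f A) x = (\<Sum>a\<in>A. f a x :: 'b::ab_group_add)"
  by (induction A rule: infinite_finite_induct) auto

section \<open>The reflection representation\<close>

definition alpha :: "'a \<Rightarrow> 'a \<Rightarrow> real" where "alpha s = (\<lambda>t. if t = s then 1 else 0)"

lemma alpha_apply: "alpha s t = (if t = s then 1 else 0)" by (simp add: alpha_def)

locale coxeter_form =
  fixes S :: "'a set" and k :: "'a \<Rightarrow> 'a \<Rightarrow> nat"
  assumes finS: "finite S"
    and k_refl: "s \<in> S \<Longrightarrow> k s s = 1"
    and k_sym: "s \<in> S \<Longrightarrow> t \<in> S \<Longrightarrow> k s t = k t s"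
    and k_ge: "s \<in> S \<Longrightarrow> t \<in> S \<Longrightarrow> s \<noteq> t \<Longrightarrow> 2 \<le> k s t"
begin

text \<open>The Tits form scaled so that roots have square two; the diagonal entries arise from
  \<open>k s s = 1\<close> and the value \<open>-1\<close> of the cosine at
  \<open>pi\<close>.\<close>

definition B :: "('a \<Rightarrow> real) \<Rightarrow> ('a \<Rightarrow> real) \<Rightarrow> real" where
  "B x y = (\<Sum>s\<in>S. \<Sum>t\<in>S. - 2 * cos (pi / k s t) * x s * y t)"

definition sigma :: "'a \<Rightarrow> ('a \<Rightarrow> real) \<Rightarrow> 'a \<Rightarrow> real" where
  "sigma s x = x - B x (alpha s) *\<^sub>R alpha s"

lemma B_linear [simp]:
  "B (x + y) z = B x z + B y z" "B z (x + y) = B z x + B z y"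
  "B (c *\<^sub>R x) z = c * B x z" "B z (c *\<^sub>R x) = c * B z x"
  "B (x - y) z = B x z - B y z" "B z (x - y) = B z x - B z y"
  "B (- x) z = - B x z" "B z (- x) = - B z x" "B 0 z = 0" "B z 0 = 0"
  by (simp_all add: B_def algebra_simps sum.distrib sum_subtractf sum_distrib_left sum_negf)

lemma B_sym: "B x y = B y x"
proof -
  have "B x y = (\<Sum>t\<in>S. \<Sum>s\<in>S. - 2 * cos (pi / k s t) * x s * y t)" unfolding B_def by (rule sum.swap)
  also have "\<dots> = B y x" unfolding B_def by (intro sum.cong) (auto simp: k_sym)
  finally show ?thesis .
qed

lemma sum_alpha: "t \<in> S \<Longrightarrow> (\<Sum>u\<in>S. f u * alpha t u) = f t"
proof -
  assume "t \<in> S"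
  have "(\<Sum>u\<in>S. f u * alpha t u) = (\<Sum>u\<in>S. if t = u then f u else 0)"
    by (rule sum.cong) (auto simp: alpha_apply)
  then show ?thesis using \<open>t \<in> S\<close> finS by simp
qed

lemma B_alpha_right: "t \<in> S \<Longrightarrow> B x (alpha t) = (\<Sum>s\<in>S. - 2 * cos (pi / k s t) * x s)"
  unfolding B_def by (simp only: sum_alpha)

lemma B_alpha: "s \<in> S \<Longrightarrow> t \<in> S \<Longrightarrow> B (alpha s) (alpha t) = - 2 * cos (pi / k s t)"
  by (simp only: B_alpha_right sum_alpha)

lemma B_alpha_self [simp]: "s \<in> S \<Longrightarrow> B (alpha s) (alpha s) = 2"
  by (simp add: B_alpha k_refl)

lemma B_alpha_nonpos: "s \<in> S \<Longrightarrow> t \<in> S \<Longrightarrow> s \<noteq> t \<Longrightarrow> B (alpha s) (alpha t) \<le> 0"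
proof -
  assume st: "s \<in> S" "t \<in> S" "s \<noteq> t"
  have "2 \<le> real (k s t)" using k_ge[OF st] by linarith
  then have "0 \<le> pi / k s t" "pi / k s t \<le> pi / 2" using divide_left_mono[of 2 "real (k s t)" pi] by auto
  then have "- (pi / 2) \<le> pi / k s t" "pi / k s t \<le> pi / 2" using pi_gt_zero by linarith+
  then have "0 \<le> cos (pi / k s t)" by (rule cos_ge_zero)
  then show ?thesis using st by (simp add: B_alpha)
qed

lemma sigma_linear: "sigma s (x + y) = sigma s x + sigma s y" "sigma s (c *\<^sub>R x) = c *\<^sub>R sigma s x" "sigma s (- x) = - sigma s x"
  by (simp_all add: sigma_def algebra_simps)

lemma sigma_alpha: "s \<in> S \<Longrightarrow> sigma s (alpha s) = - alpha s"
  by (simp add: sigma_def fun_eq_iff)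

lemma sigma_invol: "s \<in> S \<Longrightarrow> sigma s (sigma s x) = x"
  by (simp add: sigma_def fun_eq_iff)

lemma B_sigma: "s \<in> S \<Longrightarrow> B (sigma s x) (sigma s y) = B x y"
  by (simp add: sigma_def B_sym[of "alpha s" y])

lemma sigma_other: "t \<noteq> s \<Longrightarrow> sigma s x t = x t"
  by (simp add: sigma_def alpha_apply)

text \<open>Alternating products of two reflections shift the phase, by the recursion for \<open>sin\<close>.\<close>

definition wave :: "'a \<Rightarrow> 'a \<Rightarrow> real \<Rightarrow> 'a \<Rightarrow> real" where
  "wave s t \<phi> = sin (\<phi> + pi / k s t) *\<^sub>R alpha s + sin \<phi> *\<^sub>R alpha t"

lemma sin_rec: "sin (x + 2 * y) = 2 * cos y * sin (x + y) - sin (x :: real)"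
proof -
  have "sin (x + 2 * y) = sin ((x + y) + y)" by (rule arg_cong) simp
  moreover have "sin x = sin ((x + y) - y)" by simp
  ultimately show ?thesis unfolding sin_add[of "x + y" y] sin_diff by simp
qed

lemma sigma_wave:
  assumes "s \<in> S" "t \<in> S"
  shows "sigma t (wave s t \<phi>) = wave t s (\<phi> + pi / k s t)"
proof -
  let ?y = "pi / k s t"
  have BB: "B (wave s t \<phi>) (alpha t) = - 2 * cos ?y * sin (\<phi> + ?y) + 2 * sin \<phi>"
    using assms by (simp add: wave_def B_alpha k_refl)
  have "sigma t (wave s t \<phi>) = sin (\<phi> + ?y) *\<^sub>R alpha s + (2 * cos ?y * sin (\<phi> + ?y) - sin \<phi>) *\<^sub>R alpha t"
    unfolding sigma_def[of t "wave s t \<phi>"] BB by (simp add: wave_def algebra_simps fun_eq_iff)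
  also have "2 * cos ?y * sin (\<phi> + ?y) - sin \<phi> = sin (\<phi> + ?y + ?y)"
    using sin_rec[of \<phi> ?y] by (simp add: add.assoc)
  finally show ?thesis unfolding wave_def[of t s] k_sym[OF assms(2,1)] by (simp only: add.commute)
qed

lemma sigma_pow_wave:
  assumes "s \<in> S" "t \<in> S"
  shows "((sigma s \<circ> sigma t) ^^ n) (wave s t \<phi>) = wave s t (\<phi> + 2 * n * pi / k s t)"
proof (induction n)
  case (Suc n)
  have "((sigma s \<circ> sigma t) ^^ Suc n) (wave s t \<phi>) = sigma s (sigma t (wave s t (\<phi> + 2 * n * pi / k s t)))"
    unfolding funpow.simps comp_apply[of _ _ "wave s t \<phi>"] Suc by simp
  also have "\<dots> = wave s t (\<phi> + 2 * n * pi / k s t + pi / k s t + pi / k t s)"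
    using assms by (simp add: sigma_wave)
  also have "\<phi> + 2 * n * pi / k s t + pi / k s t + pi / k t s = \<phi> + 2 * real (Suc n) * pi / k s t"
    using assms by (simp add: k_sym[of t s] add_divide_distrib algebra_simps)
  finally show ?case .
qed simp

lemma sin_angle_pos:
  assumes "s \<in> S" "t \<in> S" "s \<noteq> t" shows "0 < sin (pi / k s t)"
proof -
  have "2 \<le> real (k s t)" using k_ge[OF assms] by linarith
  then have "0 < pi / k s t" "pi / k s t \<le> pi / 2" using divide_left_mono[of 2 "real (k s t)" pi] by auto
  then show ?thesis using pi_gt_zero by (intro sin_gt_zero) linarith+
qed

lemma sigma_pow_linear:
  "((sigma s \<circ> sigma t) ^^ n) (x + y) = ((sigma s \<circ> sigma t) ^^ n) x + ((sigma s \<circ> sigma t) ^^ n) y"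
  "((sigma s \<circ> sigma t) ^^ n) (c *\<^sub>R x) = c *\<^sub>R ((sigma s \<circ> sigma t) ^^ n) x"
  "((sigma s \<circ> sigma t) ^^ n) (- x) = - ((sigma s \<circ> sigma t) ^^ n) x"
  by (induction n) (simp_all add: sigma_linear)

text \<open>On the plane of the two simple roots the power shifts the phase of every
  \<open>wave\<close> by \<open>2 * pi\<close>. Every vector is the sum of one in this plane and one
  orthogonal to it, and the latter is fixed by both reflections.\<close>

lemma braid:
  assumes st: "s \<in> S" "t \<in> S"
  shows "((sigma s \<circ> sigma t) ^^ k s t) x = x"
proof (cases "s = t")
  case True
  then show ?thesis using st by (simp add: k_refl sigma_invol)
next
  case False
  let ?F = "(sigma s \<circ> sigma t) ^^ k s t" and ?y = "pi / k s t"
  have kp: "real (k s t) \<noteq> 0" using k_ge[OF st False] by auto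
  have sp: "sin ?y \<noteq> 0" using sin_angle_pos[OF st False] by simp
  have w: "?F (wave s t \<phi>) = wave s t \<phi>" for \<phi>
  proof -
    have "?F (wave s t \<phi>) = wave s t (\<phi> + 2 * pi)"
      using sigma_pow_wave[OF st, of "k s t" \<phi>] kp by simp
    also have "\<dots> = wave s t \<phi>"
    proof -
      have "sin (\<phi> + 2 * pi + ?y) = sin (\<phi> + ?y)" using sin_periodic[of "\<phi> + ?y"] by (simp add: algebra_simps)
      then show ?thesis by (simp add: wave_def)
    qed
    finally show ?thesis .
  qed
  have a1: "alpha s = (1 / sin ?y) *\<^sub>R wave s t 0" using sp by (simp add: wave_def)
  have a2: "alpha t = (- 1 / sin ?y) *\<^sub>R wave s t (- ?y)" using sp by (simp add: wave_def)
  have fs: "?F (alpha s) = alpha s" "?F (alpha t) = alpha t"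
    by (subst a1, simp add: sigma_pow_linear w a1) (subst a2, simp add: sigma_pow_linear w a2)
  define c where "c = cos ?y"
  define p q where "p = B x (alpha s)" and "q = B x (alpha t)"
  define d where "d = 2 * (1 - c\<^sup>2)"
  have d: "d \<noteq> 0" using sp by (simp add: d_def c_def sin_squared_eq[symmetric])
  \<comment> \<open>Solution of the Gram system of \<open>alpha s\<close> and
    \<open>alpha t\<close>, whose determinant is \<open>2 * d\<close>; it makes \<open>y\<close>
    orthogonal to both.\<close>
  define a b where "a = (p + c * q) / d" and "b = (q + c * p) / d"
  define y where "y = x - a *\<^sub>R alpha s - b *\<^sub>R alpha t"
  have Bst: "B (alpha s) (alpha t) = - 2 * c" "B (alpha t) (alpha s) = - 2 * c"
    using st by (simp_all add: B_alpha c_def k_sym[of t s])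
  have "2 * a - 2 * c * b = (2 * (p + c * q) - 2 * c * (q + c * p)) / d"
    unfolding a_def b_def by (simp add: diff_divide_distrib)
  also have "2 * (p + c * q) - 2 * c * (q + c * p) = p * d" by (simp add: d_def algebra_simps power2_eq_square)
  finally have e1: "2 * a - 2 * c * b = p" using d by simp
  have "2 * b - 2 * c * a = (2 * (q + c * p) - 2 * c * (p + c * q)) / d"
    unfolding a_def b_def by (simp add: diff_divide_distrib)
  also have "2 * (q + c * p) - 2 * c * (p + c * q) = q * d" by (simp add: d_def algebra_simps power2_eq_square)
  finally have e2: "2 * b - 2 * c * a = q" using d by simp
  have y0: "B y (alpha s) = 0" "B y (alpha t) = 0"
    using e1 e2 st by (simp_all add: y_def Bst p_def[symmetric] q_def[symmetric] algebra_simps)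
  have "sigma s y = y" "sigma t y = y" by (simp_all add: sigma_def y0)
  then have "((sigma s \<circ> sigma t) ^^ n) y = y" for n by (induction n) auto
  then have "?F (y + (a *\<^sub>R alpha s + b *\<^sub>R alpha t)) = y + (a *\<^sub>R alpha s + b *\<^sub>R alpha t)"
    by (simp only: sigma_pow_linear fs)
  moreover have "y + (a *\<^sub>R alpha s + b *\<^sub>R alpha t) = x" by (simp add: y_def)
  ultimately show ?thesis by simp
qed

end


section \<open>Words, lengths and the action of the group\<close>

lemma (in monoid) word_prod_Nil [simp]: "word_prod G [] = \<one>" by (simp add: word_prod_def)
lemma (in monoid) word_prod_Cons [simp]: "word_prod G (x # xs) = x \<otimes> word_prod G xs" by (simp add: word_prod_def)
lemma (in monoid) word_prod_closed [simp]: "set xs \<subseteq> carrier G \<Longrightarrow> word_prod G xs \<in> carrier G"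
  by (induction xs) auto
lemma (in monoid) word_prod_append:
  "set xs \<subseteq> carrier G \<Longrightarrow> set ys \<subseteq> carrier G \<Longrightarrow> word_prod G (xs @ ys) = word_prod G xs \<otimes> word_prod G ys"
  by (induction xs) (auto simp: m_assoc)

locale coxeter_group =
  fixes W :: "('a, 'b) monoid_scheme" (structure) and S :: "'a set" and m :: "'a \<Rightarrow> 'a \<Rightarrow> enat"
  assumes cs: "coxeter_system W S m" and finW: "finite (carrier W)"
begin

sublocale group W using cs by (simp add: coxeter_system_def)

lemma S_sub: "S \<subseteq> carrier W" using cs by (simp add: coxeter_system_def)
lemma S_carrier [simp]: "s \<in> S \<Longrightarrow> s \<in> carrier W" using S_sub by auto
lemma m_mat: "coxeter_matrix S m" using cs by (simp add: coxeter_system_def)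
lemma words_carrier: "u \<in> lists S \<Longrightarrow> set u \<subseteq> carrier W" using S_sub by auto
lemma word_eq: "u \<in> lists S \<Longrightarrow> v \<in> lists S \<Longrightarrow> word_prod W u = word_prod W v \<longleftrightarrow> equivclp (relator_insertion S m) u v"
  using cs by (simp add: coxeter_system_def)

lemma relator_one:
  assumes "s \<in> S" "t \<in> S" "m s t = enat n"
  shows "(s \<otimes> t) [^] n = \<one>"
proof -
  have "word_prod W (concat (replicate j [s, t])) = (s \<otimes> t) [^] j" for j :: nat
  proof (induction j)
    case (Suc j)
    have "(s \<otimes> t) [^] Suc j = (s \<otimes> t) \<otimes> (s \<otimes> t) [^] j" using assms by (subst nat_pow_Suc2) auto
    then show ?case using Suc assms by (simp add: m_assoc)
  qed simp
  moreover have "relator_insertion S m ([] @ []) ([] @ concat (replicate n [s, t]) @ [])"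
    using assms by (intro relator_insertion.intros)
  then have "equivclp (relator_insertion S m) [] (concat (replicate n [s, t]))" by (simp add: r_into_equivclp)
  moreover have "concat (replicate n [s, t]) \<in> lists S" using assms by (auto simp: in_lists_conv_set)
  ultimately show ?thesis using word_eq[of "[]" "concat (replicate n [s, t])"] by simp
qed

lemma S_invol [simp]: "s \<in> S \<Longrightarrow> s \<otimes> s = \<one>"
proof -
  assume s: "s \<in> S"
  then have "m s s = enat 1" using m_mat by (simp add: coxeter_matrix_def one_enat_def)
  from relator_one[OF s s this] show ?thesis using s by simp
qed

lemma S_invol_left [simp]: "s \<in> S \<Longrightarrow> w \<in> carrier W \<Longrightarrow> s \<otimes> (s \<otimes> w) = w"
  by (simp add: m_assoc[symmetric])

lemma S_invol_right [simp]: "s \<in> S \<Longrightarrow> w \<in> carrier W \<Longrightarrow> w \<otimes> s \<otimes> s = w"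
  by (simp add: m_assoc)

lemma S_inv: "s \<in> S \<Longrightarrow> inv s = s" by (rule inv_equality) auto

lemma word_exists:
  assumes "w \<in> carrier W" shows "\<exists>u\<in>lists S. word_prod W u = w"
proof -
  have "w \<in> generate W S" using assms cs by (simp add: coxeter_system_def)
  then show ?thesis
  proof (induction rule: generate.induct)
    case one show ?case by (intro bexI[of _ "[]"]) auto
  next
    case (incl s) then show ?case by (intro bexI[of _ "[s]"]) auto
  next
    case (inv s) then show ?case by (intro bexI[of _ "[s]"]) (auto simp: S_inv)
  next
    case (eng a b)
    then obtain u v where "u \<in> lists S" "v \<in> lists S" "word_prod W u = a" "word_prod W v = b" by blast
    then show ?case using words_carrier by (intro bexI[of _ "u @ v"]) (auto simp: word_prod_append)
  qed
qed

definition len :: "'a \<Rightarrow> nat" where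
  "len w = (LEAST n. \<exists>u\<in>lists S. length u = n \<and> word_prod W u = w)"

lemma len_le: "u \<in> lists S \<Longrightarrow> len (word_prod W u) \<le> length u"
  unfolding len_def by (rule Least_le) auto

lemma len_word:
  assumes "w \<in> carrier W" obtains u where "u \<in> lists S" "length u = len w" "word_prod W u = w"
proof -
  obtain v where "v \<in> lists S" "word_prod W v = w" using word_exists[OF assms] by blast
  then have "\<exists>u\<in>lists S. length u = length v \<and> word_prod W u = w" by blast
  then have "\<exists>u\<in>lists S. length u = len w \<and> word_prod W u = w" unfolding len_def by (rule LeastI)
  then show ?thesis using that by blast
qed

lemma len_mult_gen: "w \<in> carrier W \<Longrightarrow> s \<in> S \<Longrightarrow> len (w \<otimes> s) \<le> Suc (len w)"
proof -
  assume w: "w \<in> carrier W" "s \<in> S"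
  obtain u where u: "u \<in> lists S" "length u = len w" "word_prod W u = w" by (rule len_word[OF w(1)])
  then show ?thesis using len_le[of "u @ [s]"] w words_carrier by (simp add: word_prod_append)
qed


lemma len_descent:
  assumes "w \<in> carrier W" "w \<noteq> \<one>" shows "\<exists>t\<in>S. len (w \<otimes> t) < len w"
proof -
  obtain u where u: "u \<in> lists S" "length u = len w" "word_prod W u = w" by (rule len_word[OF assms(1)])
  then have "u \<noteq> []" using assms by auto
  then obtain v t where v: "u = v @ [t]" by (metis rev_exhaust)
  then have vt: "v \<in> lists S" "t \<in> S" using u by auto
  have "w \<otimes> t = word_prod W v" using u(3) vt words_carrier[of v] by (auto simp: v word_prod_append)
  then have "len (w \<otimes> t) \<le> length v" using len_le vt by simp
  then have "len (w \<otimes> t) < len w" using u(2) v by simp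
  then show ?thesis using vt by blast
qed

text \<open>
  No relation involves an infinite label, so it may be replaced by any number exceeding all lengths:
  positivity of roots only needs that reduced alternating words have length at most \<open>k s t\<close>.
\<close>

definition k :: "'a \<Rightarrow> 'a \<Rightarrow> nat" where
  "k s t = (case m s t of enat n \<Rightarrow> n | \<infinity> \<Rightarrow> 3 + Max (len ` carrier W))"

lemma k_enat: "m s t = enat n \<Longrightarrow> k s t = n" by (simp add: k_def)

sublocale coxeter_form S k
proof
  show "finite S" using S_sub finW finite_subset by auto
  show "k s s = 1" if "s \<in> S" for s using m_mat that by (auto simp: coxeter_matrix_def one_enat_def k_def)
  show "k s t = k t s" if "s \<in> S" "t \<in> S" for s t using m_mat that by (simp add: coxeter_matrix_def k_def)
  show "2 \<le> k s t" if "s \<in> S" "t \<in> S" "s \<noteq> t" for s t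
  proof -
    have "2 \<le> m s t" using m_mat that by (simp add: coxeter_matrix_def)
    then show ?thesis by (cases "m s t") (auto simp: k_def numeral_eq_enat)
  qed
qed

definition act :: "'a list \<Rightarrow> ('a \<Rightarrow> real) \<Rightarrow> 'a \<Rightarrow> real" where "act u x = foldr sigma u x"

lemma act_simps [simp]: "act [] x = x" "act (s # u) x = sigma s (act u x)" "act (u @ v) x = act u (act v x)"
  by (simp_all add: act_def)

lemma act_relator:
  assumes "relator_insertion S m u v" shows "act u = act v"
  using assms
proof cases
  case (1 s t n a b)
  have "act (concat (replicate j [s, t])) x = ((sigma s \<circ> sigma t) ^^ j) x" for j x
    by (induction j) auto
  then have "act (concat (replicate n [s, t])) x = x" for x
    using braid[OF 1(3,4)] k_enat[OF 1(5)] by simp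
  then show ?thesis unfolding 1 by (intro ext) (simp only: act_simps)
qed

lemma act_equiv: "equivclp (relator_insertion S m) u v \<Longrightarrow> act u = act v"
  by (induction rule: equivclp_induct) (auto dest: act_relator)

definition rho :: "'a \<Rightarrow> ('a \<Rightarrow> real) \<Rightarrow> 'a \<Rightarrow> real" where
  "rho w = act (SOME u. u \<in> lists S \<and> word_prod W u = w)"

lemma rho_word: assumes "u \<in> lists S" shows "rho (word_prod W u) = act u"
proof -
  let ?v = "SOME v. v \<in> lists S \<and> word_prod W v = word_prod W u"
  have "?v \<in> lists S \<and> word_prod W ?v = word_prod W u" by (rule someI[of _ u]) (use assms in auto)
  then have "equivclp (relator_insertion S m) ?v u" using word_eq assms by blast
  then show ?thesis unfolding rho_def by (rule act_equiv)
qed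

lemma rho_one [simp]: "rho \<one> x = x" using rho_word[of "[]"] by simp

lemma rho_gen [simp]: "s \<in> S \<Longrightarrow> rho s = sigma s" using rho_word[of "[s]"] by auto

lemma rho_mult [simp]:
  assumes "v \<in> carrier W" "w \<in> carrier W" shows "rho (v \<otimes> w) x = rho v (rho w x)"
proof -
  obtain a b where ab: "a \<in> lists S" "word_prod W a = v" "b \<in> lists S" "word_prod W b = w"
    using word_exists assms by meson
  then have "v \<otimes> w = word_prod W (a @ b)" using words_carrier by (simp add: word_prod_append)
  then show ?thesis using ab rho_word[of a] rho_word[of b] rho_word[of "a @ b"] by auto
qed

lemma rho_induct [consumes 1]:
  assumes "w \<in> carrier W" "P (\<lambda>x. x)" "\<And>s f. s \<in> S \<Longrightarrow> P f \<Longrightarrow> P (\<lambda>x. sigma s (f x))"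
  shows "P (rho w)"
proof -
  obtain u where u: "u \<in> lists S" "word_prod W u = w" using word_exists assms(1) by blast
  have "P (act v)" if "v \<in> lists S" for v using that
  proof (induction v)
    case Nil
    have "act [] = (\<lambda>x. x)" by auto
    then show ?case using assms(2) by simp
  next
    case (Cons s v)
    then have "P (\<lambda>x. sigma s (act v x))" using assms(3) by simp
    moreover have "act (s # v) = (\<lambda>x. sigma s (act v x))" by auto
    ultimately show ?case by simp
  qed
  then show ?thesis using u rho_word by metis
qed

lemma rho_linear:
  assumes "w \<in> carrier W"
  shows "rho w (x + y) = rho w x + rho w y" "rho w (c *\<^sub>R x) = c *\<^sub>R rho w x"
    "rho w (- x) = - rho w x" "rho w (x - y) = rho w x - rho w y" "rho w 0 = 0"
proof -
  show a: "rho w (x + y) = rho w x + rho w y" for x y using assms by (induction rule: rho_induct) (simp_all only: sigma_linear)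
  show s: "rho w (c *\<^sub>R x) = c *\<^sub>R rho w x" for c x using assms by (induction rule: rho_induct) (simp_all only: sigma_linear)
  show n: "rho w (- x) = - rho w x" for x using s[of "-1" x] by simp
  show "rho w (x - y) = rho w x - rho w y" using a[of x "-y"] n[of y] by simp
  show "rho w 0 = 0" using s[of 0 0] by simp
qed

lemma B_rho: "w \<in> carrier W \<Longrightarrow> B (rho w x) (rho w y) = B x y"
  by (induction rule: rho_induct) (auto simp: B_sigma)

lemma rho_outside: "w \<in> carrier W \<Longrightarrow> t \<notin> S \<Longrightarrow> rho w x t = x t"
proof (induction rule: rho_induct)
  case (2 s f)
  then have "t \<noteq> s" by auto
  then show ?case using 2 by (simp add: sigma_other)
qed simp

lemma rho_inv [simp]:
  assumes "w \<in> carrier W" shows "rho (inv w) (rho w x) = x" "rho w (rho (inv w) x) = x"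
  using assms rho_mult[of "inv w" w x] rho_mult[of w "inv w" x] by auto

section \<open>Positivity of roots\<close>

text \<open>The last of the \<open>n\<close> letters is \<open>t\<close>; the first one depends on
  the parity of \<open>n\<close>.\<close>

primrec alternating :: "nat \<Rightarrow> 'a \<Rightarrow> 'a \<Rightarrow> 'a" where
  "alternating 0 s t = \<one>"
| "alternating (Suc n) s t = alternating n t s \<otimes> t"

lemma alternating_closed [simp]: "s \<in> S \<Longrightarrow> t \<in> S \<Longrightarrow> alternating n s t \<in> carrier W"
  by (induction n arbitrary: s t) auto

lemma alternating_add:
  "s \<in> S \<Longrightarrow> t \<in> S \<Longrightarrow>
   alternating (a + b) s t = (if even b then alternating a s t else alternating a t s) \<otimes> alternating b s t"
  by (induction b arbitrary: s t) (auto simp: m_assoc[symmetric])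

lemma alternating_left:
  "s \<in> S \<Longrightarrow> t \<in> S \<Longrightarrow> alternating (Suc n) s t = (if even n then t else s) \<otimes> alternating n s t"
  using alternating_add[of s t 1 n] by auto

lemma pow_swap:
  assumes "s \<in> S" "t \<in> S" shows "(t \<otimes> s) [^] (n::nat) \<otimes> t = t \<otimes> (s \<otimes> t) [^] n"
proof (induction n)
  case (Suc n)
  have "(t \<otimes> s) [^] Suc n \<otimes> t = ((t \<otimes> s) [^] n \<otimes> t) \<otimes> (s \<otimes> t)" using assms by (simp add: m_assoc)
  then show ?case using Suc assms by (simp add: m_assoc)
qed (use assms in simp)

lemma alternating_swap:
  "s \<in> S \<Longrightarrow> t \<in> S \<Longrightarrow> alternating n s t = alternating n t s \<otimes> (s \<otimes> t) [^] n"
proof (induction n arbitrary: s t)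
  case (Suc n)
  have "alternating (Suc n) s t = alternating n s t \<otimes> ((t \<otimes> s) [^] n \<otimes> t)"
    using Suc.IH[of t s] Suc.prems by (simp add: m_assoc)
  also have "\<dots> = alternating n s t \<otimes> (s \<otimes> s) \<otimes> (t \<otimes> (s \<otimes> t) [^] n)"
    using Suc.prems by (simp add: pow_swap)
  also have "\<dots> = alternating (Suc n) t s \<otimes> ((s \<otimes> t) \<otimes> (s \<otimes> t) [^] n)"
    using Suc.prems by (simp only: m_assoc alternating.simps m_closed S_carrier alternating_closed nat_pow_closed)
  also have "(s \<otimes> t) \<otimes> (s \<otimes> t) [^] n = (s \<otimes> t) [^] Suc n"
    using Suc.prems by (intro nat_pow_Suc2[symmetric]) auto
  finally show ?case .
qed simp

lemma len_mult_alternating: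
  "v \<in> carrier W \<Longrightarrow> s \<in> S \<Longrightarrow> t \<in> S \<Longrightarrow> len (v \<otimes> alternating n s t) \<le> len v + n"
proof (induction n arbitrary: s t)
  case (Suc n)
  have "len (v \<otimes> alternating (Suc n) s t) = len ((v \<otimes> alternating n t s) \<otimes> t)" using Suc.prems by (simp add: m_assoc)
  also have "\<dots> \<le> Suc (len (v \<otimes> alternating n t s))" using Suc.prems by (intro len_mult_gen) auto
  finally show ?case using Suc.IH[of t s] Suc.prems by simp
qed simp

lemma rho_alternating_wave:
  "s \<in> S \<Longrightarrow> t \<in> S \<Longrightarrow> rho (alternating n s t) (wave s t \<phi>) =
     (if even n then wave s t (\<phi> + n * (pi / k s t)) else wave t s (\<phi> + n * (pi / k s t)))"
proof (induction n arbitrary: s t \<phi>)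
  case (Suc n)
  have "rho (alternating (Suc n) s t) (wave s t \<phi>) = rho (alternating n t s) (wave t s (\<phi> + pi / k s t))"
    using Suc.prems by (simp add: sigma_wave)
  then show ?case using Suc.IH[of t s "\<phi> + pi / k s t"] Suc.prems k_sym[of t s] by (auto simp: algebra_simps add_divide_distrib)
qed simp

text \<open>The two coefficients are \<open>sin ((n + 1) * y) / sin y\<close> and
  \<open>sin (n * y) / sin y\<close> with \<open>y = pi / k s t\<close>, in an order depending on
  parity; they are nonnegative as long as \<open>(n + 1) * y\<close> does not exceed
  \<open>pi\<close>.\<close>

lemma rho_alternating_alpha:
  assumes st: "s \<in> S" "t \<in> S" "s \<noteq> t" and n: "Suc n \<le> k s t"
  shows "\<exists>a b. 0 \<le> a \<and> 0 \<le> b \<and> rho (alternating n s t) (alpha s) = a *\<^sub>R alpha s + b *\<^sub>R alpha t"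
proof -
  let ?y = "pi / k s t"
  have sp: "0 < sin ?y" by (rule sin_angle_pos[OF st])
  have nn: "0 \<le> sin (j * ?y)" if "j \<le> k s t" for j :: nat
  proof (rule sin_ge_zero)
    have "real j \<le> real (k s t)" "0 < real (k s t)" using that n by auto
    then have "real j * pi \<le> pi * real (k s t)" using mult_right_mono[of "real j" "real (k s t)" pi] by (simp add: mult.commute)
    then show "j * ?y \<le> pi" using \<open>0 < real (k s t)\<close> by (simp add: divide_simps)
  qed simp
  have al: "alpha s = (1 / sin ?y) *\<^sub>R wave s t 0" using sp by (simp add: wave_def)
  have "rho (alternating n s t) (alpha s) = (1 / sin ?y) *\<^sub>R rho (alternating n s t) (wave s t 0)"
    by (subst al) (simp only: rho_linear alternating_closed st)
  also have "rho (alternating n s t) (wave s t 0) =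
     (if even n then wave s t (n * ?y) else wave t s (n * ?y))" using rho_alternating_wave[OF st(1,2), of n 0] by simp
  finally have r: "rho (alternating n s t) (alpha s) =
     (1 / sin ?y) *\<^sub>R (if even n then wave s t (n * ?y) else wave t s (n * ?y))" .
  define p q where "p = sin (Suc n * ?y) / sin ?y" and "q = sin (n * ?y) / sin ?y"
  have pq: "0 \<le> p" "0 \<le> q" using nn[of "Suc n"] nn[of n] n sp by (auto simp: p_def q_def)
  have "Suc n * ?y = n * ?y + ?y" by (simp add: algebra_simps add_divide_distrib)
  then have "rho (alternating n s t) (alpha s) = (if even n then p *\<^sub>R alpha s + q *\<^sub>R alpha t else q *\<^sub>R alpha s + p *\<^sub>R alpha t)"
    unfolding r wave_def p_def q_def k_sym[OF st(2,1)] by (simp add: scaleR_add_right add.commute)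
  then show ?thesis using pq by (cases "even n") auto
qed

lemma k_alternating:
  assumes "s \<in> S" "t \<in> S" "m s t = enat n" shows "alternating n s t = alternating n t s"
  using alternating_swap[OF assms(1,2), of n] relator_one[OF assms] assms by simp

text \<open>Choose \<open>t\<close> shortening \<open>w\<close> and split off from \<open>w\<close>
  the longest alternating factor in \<open>s\<close> and \<open>t\<close> ending in
  \<open>t\<close>. Then neither \<open>s\<close> nor \<open>t\<close> shortens the remaining
  \<open>v\<close>, so the induction hypothesis applies to \<open>v\<close> at both simple roots,
  and the factor sends \<open>alpha s\<close> to a nonnegative combination of them.\<close>

lemma tits:
  assumes "w \<in> carrier W" "s \<in> S" "len w \<le> len (w \<otimes> s)" shows "0 \<le> rho w (alpha s) u"
  using assms
proof (induction "len w" arbitrary: w s u rule: less_induct)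
  case less
  show ?case
  proof (cases "w = \<one>")
    case True then show ?thesis by (simp add: alpha_apply)
  next
    case False
    then obtain t where t: "t \<in> S" "len (w \<otimes> t) < len w" using len_descent less.prems by blast
    then have "t \<noteq> s" using less.prems by auto
    define J where "J = {j. \<exists>v\<in>carrier W. w = v \<otimes> alternating j s t \<and> len v + j \<le> len w}"
    have "1 \<in> J" unfolding J_def using t less.prems by (auto intro!: bexI[of _ "w \<otimes> t"])
    have finJ: "finite J" by (rule finite_subset[of _ "{..len w}"]) (auto simp: J_def)
    define j where "j = Max J"
    have "j \<in> J" "1 \<le> j" "Suc j \<notin> J"
      using Max_in[OF finJ] Max_ge[OF finJ, of 1] Max_ge[OF finJ, of "Suc (Max J)"] \<open>1 \<in> J\<close>
      by (auto simp: j_def)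
    then obtain v where v: "v \<in> carrier W" "w = v \<otimes> alternating j s t" "len v + j \<le> len w" by (auto simp: J_def)
    obtain i where i: "j = Suc i" using \<open>1 \<le> j\<close> by (cases j) auto
    define p q where "p = (if even i then t else s)" and "q = (if even i then s else t)"
    have pq: "p \<in> S" "q \<in> S" using t less.prems by (auto simp: p_def q_def)
    have st: "s \<in> S" "t \<in> S" "s \<noteq> t" using t less.prems \<open>t \<noteq> s\<close> by auto
    have "len v \<le> len (v \<otimes> q)"
    proof (rule ccontr)
      assume c: "\<not> len v \<le> len (v \<otimes> q)"
      have "alternating (Suc j) s t = q \<otimes> alternating j s t"
        using alternating_left[OF st(1,2), of j] by (simp add: q_def i)
      then have "w = (v \<otimes> q) \<otimes> alternating (Suc j) s t" using v pq st by (simp add: m_assoc)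
      then have "Suc j \<in> J" unfolding J_def using c v pq by (auto intro!: bexI[of _ "v \<otimes> q"] simp del: alternating.simps)
      then show False using \<open>Suc j \<notin> J\<close> by simp
    qed
    moreover have "len v \<le> len (v \<otimes> p)"
    proof (rule ccontr)
      assume c: "\<not> len v \<le> len (v \<otimes> p)"
      have "alternating j s t = p \<otimes> alternating i s t"
        using alternating_left[OF st(1,2), of i] by (simp add: p_def i)
      then have "w = (v \<otimes> p) \<otimes> alternating i s t" using v pq st by (simp add: m_assoc)
      then have "len w \<le> len (v \<otimes> p) + i" using len_mult_alternating[of "v \<otimes> p" s t i] v pq st by simp
      then show False using c v i by simp
    qed
    ultimately have nn: "0 \<le> rho v (alpha s) u" "0 \<le> rho v (alpha t) u"
      using less.hyps[of v p u] less.hyps[of v q u] v i pq by (auto simp: p_def q_def split: if_splits)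
    \<comment> \<open>Otherwise a braid relation rewrites the end of the factor so that it ends in
      \<open>s\<close>, and \<open>w \<otimes> s\<close> becomes shorter than \<open>w\<close>. For
      an infinite label \<open>k s t\<close> exceeds every length.\<close>
    have "Suc j \<le> k s t"
    proof (rule ccontr)
      assume c: "\<not> Suc j \<le> k s t"
      show False
      proof (cases "m s t")
        case infinity
        have "len w \<le> Max (len ` carrier W)" using finW less.prems by (intro Max_ge) auto
        then show False using c v infinity by (simp add: k_def)
      next
        case (enat n)
        then have "n \<le> j" "0 < n" using c k_ge[OF st] by (auto simp: k_enat)
        then obtain l where l: "n = Suc l" by (cases n) auto
        define x where "x = (if even n then alternating (j - n) s t else alternating (j - n) t s)"
        have x: "x \<in> carrier W" using st by (simp add: x_def)
        have "alternating j s t = x \<otimes> alternating n s t"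
          using alternating_add[OF st(1,2), of "j - n" n] \<open>n \<le> j\<close> by (auto simp: x_def)
        also have "alternating n s t = alternating l s t \<otimes> s"
          using k_alternating[OF st(1,2) enat] by (simp add: l)
        finally have "w \<otimes> s = (v \<otimes> x) \<otimes> alternating l s t" using v x st by (simp add: m_assoc)
        then have "len (w \<otimes> s) \<le> len (v \<otimes> x) + l" using len_mult_alternating[of "v \<otimes> x" s t l] v x st by simp
        also have "len (v \<otimes> x) \<le> len v + (j - n)" unfolding x_def using len_mult_alternating v(1) st by auto
        finally show False using less.prems(3) v(3) l \<open>n \<le> j\<close> by simp
      qed
    qed
    then obtain a b where ab: "0 \<le> a" "0 \<le> b" "rho (alternating j s t) (alpha s) = a *\<^sub>R alpha s + b *\<^sub>R alpha t"
      using rho_alternating_alpha[OF st] by blast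
    have "rho w (alpha s) = rho v (rho (alternating j s t) (alpha s))" using v st by simp
    also have "\<dots> = a *\<^sub>R rho v (alpha s) + b *\<^sub>R rho v (alpha t)" unfolding ab(3) by (simp only: rho_linear v(1))
    finally show ?thesis using ab nn by simp
  qed
qed

end


context coxeter_group begin

section \<open>Roots and positive roots\<close>

definition roots :: "('a \<Rightarrow> real) set" where
  "roots = {rho w (alpha s) | w s. w \<in> carrier W \<and> s \<in> S}"

definition pos_roots :: "('a \<Rightarrow> real) set" where
  "pos_roots = {x \<in> roots. \<forall>u. 0 \<le> x u}"

definition supp :: "('a \<Rightarrow> real) \<Rightarrow> bool" where "supp x \<longleftrightarrow> (\<forall>t. t \<notin> S \<longrightarrow> x t = 0)"

lemma rootsI: "w \<in> carrier W \<Longrightarrow> s \<in> S \<Longrightarrow> rho w (alpha s) \<in> roots" by (auto simp: roots_def)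

lemma rootsE:
  assumes "x \<in> roots" obtains w s where "w \<in> carrier W" "s \<in> S" "x = rho w (alpha s)"
  using assms by (auto simp: roots_def)

lemma finite_roots: "finite roots"
proof -
  have "roots = (\<lambda>(w, s). rho w (alpha s)) ` (carrier W \<times> S)" by (auto simp: roots_def)
  then show ?thesis using finW finS by simp
qed

lemma root_cases:
  assumes "x \<in> roots" shows "(\<forall>u. 0 \<le> x u) \<or> (\<forall>u. x u \<le> 0)"
proof -
  obtain w s where w: "w \<in> carrier W" "s \<in> S" "x = rho w (alpha s)" by (rule rootsE[OF assms])
  show ?thesis
  proof (cases "len w \<le> len (w \<otimes> s)")
    case True then show ?thesis using tits w by auto
  next
    case False
    then have "0 \<le> rho (w \<otimes> s) (alpha s) u" for u using w by (intro tits) (auto simp: S_invol_right)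
    moreover have "rho (w \<otimes> s) (alpha s) = - x" using w by (simp add: sigma_alpha rho_linear)
    ultimately show ?thesis by simp
  qed
qed

lemma root_rho: "x \<in> roots \<Longrightarrow> w \<in> carrier W \<Longrightarrow> rho w x \<in> roots"
  by (erule rootsE) (metis rho_mult rootsI m_closed)

lemma alpha_root: "s \<in> S \<Longrightarrow> alpha s \<in> roots" using rootsI[of \<one> s] by simp

lemma alpha_pos: "s \<in> S \<Longrightarrow> alpha s \<in> pos_roots" by (simp add: pos_roots_def alpha_root alpha_apply)

lemma root_sigma: "x \<in> roots \<Longrightarrow> s \<in> S \<Longrightarrow> sigma s x \<in> roots" using root_rho[of x s] by simp

lemma root_minus: "x \<in> roots \<Longrightarrow> - x \<in> roots"
proof (erule rootsE)
  fix w s assume w: "w \<in> carrier W" "s \<in> S" "x = rho w (alpha s)"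
  then have "rho (w \<otimes> s) (alpha s) = - x" by (simp add: sigma_alpha rho_linear)
  then show "- x \<in> roots" using rootsI[of "w \<otimes> s" s] w by simp
qed

lemma B_root: "x \<in> roots \<Longrightarrow> B x x = 2"
  by (erule rootsE) (simp add: B_rho)

lemma root_ne0: "x \<in> roots \<Longrightarrow> x \<noteq> 0" using B_root by fastforce

lemma supp_alpha: "s \<in> S \<Longrightarrow> supp (alpha s)" by (auto simp: supp_def alpha_apply)
lemma supp_rho: "w \<in> carrier W \<Longrightarrow> supp x \<Longrightarrow> supp (rho w x)" by (simp add: supp_def rho_outside)
lemma supp_root: "x \<in> roots \<Longrightarrow> supp x" by (erule rootsE) (simp add: supp_rho supp_alpha)

lemma supp_expand: assumes "supp x" shows "x = (\<Sum>s\<in>S. x s *\<^sub>R alpha s)"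
proof
  fix t
  have "(\<Sum>s\<in>S. x s *\<^sub>R alpha s) t = (\<Sum>s\<in>S. if t = s then x s else 0)"
    by (simp add: alpha_apply) (rule sum.cong, auto)
  also have "\<dots> = x t" using assms finS by (auto simp: supp_def)
  finally show "x t = (\<Sum>s\<in>S. x s *\<^sub>R alpha s) t" ..
qed

lemma supp_span: "supp x \<longleftrightarrow> x \<in> span (alpha ` S)"
proof
  assume "supp x"
  then have "x = (\<Sum>s\<in>S. x s *\<^sub>R alpha s)" by (rule supp_expand)
  moreover have "(\<Sum>s\<in>S. x s *\<^sub>R alpha s) \<in> span (alpha ` S)" by (intro span_sum span_scale span_base) auto
  ultimately show "x \<in> span (alpha ` S)" by simp
next
  assume "x \<in> span (alpha ` S)"
  then show "supp x"
    by (rule span_induct) (auto simp: subspace_def supp_alpha, auto simp: supp_def)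
qed

text \<open>A nontrivial element is shortened by some \<open>t\<close>; then \<open>tits\<close>
  makes the image of \<open>alpha t\<close> under \<open>w \<otimes> t\<close> nonnegative, whereas
  that image is \<open>- alpha t\<close>.\<close>

lemma faithful:
  assumes "w \<in> carrier W" "\<And>s. s \<in> S \<Longrightarrow> rho w (alpha s) = alpha s" shows "w = \<one>"
proof (rule ccontr)
  assume "w \<noteq> \<one>"
  then obtain t where t: "t \<in> S" "len (w \<otimes> t) < len w" using len_descent assms by blast
  then have "0 \<le> rho (w \<otimes> t) (alpha t) t" using assms by (intro tits) auto
  moreover have "rho (w \<otimes> t) (alpha t) = - alpha t" using assms t by (simp add: sigma_alpha rho_linear)
  ultimately show False by (simp add: alpha_apply)
qed

text \<open>\<open>sigma s\<close> changes only the coordinate at \<open>s\<close>. If the image is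
  not positive it is negative, so all other coordinates of \<open>x\<close> vanish, and the norm of
  roots leaves only \<open>alpha s\<close>.\<close>

lemma sigma_pos:
  assumes "x \<in> pos_roots" "s \<in> S" "x \<noteq> alpha s" shows "sigma s x \<in> pos_roots"
proof (rule ccontr)
  assume c: "sigma s x \<notin> pos_roots"
  have x: "x \<in> roots" "\<And>u. 0 \<le> x u" using assms by (auto simp: pos_roots_def)
  have "sigma s x u \<le> 0" for u using c root_sigma[OF x(1) assms(2)] root_cases by (auto simp: pos_roots_def)
  then have "x u = 0" if "u \<noteq> s" for u using sigma_other[OF that] x(2)[of u] by (metis order_antisym)
  then have xs: "x = x s *\<^sub>R alpha s" by (auto simp: fun_eq_iff alpha_apply)
  have "B x x = x s * x s * 2" by (subst (1 2) xs) (simp add: assms(2))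
  then have "(x s)\<^sup>2 = 1" using B_root[OF x(1)] by (simp add: power2_eq_square)
  then have "x s = 1" using x(2)[of s] by (metis abs_of_nonneg power2_eq_1_iff abs_minus abs_one)
  then show False using xs assms(3) by simp
qed

end

locale irreducible_coxeter_group = coxeter_group +
  assumes irr: "coxeter_irreducible S m"
begin

lemma B_edge: "s \<in> S \<Longrightarrow> t \<in> S \<Longrightarrow> 3 \<le> m s t \<Longrightarrow> B (alpha s) (alpha t) \<noteq> 0"
proof -
  assume st: "s \<in> S" "t \<in> S" "3 \<le> m s t"
  have "3 \<le> real (k s t)" using st(3) by (cases "m s t") (auto simp: k_def numeral_eq_enat)
  then have "0 \<le> pi / k s t" "pi / k s t \<le> pi / 3" using divide_left_mono[of 3 "real (k s t)" pi] by auto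
  then have "0 < cos (pi / k s t)" using pi_gt_zero by (intro cos_gt_zero_pi) linarith+
  then show ?thesis using st by (simp add: B_alpha)
qed

text \<open>An averaged inner product is a multiple of \<open>B\<close>, the scalar being constant along the Coxeter graph.\<close>

lemma B_pos_def:
  assumes "supp x" "x \<noteq> 0" shows "0 < B x x"
proof -
  define ip where "ip x y = (\<Sum>w\<in>carrier W. \<Sum>s\<in>S. rho w x s * rho w y s)" for x y
  have ip_rho: "ip (rho v x) (rho v y) = ip x y" if v: "v \<in> carrier W" for v x y
  proof -
    have "bij_betw (\<lambda>w. w \<otimes> v) (carrier W) (carrier W)"
      by (rule bij_betw_byWitness[where f' = "\<lambda>w. w \<otimes> inv v"]) (use v in \<open>auto simp: m_assoc\<close>)
    then have "ip x y = (\<Sum>w\<in>carrier W. \<Sum>s\<in>S. rho (w \<otimes> v) x s * rho (w \<otimes> v) y s)"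
      unfolding ip_def by (rule sum.reindex_bij_betw[symmetric])
    also have "\<dots> = ip (rho v x) (rho v y)" unfolding ip_def by (intro sum.cong) (auto simp: v)
    finally show ?thesis ..
  qed
  have ip_left: "ip (x - c *\<^sub>R a) y = ip x y - c * ip a y" for x c a y
    by (simp add: ip_def rho_linear algebra_simps sum_subtractf sum_distrib_left)
  have ip_right: "ip x (- y) = - ip x y" for x y
    by (simp add: ip_def rho_linear sum_negf)
  have ip_sym: "ip x y = ip y x" for x y by (simp add: ip_def mult.commute)
  have ip_pos: "0 < ip x x" if x: "supp x" "x \<noteq> 0" for x
  proof -
    obtain t where "x t \<noteq> 0" using x(2) by (auto simp: fun_eq_iff)
    then obtain s where s: "s \<in> S" "x s \<noteq> 0" using x(1) by (auto simp: supp_def)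
    have "0 < x s * x s" using s by (meson not_real_square_gt_zero)
    also have "\<dots> \<le> (\<Sum>s\<in>S. x s * x s)" using s finS by (intro member_le_sum) auto
    also have "\<dots> = (\<Sum>s\<in>S. rho \<one> x s * rho \<one> x s)" by simp
    also have "\<dots> \<le> ip x x" unfolding ip_def using finW
      by (intro member_le_sum[of \<one> "carrier W" "\<lambda>w. \<Sum>s\<in>S. rho w x s * rho w x s"]) (auto intro: sum_nonneg)
    finally show ?thesis .
  qed
  define q where "q s = ip (alpha s) (alpha s) / 2" for s
  have ip_alpha: "ip x (alpha s) = q s * B x (alpha s)" if "s \<in> S" for x s
  proof -
    have "ip (sigma s x) (- alpha s) = ip x (alpha s)"
      using ip_rho[of s x "alpha s"] that by (simp add: sigma_alpha)
    then have "- ip x (alpha s) + B x (alpha s) * ip (alpha s) (alpha s) = ip x (alpha s)"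
      unfolding ip_right sigma_def ip_left by simp
    then show ?thesis by (simp add: q_def mult.commute)
  qed
  have edge: "q s = q t" if "s \<in> S" "t \<in> S" "3 \<le> m s t" for s t
    using ip_alpha[of t "alpha s"] ip_alpha[of s "alpha t"] ip_sym[of "alpha s" "alpha t"]
      B_sym[of "alpha s" "alpha t"] B_edge[OF that] that by auto
  obtain s0 where s0: "s0 \<in> S" using irr by (auto simp: coxeter_irreducible_def)
  have q: "q t = q s0" if "t \<in> S" for t
  proof -
    have "(\<lambda>x y. x \<in> S \<and> y \<in> S \<and> 3 \<le> m x y)\<^sup>*\<^sup>* s0 t" using irr s0 that by (auto simp: coxeter_irreducible_def)
    then show ?thesis by (induction rule: rtranclp_induct) (auto simp: edge)
  qed
  have "alpha s0 \<noteq> 0" using alpha_root root_ne0 s0 by blast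
  then have q0: "0 < q s0" using ip_pos[of "alpha s0"] supp_alpha[OF s0] by (simp add: q_def)
  have "q s0 * B x (\<Sum>s\<in>S. x s *\<^sub>R alpha s) = ip x (\<Sum>s\<in>S. x s *\<^sub>R alpha s)"
  proof -
    have r: "ip x (y + z) = ip x y + ip x z" "ip x (c *\<^sub>R y) = c * ip x y" "ip x 0 = 0" for x y z c
      by (simp_all add: ip_def rho_linear algebra_simps sum.distrib sum_distrib_left)
    have "q s0 * B x (\<Sum>s\<in>T. x s *\<^sub>R alpha s) = ip x (\<Sum>s\<in>T. x s *\<^sub>R alpha s)" if "T \<subseteq> S" for T
      using finite_subset[OF that finS] that
    proof (induction T rule: finite_induct)
      case (insert s T)
      then have "s \<in> S" by simp
      have "q s0 * B x (\<Sum>s\<in>insert s T. x s *\<^sub>R alpha s) = q s0 * (x s * B x (alpha s)) + q s0 * B x (\<Sum>s\<in>T. x s *\<^sub>R alpha s)"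
        by (simp only: sum.insert[OF insert.hyps] B_linear distrib_left)
      also have "\<dots> = x s * ip x (alpha s) + ip x (\<Sum>s\<in>T. x s *\<^sub>R alpha s)"
        using insert ip_alpha[OF \<open>s \<in> S\<close>, of x] q[OF \<open>s \<in> S\<close>] by (simp only: insert_subset mult.left_commute)
      also have "\<dots> = ip x (\<Sum>s\<in>insert s T. x s *\<^sub>R alpha s)" by (simp only: sum.insert[OF insert.hyps] r)
      finally show ?case .
    qed (simp add: r)
    then show ?thesis by simp
  qed
  then have "q s0 * B x x = ip x x" using supp_expand[OF assms(1)] by simp
  then show ?thesis using ip_pos[OF assms] q0 by (metis zero_less_mult_pos)
qed

end


section \<open>The Euler form of a Coxeter word\<close>

context coxeter_group begin

text \<open>A triangular half of the Tits form: on simple roots the value at \<open>(i, t)\<close>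
  is \<open>B (alpha i) (alpha t)\<close> if \<open>t\<close> precedes \<open>i\<close> in the word,
  one if \<open>i = t\<close>, and zero otherwise.\<close>

primrec euler :: "'a list \<Rightarrow> ('a \<Rightarrow> real) \<Rightarrow> ('a \<Rightarrow> real) \<Rightarrow> real" where
  "euler [] x y = 0"
| "euler (t # ts) x y = x t * y t + (\<Sum>i\<in>set ts. B (alpha i) (alpha t) * x i) * y t + euler ts x y"

lemma euler_linear:
  "euler w (x + y) z = euler w x z + euler w y z" "euler w (c *\<^sub>R x) z = c * euler w x z"
  "euler w z (x + y) = euler w z x + euler w z y" "euler w z (c *\<^sub>R x) = c * euler w z x"
  "euler w (- x) z = - euler w x z" "euler w z (- x) = - euler w z x"
  by (induction w) (simp_all add: algebra_simps sum.distrib sum_distrib_left sum_negf)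

lemma euler_cong:
  "(\<And>t. t \<in> set w \<Longrightarrow> x t = x' t \<and> y t = y' t) \<Longrightarrow> euler w x y = euler w x' y'"
  by (induction w) auto

lemma euler_snoc:
  "distinct (t # w) \<Longrightarrow> euler (w @ [t]) x y =
     x t * y t + x t * (\<Sum>i\<in>set w. B (alpha t) (alpha i) * y i) + euler w x y"
proof (induction w)
  case (Cons a w)
  then show ?case by (simp add: algebra_simps)
qed simp

lemma euler_separated:
  "(\<And>t. t \<in> set q \<Longrightarrow> x t = 0) \<Longrightarrow> (\<And>t. t \<in> set p \<Longrightarrow> y t = 0) \<Longrightarrow> euler (p @ q) x y = 0"
proof (induction p)
  case Nil
  then show ?case by (induction q) auto
qed simp

lemma euler_commute:
  "distinct (p @ t # q) \<Longrightarrow> (\<And>i. i \<in> set p \<Longrightarrow> B (alpha i) (alpha t) = 0) \<Longrightarrow>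
   euler (p @ t # q) x y = euler (t # p @ q) x y"
proof (induction p)
  case (Cons i p)
  have "B (alpha t) (alpha i) = 0" using Cons.prems(2)[of i] B_sym[of "alpha t" "alpha i"] by simp
  then show ?case using Cons by simp
qed simp

lemma euler_sym:
  "distinct w \<Longrightarrow> set w \<subseteq> S \<Longrightarrow>
   euler w x y + euler w y x = (\<Sum>i\<in>set w. \<Sum>j\<in>set w. B (alpha i) (alpha j) * x i * y j)"
proof (induction w)
  case (Cons t w)
  have "(\<Sum>i\<in>set (t # w). \<Sum>j\<in>set (t # w). B (alpha i) (alpha j) * x i * y j) =
    B (alpha t) (alpha t) * x t * y t + (\<Sum>j\<in>set w. B (alpha t) (alpha j) * x t * y j) +
    (\<Sum>i\<in>set w. B (alpha i) (alpha t) * x i * y t) + (\<Sum>i\<in>set w. \<Sum>j\<in>set w. B (alpha i) (alpha j) * x i * y j)"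
    using Cons.prems by (simp add: sum.distrib)
  also have "(\<Sum>j\<in>set w. B (alpha t) (alpha j) * x t * y j) = (\<Sum>j\<in>set w. B (alpha j) (alpha t) * y j) * x t"
    unfolding sum_distrib_right by (intro sum.cong refl) (simp add: B_sym mult_ac)
  also have "(\<Sum>i\<in>set w. B (alpha i) (alpha t) * x i * y t) = (\<Sum>i\<in>set w. B (alpha i) (alpha t) * x i) * y t"
    by (simp add: sum_distrib_right)
  finally show ?case using Cons by (simp add: algebra_simps)
qed simp

lemma B_expand: "B x y = (\<Sum>i\<in>S. \<Sum>j\<in>S. B (alpha i) (alpha j) * x i * y j)"
  unfolding B_def[of x y] by (intro sum.cong refl) (simp only: B_alpha)

lemma euler_B: "distinct w \<Longrightarrow> set w = S \<Longrightarrow> euler w x y + euler w y x = B x y"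
  using euler_sym[of w x y] by (simp add: B_expand[of x y, symmetric])

text \<open>The analogue of a reflection functor. The reflection changes only coordinate
  \<open>t\<close>, to \<open>- x t - a x\<close>, and this moves the cross terms of
  \<open>t\<close> from the second argument to the first.\<close>

lemma euler_rotate:
  assumes w: "distinct (t # w)" "set (t # w) = S"
  shows "euler (t # w) (sigma t x) (sigma t y) = euler (w @ [t]) x y"
proof -
  have t: "t \<in> S" using w by auto
  define a where "a x = (\<Sum>i\<in>set w. B (alpha i) (alpha t) * x i)" for x :: "'a \<Rightarrow> real"
  have Bx: "B x (alpha t) = 2 * x t + a x" for x
  proof -
    have "B x (alpha t) = (\<Sum>i\<in>S. B (alpha i) (alpha t) * x i)"
      unfolding B_alpha_right[OF t, of x] using t by (intro sum.cong refl) (simp only: B_alpha)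
    also have "\<dots> = (\<Sum>i\<in>insert t (set w). B (alpha i) (alpha t) * x i)" using w(2) by simp
    also have "\<dots> = 2 * x t + a x" using w(1) t by (simp add: a_def)
    finally show ?thesis .
  qed
  have st: "sigma t x t = - x t - a x" for x by (simp add: sigma_def Bx alpha_apply)
  have o: "sigma t x i = x i" if "i \<in> set w" for x i
  proof -
    have "i \<noteq> t" using that w by auto
    then show ?thesis by (rule sigma_other)
  qed
  have as: "a (sigma t x) = a x" for x unfolding a_def by (rule sum.cong) (auto simp: o)
  have ew: "euler w (sigma t x) (sigma t y) = euler w x y" by (rule euler_cong) (simp add: o)
  have "euler (t # w) (sigma t x) (sigma t y) =
    sigma t x t * sigma t y t + a (sigma t x) * sigma t y t + euler w x y"
    by (simp add: a_def ew)
  also have "\<dots> = x t * y t + x t * a y + euler w x y" unfolding as st by (simp add: algebra_simps)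
  also have "a y = (\<Sum>i\<in>set w. B (alpha t) (alpha i) * y i)"
    unfolding a_def by (intro sum.cong refl) (simp add: B_sym)
  finally show ?thesis using w by (simp add: euler_snoc)
qed

lemma euler_head_alpha:
  assumes "t \<notin> set w" shows "euler (t # w) (alpha t) y = y t"
proof -
  have "alpha t i = 0" if "i \<in> set w" for i using assms that by (auto simp: alpha_apply)
  then have "euler w (alpha t) y = 0" "(\<Sum>i\<in>set w. B (alpha i) (alpha t) * alpha t i) = 0"
    using euler_separated[of w "alpha t" "[]" y] by auto
  then show ?thesis by (simp add: alpha_apply)
qed

lemma euler_last_alpha:
  assumes "distinct (t # w)" shows "euler (w @ [t]) x (alpha t) = x t"
proof -
  have z: "alpha t i = 0" if "i \<in> set w" for i using assms that by (auto simp: alpha_apply)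
  have "euler w x (alpha t) = 0"
    using euler_separated[of "[]" x w "alpha t"] z by auto
  moreover have "(\<Sum>i\<in>set w. B (alpha t) (alpha i) * alpha t i) = 0" using z by simp
  ultimately show ?thesis using assms by (simp add: euler_snoc alpha_apply)
qed

end

locale coxeter_word = irreducible_coxeter_group +
  fixes ss :: "'a list"
  assumes ss: "distinct ss" "set ss = S"
begin

abbreviation E :: "('a \<Rightarrow> real) \<Rightarrow> ('a \<Rightarrow> real) \<Rightarrow> real" where "E \<equiv> euler ss"

lemma E_B: "E x y + E y x = B x y" using euler_B ss by simp

text \<open>The invariant of the reading process: in coordinates moved by \<open>u\<close> the fixed
  form \<open>E\<close> is the Euler form of the current word \<open>w\<close>.\<close>

definition frame :: "'a \<Rightarrow> 'a list \<Rightarrow> bool" where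
  "frame u w \<longleftrightarrow> u \<in> carrier W \<and> distinct w \<and> set w = S \<and> (\<forall>x y. E (rho u x) (rho u y) = euler w x y)"

text \<open>In the reading process these are the positive roots not yet read; by
  \<open>ahead_step\<close> every step removes exactly one of them.\<close>

definition ahead :: "'a \<Rightarrow> ('a \<Rightarrow> real) set" where
  "ahead u = {x \<in> pos_roots. rho (inv u) x \<in> pos_roots}"

lemma frame_one: "frame \<one> ss" by (simp add: frame_def ss)

lemma ahead_one: "ahead \<one> = pos_roots" by (auto simp: ahead_def)

lemma frame_step:
  assumes f: "frame u (t # w)" shows "frame (u \<otimes> t) (w @ [t])"
proof -
  have u: "u \<in> carrier W" "t \<in> S" "distinct (t # w)" "set (t # w) = S"
    "\<And>x y. E (rho u x) (rho u y) = euler (t # w) x y" using f by (auto simp: frame_def)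
  then show ?thesis using euler_rotate[OF u(3,4)] by (auto simp: frame_def simp del: euler.simps)
qed

lemma nonpos_combination:
  assumes "supp y" "\<And>s. 0 \<le> y s" "u \<in> carrier W" "\<And>s i. s \<in> S \<Longrightarrow> rho u (alpha s) i \<le> 0"
  shows "rho u y i \<le> 0"
proof -
  have "rho u (\<Sum>s\<in>T. y s *\<^sub>R alpha s) i \<le> 0" if "finite T" "T \<subseteq> S" for T
    using that
  proof (induction T rule: finite_induct)
    case (insert s T)
    have "rho u (\<Sum>s\<in>insert s T. y s *\<^sub>R alpha s) i = y s * rho u (alpha s) i + rho u (\<Sum>s\<in>T. y s *\<^sub>R alpha s) i"
      by (simp only: sum.insert[OF insert.hyps] rho_linear[OF assms(3)] plus_fun_apply scaleR_apply real_scaleR_def)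
    moreover have "y s * rho u (alpha s) i \<le> 0" using assms(2,4) insert.prems by (simp add: mult_nonneg_nonpos)
    moreover have "rho u (\<Sum>s\<in>T. y s *\<^sub>R alpha s) i \<le> 0" by (rule insert.IH) (use insert.prems in auto)
    ultimately show ?case by linarith
  qed (simp add: rho_linear[OF assms(3)])
  then show ?thesis using supp_expand[OF assms(1)] finS by (metis order_refl)
qed

lemma ahead_step:
  assumes u: "u \<in> carrier W" "t \<in> S" "rho u (alpha t) \<in> pos_roots"
  shows "ahead (u \<otimes> t) = ahead u - {rho u (alpha t)}" "rho u (alpha t) \<in> ahead u"
proof -
  show "rho u (alpha t) \<in> ahead u" using u by (simp add: ahead_def alpha_pos)
  have inv: "rho (inv (u \<otimes> t)) x = sigma t (rho (inv u) x)" for x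
    using u by (simp add: inv_mult_group S_inv)
  show "ahead (u \<otimes> t) = ahead u - {rho u (alpha t)}"
  proof (intro equalityI subsetI)
    fix x assume x: "x \<in> ahead u - {rho u (alpha t)}"
    then have "rho (inv u) x \<noteq> alpha t" using rho_inv(2)[OF u(1), of x] by auto
    then have "sigma t (rho (inv u) x) \<in> pos_roots" using x u by (intro sigma_pos) (auto simp: ahead_def)
    then show "x \<in> ahead (u \<otimes> t)" using x inv by (auto simp: ahead_def)
  next
    fix x assume x: "x \<in> ahead (u \<otimes> t)"
    then have p: "x \<in> pos_roots" "sigma t (rho (inv u) x) \<in> pos_roots" using inv by (auto simp: ahead_def)
    have "sigma t (rho (inv u) x) \<noteq> alpha t"
    proof
      assume "sigma t (rho (inv u) x) = alpha t"
      then have "rho (inv u) x = - alpha t" using sigma_invol[OF u(2)] sigma_alpha[OF u(2)] by metis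
      then have "x = - rho u (alpha t)" using u by (metis rho_inv(2) rho_linear(3))
      then have "rho u (alpha t) i = 0" for i using p(1) u(3) by (auto simp: pos_roots_def intro!: order_antisym)
      then have "rho u (alpha t) = 0" by auto
      then show False using u(3) root_ne0 by (auto simp: pos_roots_def)
    qed
    then have "sigma t (sigma t (rho (inv u) x)) \<in> pos_roots" using p u by (intro sigma_pos[of "sigma t (rho (inv u) x)"])
    then have "x \<in> ahead u" using p u by (simp add: ahead_def sigma_invol)
    moreover have "x \<noteq> rho u (alpha t)"
    proof
      assume "x = rho u (alpha t)"
      then have "- alpha t \<in> pos_roots" using p u by (simp add: sigma_alpha)
      then have "0 \<le> (- alpha t) t" unfolding pos_roots_def by blast
      then show False by (simp add: alpha_apply)
    qed
    ultimately show "x \<in> ahead u - {rho u (alpha t)}" by simp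
  qed
qed

text \<open>
  The next root is \<open>u \<alpha>\<^sub>t\<close> for the first letter \<open>t\<close> of the current word with \<open>u \<alpha>\<^sub>t\<close> positive. For each
  earlier letter \<open>i\<close> the root \<open>- u \<alpha>\<^sub>i\<close> has already been read, which forces \<open>i\<close> and \<open>t\<close> to commute;
  so \<open>t\<close> may be moved to the front of the word and then rotated to its end.
\<close>

lemma greedy:
  assumes "frame u w"
    and "\<And>y z. y \<in> pos_roots - ahead u \<Longrightarrow> z \<in> ahead u \<Longrightarrow> 0 \<le> E y z \<and> E z y \<le> 0"
  shows "\<exists>bs. distinct bs \<and> set bs = ahead u \<and> sorted_wrt (\<lambda>y z. 0 \<le> E y z \<and> E z y \<le> 0) bs \<and>
    (\<forall>a\<le>length bs. \<exists>v\<in>carrier W. set (drop a bs) = ahead v)"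
  using assms
proof (induction "card (ahead u)" arbitrary: u w rule: less_induct)
  case less
  have u: "u \<in> carrier W" "distinct w" "set w = S" "\<And>x y. E (rho u x) (rho u y) = euler w x y"
    using less.prems(1) by (auto simp: frame_def)
  have fin: "finite (ahead u)" using finite_roots by (rule finite_subset[rotated]) (auto simp: ahead_def pos_roots_def)
  show ?case
  proof (cases "ahead u = {}")
    case True
    then show ?thesis using u(1) by (intro exI[of _ "[]"]) auto
  next
    case False
    then obtain x where x: "x \<in> ahead u" by auto
    \<comment> \<open>If \<open>u\<close> made all simple roots negative, it would send the
      nonnegative vector \<open>rho (inv u) x\<close> to a nonpositive one, although the result is
      the positive root \<open>x\<close>.\<close>
    have ex: "\<exists>t\<in>set w. rho u (alpha t) \<in> pos_roots"
    proof (rule ccontr)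
      assume c: "\<not> ?thesis"
      have np: "rho u (alpha s) i \<le> 0" if "s \<in> S" for s i
        using c u that root_cases[OF rootsI[OF u(1) that]] rootsI[OF u(1) that] by (auto simp: pos_roots_def)
      have y: "rho (inv u) x \<in> roots" "0 \<le> rho (inv u) x s" for s using x by (auto simp: ahead_def pos_roots_def)
      have "rho u (rho (inv u) x) i \<le> 0" for i
        by (rule nonpos_combination) (use supp_root y u np in auto)
      moreover have "0 \<le> x i" for i using x by (auto simp: ahead_def pos_roots_def)
      ultimately have "x i = 0" for i using u(1) by (metis rho_inv(2) order_antisym)
      then have "x = 0" by auto
      then show False using x root_ne0 by (auto simp: ahead_def pos_roots_def)
    qed
    obtain p t q where w: "w = p @ t # q" "rho u (alpha t) \<in> pos_roots" "\<forall>i\<in>set p. rho u (alpha i) \<notin> pos_roots"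
      using split_list_first_propE[OF ex] by metis
    have S: "t \<in> S" "\<And>i. i \<in> set p \<Longrightarrow> i \<in> S" "distinct (p @ t # q)" "set (t # p @ q) = S"
      "t \<notin> set (p @ q)" "distinct (t # p @ q)" using u(2,3) w(1) by auto
    define b where "b = rho u (alpha t)"
    note st = ahead_step[OF u(1) S(1) w(2), folded b_def]
    have orth: "B (alpha i) (alpha t) = 0" if i: "i \<in> set p" for i
    proof -
      have "- rho u (alpha i) \<in> pos_roots"
        using w(3) i rootsI[OF u(1) S(2)[OF i]] root_cases[of "rho u (alpha i)"] root_minus by (auto simp: pos_roots_def)
      moreover have "- rho u (alpha i) \<notin> ahead u"
      proof
        assume "- rho u (alpha i) \<in> ahead u"
        then have "- alpha i \<in> pos_roots" using u(1) by (simp add: ahead_def rho_linear)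
        then have "0 \<le> (- alpha i) i" unfolding pos_roots_def by blast
        then show False by (simp add: alpha_apply)
      qed
      ultimately have d: "0 \<le> E (- rho u (alpha i)) b \<and> E b (- rho u (alpha i)) \<le> 0" using less.prems(2) st(2) by blast
      have "euler w (alpha i) (alpha t) = 0" unfolding w(1)
        by (rule euler_separated) (use S(3) i in \<open>auto simp: alpha_apply\<close>)
      moreover have "0 \<le> euler w (alpha t) (alpha i)" using d by (simp add: b_def euler_linear u(4))
      ultimately have "0 \<le> B (alpha i) (alpha t)" using euler_B[OF u(2,3), of "alpha i" "alpha t"] by simp
      moreover have "i \<noteq> t" using S i by auto
      ultimately show ?thesis using B_alpha_nonpos[OF S(2)[OF i] S(1)] by simp
    qed
    have f: "frame u (t # p @ q)"
      using u(4) S u(1) euler_commute[OF S(3) orth] by (auto simp: frame_def w(1) simp del: euler.simps)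
    define w' where "w' = p @ q @ [t]"
    have f': "frame (u \<otimes> t) w'" using frame_step[OF f] by (simp add: w'_def)
    \<comment> \<open>Seen from the frame before the step the first pairing is a coordinate of a
      positive root; seen from the frame after the step, where \<open>b\<close> is the image of
      \<open>- alpha t\<close>, the second is minus such a coordinate.\<close>
    have Eb: "0 \<le> E b z \<and> E z b \<le> 0" if z: "z \<in> ahead (u \<otimes> t)" for z
    proof
      have z1: "rho (inv u) z \<in> pos_roots" using z unfolding st(1) by (simp add: ahead_def)
      have "E b z = E (rho u (alpha t)) (rho u (rho (inv u) z))" using u(1) by (simp add: b_def)
      also have "\<dots> = euler (t # p @ q) (alpha t) (rho (inv u) z)" using f unfolding frame_def by blast
      also have "\<dots> = rho (inv u) z t" by (rule euler_head_alpha[OF S(5)])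
      also have "\<dots> \<ge> 0" using z1 by (simp add: pos_roots_def)
      finally show "0 \<le> E b z" .
      let ?y = "rho (inv (u \<otimes> t)) z"
      have y: "?y \<in> pos_roots" using z by (simp add: ahead_def)
      have ut: "u \<otimes> t \<in> carrier W" using u S by simp
      have "rho (u \<otimes> t) (- alpha t) = b" using u S by (simp add: b_def sigma_linear sigma_alpha)
      then have "E z b = E (rho (u \<otimes> t) ?y) (rho (u \<otimes> t) (- alpha t))" using ut by simp
      also have "\<dots> = euler w' ?y (- alpha t)" using f' unfolding frame_def by blast
      also have "\<dots> = - ?y t" unfolding w'_def append_assoc[symmetric] using euler_last_alpha[OF S(6), of ?y] by (simp add: euler_linear)
      finally show "E z b \<le> 0" using y by (simp add: pos_roots_def)
    qed
    have "card (ahead (u \<otimes> t)) < card (ahead u)" unfolding st(1) using fin st(2) by (rule card_Diff1_less)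
    moreover have "0 \<le> E y z \<and> E z y \<le> 0" if "y \<in> pos_roots - ahead (u \<otimes> t)" "z \<in> ahead (u \<otimes> t)" for y z
    proof (cases "y = b")
      case True then show ?thesis using Eb that by simp
    next
      case False then show ?thesis using that less.prems(2)[of y z] unfolding st(1) by blast
    qed
    ultimately obtain bs where bs: "distinct bs" "set bs = ahead (u \<otimes> t)"
      "sorted_wrt (\<lambda>y z. 0 \<le> E y z \<and> E z y \<le> 0) bs" "\<forall>a\<le>length bs. \<exists>v\<in>carrier W. set (drop a bs) = ahead v"
      using less.hyps f' by blast
    have "set (b # bs) = ahead u" using bs(2) st by auto
    moreover have "\<exists>v\<in>carrier W. set (drop a (b # bs)) = ahead v" if "a \<le> length (b # bs)" for a
      using that bs(4) u(1) \<open>set (b # bs) = ahead u\<close> by (cases a) auto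
    moreover have "distinct (b # bs)" using bs st by auto
    moreover have "sorted_wrt (\<lambda>y z. 0 \<le> E y z \<and> E z y \<le> 0) (b # bs)" using bs Eb by auto
    ultimately show ?thesis by blast
  qed
qed

end


context coxeter_word begin

section \<open>The periodic sequence of roots\<close>

text \<open>The last clause describes end segments as sets \<open>ahead v\<close>; it is what
  provides the half-spaces in \<open>beta_posit\<close>.\<close>

definition reading :: "('a \<Rightarrow> real) list" where
  "reading = (SOME bs. distinct bs \<and> set bs = pos_roots \<and> sorted_wrt (\<lambda>y z. 0 \<le> E y z \<and> E z y \<le> 0) bs \<and>
    (\<forall>a\<le>length bs. \<exists>v\<in>carrier W. set (drop a bs) = ahead v))"

lemma reading:
  "distinct reading" "set reading = pos_roots" "sorted_wrt (\<lambda>y z. 0 \<le> E y z \<and> E z y \<le> 0) reading"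
  "a \<le> length reading \<Longrightarrow> \<exists>v\<in>carrier W. set (drop a reading) = ahead v"
proof -
  have "\<exists>bs. distinct bs \<and> set bs = ahead \<one> \<and> sorted_wrt (\<lambda>y z. 0 \<le> E y z \<and> E z y \<le> 0) bs \<and>
    (\<forall>a\<le>length bs. \<exists>v\<in>carrier W. set (drop a bs) = ahead v)"
    by (rule greedy[OF frame_one]) (simp add: ahead_one)
  then have "distinct reading \<and> set reading = pos_roots \<and> sorted_wrt (\<lambda>y z. 0 \<le> E y z \<and> E z y \<le> 0) reading \<and>
    (\<forall>a\<le>length reading. \<exists>v\<in>carrier W. set (drop a reading) = ahead v)"
    unfolding ahead_one reading_def by (rule someI_ex)
  then show "distinct reading" "set reading = pos_roots" "sorted_wrt (\<lambda>y z. 0 \<le> E y z \<and> E z y \<le> 0) reading"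
    "a \<le> length reading \<Longrightarrow> \<exists>v\<in>carrier W. set (drop a reading) = ahead v" by blast+
qed

definition N :: nat where "N = length reading"

definition beta :: "nat \<Rightarrow> 'a \<Rightarrow> real" where
  "beta i = (-1) ^ (i div N) *\<^sub>R reading ! (i mod N)"

lemma S_nonempty: "S \<noteq> {}" using irr by (simp add: coxeter_irreducible_def)

lemma N_pos: "0 < N"
proof -
  obtain s where "s \<in> S" using S_nonempty by auto
  then have "alpha s \<in> set reading" using alpha_pos by (simp add: reading(2))
  then show ?thesis unfolding N_def by (rule length_pos_if_in_set)
qed

lemma beta_block: "r < N \<Longrightarrow> beta (q * N + r) = (-1) ^ q *\<^sub>R reading ! r"
  by (simp add: beta_def)

lemma beta_small: "r < N \<Longrightarrow> beta r = reading ! r" by (simp add: beta_def)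

lemma roots_eq: "roots = pos_roots \<union> uminus ` pos_roots"
proof (intro equalityI subsetI)
  fix x assume x: "x \<in> roots"
  show "x \<in> pos_roots \<union> uminus ` pos_roots"
  proof (cases "\<forall>u. 0 \<le> x u")
    case True then show ?thesis using x by (simp add: pos_roots_def)
  next
    case False
    then have "- x \<in> pos_roots" using root_cases[OF x] root_minus[OF x] by (auto simp: pos_roots_def)
    then have "- (- x) \<in> uminus ` pos_roots" by (rule imageI)
    then show ?thesis by simp
  qed
qed (auto simp: pos_roots_def intro: root_minus)

lemma reading_nth: "r < N \<Longrightarrow> reading ! r \<in> pos_roots"
  using reading(2) nth_mem[of r reading] by (simp add: N_def)

lemma reading_dir: "i < j \<Longrightarrow> j < N \<Longrightarrow> 0 \<le> E (reading ! i) (reading ! j) \<and> E (reading ! j) (reading ! i) \<le> 0"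
  using reading(3) by (simp add: sorted_wrt_iff_nth_less N_def)

lemma beta_dir:
  assumes "i < j" "j < i + N" shows "0 \<le> E (beta i) (beta j) \<and> E (beta j) (beta i) \<le> 0"
proof -
  define q r d where "q = i div N" and "r = i mod N" and "d = j - i"
  have i: "i = q * N + r" "r < N" using N_pos by (auto simp: q_def r_def)
  have d: "0 < d" "d < N" "j = q * N + (r + d)" using assms i by (auto simp: d_def)
  show ?thesis
  proof (cases "r + d < N")
    case True
    then show ?thesis using reading_dir[of r "r + d"] d
      unfolding i(1) d(3) by (simp add: beta_block euler_linear)
  next
    case False
    then have j: "j = Suc q * N + (r + d - N)" "r + d - N < r" using d by (auto simp: i(2))
    have bj: "beta j = (-1) ^ Suc q *\<^sub>R reading ! (r + d - N)" unfolding j(1) by (rule beta_block) (use j i in simp)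
    have bi: "beta i = (-1) ^ q *\<^sub>R reading ! r" unfolding i(1) by (rule beta_block[OF i(2)])
    show ?thesis using reading_dir[OF j(2) i(2)] unfolding bi bj by (simp add: euler_linear)
  qed
qed

definition reflection :: "('a \<Rightarrow> real) \<Rightarrow> 'a" where
  "reflection x = (SOME w. w \<in> reflections W S \<and> (\<forall>y. rho w y = y - B y x *\<^sub>R x))"

lemma reflection_conj:
  assumes "w \<in> carrier W" "s \<in> S"
  shows "rho (w \<otimes> s \<otimes> inv w) y = y - B y (rho w (alpha s)) *\<^sub>R rho w (alpha s)"
proof -
  have "rho (w \<otimes> s \<otimes> inv w) y = rho w (rho (inv w) y - B (rho (inv w) y) (alpha s) *\<^sub>R alpha s)"
    using assms by (simp add: sigma_def)
  also have "\<dots> = y - B (rho (inv w) y) (alpha s) *\<^sub>R rho w (alpha s)"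
    using assms(1) by (simp only: rho_linear rho_inv)
  also have "B (rho (inv w) y) (alpha s) = B y (rho w (alpha s))"
    using B_rho[OF assms(1), of "rho (inv w) y" "alpha s"] assms(1) by simp
  finally show ?thesis .
qed

lemma reflection:
  assumes "x \<in> roots"
  shows "reflection x \<in> reflections W S" "rho (reflection x) y = y - B y x *\<^sub>R x"
proof -
  obtain w s where w: "w \<in> carrier W" "s \<in> S" "x = rho w (alpha s)" by (rule rootsE[OF assms])
  then have "w \<otimes> s \<otimes> inv w \<in> reflections W S \<and> (\<forall>y. rho (w \<otimes> s \<otimes> inv w) y = y - B y x *\<^sub>R x)"
    using reflection_conj by (auto simp: reflections_def)
  then have "reflection x \<in> reflections W S \<and> (\<forall>y. rho (reflection x) y = y - B y x *\<^sub>R x)"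
    unfolding reflection_def by (rule someI)
  then show "reflection x \<in> reflections W S" "rho (reflection x) y = y - B y x *\<^sub>R x" by auto
qed

lemma reflections_carrier: "reflections W S \<subseteq> carrier W" by (auto simp: reflections_def)

lemma reflection_carrier [simp]: "x \<in> roots \<Longrightarrow> reflection x \<in> carrier W"
  using reflection(1) reflections_carrier by blast

text \<open>Up to a common sign, a window consists of an end segment of the reading, which is some
  \<open>ahead v\<close>, followed by the negatives of the remaining positive roots. The coordinate
  sum of \<open>rho (inv v) x\<close> is positive on the former and negative on the positive roots
  outside \<open>ahead v\<close>.\<close>

lemma beta_posit: "\<exists>f :: ('a \<Rightarrow> real) \<Rightarrow> real. linear f \<and> (\<forall>i\<in>{a..<a+N}. 0 < f (beta i))"
proof -
  define q r where "q = a div N" and "r = a mod N"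
  have a: "a = q * N + r" "r < N" using N_pos by (auto simp: q_def r_def)
  obtain v where v: "v \<in> carrier W" "set (drop r reading) = ahead v" using reading(4)[of r] a(2) by (auto simp: N_def)
  define h where "h x = (\<Sum>s\<in>S. rho (inv v) x s)" for x
  define f where "f x = (-1) ^ q * h x" for x
  have h_lin: "h (x + y) = h x + h y" "h (c *\<^sub>R x) = c * h x" "h (- x) = - h x" for x y c
    using v(1) by (simp_all add: h_def rho_linear sum.distrib sum_distrib_left sum_negf)
  have "linear f" by (rule linearI) (simp_all add: f_def h_lin algebra_simps)
  have sum_pos: "0 < (\<Sum>s\<in>S. x s)" if "x \<in> pos_roots" for x
  proof -
    have x: "x \<in> roots" "\<And>u. 0 \<le> x u" using that by (auto simp: pos_roots_def)
    obtain t where "x t \<noteq> 0" using root_ne0[OF x(1)] by (auto simp: fun_eq_iff)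
    then have "t \<in> S" "0 < x t" using supp_root[OF x(1)] x(2)[of t] by (auto simp: supp_def less_le)
    then show ?thesis using finS x(2) by (intro sum_pos2) auto
  qed
  have pos: "0 < h x" if "x \<in> ahead v" for x using sum_pos that by (simp add: h_def ahead_def)
  have neg: "h x < 0" if x: "x \<in> pos_roots" "x \<notin> ahead v" for x
  proof -
    have r: "rho (inv v) x \<in> roots" using x v(1) by (auto simp: pos_roots_def intro: root_rho)
    then have "- rho (inv v) x \<in> pos_roots" using x roots_eq by (auto simp: ahead_def)
    then show ?thesis using sum_pos[of "- rho (inv v) x"] by (simp add: h_def sum_negf)
  qed
  have "0 < f (beta i)" if "i \<in> {a..<a+N}" for i
  proof -
    define d where "d = i - a"
    have d: "d < N" "i = q * N + (r + d)" using that a by (auto simp: d_def)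
    show ?thesis
    proof (cases "r + d < N")
      case True
      then have "reading ! (r + d) \<in> set (drop r reading)"
        using nth_mem[of d "drop r reading"] by (simp add: N_def)
      then have "0 < h (reading ! (r + d))" using pos v by simp
      then show ?thesis using True by (simp add: d(2) beta_block f_def h_lin)
    next
      case False
      define e where "e = r + d - N"
      have e: "e < r" "e < N" "i = Suc q * N + e" using False d a by (auto simp: e_def)
      have "reading ! e \<notin> set (drop r reading)"
      proof
        assume "reading ! e \<in> set (drop r reading)"
        then obtain l where "l < length (drop r reading)" "drop r reading ! l = reading ! e" by (auto simp: in_set_conv_nth)
        then have "reading ! (r + l) = reading ! e" "r + l < length reading" by auto
        then show False using reading(1) e by (auto simp: nth_eq_iff_index_eq N_def)
      qed
      then have "h (reading ! e) < 0" using neg reading_nth e v by simp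
      moreover have "beta i = (-1) ^ Suc q *\<^sub>R reading ! e" unfolding e(3) by (rule beta_block[OF e(2)])
      ultimately show ?thesis by (simp add: f_def h_lin)
    qed
  qed
  then show ?thesis using \<open>linear f\<close> by blast
qed

lemma roots_beta: "roots = range beta"
proof (intro equalityI subsetI)
  fix x assume "x \<in> range beta"
  then obtain i where i: "x = beta i" by auto
  have "reading ! (i mod N) \<in> roots" using reading_nth N_pos by (auto simp: pos_roots_def)
  then show "x \<in> roots" unfolding i beta_def by (cases "even (i div N)") (auto intro: root_minus)
next
  fix x assume "x \<in> roots"
  then consider "x \<in> pos_roots" | "- x \<in> pos_roots" using roots_eq by auto
  then show "x \<in> range beta"
  proof cases
    case 1
    then obtain r where "r < N" "reading ! r = x" unfolding reading(2)[symmetric] N_def in_set_conv_nth by blast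
    then have "beta r = x" by (simp add: beta_small)
    then show ?thesis by auto
  next
    case 2
    then obtain r where "r < N" "reading ! r = - x" unfolding reading(2)[symmetric] N_def in_set_conv_nth by blast
    then have "beta (1 * N + r) = x" by (simp only: beta_block) simp
    then show ?thesis by (metis rangeI)
  qed
qed

section \<open>Projective roots and the initial slice\<close>

lemma frame_prefix: "ss = p @ q \<Longrightarrow> frame (word_prod W p) (q @ p)"
proof (induction p arbitrary: q rule: rev_induct)
  case Nil then show ?case using frame_one by simp
next
  case (snoc t p)
  have "set p \<subseteq> carrier W" "t \<in> S" using snoc.prems ss S_sub by auto
  moreover have "frame (word_prod W p) (t # (q @ p))" using snoc.IH[of "t # q"] snoc.prems by simp
  from frame_step[OF this] have "frame (word_prod W p \<otimes> t) (q @ p @ [t])" by simp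
  ultimately show ?case by (simp add: word_prod_append)
qed

lemma word_supp:
  assumes "set p \<subseteq> S" "t \<notin> set p" shows "rho (word_prod W p) x t = x t"
  using assms
proof (induction p)
  case (Cons a p)
  have "word_prod W p \<in> carrier W" using Cons.prems S_sub by auto
  then show ?case using Cons by (simp add: sigma_other)
qed simp

lemma word_span:
  assumes "set p \<subseteq> S" shows "rho (word_prod W p) x - x \<in> span (alpha ` set p)"
  using assms
proof (induction p)
  case (Cons a p)
  have c: "word_prod W p \<in> carrier W" using Cons.prems S_sub by auto
  have "rho (word_prod W (a # p)) x - x =
    (rho (word_prod W p) x - x) - B (rho (word_prod W p) x) (alpha a) *\<^sub>R alpha a"
    using c Cons.prems by (simp add: sigma_def)
  moreover have "rho (word_prod W p) x - x \<in> span (alpha ` set (a # p))"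
  proof (rule subsetD[OF span_mono])
    show "rho (word_prod W p) x - x \<in> span (alpha ` set p)" by (rule Cons.IH) (use Cons.prems in simp)
  qed auto
  moreover have "alpha a \<in> span (alpha ` set (a # p))" by (rule span_base) simp
  ultimately show ?case by (metis span_diff span_scale)
qed (simp add: span_zero)

text \<open>The roots \<open>s\<^sub>1 \<cdots> s\<^bsub>i-1\<^esub> \<alpha>\<^sub>i\<close> represent the coordinate functionals under \<open>E\<close>.\<close>

definition projective :: "'a list \<Rightarrow> 'a \<Rightarrow> 'a \<Rightarrow> real" where
  "projective p t = rho (word_prod W p) (alpha t)"

lemma projective:
  assumes "ss = p @ t # q"
  shows "projective p t \<in> roots" "E (projective p t) y = y t" "projective p t \<in> pos_roots"
proof -
  have t: "t \<in> S" "set p \<subseteq> S" "t \<notin> set p" "t \<notin> set (q @ p)" using ss assms by auto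
  have c: "word_prod W p \<in> carrier W" using t S_sub by auto
  show r: "projective p t \<in> roots" unfolding projective_def using c t by (rule_tac rootsI)
  have f: "frame (word_prod W p) (t # q @ p)" using frame_prefix[OF assms] by simp
  have "E (projective p t) y = E (rho (word_prod W p) (alpha t)) (rho (word_prod W p) (rho (inv word_prod W p) y))"
    using c by (simp add: projective_def)
  also have "\<dots> = euler (t # q @ p) (alpha t) (rho (inv word_prod W p) y)" using f unfolding frame_def by blast
  also have "\<dots> = rho (inv word_prod W p) y t" by (rule euler_head_alpha[OF t(4)])
  also have "\<dots> = y t" using word_supp[OF t(2,3), of "rho (inv word_prod W p) y"] c by simp
  finally show "E (projective p t) y = y t" .
  have "projective p t t = 1" unfolding projective_def using word_supp[OF t(2,3)] by (simp add: alpha_apply)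
  then have "\<not> projective p t t \<le> 0" by simp
  then show "projective p t \<in> pos_roots" using root_cases[OF r] r unfolding pos_roots_def by blast
qed

abbreviation initial_slice :: "nat set" where "initial_slice \<equiv> euler_data.slice E beta N roots 0"

text \<open>Pairing a projective root with a positive root yields one of its coordinates, hence a
  nonnegative number; the direction of the reading makes the same pairing nonpositive for earlier
  roots.\<close>

lemma projective_slice:
  assumes "ss = p @ t # q" shows "projective p t \<in> beta ` initial_slice"
proof -
  obtain i where i: "i < N" "reading ! i = projective p t"
    using projective(3)[OF assms] unfolding reading(2)[symmetric] N_def in_set_conv_nth by blast
  have "E (beta i) (beta j) = 0" if "j < i" for j
  proof -
    have j: "j < N" using that i by simp
    have "0 \<le> E (beta i) (beta j)"
      using projective(2)[OF assms] reading_nth[OF j] by (simp add: beta_small i j pos_roots_def)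
    moreover have "E (beta i) (beta j) \<le> 0" using reading_dir[OF that i(1)] by (simp add: beta_small i(1) j)
    ultimately show ?thesis by simp
  qed
  then have "i \<in> initial_slice" using i(1) by (auto simp: euler_data.slice_def roots_beta)
  then show ?thesis using i beta_small by (metis imageI)
qed

text \<open>By \<open>word_span\<close> a projective root differs from its simple root by a
  combination of simple roots of earlier letters, so the change of basis is unitriangular.\<close>

lemma alpha_span_slice: "ss = p @ q \<Longrightarrow> alpha ` set p \<subseteq> span (beta ` initial_slice)"
proof (induction p arbitrary: q rule: rev_induct)
  case (snoc t p)
  let ?V = "span (beta ` initial_slice)"
  have e: "ss = p @ t # q" using snoc.prems by simp
  have ih: "alpha ` set p \<subseteq> ?V" by (rule snoc.IH[OF e])
  have "set p \<subseteq> S" using ss e by auto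
  then have "projective p t - alpha t \<in> span (alpha ` set p)" unfolding projective_def by (rule word_span)
  then have "projective p t - alpha t \<in> ?V" using span_minimal[OF ih subspace_span] by blast
  moreover have "projective p t \<in> ?V" by (rule span_base) (rule projective_slice[OF e])
  ultimately have "projective p t - (projective p t - alpha t) \<in> ?V" by (metis span_diff)
  then show ?case using ih by simp
qed simp

lemma span_slice: "supp x \<longleftrightarrow> x \<in> span (beta ` initial_slice)"
proof -
  have "span (alpha ` S) \<subseteq> span (beta ` initial_slice)"
    using alpha_span_slice[of ss "[]"] ss by (intro span_minimal subspace_span) auto
  moreover have "span (beta ` initial_slice) \<subseteq> span (alpha ` S)"
  proof (rule span_minimal[OF _ subspace_span])
    show "beta ` initial_slice \<subseteq> span (alpha ` S)"
      using supp_root supp_span roots_beta by blast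
  qed
  ultimately show ?thesis using supp_span by blast
qed

sublocale euler_system E roots beta N
proof
  show "E (x + y) z = E x z + E y z" "E (c *\<^sub>R x) z = c * E x z"
    "E z (x + y) = E z x + E z y" "E z (c *\<^sub>R x) = c * E z x" for x y z c by (simp_all add: euler_linear)
  show "0 < N" by (rule N_pos)
  show "beta (i + N) = - beta i" for i using N_pos by (simp add: beta_def)
  show "roots = range beta" by (rule roots_beta)
  show "E x x = 1" if "x \<in> roots" for x using E_B[of x x] B_root[OF that] by simp
  show "x - (E x y + E y x) *\<^sub>R y \<in> roots" if "x \<in> roots" "y \<in> roots" for x y
    using root_rho[OF that(1), of "reflection y"] reflection[OF that(2)] that(2) unfolding E_B by simp
  show "i < j \<Longrightarrow> j < i + N \<Longrightarrow> 0 \<le> E (beta i) (beta j)" for i j using beta_dir by simp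
  show "i < j \<Longrightarrow> j < i + N \<Longrightarrow> E (beta j) (beta i) \<le> 0" for i j using beta_dir by simp
  show "\<exists>f :: ('a \<Rightarrow> real) \<Rightarrow> real. linear f \<and> (\<forall>i\<in>{a..<a+N}. 0 < f (beta i))" for a by (rule beta_posit)
  show "euler_data.spans E beta N roots 0" unfolding euler_data.spans_def using supp_root span_slice by blast
qed

lemma alpha_independent: "independent (alpha ` S)" "inj_on alpha S"
proof -
  have "s = t" if "alpha s = alpha t" for s t :: 'a
    using fun_cong[OF that, of s] by (simp add: alpha_apply split: if_splits)
  then show inj: "inj_on alpha S" by (rule inj_onI)
  have "independent (alpha ` T)" if "finite T" for T :: "'a set" using that
  proof (induction T rule: finite_induct)
    case (insert t T)
    have "x t = 0" if "x \<in> span (alpha ` T)" for x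
      using that by (rule span_induct) (use insert.hyps in \<open>auto simp: subspace_def alpha_apply\<close>)
    from this[of "alpha t"] have "alpha t \<notin> span (alpha ` T)" by (auto simp: alpha_apply)
    then show ?case using insert.IH by (auto simp: independent_insert)
  qed (simp add: independent_empty)
  then show "independent (alpha ` S)" using finS by blast
qed

lemma dim_supp: "dim {x. supp x} = card S"
proof -
  have "{x. supp x} = span (alpha ` S)" by (intro Set.set_eqI) (simp only: mem_Collect_eq supp_span)
  then show ?thesis using dim_span_eq_card_independent[OF alpha_independent(1)] card_image[OF alpha_independent(2)] by metis
qed

lemma rk_roots: "rk roots = card S"
proof -
  have "{x. supp x} = span (beta ` slice roots 0)"
    by (intro Set.set_eqI) (simp only: mem_Collect_eq span_slice)
  then have "dim {x. supp x} = card (beta ` slice roots 0)"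
    using dim_span_eq_card_independent[OF slice_independent(1)] by metis
  also have "\<dots> = card (slice roots 0)" by (rule card_image[OF slice_independent(2)])
  finally show ?thesis unfolding dim_supp rk_def by (rule sym)
qed

end


section \<open>Exceptional sequences and factorisations of the Coxeter element\<close>

context coxeter_word begin

abbreviation gamma :: 'a where "gamma \<equiv> word_prod W ss"

lemma gamma_carrier [simp]: "gamma \<in> carrier W" using ss S_sub by simp

definition exceptional :: "('a \<Rightarrow> real) list \<Rightarrow> bool" where
  "exceptional bs \<longleftrightarrow> set bs \<subseteq> roots \<and> sorted_wrt (\<lambda>x y. E x y = 0) bs"

definition refl_prod :: "('a \<Rightarrow> real) list \<Rightarrow> 'a" where
  "refl_prod bs = word_prod W (map reflection bs)"

lemma refl_prod_simps [simp]: "refl_prod [] = \<one>" "refl_prod (b # bs) = reflection b \<otimes> refl_prod bs"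
  by (simp_all add: refl_prod_def)

lemma refl_prod_closed [simp]: "set bs \<subseteq> roots \<Longrightarrow> refl_prod bs \<in> carrier W"
  by (induction bs) auto

lemma refl_prod_append:
  "set bs \<subseteq> roots \<Longrightarrow> set cs \<subseteq> roots \<Longrightarrow> refl_prod (bs @ cs) = refl_prod bs \<otimes> refl_prod cs"
  by (induction bs) (auto simp: m_assoc)

lemma rho_eqI:
  assumes "u \<in> carrier W" "w \<in> carrier W" "\<And>s. s \<in> S \<Longrightarrow> rho u (alpha s) = rho w (alpha s)"
  shows "u = w"
proof -
  have "inv w \<otimes> u = \<one>" by (rule faithful) (use assms in auto)
  then have "w \<otimes> (inv w \<otimes> u) = w \<otimes> \<one>" by simp
  then show ?thesis using assms by (simp add: m_assoc[symmetric])
qed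

lemma reflection_unique:
  "x \<in> roots \<Longrightarrow> w \<in> carrier W \<Longrightarrow> (\<And>y. rho w y = y - B y x *\<^sub>R x) \<Longrightarrow> w = reflection x"
  by (rule rho_eqI) (auto simp: reflection(2))

lemma reflection_alpha: "s \<in> S \<Longrightarrow> reflection (alpha s) = s"
  by (rule reflection_unique[symmetric]) (auto simp: alpha_root sigma_def)

lemma reflections_image: "reflections W S = reflection ` roots"
proof (intro equalityI subsetI)
  fix t assume "t \<in> reflections W S"
  then obtain w s where w: "w \<in> carrier W" "s \<in> S" "t = w \<otimes> s \<otimes> inv w" by (auto simp: reflections_def)
  have "t = reflection (rho w (alpha s))" unfolding w(3)
    by (rule reflection_unique[OF rootsI[OF w(1,2)] _ reflection_conj[OF w(1,2)]]) (use w in simp)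
  then show "t \<in> reflection ` roots" using rootsI w by blast
qed (auto simp: reflection(1))

lemma exceptional_Cons:
  "exceptional (b # bs) \<longleftrightarrow> b \<in> roots \<and> (\<forall>c\<in>set bs. E b c = 0) \<and> exceptional bs"
  by (auto simp: exceptional_def)

lemma exceptional_append:
  "exceptional (bs @ cs) \<longleftrightarrow> exceptional bs \<and> exceptional cs \<and> (\<forall>b\<in>set bs. \<forall>c\<in>set cs. E b c = 0)"
  by (auto simp: exceptional_def sorted_wrt_append)

lemma refl_prod_diff_span:
  "set bs \<subseteq> roots \<Longrightarrow> rho (refl_prod bs) x - x \<in> span (set bs)"
proof (induction bs)
  case (Cons b bs)
  let ?z = "rho (refl_prod bs) x"
  have "?z - x \<in> span (set bs)" by (rule Cons.IH) (use Cons.prems in simp)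
  then have "?z - x \<in> span (set (b # bs))" by (rule subsetD[OF span_mono, rotated]) auto
  moreover have "b \<in> span (set (b # bs))" by (rule span_base) simp
  ultimately have "(?z - x) - B ?z b *\<^sub>R b \<in> span (set (b # bs))" by (metis span_diff span_scale)
  moreover have e: "rho (refl_prod (b # bs)) x = ?z - B ?z b *\<^sub>R b" using Cons.prems by (simp add: reflection(2))
  have "rho (refl_prod (b # bs)) x - x = (?z - x) - B ?z b *\<^sub>R b" unfolding e by (rule ext) simp
  ultimately show ?case by (simp only:)
qed (simp add: span_zero)

text \<open>The factor of \<open>b\<close> adds a multiple of \<open>b\<close> to the displacement.
  This is invisible to later roots, on which \<open>E b\<close> vanishes, and at \<open>b\<close>
  itself the value follows from \<open>E b b = 1\<close> and the decomposition of \<open>B\<close>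
  into \<open>E\<close> and its transpose.\<close>

lemma E_refl_prod:
  "exceptional bs \<Longrightarrow> y \<in> span (set bs) \<Longrightarrow> E (rho (refl_prod bs) x - x) y = - B x y"
proof -
  assume ex: "exceptional bs" and y: "y \<in> span (set bs)"
  have "\<forall>y\<in>set bs. E (rho (refl_prod bs) x - x) y = - B x y" using ex
  proof (induction bs)
    case (Cons b bs)
    let ?z = "rho (refl_prod bs) x"
    have b: "b \<in> roots" "\<forall>c\<in>set bs. E b c = 0" "exceptional bs" "set bs \<subseteq> roots"
      using Cons.prems by (auto simp: exceptional_def)
    have r: "rho (refl_prod (b # bs)) x - x = (?z - x) - B ?z b *\<^sub>R b" using b by (simp add: reflection(2))
    have "E b (?z - x) = 0"
      by (rule span_zero_right[OF refl_prod_diff_span[OF b(4)]]) (use b(2) in auto)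
    then have bz: "E b ?z = E b x" by (simp add: E_simps)
    have bb: "B ?z b = E ?z b + E b x" "B x b = E x b + E b x" by (simp_all add: E_B[symmetric] bz)
    show ?case
    proof
      fix y assume "y \<in> set (b # bs)"
      then consider "y = b" | "y \<in> set bs" by auto
      then show "E (rho (refl_prod (b # bs)) x - x) y = - B x y"
      proof cases
        case 1 then show ?thesis unfolding r 1 by (simp add: E_simps E_unit[OF b(1)] bb)
      next
        case 2
        have "E (?z - x) y = - B x y" using Cons.IH[OF b(3)] 2 by blast
        then show ?thesis unfolding r E_diff(1)[of "?z - x"] E_scale_left using b(2) 2 by simp
      qed
    qed
  qed simp
  moreover define z where "z = rho (refl_prod bs) x - x"
  ultimately have sp: "E z s + B x s = 0" if "s \<in> set bs" for s using that by simp
  have "subspace {y. E z y + B x y = 0}"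
    unfolding subspace_def by (simp add: E_add_right E_scale_right distrib_left[symmetric])
  then have "E z y + B x y = 0" by (rule span_induct[OF y]) (use sp in simp)
  then show ?thesis unfolding z_def by simp
qed

lemma exceptional_independent: "exceptional bs \<Longrightarrow> independent (set bs) \<and> distinct bs"
proof (induction bs)
  case (Cons b bs)
  then have b: "b \<in> roots" "\<forall>c\<in>set bs. E b c = 0" "exceptional bs" by (auto simp: exceptional_Cons)
  have "b \<notin> span (set bs)"
  proof
    assume "b \<in> span (set bs)"
    then have "E b b = 0" by (rule span_zero_right) (use b in auto)
    then show False using E_unit[OF b(1)] by simp
  qed
  then show ?case using Cons.IH[OF b(3)] by (auto simp: independent_insert intro: span_base)
qed (simp add: independent_empty)

lemma supp_sub: "set bs \<subseteq> roots \<Longrightarrow> y \<in> span (set bs) \<Longrightarrow> supp y"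
  using span_mono[of "set bs" "span (alpha ` S)"] supp_root supp_span by (auto simp: span_span)

definition complete :: "('a \<Rightarrow> real) list \<Rightarrow> bool" where
  "complete bs \<longleftrightarrow> exceptional bs \<and> length bs = card S"

lemma complete_span: assumes "complete bs" "supp y" shows "y \<in> span (set bs)"
proof -
  have bs: "independent (set bs)" "distinct bs" "set bs \<subseteq> roots" "length bs = card S"
    using assms exceptional_independent by (auto simp: complete_def exceptional_def)
  have b: "set bs \<subseteq> span (alpha ` S)" using bs(3) supp_root supp_span by blast
  show ?thesis
  proof (rule ccontr)
    assume c: "y \<notin> span (set bs)"
    then have ny: "y \<notin> set bs" using span_base by blast
    have "independent (insert y (set bs))" using c ny bs(1) by (simp add: independent_insert)
    moreover have "insert y (set bs) \<subseteq> span (alpha ` S)" using b assms(2) supp_span by blast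
    ultimately have "card (insert y (set bs)) \<le> card (alpha ` S)"
      using real_vector.independent_span_bound[of "alpha ` S" "insert y (set bs)"] finS by blast
    then show False using ny bs by (simp add: card_image[OF alpha_independent(2)] distinct_card)
  qed
qed

lemma E_definite: "supp z \<Longrightarrow> E z z = 0 \<Longrightarrow> z = 0"
  using B_pos_def[of z] E_B[of z z] by auto

lemma supp_diff: "supp x \<Longrightarrow> supp y \<Longrightarrow> supp (x - y)" by (simp add: supp_def)

lemma simple_complete: "complete (map alpha ss)" "refl_prod (map alpha ss) = gamma"
proof -
  have "sorted_wrt (\<lambda>x y. E x y = 0) (map alpha ss)"
    unfolding sorted_wrt_map
  proof (rule sorted_wrt_iff_nth_less[THEN iffD2], intro allI impI)
    fix i j assume ij: "i < j" "j < length ss"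
    have "E (alpha (ss ! i)) (alpha (ss ! j)) = euler (take j ss @ drop j ss) (alpha (ss ! i)) (alpha (ss ! j))"
      by simp
    also have "\<dots> = 0"
    proof (rule euler_separated)
      fix t assume "t \<in> set (drop j ss)"
      then obtain l where "t = ss ! (j + l)" "j + l < length ss" by (auto simp: in_set_conv_nth)
      then show "alpha (ss ! i) t = 0" using ij ss(1) by (auto simp: alpha_apply nth_eq_iff_index_eq)
    next
      fix t assume "t \<in> set (take j ss)"
      then obtain l where "t = ss ! l" "l < j" by (auto simp: in_set_conv_nth)
      then show "alpha (ss ! j) t = 0" using ij ss(1) by (auto simp: alpha_apply nth_eq_iff_index_eq)
    qed
    finally show "E (alpha (ss ! i)) (alpha (ss ! j)) = 0" .
  qed
  moreover have "length ss = card S" using ss distinct_card by metis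
  ultimately show "complete (map alpha ss)" using ss alpha_root by (auto simp: complete_def exceptional_def)
  have "map reflection (map alpha ss) = ss" unfolding map_map by (rule map_idI) (simp add: reflection_alpha ss)
  then show "refl_prod (map alpha ss) = gamma" unfolding refl_prod_def by simp
qed

lemma complete_exceptional: "complete bs \<Longrightarrow> exceptional bs" and complete_roots: "complete bs \<Longrightarrow> set bs \<subseteq> roots"
  by (auto simp: complete_def exceptional_def)

text \<open>For a spanning list the identity \<open>E_refl_prod\<close> no longer depends on the
  list. Two such products therefore displace a vector by amounts whose difference is
  \<open>E\<close>-orthogonal to itself, and \<open>E\<close> is definite.\<close>

lemma complete_refl_prod: assumes c: "complete bs" shows "refl_prod bs = gamma"
proof (rule rho_eqI)
  show "refl_prod bs \<in> carrier W" using complete_roots[OF c] by simp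
  fix s assume s: "s \<in> S"
  let ?P = "rho (refl_prod bs) (alpha s)" and ?Q = "rho gamma (alpha s)"
  have z: "supp (?P - ?Q)" using complete_roots[OF c] s by (intro supp_diff supp_rho supp_alpha) auto
  have "E (?P - alpha s) (?P - ?Q) = - B (alpha s) (?P - ?Q)"
    by (rule E_refl_prod[OF complete_exceptional[OF c] complete_span[OF c z]])
  moreover have "E (?Q - alpha s) (?P - ?Q) = - B (alpha s) (?P - ?Q)"
    using E_refl_prod[OF complete_exceptional[OF simple_complete(1)] complete_span[OF simple_complete(1) z]]
    by (simp only: simple_complete(2))
  ultimately have "E ((?P - alpha s) - (?Q - alpha s)) (?P - ?Q) = 0" by (simp only: E_diff(1)[of "?P - alpha s"] diff_self)
  moreover have "(?P - alpha s) - (?Q - alpha s) = ?P - ?Q" by (rule ext) simp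
  ultimately have "?P - ?Q = 0" using E_definite[OF z] by (simp only:)
  then show "?P = ?Q" by (simp only: right_minus_eq)
qed simp

lemma E_gamma: "supp y \<Longrightarrow> E (rho gamma x - x) y = - B x y"
  using E_refl_prod[OF complete_exceptional[OF simple_complete(1)] complete_span[OF simple_complete(1)]]
  by (simp only: simple_complete(2))

lemma orthogonal_projection:
  "(\<And>b. b \<in> set bs \<Longrightarrow> supp b) \<Longrightarrow> \<exists>u\<in>span (set bs). \<forall>b\<in>set bs. B (v - u) b = 0"
proof (induction bs arbitrary: v)
  case Nil then show ?case by (auto simp: span_zero)
next
  case (Cons b bs)
  have IH: "\<exists>u\<in>span (set bs). \<forall>b\<in>set bs. B (v - u) b = 0" for v by (rule Cons.IH) (use Cons.prems in auto)
  obtain u where u: "u \<in> span (set bs)" "\<forall>c\<in>set bs. B (v - u) c = 0" using IH by blast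
  obtain p where p: "p \<in> span (set bs)" "\<forall>c\<in>set bs. B (b - p) c = 0" using IH by blast
  have zero: "B x y = 0" if "\<forall>c\<in>set bs. B x c = 0" "y \<in> span (set bs)" for x y
    using that(2) by (rule span_induct) (use that(1) in \<open>auto simp: subspace_def\<close>)
  have sup: "z \<in> span (set (b # bs))" if "z \<in> span (set bs)" for z
    by (rule subsetD[OF span_mono that]) auto
  define d where "d = b - p"
  \<comment> \<open>The list may be linearly dependent; then the residual \<open>d\<close> can
    vanish and contributes nothing to the projection.\<close>
  define l where "l = (if d = 0 then 0 else B (v - u) d / B d d)"
  have "supp p"
  proof -
    have "span (set bs) \<subseteq> span (alpha ` S)"
      by (rule span_minimal[OF _ subspace_span]) (use Cons.prems supp_span in auto)
    then show ?thesis using p supp_span by blast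
  qed
  then have "supp d" unfolding d_def using Cons.prems by (intro supp_diff) auto
  define w where "w = u + l *\<^sub>R d"
  have "d \<in> span (set (b # bs))" unfolding d_def using sup[OF p(1)] by (intro span_diff) (auto intro: span_base)
  then have "w \<in> span (set (b # bs))" unfolding w_def using sup[OF u(1)] by (intro span_add span_scale)
  moreover have vw: "B (v - w) y = B (v - u) y - l * B d y" for y by (simp add: w_def)
  have "B (v - w) c = 0" if "c \<in> set (b # bs)" for c
  proof -
    have d0: "B (v - u) d - l * B d d = 0"
    proof (cases "d = 0")
      case False
      then have "B d d \<noteq> 0" using B_pos_def[OF \<open>supp d\<close>] by simp
      then show ?thesis using False by (simp add: l_def)
    qed simp
    consider "c = b" | "c \<in> set bs" using \<open>c \<in> set (b # bs)\<close> by auto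
    then show ?thesis
    proof cases
      case 1
      have "b = d + p" by (simp add: d_def)
      then have "B (v - w) c = (B (v - u) d - l * B d d) + (B (v - u) p - l * B d p)"
        unfolding vw 1 by (simp add: algebra_simps)
      then show ?thesis using d0 zero[OF u(2) p(1)] zero[OF p(2) p(1)] by (simp add: d_def)
    next
      case 2
      then show ?thesis unfolding vw using u(2) p(2) by (simp add: d_def)
    qed
  qed
  ultimately show ?case by blast
qed

lemma orthogonal_vector:
  assumes "set bs \<subseteq> roots" "length bs < card S"
  shows "\<exists>x. supp x \<and> x \<noteq> 0 \<and> (\<forall>b\<in>set bs. B x b = 0)"
proof -
  have "\<not> alpha ` S \<subseteq> span (set bs)"
  proof
    assume "alpha ` S \<subseteq> span (set bs)"
    then have "card (alpha ` S) \<le> card (set bs)"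
      using real_vector.independent_span_bound[OF _ alpha_independent(1)] by blast
    then show False using assms(2) card_length[of bs] by (simp add: card_image alpha_independent)
  qed
  then obtain s where s: "s \<in> S" "alpha s \<notin> span (set bs)" by auto
  obtain u where u: "u \<in> span (set bs)" "\<forall>b\<in>set bs. B (alpha s - u) b = 0"
    using orthogonal_projection[of bs "alpha s"] assms(1) supp_root by blast
  have "alpha s - u \<noteq> 0" using s u(1) by auto
  moreover have "supp (alpha s - u)" using supp_alpha[OF s(1)] supp_sub[OF assms(1) u(1)] by (rule supp_diff)
  ultimately show ?thesis using u(2) by blast
qed

lemma refl_prod_fixes:
  "set bs \<subseteq> roots \<Longrightarrow> (\<forall>b\<in>set bs. B x b = 0) \<Longrightarrow> rho (refl_prod bs) x = x"
  by (induction bs) (auto simp: reflection(2))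

text \<open>By \<open>E_gamma\<close> a fixed vector \<open>x\<close> of the Coxeter element with
  \<open>supp x\<close> satisfies \<open>B x x = 0\<close>, while fewer than \<open>card S\<close>
  reflections have a common nonzero fixed vector of this kind.\<close>

lemma factorisation_length:
  assumes "set bs \<subseteq> roots" "refl_prod bs = gamma" shows "card S \<le> length bs"
proof (rule ccontr)
  assume "\<not> card S \<le> length bs"
  then obtain x where x: "supp x" "x \<noteq> 0" "\<forall>b\<in>set bs. B x b = 0" using orthogonal_vector[OF assms(1)] by auto
  have "rho gamma x = x" using refl_prod_fixes[OF assms(1) x(3)] assms(2) by simp
  then have "B x x = 0" using E_gamma[OF x(1), of x] by simp
  then show False using B_pos_def[OF x(1,2)] by simp
qed

text \<open>Take \<open>x\<close> orthogonal to all roots after the first. The Coxeter element moves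
  it by a nonzero multiple of \<open>b\<close>, so \<open>E_gamma\<close> makes \<open>E b\<close>
  proportional to \<open>B x\<close>, which vanishes on the later roots.\<close>

lemma factorisation_head:
  assumes "set (b # bs) \<subseteq> roots" "refl_prod (b # bs) = gamma" "length (b # bs) \<le> card S" "c \<in> set bs"
  shows "E b c = 0"
proof -
  have r: "b \<in> roots" "set bs \<subseteq> roots" using assms(1) by auto
  obtain x where x: "supp x" "x \<noteq> 0" "\<forall>b\<in>set bs. B x b = 0"
    using orthogonal_vector[of bs] assms by auto
  have "rho gamma x = x - B x b *\<^sub>R b"
    unfolding assms(2)[symmetric] using r refl_prod_fixes[OF r(2) x(3)] by (simp add: reflection(2))
  then have "rho gamma x - x = - (B x b *\<^sub>R b)" by simp
  then have e: "B x b * E b y = B x y" if "supp y" for y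
    using E_gamma[OF that, of x] by (simp add: E_simps del: scaleR_minus_left)
  have "B x b \<noteq> 0" using e[OF x(1)] B_pos_def[OF x(1,2)] by auto
  moreover have "B x b * E b c = 0" using e[of c] x(3) assms(4) r supp_root by auto
  ultimately show ?thesis by simp
qed

lemma reflection_conjugate:
  assumes "x \<in> roots" "w \<in> carrier W"
  shows "reflection (rho (inv w) x) = inv w \<otimes> reflection x \<otimes> w"
proof (rule reflection_unique[symmetric])
  show "rho (inv w) x \<in> roots" using assms by (intro root_rho) auto
  show "inv w \<otimes> reflection x \<otimes> w \<in> carrier W" using assms by simp
  fix y
  have "rho (inv w \<otimes> reflection x \<otimes> w) y = rho (inv w) (rho w y - B (rho w y) x *\<^sub>R x)"
    using assms by (simp add: reflection(2))
  also have "\<dots> = y - B (rho w y) x *\<^sub>R rho (inv w) x"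
    using assms(2) by (simp only: rho_linear inv_closed rho_inv)
  also have "B (rho w y) x = B y (rho (inv w) x)"
    using B_rho[of w y "rho (inv w) x"] assms(2) by simp
  finally show "rho (inv w \<otimes> reflection x \<otimes> w) y = y - B y (rho (inv w) x) *\<^sub>R rho (inv w) x" .
qed

text \<open>
  A factorisation of the Coxeter element is rotated by conjugating its first factor, so
  orthogonality to the first root (\<open>factorisation_head\<close>) suffices.
\<close>

lemma factorisation_sorted:
  "set (bs @ cs) \<subseteq> roots \<Longrightarrow> refl_prod (bs @ cs) = gamma \<Longrightarrow> length (bs @ cs) \<le> card S \<Longrightarrow>
   sorted_wrt (\<lambda>x y. E x y = 0) bs"
proof (induction bs arbitrary: cs)
  case (Cons b bs)
  have r: "b \<in> roots" "set (bs @ cs) \<subseteq> roots" using Cons.prems by auto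
  define b' where "b' = rho (inv gamma) b"
  have b': "b' \<in> roots" unfolding b'_def using r by (intro root_rho) auto
  have g: "reflection b \<otimes> refl_prod (bs @ cs) = gamma" using Cons.prems by simp
  have c: "refl_prod (bs @ cs) \<in> carrier W" using r by simp
  have "refl_prod (bs @ cs @ [b']) = refl_prod (bs @ cs) \<otimes> (inv gamma \<otimes> reflection b \<otimes> gamma)"
    using refl_prod_append[of "bs @ cs" "[b']"] r b' by (simp add: b'_def reflection_conjugate)
  also have "refl_prod (bs @ cs) = inv (reflection b) \<otimes> gamma"
    unfolding g[symmetric] using r c by (simp add: m_assoc[symmetric])
  also have "(inv (reflection b) \<otimes> gamma) \<otimes> (inv gamma \<otimes> reflection b \<otimes> gamma) = gamma"
    using r by (simp add: m_assoc) (simp add: m_assoc[symmetric])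
  finally have "sorted_wrt (\<lambda>x y. E x y = 0) bs"
    using Cons.IH[of "cs @ [b']"] r b' Cons.prems(3) by simp
  moreover have "E b c = 0" if "c \<in> set bs" for c
    by (rule factorisation_head[of b "bs @ cs"]) (use Cons.prems that in auto)
  ultimately show ?case by simp
qed simp

lemma factorisation_complete:
  assumes "set bs \<subseteq> roots" "refl_prod bs = gamma" "length bs \<le> card S" shows "complete bs"
  using factorisation_sorted[of bs "[]"] factorisation_length[OF assms(1,2)] assms
  by (simp add: complete_def exceptional_def)

end


section \<open>Noncrossing partitions and flats\<close>

context coxeter_word begin

abbreviation ell :: "'a \<Rightarrow> nat" where "ell \<equiv> refl_length W S"

lemma map_reflection_word:
  assumes "set ts \<subseteq> reflections W S"
  shows "\<exists>bs. set bs \<subseteq> roots \<and> length bs = length ts \<and> refl_prod bs = word_prod W ts"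
proof -
  have "ts \<in> lists (reflection ` roots)" using assms by (auto simp: reflections_image)
  then obtain bs where "bs \<in> lists roots" "ts = map reflection bs" unfolding lists_image by blast
  then show ?thesis by (intro exI[of _ bs]) (auto simp: refl_prod_def)
qed

lemma ell_le: assumes "set bs \<subseteq> roots" shows "ell (refl_prod bs) \<le> length bs"
proof -
  have "\<exists>ts. set ts \<subseteq> reflections W S \<and> length ts = length bs \<and> word_prod W ts = refl_prod bs"
    using assms by (intro exI[of _ "map reflection bs"]) (auto simp: refl_prod_def reflection(1))
  then show ?thesis unfolding refl_length_def by (rule Least_le)
qed

lemma ell_attained:
  assumes "w \<in> carrier W"
  obtains bs where "set bs \<subseteq> roots" "length bs = ell w" "refl_prod bs = w"
proof -
  obtain u where u: "u \<in> lists S" "word_prod W u = w" using word_exists[OF assms] by blast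
  have "s \<in> reflections W S" if "s \<in> S" for s
    using reflection(1)[OF alpha_root[OF that]] reflection_alpha[OF that] by simp
  then have "\<exists>ts. set ts \<subseteq> reflections W S \<and> length ts = length u \<and> word_prod W ts = w"
    using u by (intro exI[of _ u]) auto
  then have "\<exists>ts. set ts \<subseteq> reflections W S \<and> length ts = ell w \<and> word_prod W ts = w"
    unfolding refl_length_def by (rule LeastI)
  then show ?thesis using map_reflection_word that by metis
qed

lemma ell_mult: assumes "u \<in> carrier W" "w \<in> carrier W" shows "ell (u \<otimes> w) \<le> ell u + ell w"
proof -
  obtain a where a: "set a \<subseteq> roots" "length a = ell u" "refl_prod a = u" by (rule ell_attained[OF assms(1)])
  obtain b where b: "set b \<subseteq> roots" "length b = ell w" "refl_prod b = w" by (rule ell_attained[OF assms(2)])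
  show ?thesis using ell_le[of "a @ b"] a b by (simp add: refl_prod_append)
qed

lemma ell_one [simp]: "ell \<one> = 0" using ell_le[of "[]"] by simp

lemma ell_zero: "w \<in> carrier W \<Longrightarrow> ell w = 0 \<Longrightarrow> w = \<one>"
  by (rule ell_attained) auto

lemma ell_gamma: "ell gamma = card S"
proof (rule antisym)
  have "length (map alpha ss) = card S" using simple_complete(1) unfolding complete_def by blast
  then show "ell gamma \<le> card S"
    using ell_le[OF complete_roots[OF simple_complete(1)]] unfolding simple_complete(2) by simp
  obtain bs where "set bs \<subseteq> roots" "length bs = ell gamma" "refl_prod bs = gamma" by (rule ell_attained[OF gamma_carrier])
  then show "card S \<le> ell gamma" using factorisation_length by metis
qed

abbreviation le :: "'a \<Rightarrow> 'a \<Rightarrow> bool" where "le \<equiv> abs_le W S"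
abbreviation NC :: "'a set" where "NC \<equiv> noncrossing W S gamma"

lemma le_refl: "x \<in> carrier W \<Longrightarrow> le x x" by (simp add: abs_le_def)

lemma le_antisym:
  assumes "x \<in> carrier W" "y \<in> carrier W" "le x y" "ell y \<le> ell x" shows "x = y"
proof -
  have "ell (inv x \<otimes> y) = 0" using assms(3,4) by (simp add: abs_le_def)
  then have "inv x \<otimes> y = \<one>" using assms by (intro ell_zero) auto
  then have "x \<otimes> (inv x \<otimes> y) = x" using assms by simp
  then show ?thesis using assms by (simp add: m_assoc[symmetric])
qed

lemma le_trans:
  assumes "x \<in> carrier W" "y \<in> carrier W" "z \<in> carrier W" "le x y" "le y z" shows "le x z"
proof -
  have "inv x \<otimes> z = (inv x \<otimes> y) \<otimes> (inv y \<otimes> z)" using assms by (simp add: m_assoc) (simp add: m_assoc[symmetric])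
  then have "ell (inv x \<otimes> z) \<le> ell (inv x \<otimes> y) + ell (inv y \<otimes> z)" using ell_mult assms by simp
  moreover have "x \<otimes> (inv x \<otimes> z) = z" using assms by (simp add: m_assoc[symmetric])
  then have "ell z \<le> ell x + ell (inv x \<otimes> z)" using ell_mult[of x "inv x \<otimes> z"] assms by simp
  ultimately show ?thesis using assms(4,5) by (simp add: abs_le_def)
qed

lemma NC_iff: "w \<in> NC \<longleftrightarrow> w \<in> carrier W \<and> le w gamma"
  by (auto simp: noncrossing_def) (simp add: abs_le_def)

lemma gamma_NC: "gamma \<in> NC" by (simp add: NC_iff le_refl)

lemma complete_ell:
  assumes "complete (a @ b)" shows "ell (refl_prod a) = length a" "ell (refl_prod b) = length b"
proof -
  have r: "set a \<subseteq> roots" "set b \<subseteq> roots" using complete_roots[OF assms] by auto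
  have "refl_prod a \<otimes> refl_prod b = gamma" using complete_refl_prod[OF assms] r by (simp add: refl_prod_append)
  then have "card S \<le> ell (refl_prod a) + ell (refl_prod b)"
    using ell_mult[of "refl_prod a" "refl_prod b"] r ell_gamma by simp
  moreover have "length a + length b = card S" using assms by (simp add: complete_def)
  ultimately show "ell (refl_prod a) = length a" "ell (refl_prod b) = length b"
    using ell_le[OF r(1)] ell_le[OF r(2)] by auto
qed

lemma le_complete:
  assumes "complete (a @ b @ c)" shows "le (refl_prod a) (refl_prod (a @ b))"
proof -
  have r: "set a \<subseteq> roots" "set b \<subseteq> roots" using complete_roots[OF assms] by auto
  have la: "ell (refl_prod a) = length a" by (rule complete_ell[OF assms])
  have lab: "ell (refl_prod (a @ b)) = length a + length b" using complete_ell(1)[of "a @ b" c] assms by simp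
  have e: "inv (refl_prod a) \<otimes> refl_prod (a @ b) = refl_prod b" using r by (simp add: refl_prod_append m_assoc[symmetric])
  have "length a + length b \<le> ell (refl_prod a) + ell (refl_prod b)"
    using ell_mult[of "refl_prod a" "refl_prod b"] r lab by (simp add: refl_prod_append)
  then have "ell (refl_prod b) = length b" using ell_le[OF r(2)] la by simp
  then show ?thesis unfolding abs_le_def e la lab by simp
qed

lemma prefix_NC:
  assumes "complete (a @ b)" shows "refl_prod a \<in> NC"
  using le_complete[of a b "[]"] complete_refl_prod[OF assms] complete_roots[OF assms] assms by (simp add: NC_iff)

text \<open>Shortest factorisations of \<open>u\<close>, of \<open>inv u \<otimes> w\<close> and of
  \<open>inv w \<otimes> gamma\<close> are concatenated. The two order relations make the lengths
  add up to \<open>card S\<close>, so the result is a complete exceptional sequence.\<close>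

lemma le_NC_factor:
  assumes "u \<in> carrier W" "w \<in> NC" "le u w"
  obtains a b c where "complete (a @ b @ c)" "u = refl_prod a" "w = refl_prod (a @ b)"
proof -
  have w: "w \<in> carrier W" "le w gamma" using assms(2) by (auto simp: NC_iff)
  obtain a where a: "set a \<subseteq> roots" "length a = ell u" "refl_prod a = u" by (rule ell_attained[OF assms(1)])
  have "inv u \<otimes> w \<in> carrier W" "inv w \<otimes> gamma \<in> carrier W" using assms w by auto
  then obtain b c where b: "set b \<subseteq> roots" "length b = ell (inv u \<otimes> w)" "refl_prod b = inv u \<otimes> w"
    and c: "set c \<subseteq> roots" "length c = ell (inv w \<otimes> gamma)" "refl_prod c = inv w \<otimes> gamma"
    by (metis ell_attained)
  have ab: "refl_prod (a @ b) = w" using a b assms(1) w(1) by (simp add: refl_prod_append m_assoc[symmetric])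
  have "refl_prod ((a @ b) @ c) = refl_prod (a @ b) \<otimes> refl_prod c" using a b c by (intro refl_prod_append) auto
  also have "\<dots> = gamma" unfolding ab c(3) using w(1) by (simp add: m_assoc[symmetric])
  finally have "refl_prod (a @ b @ c) = gamma" by simp
  moreover have "length (a @ b @ c) = card S"
    using a(2) b(2) c(2) assms(3) w(2) ell_gamma by (simp add: abs_le_def)
  ultimately have "complete (a @ b @ c)" using a b c by (intro factorisation_complete) auto
  then show ?thesis using that a(3) ab by blast
qed

lemma NC_factor:
  assumes "w \<in> NC" obtains a b where "complete (a @ b)" "w = refl_prod a"
proof -
  have w: "w \<in> carrier W" "le w gamma" using assms by (auto simp: NC_iff)
  from le_NC_factor[OF w(1) gamma_NC w(2)] obtain a b c where "complete (a @ b @ c)" "w = refl_prod a" by blast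
  then show ?thesis using that by blast
qed

definition rest :: "('a \<Rightarrow> real) set \<Rightarrow> ('a \<Rightarrow> real) list \<Rightarrow> ('a \<Rightarrow> real) set" where
  "rest A bs = {y \<in> A. \<forall>b\<in>set bs. E y b = 0}"

lemma exceptional_cut:
  "exceptional (a @ b) \<Longrightarrow> y \<in> span (set (a @ b)) \<Longrightarrow> (\<forall>c\<in>set b. E y c = 0) \<Longrightarrow> y \<in> span (set a)"
proof (induction b rule: rev_induct)
  case (snoc x b)
  have x: "x \<in> roots" "\<forall>c\<in>set (a @ b). E c x = 0" "exceptional (a @ b)"
    using snoc.prems(1) by (auto simp: exceptional_append exceptional_Cons)
  have "y \<in> span (insert x (set (a @ b)))" using snoc.prems(2) by simp
  then obtain l where l: "y - l *\<^sub>R x \<in> span (set (a @ b))" unfolding span_insert by blast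
  have "E (y - l *\<^sub>R x) x = 0" by (rule span_zero_left[OF l]) (use x in blast)
  then have "l = 0" using snoc.prems(3) E_unit[OF x(1)] by (simp add: E_diff(1) E_scale_left)
  then have "y \<in> span (set (a @ b))" using l by simp
  then show ?case using snoc.IH x(3) snoc.prems(3) by simp
qed simp

lemma rest_span:
  assumes "complete (a @ b)" shows "rest roots b = {y \<in> roots. y \<in> span (set a)}"
proof (intro equalityI subsetI)
  fix y assume y: "y \<in> rest roots b"
  then have "y \<in> span (set (a @ b))" using complete_span[OF assms] supp_root by (auto simp: rest_def)
  then show "y \<in> {y \<in> roots. y \<in> span (set a)}"
    using exceptional_cut[OF complete_exceptional[OF assms]] y by (auto simp: rest_def)
next
  fix y assume y: "y \<in> {y \<in> roots. y \<in> span (set a)}"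
  have "E y c = 0" if "c \<in> set b" for c
    by (rule span_zero_left[of y "set a"]) (use y that complete_exceptional[OF assms] in \<open>auto simp: exceptional_append\<close>)
  then show "y \<in> rest roots b" using y by (auto simp: rest_def)
qed

text \<open>By \<open>rest_span\<close> these are the roots in the span of the factors of
  \<open>w\<close>. The description by perpendiculars of the complementary factors is the one that
  fits \<open>below\<close>; independence of the chosen factorisation is
  \<open>Psi_eq\<close>.\<close>

definition Psi :: "'a \<Rightarrow> ('a \<Rightarrow> real) set" where
  "Psi w = rest roots (SOME b. \<exists>a. complete (a @ b) \<and> w = refl_prod a)"

lemma Psi_eq:
  assumes c: "complete (a @ b)" shows "Psi (refl_prod a) = rest roots b"
proof -
  define h where "h = (SOME b. \<exists>a'. complete (a' @ b) \<and> refl_prod a = refl_prod a')"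
  have "\<exists>b a'. complete (a' @ b) \<and> refl_prod a = refl_prod a'" using c by blast
  then have "\<exists>a'. complete (a' @ h) \<and> refl_prod a = refl_prod a'" unfolding h_def by (rule someI_ex)
  then obtain a' where a': "complete (a' @ h)" "refl_prod a = refl_prod a'" by blast
  have r: "set a \<subseteq> roots" "set a' \<subseteq> roots" "set h \<subseteq> roots" using complete_roots[OF c] complete_roots[OF a'(1)] by auto
  have "refl_prod (a @ h) = refl_prod (a' @ h)" using r a'(2) by (simp add: refl_prod_append)
  then have g: "refl_prod (a @ h) = gamma" using complete_refl_prod[OF a'(1)] by simp
  have "length a = length a'" using complete_ell(1)[OF c] complete_ell(1)[OF a'(1)] a'(2) by simp
  then have "length (a @ h) \<le> card S" using a'(1) by (simp add: complete_def)
  then have "complete (a @ h)" using g r by (intro factorisation_complete) auto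
  then have "rest roots h = rest roots b" using rest_span c by simp
  then show ?thesis unfolding Psi_def h_def .
qed

lemma rest_below:
  "sorted_wrt (\<lambda>x y. E x y = 0) bs \<Longrightarrow> set bs \<subseteq> A \<Longrightarrow> rest A bs \<in> below E A"
proof (induction bs)
  case Nil
  have "rest A [] = A" by (auto simp: rest_def)
  then show ?case by (simp add: below.self)
next
  case (Cons b bs)
  have "b \<in> rest A bs" using Cons.prems by (auto simp: rest_def)
  moreover have "rest A (b # bs) = rperp E (rest A bs) b" by (auto simp: rest_def rperp_def)
  ultimately show ?case using Cons by (auto intro: below.step)
qed

lemma below_rest:
  assumes "C \<in> below E A" "good A"
  shows "\<exists>bs. sorted_wrt (\<lambda>x y. E x y = 0) bs \<and> set bs \<subseteq> A \<and> C = rest A bs \<and> length bs + rk C = rk A"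
  using assms
proof (induction rule: below.induct)
  case self
  then show ?case by (intro exI[of _ "[]"]) (auto simp: rest_def)
next
  case (step C x)
  then obtain bs where bs: "sorted_wrt (\<lambda>x y. E x y = 0) bs" "set bs \<subseteq> A" "C = rest A bs" "length bs + rk C = rk A"
    by blast
  have "rk C = Suc (rk (rperp E C x))" by (rule good_Rp(2)[OF good_below[OF step.hyps(1) step.prems] step.hyps(2)])
  moreover have "rperp E C x = rest A (x # bs)" by (auto simp: bs(3) rest_def rperp_def)
  ultimately show ?case using bs step.hyps(2) by (intro exI[of _ "x # bs"]) (auto simp: rest_def)
qed

lemma good_basis:
  assumes "good A"
  obtains bs where "exceptional bs" "set bs \<subseteq> A" "length bs = rk A" "A \<subseteq> span (set bs)"
proof -
  define l where "l = rev (sorted_list_of_set (slice A 0))"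
  have l: "set l = slice A 0" "sorted_wrt (\<lambda>i j. j < i) l"
    by (auto simp: l_def sorted_wrt_rev)
  have "sorted_wrt (\<lambda>i j. E (beta i) (beta j) = 0) l"
    using l(2) by (rule sorted_wrt_mono_rel[rotated]) (use slice_orth[of _ A 0] l(1) in auto)
  then have "exceptional (map beta l)" unfolding exceptional_def sorted_wrt_map by (auto simp: roots_beta)
  moreover have "set (map beta l) \<subseteq> A" using slice_in l(1) by auto
  moreover have "length (map beta l) = rk A" by (simp add: l_def rk_def)
  moreover have "A \<subseteq> span (set (map beta l))" using good_spans[OF assms, of 0] l(1) by (simp add: spans_def)
  ultimately show ?thesis by (rule that)
qed

lemma Psi_below: "w \<in> NC \<Longrightarrow> Psi w \<in> below E roots"
proof (erule NC_factor)
  fix a b assume c: "complete (a @ b)" "w = refl_prod a"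
  then have "sorted_wrt (\<lambda>x y. E x y = 0) b" "set b \<subseteq> roots"
    using complete_exceptional[OF c(1)] by (auto simp: exceptional_def sorted_wrt_append)
  then show "Psi w \<in> below E roots" unfolding c(2) Psi_eq[OF c(1)] by (rule rest_below)
qed

lemma good_roots: "good roots" by (rule good_Phi)

lemma rk_rest:
  assumes "complete (a @ b)" shows "rk (rest roots b) = length a"
proof -
  let ?A = "rest roots b"
  have "exceptional b" "set b \<subseteq> roots" using complete_exceptional[OF assms] complete_roots[OF assms]
    by (auto simp: exceptional_append)
  then have "good ?A" using good_below[OF rest_below good_roots] by (simp add: exceptional_def)
  then obtain bs where bs: "exceptional bs" "set bs \<subseteq> ?A" "length bs = rk ?A" "?A \<subseteq> span (set bs)" by (rule good_basis)
  have a: "exceptional a" using complete_exceptional[OF assms] by (simp add: exceptional_append)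
  have ia: "independent (set a)" "card (set a) = length a" "independent (set bs)" "card (set bs) = length bs"
    using exceptional_independent[OF a] exceptional_independent[OF bs(1)] by (simp_all add: distinct_card)
  have "set bs \<subseteq> span (set a)" using bs(2) unfolding rest_span[OF assms] by blast
  then have "length bs \<le> length a"
    using real_vector.independent_span_bound[OF _ ia(3), of "set a"] ia by simp
  moreover have "set a \<subseteq> ?A" unfolding rest_span[OF assms] using complete_roots[OF assms] by (auto intro: span_base)
  then have "set a \<subseteq> span (set bs)" using bs(4) by blast
  then have "length a \<le> length bs"
    using real_vector.independent_span_bound[OF _ ia(1), of "set bs"] ia by simp
  ultimately show ?thesis using bs(3) by simp
qed

lemma prefix_in_rest: "complete (a @ b) \<Longrightarrow> set a \<subseteq> rest roots b"
  using rest_span[of a b] complete_roots[of "a @ b"] by (auto intro: span_base)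

text \<open>An order relation splits a complete sequence into three blocks, whose middle block leads
  from \<open>Psi w\<close> down to \<open>Psi u\<close>. Conversely, roots \<open>gs\<close>
  realising such a descent fit between a factorisation \<open>a\<close> of \<open>u\<close> and the
  complementary factors \<open>h\<close> of \<open>w\<close>; the joined sequence is complete by its
  length, and cancelling \<open>h\<close> identifies \<open>a @ gs\<close> as a factorisation of
  \<open>w\<close>.\<close>

lemma le_iff_below:
  assumes u: "u \<in> NC" and w: "w \<in> NC"
  shows "le u w \<longleftrightarrow> Psi u \<in> below E (Psi w)"
proof
  assume "le u w"
  then obtain a b c where c: "complete (a @ b @ c)" "u = refl_prod a" "w = refl_prod (a @ b)"
    using le_NC_factor[of u w] u w by (auto simp: NC_iff)
  have pw: "Psi w = rest roots c" unfolding c(3) using c(1) by (intro Psi_eq) simp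
  have pu: "Psi u = rest roots (b @ c)" unfolding c(2) by (rule Psi_eq[OF c(1)])
  have "rest roots (b @ c) = rest (rest roots c) b" by (auto simp: rest_def)
  moreover have "sorted_wrt (\<lambda>x y. E x y = 0) b"
    using complete_exceptional[OF c(1)] by (auto simp: exceptional_def sorted_wrt_append)
  moreover have "set b \<subseteq> rest roots c" using prefix_in_rest[of "a @ b" c] c(1) by simp
  ultimately show "Psi u \<in> below E (Psi w)" unfolding pw pu using rest_below by simp
next
  assume b: "Psi u \<in> below E (Psi w)"
  obtain a k where a: "complete (a @ k)" "u = refl_prod a" by (rule NC_factor[OF u])
  obtain d h where d: "complete (d @ h)" "w = refl_prod d" by (rule NC_factor[OF w])
  have pu: "Psi u = rest roots k" unfolding a(2) by (rule Psi_eq[OF a(1)])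
  have pw: "Psi w = rest roots h" unfolding d(2) by (rule Psi_eq[OF d(1)])
  have gw: "good (Psi w)" by (rule good_below[OF Psi_below[OF w] good_roots])
  obtain gs where gs: "sorted_wrt (\<lambda>x y. E x y = 0) gs" "set gs \<subseteq> Psi w" "Psi u = rest (Psi w) gs"
    "length gs + rk (Psi u) = rk (Psi w)" using below_rest[OF b gw] by blast
  have au: "set a \<subseteq> rest (Psi w) gs" using prefix_in_rest[OF a(1)] pu gs(3) by simp
  have "exceptional (a @ gs @ h)"
    using complete_exceptional[OF a(1)] complete_exceptional[OF d(1)] gs(1,2) au
    unfolding pw exceptional_append by (auto simp: exceptional_def rest_def)
  moreover have "length (a @ gs @ h) = card S"
    using gs(4) d(1) unfolding pu pw rk_rest[OF a(1)] rk_rest[OF d(1)] by (simp add: complete_def)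
  ultimately have c: "complete (a @ gs @ h)" by (simp add: complete_def)
  have r: "set (a @ gs) \<subseteq> roots" "set h \<subseteq> roots" "set d \<subseteq> roots" using complete_roots[OF c] complete_roots[OF d(1)] by auto
  have "refl_prod (a @ gs) \<otimes> refl_prod h = refl_prod d \<otimes> refl_prod h"
    using complete_refl_prod[OF c] complete_refl_prod[OF d(1)] refl_prod_append[OF r(1,2)] refl_prod_append[OF r(3,2)] by simp
  then have "refl_prod (a @ gs) = w" using r by (simp add: d(2))
  then show "le u w" using le_complete[OF c] a(2) by simp
qed

lemma NC_carrier: "w \<in> NC \<Longrightarrow> w \<in> carrier W" by (simp add: NC_iff)

lemma NC_antisym: "x \<in> NC \<Longrightarrow> y \<in> NC \<Longrightarrow> le x y \<Longrightarrow> le y x \<Longrightarrow> x = y"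
  by (rule le_antisym) (auto simp: NC_carrier abs_le_def)

lemma Psi_bij: "bij_betw Psi NC (below E roots)"
proof (rule bij_betw_imageI)
  show "inj_on Psi NC"
  proof (rule inj_onI)
    fix u w assume "u \<in> NC" "w \<in> NC" "Psi u = Psi w"
    then show "u = w" using le_iff_below[of u w] le_iff_below[of w u] NC_antisym by (simp add: below.self)
  qed
  show "Psi ` NC = below E roots"
  proof (intro equalityI subsetI)
    fix C assume C: "C \<in> below E roots"
    obtain gs where gs: "sorted_wrt (\<lambda>x y. E x y = 0) gs" "set gs \<subseteq> roots" "C = rest roots gs"
      "length gs + rk C = rk roots" using below_rest[OF C good_roots] by blast
    obtain bs where bs: "exceptional bs" "set bs \<subseteq> C" "length bs = rk C" by (rule good_basis[OF good_below[OF C good_roots]])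
    have "exceptional (bs @ gs)" using gs bs unfolding exceptional_append by (auto simp: exceptional_def rest_def)
    then have c: "complete (bs @ gs)" using gs(4) bs(3) by (simp add: complete_def rk_roots)
    have "Psi (refl_prod bs) = C" unfolding gs(3) by (rule Psi_eq[OF c])
    then show "C \<in> Psi ` NC" using prefix_NC[OF c] by blast
  qed (use Psi_below in auto)
qed

lemma multichain_count_Psi: "w \<in> NC \<Longrightarrow> multichain_count NC le n w = multichains E n (Psi w)"
proof (induction n arbitrary: w)
  case (Suc n)
  have inj: "inj_on Psi {u. u \<in> NC \<and> le u w}" by (rule inj_on_subset[OF bij_betw_imp_inj_on[OF Psi_bij]]) auto
  have im: "Psi ` {u. u \<in> NC \<and> le u w} = below E (Psi w)"
  proof (intro equalityI subsetI)
    fix C assume C: "C \<in> below E (Psi w)"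
    then have "C \<in> Psi ` NC" using below_trans[OF C Psi_below[OF Suc.prems]] Psi_bij by (simp add: bij_betw_def)
    then show "C \<in> Psi ` {u. u \<in> NC \<and> le u w}" using C le_iff_below Suc.prems by auto
  qed (use le_iff_below Suc.prems in auto)
  have "multichains E (Suc n) (Psi w) = (\<Sum>C\<in>Psi ` {u. u \<in> NC \<and> le u w}. multichains E n C)"
    by (simp add: im)
  also have "\<dots> = (\<Sum>u | u \<in> NC \<and> le u w. multichains E n (Psi u))"
    by (simp add: sum.reindex[OF inj])
  also have "\<dots> = (\<Sum>u | u \<in> NC \<and> le u w. multichain_count NC le n u)" using Suc.IH by (intro sum.cong) auto
  finally show ?case by simp
qed simp

lemma Psi_gamma: "Psi gamma = roots"
proof -
  have "Psi (refl_prod (map alpha ss)) = rest roots []" using simple_complete(1) by (intro Psi_eq) simp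
  then show ?thesis by (simp add: simple_complete(2) rest_def)
qed

lemma finite_NC: "finite NC" using finW by (rule finite_subset[rotated]) (auto simp: NC_iff)

text \<open>\<open>ell\<close> is injective on chains with values from zero to
  \<open>card S\<close>, and the prefixes of the Coxeter word form a chain that attains all of them.
  The extra one beyond the rank is the exponent \<open>Suc r\<close> in
  \<open>eulerian_transform\<close>.\<close>

lemma max_face_card_NC: "max_face_card (order_complex NC le) = Suc (card S)"
proof (rule antisym)
  let ?D = "order_complex NC le"
  have "card C \<le> Suc (card S)" if C: "C \<in> ?D" for C
  proof -
    have CN: "C \<subseteq> NC" "Complete_Partial_Order.chain le C" using C by (auto simp: order_complex_def)
    have "inj_on ell C"
    proof (rule inj_onI)
      fix x y assume xy: "x \<in> C" "y \<in> C" "ell x = ell y"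
      then have "le x y \<or> le y x" using CN(2) by (auto simp: chain_def)
      then show "x = y" using le_antisym[of x y] le_antisym[of y x] xy CN(1) NC_carrier by fastforce
    qed
    moreover have "ell ` C \<subseteq> {..card S}" using CN(1) ell_gamma by (auto simp: NC_iff abs_le_def)
    ultimately have "card C \<le> card {..card S}" by (intro card_inj_on_le) auto
    then show ?thesis by simp
  qed
  moreover have "{} \<in> ?D" by (auto simp: order_complex_def chain_def)
  ultimately show "max_face_card ?D \<le> Suc (card S)"
    unfolding max_face_card_def using finite_order_complex[OF finite_NC] by (intro Max.boundedI) auto
  define g where "g i = refl_prod (take i (map alpha ss))" for i
  have len: "length ss = card S" using ss distinct_card by metis
  have cpl: "complete (take i (map alpha ss) @ drop i (map alpha ss))" for i using simple_complete(1) by simp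
  have gle: "le (g i) (g j)" if "i \<le> j" for i j
  proof -
    have e: "take j (map alpha ss) = take i (map alpha ss) @ drop i (take j (map alpha ss))"
      using that append_take_drop_id[of i "take j (map alpha ss)"] by (simp add: min_def)
    have "complete (take i (map alpha ss) @ drop i (take j (map alpha ss)) @ drop j (map alpha ss))"
      using cpl[of j] e by (metis append_assoc)
    from le_complete[OF this] show ?thesis using e unfolding g_def by (simp only:)
  qed
  have "g i \<in> NC" for i unfolding g_def by (rule prefix_NC[OF cpl])
  moreover have "le (g i) (g j) \<or> le (g j) (g i)" for i j using gle[of i j] gle[of j i] by (meson nle_le)
  ultimately have "g ` {..card S} \<in> ?D" unfolding order_complex_def chain_def by blast
  moreover have "inj_on g {..card S}"
  proof (rule inj_onI)
    fix i j assume ij: "i \<in> {..card S}" "j \<in> {..card S}" "g i = g j"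
    have l: "ell (g l) = l" if "l \<le> card S" for l
    proof -
      have "ell (g l) = length (take l (map alpha ss))" unfolding g_def by (rule complete_ell(1)[OF cpl])
      then show ?thesis using that len by simp
    qed
    have "i = ell (g i)" using l[of i] ij(1) by simp
    also have "\<dots> = ell (g j)" unfolding ij(3) ..
    also have "\<dots> = j" using l[of j] ij(2) by simp
    finally show "i = j" .
  qed
  then have "card (g ` {..card S}) = Suc (card S)" by (simp add: card_image)
  ultimately show "Suc (card S) \<le> max_face_card ?D" using face_card_le[OF finite_NC] by metis
qed

end

theorem theorem1p3:
  fixes W :: "('a, 'b) monoid_scheme"
    and S :: "'a set"
    and m :: "'a \<Rightarrow> 'a \<Rightarrow> enat"
    and \<gamma> :: 'a
  assumes "coxeter_system W S m"
    and "finite (carrier W)"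
    and "coxeter_irreducible S m"
    and "coxeter_element W S \<gamma>"
  shows "real_rooted (chain_poly (noncrossing W S \<gamma>) (abs_le W S)) \<and>
    nonneg_real_rooted_symmetric_decomposition (card S - 1)
      (h_poly (order_complex (noncrossing W S \<gamma>) (abs_le W S))) \<and>
    unimodal_with_peak
      (h_poly (order_complex (noncrossing W S \<gamma>) (abs_le W S))) (card S div 2)"
proof -
  obtain ss where word: "distinct ss" "set ss = S" "\<gamma> = word_prod W ss"
    using assms(4) by (auto simp: coxeter_element_def)
  interpret coxeter_word W S m ss
    by unfold_locales (use assms word in auto)
  let ?D = "order_complex (noncrossing W S \<gamma>) (abs_le W S)"
  have NC: "noncrossing W S \<gamma> = NC" by (simp add: word(3))
  have pos: "0 < card S" using S_nonempty finS by (simp add: card_gt_0_iff)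
  obtain D where D: "nonneg_coeffs D"
    "\<And>z. z \<noteq> 0 \<Longrightarrow> poly (cpoly roots) z - z ^ card S * poly (cpoly roots) (1 / z) = (1 - z) * poly D z"
    using cpoly_symmetric_part[OF good_roots] unfolding rk_roots by blast
  have f: "fps_of_poly (h_poly ?D) =
      (1 - fps_X) ^ max_face_card ?D * Abs_fps (\<lambda>n. multichain_count NC le n gamma)"
    unfolding NC
  proof (rule fps_h_poly)
    show "le x z" if "x \<in> NC" "y \<in> NC" "z \<in> NC" "le x y" "le y z" for x y z
      using le_trans NC_carrier that by blast
  qed (use finite_NC le_refl NC_carrier NC_antisym gamma_NC NC_iff in auto)
  have g: "multichain_count NC le n gamma = (real n + 1) ^ card S * poly (cpoly roots) (real n / (real n + 1))" for n
    using multichain_count_Psi[OF gamma_NC] multichains_cpoly[OF good_roots] by (simp add: Psi_gamma rk_roots)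
  have h: "fps_of_poly (h_poly ?D) = (1 - fps_X) ^ Suc (card S) *
      Abs_fps (\<lambda>n. (real n + 1) ^ card S * poly (cpoly roots) (real n / (real n + 1)))"
    using f unfolding g NC max_face_card_NC .
  have c0: "coeff (cpoly roots) i = 0" if "card S \<le> i" for i
    using coeff_cpoly_0[OF good_roots, of i] that pos by (simp add: rk_roots)
  note e = eulerian_transform[OF pos nonneg_cpoly[OF good_roots] c0 D h]
  have "real_rooted (chain_poly (noncrossing W S \<gamma>) (abs_le W S))"
    unfolding chain_poly_def using real_rooted_f_poly[OF _ e(1)] finite_NC by (simp add: NC)
  then show ?thesis using e by simp
qed

end
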